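(* Consider a $K$-user CoMP BC tree network with rooted tree graph $\mathcal T$ on vertices $\{\text{Tx-}0,\text{Tx-}1,\dots,\text{Tx-}B\}$. Under both the finite-field model and the real Gaussian model, the classical DoF region is $$\mathcal D=\Big\{(d_1,\dots,d_K)\in\mathbb R_+^K: \sum_{i=1}^L d_\Sigma(\text{Tx-}b_i)\le1 \text{ for every } L\in\mathbb N \text{ and every root-to-leaf path } (\text{Tx-}0,\text{Tx-}b_1,\dots,\text{Tx-}b_L)\text{ of }\mathcal T\Big\},$$ and the NS-assisted DoF region is $$\mathcal D^{\mathrm{NS}}=\{(d_1,\dots,d_K)\in\mathbb R_+^K: d_\Sigma(\text{Tx-}b)\le 1\ \ \forall b\in[B]\}.$$ Moreover, under the finite-field model over $\mathbb F_q$, the NS-assisted capacity region is $$\mathcal C^{\mathrm{NS}}(q)=\{(R_1,\dots,R_K)\in\mathbb R_+^K: R_\Sigma(\text{Tx-}b)\le\log_2 q\ \ \forall b\in[B]\}.$$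
   Context: CoMP BC, finite-field model: $q$ a prime power, $B$ transmit antennas Tx-1..Tx-$B$, $K$ receivers Rx-1..Rx-$K$, connectivity matrix $\mathbf M\in\{0,*\}^{K\times B}$. At use $\tau$ the transmitter sends $(X_1^{(\tau)},\dots,X_B^{(\tau)})\in\mathbb F_q^B$ and Rx-$k$ observes $(Y_k^{(\tau)},(G_{kj}^{(\tau)})_{j})$, $Y_k^{(\tau)}=\sum_jG_{kj}^{(\tau)}X_j^{(\tau)}$; coefficients are mutually independent over $k,j,\tau$ and of the messages, uniform on $\mathbb F_q^\times$ if $M_{kj}=*$, and $0$ if $M_{kj}=0$. Gaussian model: same with real signals, $Y_k^{(\tau)}=\sum_jG_{kj}^{(\tau)}X_j^{(\tau)}+Z_k^{(\tau)}$, $Z_k^{(\tau)}$ i.i.d. $\mathcal N(0,1)$, connected coefficients i.i.d. with a density $f$ with $\sup f<\infty$ and $1/c\le|G|\le c$, and power constraint $\mathbb E[\frac1n\sum_\tau\sum_j|X_j^{(\tau)}|^2]\le P$. Coding: independent messages $W_k$ uniform on finite $\mathcal M_k$ for Rx-$k$. Classical schemes: stochastic encoder from messages to inputs, stochastic decoders from each receiver's output sequence. A $\kappa$-partite NS box is a conditional pmf of outputs given inputs (finite output alphabets) such that for every subset of parties the marginal of their outputs depends only on their inputs. NS-assisted scheme: a $(K+1)$-partite NS box in which the transmitter inputs $(W_1,\dots,W_K)$ and obtains the channel input sequence, and Rx-$k$ inputs its full channel output sequence and obtains $\hat W_k$; joint law = uniform message pmf $\times$ box $\times$ channel law. Achievability: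 sequence of schemes with $\max_k\Pr(\hat W_k\ne W_k)\to0$ and $\lim\frac1n\log_2|\mathcal M_k^{(n)}|\ge R_k$; capacity regions $\mathcal C(q),\mathcal C^{\mathrm{NS}}(q)$ (or $\mathcal C(P),\mathcal C^{\mathrm{NS}}(P)$) are closures. DoF tuple $(d_k)$ achievable if for every prime power $q$ (resp. every $P>0$) some $(R_k)$ in the corresponding region has $\lim_{q\to\infty}R_k(q)/\log_2q\ge d_k$ (limit along prime powers) (resp. $\lim_{P\to\infty}R_k(P)/(\frac12\log_2P)\ge d_k$); $\mathcal D,\mathcal D^{\mathrm{NS}}$ are closures. Tree network: $\mathcal T$ is a rooted tree whose root Tx-0 is an imaginary transmitter connected to all receivers, with other vertices Tx-1..Tx-$B$; $\mathbf M$ must satisfy: (1) for each $k$, the set $\{\text{Tx-}j: M_{kj}=*\}$ lies on a single path from the root; (2) if $M_{kj}=*$ then Rx-$k$ is connected to every ancestor of Tx-$j$. depth(Tx-$j$) is the length of the path from the root to Tx-$j$; Tx(Rx-$k$) is the Tx of greatest depth among those connected to Rx-$k$. Assume $B,K>0$, every Rx-$k$ has a (unique) associated Tx, and every Tx-$b$ is associated with at least one receiver. Define $d_\Sigma(\text{Tx-}b)=\sum_{k:\text{Tx(Rx-}k)=\text{Tx-}b}d_k$ and $R_\Sigma(\text{Tx-}b)=\sum_{k:\text{Tx(Rx-}k)=\text{Tx-}b}R_k$. *)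

theory Defs
  imports "HOL-Probability.Probability" "HOL-Algebra.Ring"
begin

section \<open>Tree network (indices: receivers 1..K, transmitters 1..B, root Tx-0)\<close>

text \<open>par j is the parent of Tx-j in the rooted tree T; M k j means that Rx-k is connected to Tx-j
  (i.e. the entry of the connectivity matrix is a star).\<close>

definition anc_eq :: "(nat \<Rightarrow> nat) \<Rightarrow> nat \<Rightarrow> nat \<Rightarrow> bool" where
  "anc_eq par i j \<longleftrightarrow> (\<exists>t. (par ^^ t) j = i \<and> (\<forall>s<t. (par ^^ s) j \<noteq> 0))"

definition depth :: "(nat \<Rightarrow> nat) \<Rightarrow> nat \<Rightarrow> nat" where
  "depth par j = (LEAST t. (par ^^ t) j = 0)"

definition txof :: "nat \<Rightarrow> (nat \<Rightarrow> nat) \<Rightarrow> (nat \<Rightarrow> nat \<Rightarrow> bool) \<Rightarrow> nat \<Rightarrow> nat" where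
  "txof B par M k = (THE j. j \<in> {1..B} \<and> M k j \<and>
      (\<forall>i\<in>{1..B}. M k i \<longrightarrow> depth par i \<le> depth par j))"

definition tree_net :: "nat \<Rightarrow> nat \<Rightarrow> (nat \<Rightarrow> nat) \<Rightarrow> (nat \<Rightarrow> nat \<Rightarrow> bool) \<Rightarrow> bool" where
  "tree_net K B par M \<longleftrightarrow>
     0 < B \<and> 0 < K \<and>
     (\<forall>j\<in>{1..B}. par j \<in> {0..B} \<and> (\<exists>t. (par ^^ t) j = 0)) \<and>
     (\<forall>k\<in>{1..K}. \<forall>i\<in>{1..B}. \<forall>j\<in>{1..B}. M k i \<and> M k j \<longrightarrow> anc_eq par i j \<or> anc_eq par j i) \<and>
     (\<forall>k\<in>{1..K}. \<forall>j\<in>{1..B}. \<forall>i\<in>{1..B}. M k j \<and> anc_eq par i j \<longrightarrow> M k i) \<and>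
     (\<forall>k\<in>{1..K}. \<exists>j\<in>{1..B}. M k j) \<and>
     (\<forall>b\<in>{1..B}. \<exists>k\<in>{1..K}. txof B par M k = b)"

definition rtl_path :: "nat \<Rightarrow> (nat \<Rightarrow> nat) \<Rightarrow> nat list \<Rightarrow> bool" where
  "rtl_path B par bs \<longleftrightarrow> bs \<noteq> [] \<and> set bs \<subseteq> {1..B} \<and> par (hd bs) = 0 \<and>
     (\<forall>i. Suc i < length bs \<longrightarrow> par (bs ! Suc i) = bs ! i) \<and>
     (\<forall>j\<in>{1..B}. par j \<noteq> last bs)"

definition txsum :: "nat \<Rightarrow> nat \<Rightarrow> (nat \<Rightarrow> nat) \<Rightarrow> (nat \<Rightarrow> nat \<Rightarrow> bool) \<Rightarrow> (nat \<Rightarrow> real) \<Rightarrow> nat \<Rightarrow> real" where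
  "txsum K B par M d b = (\<Sum>k\<in>{k\<in>{1..K}. txof B par M k = b}. d k)"

definition rplus :: "nat \<Rightarrow> (nat \<Rightarrow> real) set" where
  "rplus K = {d. (\<forall>k. k \<notin> {1..K} \<longrightarrow> d k = 0) \<and> (\<forall>k\<in>{1..K}. 0 \<le> d k)}"

definition tree_dof_region :: "nat \<Rightarrow> nat \<Rightarrow> (nat \<Rightarrow> nat) \<Rightarrow> (nat \<Rightarrow> nat \<Rightarrow> bool) \<Rightarrow> (nat \<Rightarrow> real) set" where
  "tree_dof_region K B par M = {d \<in> rplus K.
     \<forall>bs. rtl_path B par bs \<longrightarrow> (\<Sum>b\<leftarrow>bs. txsum K B par M d b) \<le> 1}"

definition ns_dof_region :: "nat \<Rightarrow> nat \<Rightarrow> (nat \<Rightarrow> nat) \<Rightarrow> (nat \<Rightarrow> nat \<Rightarrow> bool) \<Rightarrow> (nat \<Rightarrow> real) set" where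
  "ns_dof_region K B par M = {d \<in> rplus K. \<forall>b\<in>{1..B}. txsum K B par M d b \<le> 1}"

definition msg_set :: "nat \<Rightarrow> (nat \<Rightarrow> nat) \<Rightarrow> (nat \<Rightarrow> nat) set" where
  "msg_set K m = {w. (\<forall>k\<in>{1..K}. w k < m k) \<and> (\<forall>k. k \<notin> {1..K} \<longrightarrow> w k = 0)}"

definition msg_pmf :: "nat \<Rightarrow> (nat \<Rightarrow> nat) \<Rightarrow> (nat \<Rightarrow> nat) pmf" where
  "msg_pmf K m = pmf_of_set (msg_set K m)"

text \<open>Party 0 is the transmitter (input i0, output x), party k in 1..K is Rx-k
  (input o k, output v k).\<close>

definition ns_restr :: "nat set \<Rightarrow> ('x \<times> (nat \<Rightarrow> nat)) \<Rightarrow> ('x option \<times> (nat \<Rightarrow> nat))" where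
  "ns_restr S = (\<lambda>(x, v). (if 0 \<in> S then Some x else None, \<lambda>k. if k \<in> S - {0} then v k else 0))"

definition ns_box :: "nat \<Rightarrow> ('i \<times> (nat \<Rightarrow> 'o) \<Rightarrow> ('x \<times> (nat \<Rightarrow> nat)) pmf) \<Rightarrow> bool" where
  "ns_box K nsb \<longleftrightarrow> (\<forall>S \<subseteq> {0..K}. \<forall>i ob i' ob'.
      (0 \<in> S \<longrightarrow> i = i') \<and> (\<forall>k\<in>S - {0}. ob k = ob' k) \<longrightarrow>
      map_pmf (ns_restr S) (nsb (i, ob)) = map_pmf (ns_restr S) (nsb (i', ob')))"

definition ff_X :: "('a, 'b) ring_scheme \<Rightarrow> nat \<Rightarrow> nat \<Rightarrow> (nat \<times> nat \<Rightarrow> 'a) set" where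
  "ff_X F n B = {x. \<forall>\<tau> j. ((\<tau>, j) \<in> {..<n} \<times> {1..B} \<longrightarrow> x (\<tau>, j) \<in> carrier F) \<and>
                            ((\<tau>, j) \<notin> {..<n} \<times> {1..B} \<longrightarrow> x (\<tau>, j) = \<zero>\<^bsub>F\<^esub>)}"

definition ff_coef :: "('a, 'b) ring_scheme \<Rightarrow> (nat \<Rightarrow> nat \<Rightarrow> bool) \<Rightarrow> nat \<Rightarrow> nat \<Rightarrow> nat
      \<Rightarrow> (nat \<times> nat \<times> nat \<Rightarrow> 'a) pmf" where
  "ff_coef F M K B n = Pi_pmf ({..<n} \<times> {1..K} \<times> {1..B}) \<zero>\<^bsub>F\<^esub>
     (\<lambda>(\<tau>, k, j). if M k j then pmf_of_set (carrier F - {\<zero>\<^bsub>F\<^esub>}) else return_pmf \<zero>\<^bsub>F\<^esub>)"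

definition ff_obs :: "('a, 'b) ring_scheme \<Rightarrow> nat \<Rightarrow> nat \<Rightarrow> (nat \<times> nat \<Rightarrow> 'a)
      \<Rightarrow> (nat \<times> nat \<times> nat \<Rightarrow> 'a) \<Rightarrow> nat \<Rightarrow> nat \<Rightarrow> 'a \<times> (nat \<Rightarrow> 'a)" where
  "ff_obs F n B x G k = (\<lambda>\<tau>. if \<tau> < n
      then (finsum F (\<lambda>j. G (\<tau>, k, j) \<otimes>\<^bsub>F\<^esub> x (\<tau>, j)) {1..B}, \<lambda>j. G (\<tau>, k, j))
      else (\<zero>\<^bsub>F\<^esub>, \<lambda>_. \<zero>\<^bsub>F\<^esub>))"

definition ff_cl_scheme :: "('a, 'b) ring_scheme \<Rightarrow> nat \<Rightarrow> nat \<Rightarrow> nat \<Rightarrow> (nat \<Rightarrow> nat)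
      \<Rightarrow> ((nat \<Rightarrow> nat) \<Rightarrow> (nat \<times> nat \<Rightarrow> 'a) pmf) \<Rightarrow> bool" where
  "ff_cl_scheme F K B n m enc \<longleftrightarrow> (\<forall>k\<in>{1..K}. 1 \<le> m k) \<and>
     (\<forall>w\<in>msg_set K m. set_pmf (enc w) \<subseteq> ff_X F n B)"

definition ff_cl_err :: "('a, 'b) ring_scheme \<Rightarrow> (nat \<Rightarrow> nat \<Rightarrow> bool) \<Rightarrow> nat \<Rightarrow> nat \<Rightarrow> nat
      \<Rightarrow> (nat \<Rightarrow> nat) \<Rightarrow> ((nat \<Rightarrow> nat) \<Rightarrow> (nat \<times> nat \<Rightarrow> 'a) pmf)
      \<Rightarrow> (nat \<Rightarrow> (nat \<Rightarrow> 'a \<times> (nat \<Rightarrow> 'a)) \<Rightarrow> nat pmf) \<Rightarrow> nat \<Rightarrow> real" where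
  "ff_cl_err F M K B n m enc dec k = measure_pmf.prob
     (bind_pmf (msg_pmf K m) (\<lambda>w. bind_pmf (enc w) (\<lambda>x. bind_pmf (ff_coef F M K B n) (\<lambda>G.
        map_pmf (\<lambda>v. v \<noteq> w k) (dec k (ff_obs F n B x G k)))))) {True}"

definition ff_ns_scheme :: "('a, 'b) ring_scheme \<Rightarrow> nat \<Rightarrow> nat \<Rightarrow> nat \<Rightarrow> (nat \<Rightarrow> nat)
      \<Rightarrow> ((nat \<Rightarrow> nat) \<times> (nat \<Rightarrow> nat \<Rightarrow> 'a \<times> (nat \<Rightarrow> 'a)) \<Rightarrow> ((nat \<times> nat \<Rightarrow> 'a) \<times> (nat \<Rightarrow> nat)) pmf)
      \<Rightarrow> bool" where
  "ff_ns_scheme F K B n m nsb \<longleftrightarrow> (\<forall>k\<in>{1..K}. 1 \<le> m k) \<and> ns_box K nsb \<and>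
     (\<exists>A. finite A \<and> (\<forall>i. set_pmf (nsb i) \<subseteq> A)) \<and>
     (\<forall>i. fst ` set_pmf (nsb i) \<subseteq> ff_X F n B)"

text \<open>Error probability of Rx-k under the joint law message pmf x nsb x channel law.\<close>
definition ff_ns_err :: "('a, 'b) ring_scheme \<Rightarrow> (nat \<Rightarrow> nat \<Rightarrow> bool) \<Rightarrow> nat \<Rightarrow> nat \<Rightarrow> nat
      \<Rightarrow> (nat \<Rightarrow> nat)
      \<Rightarrow> ((nat \<Rightarrow> nat) \<times> (nat \<Rightarrow> nat \<Rightarrow> 'a \<times> (nat \<Rightarrow> 'a)) \<Rightarrow> ((nat \<times> nat \<Rightarrow> 'a) \<times> (nat \<Rightarrow> nat)) pmf)
      \<Rightarrow> nat \<Rightarrow> real" where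
  "ff_ns_err F M K B n m nsb k =
     (\<Sum>w\<in>msg_set K m. \<Sum>x\<in>ff_X F n B.
        measure_pmf.expectation (ff_coef F M K B n)
          (\<lambda>G. measure_pmf.prob (nsb (w, \<lambda>k'. ff_obs F n B x G k'))
                 {(x', v). x' = x \<and> v k \<noteq> w k}))
     / real (card (msg_set K m))"

definition ff_cl_cap :: "('a, 'b) ring_scheme \<Rightarrow> (nat \<Rightarrow> nat \<Rightarrow> bool) \<Rightarrow> nat \<Rightarrow> nat \<Rightarrow> (nat \<Rightarrow> real) set" where
  "ff_cl_cap F M K B = closure {R \<in> rplus K. \<exists>m enc dec.
     (\<forall>n. ff_cl_scheme F K B n (m n) (enc n)) \<and>
     (\<lambda>n. Max ((\<lambda>k. ff_cl_err F M K B n (m n) (enc n) (dec n) k) ` {1..K})) \<longlonglongrightarrow> 0 \<and>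
     (\<forall>k\<in>{1..K}. ereal (R k) \<le> liminf (\<lambda>n. ereal (log 2 (real (m n k)) / real n)))}"

definition ff_ns_cap :: "('a, 'b) ring_scheme \<Rightarrow> (nat \<Rightarrow> nat \<Rightarrow> bool) \<Rightarrow> nat \<Rightarrow> nat \<Rightarrow> (nat \<Rightarrow> real) set" where
  "ff_ns_cap F M K B = closure {R \<in> rplus K. \<exists>m nsb.
     (\<forall>n. ff_ns_scheme F K B n (m n) (nsb n)) \<and>
     (\<lambda>n. Max ((\<lambda>k. ff_ns_err F M K B n (m n) (nsb n) k) ` {1..K})) \<longlonglongrightarrow> 0 \<and>
     (\<forall>k\<in>{1..K}. ereal (R k) \<le> liminf (\<lambda>n. ereal (log 2 (real (m n k)) / real n)))}"

definition prime_powers :: "nat set" where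
  "prime_powers = {q. \<exists>p e. prime p \<and> 0 < e \<and> q = p ^ e}"

text \<open>DoF regions: fields are represented with carrier type nat (every finite field is isomorphic
  to such a one); R q must lie in the capacity region of (every copy of) F_q.\<close>
definition ff_cl_dof :: "(nat \<Rightarrow> nat \<Rightarrow> bool) \<Rightarrow> nat \<Rightarrow> nat \<Rightarrow> (nat \<Rightarrow> real) set" where
  "ff_cl_dof M K B = closure {d \<in> rplus K. \<exists>R :: nat \<Rightarrow> nat \<Rightarrow> real.
     (\<forall>F :: nat ring. field F \<and> finite (carrier F) \<longrightarrow> R (card (carrier F)) \<in> ff_cl_cap F M K B) \<and>
     (\<forall>k\<in>{1..K}. ereal (d k) \<le>
        Liminf (at_top \<sqinter> principal prime_powers) (\<lambda>q. ereal (R q k / log 2 (real q))))}"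

definition ff_ns_dof :: "(nat \<Rightarrow> nat \<Rightarrow> bool) \<Rightarrow> nat \<Rightarrow> nat \<Rightarrow> (nat \<Rightarrow> real) set" where
  "ff_ns_dof M K B = closure {d \<in> rplus K. \<exists>R :: nat \<Rightarrow> nat \<Rightarrow> real.
     (\<forall>F :: nat ring. field F \<and> finite (carrier F) \<longrightarrow> R (card (carrier F)) \<in> ff_ns_cap F M K B) \<and>
     (\<forall>k\<in>{1..K}. ereal (d k) \<le>
        Liminf (at_top \<sqinter> principal prime_powers) (\<lambda>q. ereal (R q k / log 2 (real q))))}"

definition admissible_density :: "(real \<Rightarrow> real) \<Rightarrow> real \<Rightarrow> bool" where
  "admissible_density f c \<longleftrightarrow> f \<in> borel_measurable borel \<and> (\<forall>x. 0 \<le> f x) \<and>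
     (\<integral>\<^sup>+x. ennreal (f x) \<partial>lborel) = 1 \<and> bdd_above (range f) \<and> 0 < c \<and>
     (AE x in lborel. f x \<noteq> 0 \<longrightarrow> 1 / c \<le> \<bar>x\<bar> \<and> \<bar>x\<bar> \<le> c)"

definition gX :: "nat \<Rightarrow> nat \<Rightarrow> (nat \<times> nat \<Rightarrow> real) measure" where
  "gX n B = (\<Pi>\<^sub>M p\<in>{..<n} \<times> {1..B}. borel)"

definition gState :: "(nat \<Rightarrow> nat \<Rightarrow> bool) \<Rightarrow> nat \<Rightarrow> nat \<Rightarrow> nat \<Rightarrow> (real \<Rightarrow> real)
      \<Rightarrow> ((nat \<times> nat \<times> nat \<Rightarrow> real) \<times> (nat \<times> nat \<Rightarrow> real)) measure" where
  "gState M K B n f =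
     (\<Pi>\<^sub>M p\<in>{..<n} \<times> {1..K} \<times> {1..B}.
        (case p of (\<tau>, k, j) \<Rightarrow> if M k j then density lborel (\<lambda>x. ennreal (f x)) else return borel 0))
     \<Otimes>\<^sub>M (\<Pi>\<^sub>M p\<in>{..<n} \<times> {1..K}. density lborel (\<lambda>x. ennreal (std_normal_density x)))"

definition gOM :: "nat \<Rightarrow> nat \<Rightarrow> (nat \<Rightarrow> real \<times> (nat \<Rightarrow> real)) measure" where
  "gOM n B = (\<Pi>\<^sub>M \<tau>\<in>{..<n}. (borel \<Otimes>\<^sub>M (\<Pi>\<^sub>M j\<in>{1..B}. borel)))"

definition gobs :: "nat \<Rightarrow> nat \<Rightarrow> (nat \<times> nat \<Rightarrow> real)
      \<Rightarrow> ((nat \<times> nat \<times> nat \<Rightarrow> real) \<times> (nat \<times> nat \<Rightarrow> real)) \<Rightarrow> nat \<Rightarrow> nat \<Rightarrow> real \<times> (nat \<Rightarrow> real)" where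
  "gobs n B x s k = (\<lambda>\<tau>\<in>{..<n}.
      ((\<Sum>j\<in>{1..B}. fst s (\<tau>, k, j) * x (\<tau>, j)) + snd s (\<tau>, k), \<lambda>j\<in>{1..B}. fst s (\<tau>, k, j)))"

definition gpow :: "nat \<Rightarrow> nat \<Rightarrow> (nat \<times> nat \<Rightarrow> real) \<Rightarrow> real" where
  "gpow n B x = (\<Sum>\<tau><n. \<Sum>j\<in>{1..B}. (x (\<tau>, j))\<^sup>2) / real n"

definition g_cl_scheme :: "nat \<Rightarrow> nat \<Rightarrow> nat \<Rightarrow> real \<Rightarrow> (nat \<Rightarrow> nat)
      \<Rightarrow> ((nat \<Rightarrow> nat) \<Rightarrow> (nat \<times> nat \<Rightarrow> real) measure)
      \<Rightarrow> (nat \<Rightarrow> (nat \<Rightarrow> real \<times> (nat \<Rightarrow> real)) \<Rightarrow> nat pmf) \<Rightarrow> bool" where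
  "g_cl_scheme K B n P m enc dec \<longleftrightarrow> (\<forall>k\<in>{1..K}. 1 \<le> m k) \<and>
     (\<forall>w\<in>msg_set K m. enc w \<in> space (prob_algebra (gX n B))) \<and>
     (\<forall>k\<in>{1..K}. \<forall>a. (\<lambda>ob. pmf (dec k ob) a) \<in> borel_measurable (gOM n B)) \<and>
     (\<Sum>w\<in>msg_set K m. \<integral>\<^sup>+x. ennreal (gpow n B x) \<partial>enc w)
        \<le> ennreal (P * real (card (msg_set K m)))"

definition g_cl_err :: "(nat \<Rightarrow> nat \<Rightarrow> bool) \<Rightarrow> nat \<Rightarrow> nat \<Rightarrow> (real \<Rightarrow> real) \<Rightarrow> nat \<Rightarrow> (nat \<Rightarrow> nat)
      \<Rightarrow> ((nat \<Rightarrow> nat) \<Rightarrow> (nat \<times> nat \<Rightarrow> real) measure)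
      \<Rightarrow> (nat \<Rightarrow> (nat \<Rightarrow> real \<times> (nat \<Rightarrow> real)) \<Rightarrow> nat pmf) \<Rightarrow> nat \<Rightarrow> real" where
  "g_cl_err M K B f n m enc dec k = 1 -
     (\<Sum>w\<in>msg_set K m. \<integral>x. (\<integral>s. pmf (dec k (gobs n B x s k)) (w k) \<partial>gState M K B n f) \<partial>enc w)
     / real (card (msg_set K m))"

definition g_ns_scheme :: "nat \<Rightarrow> nat \<Rightarrow> nat \<Rightarrow> real \<Rightarrow> (nat \<Rightarrow> nat) \<Rightarrow> (real \<Rightarrow> real) \<Rightarrow> (nat \<Rightarrow> nat \<Rightarrow> bool)
      \<Rightarrow> ((nat \<Rightarrow> nat) \<times> (nat \<Rightarrow> nat \<Rightarrow> real \<times> (nat \<Rightarrow> real)) \<Rightarrow> ((nat \<times> nat \<Rightarrow> real) \<times> (nat \<Rightarrow> nat)) pmf)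
      \<Rightarrow> ((nat \<times> nat \<Rightarrow> real) \<times> (nat \<Rightarrow> nat)) set \<Rightarrow> bool" where
  "g_ns_scheme K B n P m f M nsb A \<longleftrightarrow> (\<forall>k\<in>{1..K}. 1 \<le> m k) \<and> ns_box K nsb \<and>
     finite A \<and> (\<forall>i. set_pmf (nsb i) \<subseteq> A) \<and>
     (\<forall>w a. (\<lambda>ob. pmf (nsb (w, ob)) a) \<in> borel_measurable (\<Pi>\<^sub>M k\<in>{1..K}. gOM n B)) \<and>
     (\<Sum>w\<in>msg_set K m. \<Sum>x\<in>fst ` A.
        \<integral>s. measure_pmf.prob (nsb (w, \<lambda>k\<in>{1..K}. gobs n B x s k)) {p. fst p = x} * gpow n B x
          \<partial>gState M K B n f) \<le> P * real (card (msg_set K m))"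

definition g_ns_err :: "(nat \<Rightarrow> nat \<Rightarrow> bool) \<Rightarrow> nat \<Rightarrow> nat \<Rightarrow> (real \<Rightarrow> real) \<Rightarrow> nat \<Rightarrow> (nat \<Rightarrow> nat)
      \<Rightarrow> ((nat \<Rightarrow> nat) \<times> (nat \<Rightarrow> nat \<Rightarrow> real \<times> (nat \<Rightarrow> real)) \<Rightarrow> ((nat \<times> nat \<Rightarrow> real) \<times> (nat \<Rightarrow> nat)) pmf)
      \<Rightarrow> ((nat \<times> nat \<Rightarrow> real) \<times> (nat \<Rightarrow> nat)) set \<Rightarrow> nat \<Rightarrow> real" where
  "g_ns_err M K B f n m nsb A k =
     (\<Sum>w\<in>msg_set K m. \<Sum>x\<in>fst ` A.
        \<integral>s. measure_pmf.prob (nsb (w, \<lambda>k'\<in>{1..K}. gobs n B x s k')) {(x', v). x' = x \<and> v k \<noteq> w k}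
          \<partial>gState M K B n f)
     / real (card (msg_set K m))"

definition g_cl_cap :: "(nat \<Rightarrow> nat \<Rightarrow> bool) \<Rightarrow> nat \<Rightarrow> nat \<Rightarrow> (real \<Rightarrow> real) \<Rightarrow> real \<Rightarrow> (nat \<Rightarrow> real) set" where
  "g_cl_cap M K B f P = closure {R \<in> rplus K. \<exists>m enc dec.
     (\<forall>n. g_cl_scheme K B n P (m n) (enc n) (dec n)) \<and>
     (\<lambda>n. Max ((\<lambda>k. g_cl_err M K B f n (m n) (enc n) (dec n) k) ` {1..K})) \<longlonglongrightarrow> 0 \<and>
     (\<forall>k\<in>{1..K}. ereal (R k) \<le> liminf (\<lambda>n. ereal (log 2 (real (m n k)) / real n)))}"

definition g_ns_cap :: "(nat \<Rightarrow> nat \<Rightarrow> bool) \<Rightarrow> nat \<Rightarrow> nat \<Rightarrow> (real \<Rightarrow> real) \<Rightarrow> real \<Rightarrow> (nat \<Rightarrow> real) set" where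
  "g_ns_cap M K B f P = closure {R \<in> rplus K. \<exists>m nsb A.
     (\<forall>n. g_ns_scheme K B n P (m n) f M (nsb n) (A n)) \<and>
     (\<lambda>n. Max ((\<lambda>k. g_ns_err M K B f n (m n) (nsb n) (A n) k) ` {1..K})) \<longlonglongrightarrow> 0 \<and>
     (\<forall>k\<in>{1..K}. ereal (R k) \<le> liminf (\<lambda>n. ereal (log 2 (real (m n k)) / real n)))}"

definition g_cl_dof :: "(nat \<Rightarrow> nat \<Rightarrow> bool) \<Rightarrow> nat \<Rightarrow> nat \<Rightarrow> (real \<Rightarrow> real) \<Rightarrow> (nat \<Rightarrow> real) set" where
  "g_cl_dof M K B f = closure {d \<in> rplus K. \<exists>R :: real \<Rightarrow> nat \<Rightarrow> real.
     (\<forall>P>0. R P \<in> g_cl_cap M K B f P) \<and>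
     (\<forall>k\<in>{1..K}. ereal (d k) \<le> Liminf at_top (\<lambda>P. ereal (R P k / (log 2 P / 2))))}"

definition g_ns_dof :: "(nat \<Rightarrow> nat \<Rightarrow> bool) \<Rightarrow> nat \<Rightarrow> nat \<Rightarrow> (real \<Rightarrow> real) \<Rightarrow> (nat \<Rightarrow> real) set" where
  "g_ns_dof M K B f = closure {d \<in> rplus K. \<exists>R :: real \<Rightarrow> nat \<Rightarrow> real.
     (\<forall>P>0. R P \<in> g_ns_cap M K B f P) \<and>
     (\<forall>k\<in>{1..K}. ereal (d k) \<le> Liminf at_top (\<lambda>P. ereal (R P k / (log 2 P / 2))))}"

end

theory Submission
  imports Defs "HOL-Real_Asymp.Real_Asymp" "HOL-Number_Theory.Residues" "HOL-Algebra.Weak_Morphisms"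
begin

text \<open>Classical converse: the receivers associated with a root-to-leaf path observe nested sets of
  transmitters.  Instead of entropies one estimates the weighted number of pairs of messages and inputs
  that agree on the receivers decoded so far, weighted with a correlation kernel of the two inputs on the
  current set of transmitters.  A Schur test passes from one receiver to the next at the cost of the
  factor q (or about the square root of P) for the first receiver only; each further step costs a constant
  because the fading makes distinct inputs distinguishable.

  Non-signalling converse: receivers with the same transmitter have exchangeable observations, so by
  no-signalling they may share one observation; since that observation has density at most q^n
  (or about P^(n/2)) relative to a fixed output law, the product of their message sets obeys the
  point-to-point bound.

  Achievability: time slots are assigned greedily so that receivers in conflict use disjoint slots.
  Classically, two receivers on a common path conflict.  With a non-signalling box only receivers of the
  same transmitter do: the uniformly distributed channel input acts as a one-time pad that lets a receiver
  cancel the interference of its ancestors, which triangularity along the tree makes non-signalling.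
  For the Gaussian channel the inputs are taken from an integer lattice and a Gilbert--Varshamov code
  corrects the few symbols with large noise.\<close>

section \<open>Collision bounds for chains of receivers with nested observations\<close>

text \<open>Counting pairs needs only second moments, so arbitrary encoders and continuous inputs
  require no differential entropies. The delicate point is the Gaussian correlation kernel.
  Averaging over a gain of bounded density makes the overlap of two output laws decay like the
  inverse distance of the inputs, and this decay is not integrable on the line. The kernel therefore
  gets an exponent \<open>a\<close> slightly above \<open>1/2\<close> in the squared distance. The
  mismatch costs the power \<open>a - 1/2\<close> of \<open>1 + 16 * P\<close> per receiver and use,
  which disappears when \<open>a\<close> tends to \<open>1/2\<close> after \<open>P\<close> has
  grown. Unbounded noise is the second obstacle: the converse weights the normal density by
  \<open>1 + z\<^sup>2\<close>, and the code gives up a fraction \<open>2 * \<delta>\<close> of its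
  symbols and one bit per use. These losses are invisible in degrees of freedom only, whereas the
  finite-field codes make no error at all and attain capacity. In the non-signalling setting a box
  emits the very input that causes the observations fed to it; what makes this a probability law is
  that the receivers cannot signal to the transmitter.\<close>

lemma ennreal_two_mult_le_sum_squares: "2 * (a * b) \<le> a\<^sup>2 + (b::ennreal)\<^sup>2"
proof (cases "a = \<top> \<or> b = \<top>")
  case True
  then show ?thesis by (auto simp: power2_eq_square)
next
  case False
  then obtain x y where "a = ennreal x" "b = ennreal y" "0 \<le> x" "0 \<le> y"
    by (metis ennreal_cases)
  then show ?thesis
    using sum_squares_bound[of x y]
    by (simp add: ennreal_mult[symmetric] ennreal_power ennreal_plus[symmetric] mult.assoc
        ennreal_numeral[symmetric] del: ennreal_plus ennreal_numeral)
qed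

lemma ennreal_two_mult_le_cancel: "2 * a \<le> 2 * (b::ennreal) \<Longrightarrow> a \<le> b"
  by (subst (asm) ennreal_mult_le_mult_iff) auto

text \<open>Jensen's inequality for subprobability weights, after which each weight is bounded by
  one. The weights will be the probabilities with which a decoder announces the possible
  messages.\<close>

lemma weighted_sum_square_le:
  fixes D A :: "'v \<Rightarrow> ennreal"
  assumes "sum D V \<le> 1"
  shows "(\<Sum>v\<in>V. D v * A v)\<^sup>2 \<le> (\<Sum>v\<in>V. (A v)\<^sup>2)"
proof (cases "finite V")
  case True
  have D1: "D v \<le> 1" if "v \<in> V" for v
    using member_le_sum[of v V D] that True assms by (auto intro: order_trans)
  have "2 * (\<Sum>v\<in>V. D v * A v)\<^sup>2 = (\<Sum>v\<in>V. \<Sum>v'\<in>V. D v * D v' * (2 * (A v * A v')))"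
    by (simp add: power2_eq_square sum_product sum_distrib_left mult_ac)
  also have "\<dots> \<le> (\<Sum>v\<in>V. \<Sum>v'\<in>V. D v * D v' * ((A v)\<^sup>2 + (A v')\<^sup>2))"
    by (intro sum_mono mult_left_mono ennreal_two_mult_le_sum_squares) auto
  also have "\<dots> = (\<Sum>v\<in>V. D v * (A v)\<^sup>2) * sum D V + (\<Sum>v\<in>V. D v * (A v)\<^sup>2) * sum D V"
    by (simp add: distrib_left sum.distrib sum_product mult_ac)
      (subst (2) sum.swap, simp add: mult_ac)
  also have "\<dots> = 2 * ((\<Sum>v\<in>V. D v * (A v)\<^sup>2) * sum D V)"
    by (simp add: mult_2)
  finally have "(\<Sum>v\<in>V. D v * A v)\<^sup>2 \<le> (\<Sum>v\<in>V. D v * (A v)\<^sup>2) * sum D V"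
    by (rule ennreal_two_mult_le_cancel)
  also have "\<dots> \<le> (\<Sum>v\<in>V. 1 * (A v)\<^sup>2) * 1"
    using assms D1 by (intro mult_mono sum_mono) auto
  finally show ?thesis by simp
qed auto

lemma sum_square_le_card:
  fixes A :: "'v \<Rightarrow> ennreal"
  shows "(\<Sum>v\<in>V. A v)\<^sup>2 \<le> of_nat (card V) * (\<Sum>v\<in>V. (A v)\<^sup>2)"
proof (rule ennreal_two_mult_le_cancel)
  have "2 * (\<Sum>v\<in>V. A v)\<^sup>2 = (\<Sum>v\<in>V. \<Sum>v'\<in>V. 2 * (A v * A v'))"
    by (simp add: power2_eq_square sum_product sum_distrib_left mult_ac)
  also have "\<dots> \<le> (\<Sum>v\<in>V. \<Sum>v'\<in>V. (A v)\<^sup>2 + (A v')\<^sup>2)"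
    by (intro sum_mono ennreal_two_mult_le_sum_squares)
  also have "\<dots> = 2 * (of_nat (card V) * (\<Sum>v\<in>V. (A v)\<^sup>2))"
    by (simp add: sum.distrib mult_2 sum_distrib_left)
  finally show "2 * (\<Sum>v\<in>V. A v)\<^sup>2 \<le> 2 * (of_nat (card V) * (\<Sum>v\<in>V. (A v)\<^sup>2))" .
qed

text \<open>After \<open>2 * (f y * f y') \<le> (f y)\<^sup>2 + (f y')\<^sup>2\<close> the two
  resulting integrals coincide by symmetry of \<open>h\<close>, and each is controlled by the row
  integrals. A kernel that couples two outputs is thereby replaced by the diagonal.\<close>

lemma schur_test:
  fixes h :: "'y \<Rightarrow> 'y \<Rightarrow> ennreal"
  assumes "sigma_finite_measure M"
    and h[measurable]: "(\<lambda>(y, y'). h y y') \<in> borel_measurable (M \<Otimes>\<^sub>M M)"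
    and [measurable]: "f \<in> borel_measurable M"
    and sym: "\<And>y y'. h y y' = h y' y"
    and H: "\<And>y. y \<in> space M \<Longrightarrow> (\<integral>\<^sup>+y'. h y y' \<partial>M) \<le> H"
  shows "(\<integral>\<^sup>+y. \<integral>\<^sup>+y'. h y y' * (f y * f y') \<partial>M \<partial>M) \<le> H * (\<integral>\<^sup>+y. (f y)\<^sup>2 \<partial>M)"
proof (rule ennreal_two_mult_le_cancel)
  interpret sigma_finite_measure M by fact
  interpret pair_sigma_finite M M ..
  have "2 * (\<integral>\<^sup>+y. \<integral>\<^sup>+y'. h y y' * (f y * f y') \<partial>M \<partial>M)
      = (\<integral>\<^sup>+y. \<integral>\<^sup>+y'. h y y' * (2 * (f y * f y')) \<partial>M \<partial>M)"
  proof -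
    have "2 * (\<integral>\<^sup>+y. \<integral>\<^sup>+y'. h y y' * (f y * f y') \<partial>M \<partial>M)
        = (\<integral>\<^sup>+y. 2 * (\<integral>\<^sup>+y'. h y y' * (f y * f y') \<partial>M) \<partial>M)"
      by (rule nn_integral_cmult[symmetric]) measurable
    also have "\<dots> = (\<integral>\<^sup>+y. \<integral>\<^sup>+y'. 2 * (h y y' * (f y * f y')) \<partial>M \<partial>M)"
      by (intro nn_integral_cong nn_integral_cmult[symmetric]) measurable
    finally show ?thesis by (simp only: mult.left_commute[of "2::ennreal"])
  qed
  also have "\<dots> \<le> (\<integral>\<^sup>+y. \<integral>\<^sup>+y'. h y y' * ((f y)\<^sup>2 + (f y')\<^sup>2) \<partial>M \<partial>M)"
    by (intro nn_integral_mono mult_left_mono ennreal_two_mult_le_sum_squares) auto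
  also have "\<dots> = (\<integral>\<^sup>+y. \<integral>\<^sup>+y'. h y y' * (f y)\<^sup>2 \<partial>M \<partial>M) + (\<integral>\<^sup>+y. \<integral>\<^sup>+y'. h y y' * (f y')\<^sup>2 \<partial>M \<partial>M)"
  proof -
    have "(\<integral>\<^sup>+y. \<integral>\<^sup>+y'. h y y' * ((f y)\<^sup>2 + (f y')\<^sup>2) \<partial>M \<partial>M)
      = (\<integral>\<^sup>+y. (\<integral>\<^sup>+y'. h y y' * (f y)\<^sup>2 \<partial>M) + (\<integral>\<^sup>+y'. h y y' * (f y')\<^sup>2 \<partial>M) \<partial>M)"
      unfolding distrib_left by (intro nn_integral_cong nn_integral_add) measurable
    also have "\<dots> = (\<integral>\<^sup>+y. \<integral>\<^sup>+y'. h y y' * (f y)\<^sup>2 \<partial>M \<partial>M) + (\<integral>\<^sup>+y. \<integral>\<^sup>+y'. h y y' * (f y')\<^sup>2 \<partial>M \<partial>M)"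
      by (intro nn_integral_add) measurable
    finally show ?thesis .
  qed
  also have "(\<integral>\<^sup>+y. \<integral>\<^sup>+y'. h y y' * (f y')\<^sup>2 \<partial>M \<partial>M) = (\<integral>\<^sup>+y'. \<integral>\<^sup>+y. h y y' * (f y')\<^sup>2 \<partial>M \<partial>M)"
    by (rule Fubini') measurable
  also have "\<dots> = (\<integral>\<^sup>+y. \<integral>\<^sup>+y'. h y y' * (f y)\<^sup>2 \<partial>M \<partial>M)"
    by (intro nn_integral_cong) (simp add: sym)
  also have "(\<integral>\<^sup>+y. \<integral>\<^sup>+y'. h y y' * (f y)\<^sup>2 \<partial>M \<partial>M) = (\<integral>\<^sup>+y. (\<integral>\<^sup>+y'. h y y' \<partial>M) * (f y)\<^sup>2 \<partial>M)"
    by (intro nn_integral_cong nn_integral_multc) auto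
  also have "\<dots> \<le> (\<integral>\<^sup>+y. H * (f y)\<^sup>2 \<partial>M)"
    by (intro nn_integral_mono mult_right_mono H) auto
  also have "\<dots> = H * (\<integral>\<^sup>+y. (f y)\<^sup>2 \<partial>M)"
    by (simp add: nn_integral_cmult)
  finally show "2 * (\<integral>\<^sup>+y. \<integral>\<^sup>+y'. h y y' * (f y * f y') \<partial>M \<partial>M) \<le> 2 * (H * (\<integral>\<^sup>+y. (f y)\<^sup>2 \<partial>M))"
    by (simp add: mult_2 add_mono)
qed

lemma (in prob_space) nn_integral_square_le:
  assumes [measurable]: "f \<in> borel_measurable M"
  shows "(\<integral>\<^sup>+y. f y \<partial>M)\<^sup>2 \<le> (\<integral>\<^sup>+y. (f y)\<^sup>2 \<partial>M)"
proof -
  have "(\<integral>\<^sup>+y. f y \<partial>M)\<^sup>2 = (\<integral>\<^sup>+y. \<integral>\<^sup>+y'. 1 * (f y * f y') \<partial>M \<partial>M)"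
    by (simp add: nn_integral_cmult nn_integral_multc power2_eq_square)
  also have "\<dots> \<le> 1 * (\<integral>\<^sup>+y. (f y)\<^sup>2 \<partial>M)"
    by (rule schur_test) (auto simp: emeasure_space_1 sigma_finite_measure_axioms)
  finally show ?thesis by simp
qed

section \<open>Energies of message pairs\<close>

lemma nn_integral_sum_square:
  assumes g: "\<And>w. w \<in> S \<Longrightarrow> g w \<in> borel_measurable M"
  shows "(\<integral>\<^sup>+y. (\<Sum>w\<in>S. g w y)\<^sup>2 \<partial>M) = (\<Sum>w\<in>S. \<Sum>w'\<in>S. \<integral>\<^sup>+y. g w y * g w' y \<partial>M)"
  unfolding power2_eq_square sum_product
  by (intro trans[OF nn_integral_sum] sum.cong refl nn_integral_sum)
     (auto intro!: borel_measurable_sum borel_measurable_times_ennreal g)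

text \<open>Unnormalised expectation over two codewords drawn independently for two messages of the
  same class of \<open>r\<close>, the diagonal included. The weight \<open>u\<close> carries the
  success probabilities and indicators collected so far, and \<open>\<kappa>\<close> measures how
  hard the two inputs are to tell apart.\<close>

definition pair_energy ::
  "'w set \<Rightarrow> ('w \<Rightarrow> 'l) \<Rightarrow> ('w \<Rightarrow> 'x measure) \<Rightarrow> ('w \<Rightarrow> 'x \<Rightarrow> ennreal) \<Rightarrow> ('x \<Rightarrow> 'x \<Rightarrow> ennreal) \<Rightarrow> ennreal" where
  "pair_energy W r N u \<kappa> = (\<Sum>w\<in>W. \<Sum>w'\<in>{w'\<in>W. r w' = r w}.
     \<integral>\<^sup>+x. \<integral>\<^sup>+x'. u w x * u w' x' * \<kappa> x x' \<partial>N w' \<partial>N w)"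

text \<open>For a Gram kernel the double sum over a class is the integral of a square, by expanding
  the square and moving the integral over \<open>y\<close> inwards. The Schur test ends in such
  squares, and this turns them back into an energy.\<close>

lemma pair_energy_product_form:
  assumes sf: "\<And>w. w \<in> W \<Longrightarrow> sigma_finite_measure (N w)" and [simp]: "finite W"
    and "sigma_finite_measure L"
    and sets: "\<And>w. w \<in> W \<Longrightarrow> sets (N w) = sets X"
    and u: "\<And>w. w \<in> W \<Longrightarrow> u w \<in> borel_measurable X"
    and p[measurable]: "(\<lambda>(y, x). p y x) \<in> borel_measurable (L \<Otimes>\<^sub>M X)"
  shows "(\<Sum>l\<in>r ` W. \<integral>\<^sup>+y. (\<Sum>w\<in>{w\<in>W. r w = l}. \<integral>\<^sup>+x. u w x * p y x \<partial>N w)\<^sup>2 \<partial>L)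
     = pair_energy W r N u (\<lambda>x x'. \<integral>\<^sup>+y. p y x * p y x' \<partial>L)"
proof -
  interpret L: sigma_finite_measure L by fact
  note [measurable_cong] = sets
  note [measurable] = u
  have [simp]: "space (N w) = space X" if "w \<in> W" for w
    using sets_eq_imp_space_eq[OF sets] that by auto
  have m[measurable]: "w \<in> W \<Longrightarrow> (\<lambda>y. \<integral>\<^sup>+x. u w x * p y x \<partial>N w) \<in> borel_measurable L" for w
    by (rule sigma_finite_measure.borel_measurable_nn_integral[OF sf]) measurable
  have eq: "(\<integral>\<^sup>+y. (\<integral>\<^sup>+x. u w x * p y x \<partial>N w) * (\<integral>\<^sup>+x'. u w' x' * p y x' \<partial>N w') \<partial>L)
     = (\<integral>\<^sup>+x. \<integral>\<^sup>+x'. u w x * u w' x' * (\<integral>\<^sup>+y. p y x * p y x' \<partial>L) \<partial>N w' \<partial>N w)"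
    if [simp,measurable]: "w \<in> W" "w' \<in> W" for w w'
  proof -
    interpret Nw: sigma_finite_measure "N w" by (rule sf) fact
    interpret Nw': sigma_finite_measure "N w'" by (rule sf) fact
    interpret A: pair_sigma_finite "N w" L ..
    interpret A': pair_sigma_finite "N w'" L ..
    have "(\<integral>\<^sup>+y. (\<integral>\<^sup>+x. u w x * p y x \<partial>N w) * (\<integral>\<^sup>+x'. u w' x' * p y x' \<partial>N w') \<partial>L)
       = (\<integral>\<^sup>+y. \<integral>\<^sup>+x. (u w x * p y x) * (\<integral>\<^sup>+x'. u w' x' * p y x' \<partial>N w') \<partial>N w \<partial>L)"
      by (intro nn_integral_cong nn_integral_multc[symmetric]) measurable
    also have "\<dots> = (\<integral>\<^sup>+x. \<integral>\<^sup>+y. (u w x * p y x) * (\<integral>\<^sup>+x'. u w' x' * p y x' \<partial>N w') \<partial>L \<partial>N w)"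
      by (rule A.Fubini') measurable
    also have "\<dots> = (\<integral>\<^sup>+x. \<integral>\<^sup>+y. \<integral>\<^sup>+x'. (u w x * p y x) * (u w' x' * p y x') \<partial>N w' \<partial>L \<partial>N w)"
      by (intro nn_integral_cong nn_integral_cmult[symmetric]) measurable
    also have "\<dots> = (\<integral>\<^sup>+x. \<integral>\<^sup>+x'. \<integral>\<^sup>+y. (u w x * p y x) * (u w' x' * p y x') \<partial>L \<partial>N w' \<partial>N w)"
      by (intro nn_integral_cong A'.Fubini') measurable
    also have "\<dots> = (\<integral>\<^sup>+x. \<integral>\<^sup>+x'. \<integral>\<^sup>+y. u w x * u w' x' * (p y x * p y x') \<partial>L \<partial>N w' \<partial>N w)"
      by (simp add: mult_ac)
    also have "\<dots> = (\<integral>\<^sup>+x. \<integral>\<^sup>+x'. u w x * u w' x' * (\<integral>\<^sup>+y. p y x * p y x' \<partial>L) \<partial>N w' \<partial>N w)"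
      by (intro nn_integral_cong nn_integral_cmult) measurable
    finally show ?thesis .
  qed
  have "(\<Sum>l\<in>r ` W. \<integral>\<^sup>+y. (\<Sum>w\<in>{w\<in>W. r w = l}. \<integral>\<^sup>+x. u w x * p y x \<partial>N w)\<^sup>2 \<partial>L)
     = (\<Sum>l\<in>r ` W. \<Sum>w\<in>{w\<in>W. r w = l}. \<Sum>w'\<in>{w\<in>W. r w = l}.
          \<integral>\<^sup>+y. (\<integral>\<^sup>+x. u w x * p y x \<partial>N w) * (\<integral>\<^sup>+x'. u w' x' * p y x' \<partial>N w') \<partial>L)"
    by (intro sum.cong refl nn_integral_sum_square) auto
  also have "\<dots> = (\<Sum>l\<in>r ` W. \<Sum>w\<in>{w\<in>W. r w = l}. \<Sum>w'\<in>{w'\<in>W. r w' = r w}.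
          \<integral>\<^sup>+x. \<integral>\<^sup>+x'. u w x * u w' x' * (\<integral>\<^sup>+y. p y x * p y x' \<partial>L) \<partial>N w' \<partial>N w)"
    by (intro sum.cong refl) (auto simp: eq)
  also have "\<dots> = pair_energy W r N u (\<lambda>x x'. \<integral>\<^sup>+y. p y x * p y x' \<partial>L)"
    unfolding pair_energy_def by (rule sum.image_gen[symmetric]) auto
  finally show ?thesis .
qed

text \<open>Both success weights are written as integrals over outputs \<open>y\<close> and
  \<open>y'\<close>. The domination trades the kernel on inputs for \<open>h\<close> on outputs, and
  the Schur test contracts \<open>h\<close> to a common output. There the decoder is a
  subprobability over messages, so only pairs with the same message \<open>e w\<close> survive,
  which refines the label.\<close>

lemma pair_energy_step:
  assumes sf: "\<And>w. w \<in> W \<Longrightarrow> sigma_finite_measure (N w)" and [simp]: "finite W"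
    and sfL: "sigma_finite_measure L"
    and sets: "\<And>w. w \<in> W \<Longrightarrow> sets (N w) = sets X"
    and u: "\<And>w. w \<in> W \<Longrightarrow> u w \<in> borel_measurable X"
    and p[measurable]: "(\<lambda>(y, x). p y x) \<in> borel_measurable (L \<Otimes>\<^sub>M X)"
    and q[measurable]: "(\<lambda>(y, x). q y x) \<in> borel_measurable (L \<Otimes>\<^sub>M X)"
    and h[measurable]: "(\<lambda>(y, y'). h y y') \<in> borel_measurable (L \<Otimes>\<^sub>M L)"
    and D: "\<And>w. w \<in> W \<Longrightarrow> D (e w) \<in> borel_measurable L"
    and sym: "\<And>y y'. h y y' = h y' y"
    and H: "\<And>y. y \<in> space L \<Longrightarrow> (\<integral>\<^sup>+y'. h y y' \<partial>L) \<le> H"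
    and D1: "\<And>y. y \<in> space L \<Longrightarrow> (\<Sum>v\<in>e ` W. D v y) \<le> 1"
    and dom: "\<And>x x' y y'. x \<in> space X \<Longrightarrow> x' \<in> space X \<Longrightarrow> y \<in> space L \<Longrightarrow> y' \<in> space L \<Longrightarrow>
        p y x * p y' x' * \<kappa> x x' \<le> h y y' * (q y x * q y' x')"
  shows "pair_energy W r N (\<lambda>w x. u w x * (\<integral>\<^sup>+y. p y x * D (e w) y \<partial>L)) \<kappa>
     \<le> H * pair_energy W (\<lambda>w. (r w, e w)) N u (\<lambda>x x'. \<integral>\<^sup>+y. q y x * q y x' \<partial>L)"
proof -
  interpret L: sigma_finite_measure L by fact
  note [measurable_cong] = sets
  note [measurable] = u D
  define b where "b = (\<lambda>w y. \<integral>\<^sup>+x. u w x * q y x \<partial>N w)"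
  have spw[simp]: "space (N w) = space X" if "w \<in> W" for w
    using sets_eq_imp_space_eq[OF sets] that by auto
  have bm[measurable]: "w \<in> W \<Longrightarrow> b w \<in> borel_measurable L" for w
    unfolding b_def by (rule sigma_finite_measure.borel_measurable_nn_integral[OF sf]) measurable
  define A where "A = (\<lambda>l v y. \<Sum>w\<in>{w\<in>W. r w = l \<and> e w = v}. b w y)"
  have Am[measurable]: "A l v \<in> borel_measurable L" for l v
    unfolding A_def by measurable
  \<comment> \<open>For one pair of messages the domination is applied under the integrals.
    Reordering then makes the integrals over the inputs innermost, where they factor into
    \<open>b w y\<close> and \<open>b w' y'\<close>.\<close>
  have term_le: "(\<integral>\<^sup>+x. \<integral>\<^sup>+x'. (u w x * (\<integral>\<^sup>+y. p y x * D (e w) y \<partial>L)) * (u w' x' * (\<integral>\<^sup>+y. p y x' * D (e w') y \<partial>L))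
          * \<kappa> x x' \<partial>N w' \<partial>N w)
      \<le> (\<integral>\<^sup>+y. \<integral>\<^sup>+y'. h y y' * ((D (e w) y * b w y) * (D (e w') y' * b w' y')) \<partial>L \<partial>L)"
    (is "?l \<le> ?r") if [simp,measurable]: "w \<in> W" "w' \<in> W" for w w'
  proof -
    interpret Nw: sigma_finite_measure "N w" by (rule sf) fact
    interpret Nw': sigma_finite_measure "N w'" by (rule sf) fact
    interpret A: pair_sigma_finite "N w" L ..
    interpret A': pair_sigma_finite "N w'" L ..
    have "?l = (\<integral>\<^sup>+x. \<integral>\<^sup>+x'. \<integral>\<^sup>+y. \<integral>\<^sup>+y'. (u w x * u w' x' * D (e w) y * D (e w') y') * (p y x * p y' x' * \<kappa> x x')
           \<partial>L \<partial>L \<partial>N w' \<partial>N w)"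
    proof (intro nn_integral_cong)
      fix x x' assume x[measurable]: "x \<in> space (N w)" "x' \<in> space (N w')"
      then have [simp,measurable]: "x \<in> space X" "x' \<in> space X" by (auto simp: spw)
      have "(u w x * (\<integral>\<^sup>+y. p y x * D (e w) y \<partial>L)) * (u w' x' * (\<integral>\<^sup>+y. p y x' * D (e w') y \<partial>L)) * \<kappa> x x'
        = (\<integral>\<^sup>+y. p y x * D (e w) y \<partial>L) * ((\<integral>\<^sup>+y'. p y' x' * D (e w') y' \<partial>L) * (u w x * u w' x' * \<kappa> x x'))"
        by (simp add: mult_ac)
      also have "\<dots> = (\<integral>\<^sup>+y. (p y x * D (e w) y) * ((\<integral>\<^sup>+y'. p y' x' * D (e w') y' \<partial>L) * (u w x * u w' x' * \<kappa> x x')) \<partial>L)"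
        by (intro nn_integral_multc[symmetric]) auto
      also have "\<dots> = (\<integral>\<^sup>+y. \<integral>\<^sup>+y'. (p y x * D (e w) y) * ((p y' x' * D (e w') y') * (u w x * u w' x' * \<kappa> x x')) \<partial>L \<partial>L)"
        by (subst nn_integral_multc[symmetric], measurable, subst nn_integral_cmult[symmetric], auto)
      finally show "(u w x * (\<integral>\<^sup>+y. p y x * D (e w) y \<partial>L)) * (u w' x' * (\<integral>\<^sup>+y. p y x' * D (e w') y \<partial>L)) * \<kappa> x x'
        = (\<integral>\<^sup>+y. \<integral>\<^sup>+y'. (u w x * u w' x' * D (e w) y * D (e w') y') * (p y x * p y' x' * \<kappa> x x') \<partial>L \<partial>L)"
        by (simp add: mult_ac)
    qed
    also have "\<dots> \<le> (\<integral>\<^sup>+x. \<integral>\<^sup>+x'. \<integral>\<^sup>+y. \<integral>\<^sup>+y'. (u w x * u w' x' * D (e w) y * D (e w') y') * (h y y' * (q y x * q y' x'))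
           \<partial>L \<partial>L \<partial>N w' \<partial>N w)"
      by (intro nn_integral_mono mult_left_mono dom) (auto simp: spw)
    also have "\<dots> = (\<integral>\<^sup>+x. \<integral>\<^sup>+y. \<integral>\<^sup>+x'. \<integral>\<^sup>+y'. (u w x * u w' x' * D (e w) y * D (e w') y') * (h y y' * (q y x * q y' x'))
           \<partial>L \<partial>N w' \<partial>L \<partial>N w)"
      by (intro nn_integral_cong A'.Fubini'[symmetric]) measurable
    also have "\<dots> = (\<integral>\<^sup>+x. \<integral>\<^sup>+y. \<integral>\<^sup>+y'. \<integral>\<^sup>+x'. (u w x * u w' x' * D (e w) y * D (e w') y') * (h y y' * (q y x * q y' x'))
           \<partial>N w' \<partial>L \<partial>L \<partial>N w)"
      by (intro nn_integral_cong A'.Fubini'[symmetric]) measurable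
    also have "\<dots> = (\<integral>\<^sup>+y. \<integral>\<^sup>+x. \<integral>\<^sup>+y'. \<integral>\<^sup>+x'. (u w x * u w' x' * D (e w) y * D (e w') y') * (h y y' * (q y x * q y' x'))
           \<partial>N w' \<partial>L \<partial>N w \<partial>L)"
      by (intro A.Fubini'[symmetric]) measurable
    also have "\<dots> = (\<integral>\<^sup>+y. \<integral>\<^sup>+y'. \<integral>\<^sup>+x. \<integral>\<^sup>+x'. (u w x * u w' x' * D (e w) y * D (e w') y') * (h y y' * (q y x * q y' x'))
           \<partial>N w' \<partial>N w \<partial>L \<partial>L)"
      by (intro nn_integral_cong A.Fubini'[symmetric]) measurable
    also have "\<dots> = (\<integral>\<^sup>+y. \<integral>\<^sup>+y'. h y y' * ((D (e w) y * b w y) * (D (e w') y' * b w' y')) \<partial>L \<partial>L)"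
    proof (intro nn_integral_cong)
      fix y y' assume [measurable, simp]: "y \<in> space L" "y' \<in> space L"
      have "(\<integral>\<^sup>+x. \<integral>\<^sup>+x'. (u w x * u w' x' * D (e w) y * D (e w') y') * (h y y' * (q y x * q y' x')) \<partial>N w' \<partial>N w)
         = (\<integral>\<^sup>+x. \<integral>\<^sup>+x'. (h y y' * (D (e w) y * D (e w') y')) * (u w x * q y x) * (u w' x' * q y' x') \<partial>N w' \<partial>N w)"
        by (simp add: mult_ac)
      also have "\<dots> = (\<integral>\<^sup>+x. (h y y' * (D (e w) y * D (e w') y')) * (u w x * q y x) * b w' y' \<partial>N w)"
        unfolding b_def by (intro nn_integral_cong nn_integral_cmult) measurable
      also have "\<dots> = (\<integral>\<^sup>+x. (h y y' * (D (e w) y * D (e w') y') * b w' y') * (u w x * q y x) \<partial>N w)"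
        by (simp add: mult_ac)
      also have "\<dots> = (h y y' * (D (e w) y * D (e w') y') * b w' y') * b w y"
        unfolding b_def by (intro nn_integral_cmult) measurable
      finally show "(\<integral>\<^sup>+x. \<integral>\<^sup>+x'. (u w x * u w' x' * D (e w) y * D (e w') y') * (h y y' * (q y x * q y' x')) \<partial>N w' \<partial>N w)
         = h y y' * ((D (e w) y * b w y) * (D (e w') y' * b w' y'))"
        by (simp add: mult_ac)
    qed
    finally show ?thesis .
  qed
  \<comment> \<open>The decoder weight depends on a message only through \<open>e w\<close>, so it
    can be taken out of each group of equal \<open>e w\<close>.\<close>
  have Nl: "(\<Sum>w\<in>{w\<in>W. r w = l}. D (e w) y * b w y) = (\<Sum>v\<in>e ` W. D v y * A l v y)" for l y
  proof -
    have "(\<Sum>w\<in>{w\<in>W. r w = l}. D (e w) y * b w y)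
       = (\<Sum>v\<in>e ` W. \<Sum>w\<in>{w\<in>{w\<in>W. r w = l}. e w = v}. D (e w) y * b w y)"
      by (rule sum.group[symmetric]) auto
    also have "\<dots> = (\<Sum>v\<in>e ` W. D v y * A l v y)"
      unfolding A_def sum_distrib_left by (intro sum.cong refl) auto
    finally show ?thesis .
  qed
  have Dv[measurable]: "v \<in> e ` W \<Longrightarrow> D v \<in> borel_measurable L" for v by auto
  have "pair_energy W r N (\<lambda>w x. u w x * (\<integral>\<^sup>+y. p y x * D (e w) y \<partial>L)) \<kappa>
     \<le> (\<Sum>w\<in>W. \<Sum>w'\<in>{w'\<in>W. r w' = r w}.
          \<integral>\<^sup>+y. \<integral>\<^sup>+y'. h y y' * ((D (e w) y * b w y) * (D (e w') y' * b w' y')) \<partial>L \<partial>L)"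
    unfolding pair_energy_def by (intro sum_mono term_le) auto
  also have "\<dots> = (\<Sum>l\<in>r ` W. \<Sum>w\<in>{w\<in>W. r w = l}. \<Sum>w'\<in>{w'\<in>W. r w' = r w}.
          \<integral>\<^sup>+y. \<integral>\<^sup>+y'. h y y' * ((D (e w) y * b w y) * (D (e w') y' * b w' y')) \<partial>L \<partial>L)"
    by (rule sum.image_gen) auto
  also have "\<dots> = (\<Sum>l\<in>r ` W. \<Sum>w\<in>{w\<in>W. r w = l}. \<Sum>w'\<in>{w'\<in>W. r w' = l}.
          \<integral>\<^sup>+y. \<integral>\<^sup>+y'. h y y' * ((D (e w) y * b w y) * (D (e w') y' * b w' y')) \<partial>L \<partial>L)"
    by (intro sum.cong refl) auto
  also have "\<dots> = (\<Sum>l\<in>r ` W. \<integral>\<^sup>+y. \<integral>\<^sup>+y'. h y y' * ((\<Sum>w\<in>{w\<in>W. r w = l}. D (e w) y * b w y)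
            * (\<Sum>w\<in>{w\<in>W. r w = l}. D (e w) y' * b w y')) \<partial>L \<partial>L)"
  proof (intro sum.cong refl)
    fix l
    let ?S = "{w\<in>W. r w = l}"
    have "(\<integral>\<^sup>+y. \<integral>\<^sup>+y'. h y y' * ((\<Sum>w\<in>?S. D (e w) y * b w y) * (\<Sum>w\<in>?S. D (e w) y' * b w y')) \<partial>L \<partial>L)
      = (\<integral>\<^sup>+y. \<integral>\<^sup>+y'. (\<Sum>w\<in>?S. \<Sum>w'\<in>?S. h y y' * ((D (e w) y * b w y) * (D (e w') y' * b w' y'))) \<partial>L \<partial>L)"
      unfolding sum_product unfolding sum_distrib_left ..
    also have "\<dots> = (\<integral>\<^sup>+y. (\<Sum>w\<in>?S. \<Sum>w'\<in>?S. \<integral>\<^sup>+y'. h y y' * ((D (e w) y * b w y) * (D (e w') y' * b w' y')) \<partial>L) \<partial>L)"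
      by (intro nn_integral_cong trans[OF nn_integral_sum] sum.cong refl nn_integral_sum) auto
    also have "\<dots> = (\<Sum>w\<in>?S. \<Sum>w'\<in>?S. \<integral>\<^sup>+y. \<integral>\<^sup>+y'. h y y' * ((D (e w) y * b w y) * (D (e w') y' * b w' y')) \<partial>L \<partial>L)"
      by (intro trans[OF nn_integral_sum] sum.cong refl nn_integral_sum) auto
    finally show "(\<Sum>w\<in>?S. \<Sum>w'\<in>?S. \<integral>\<^sup>+y. \<integral>\<^sup>+y'. h y y' * ((D (e w) y * b w y) * (D (e w') y' * b w' y')) \<partial>L \<partial>L)
      = (\<integral>\<^sup>+y. \<integral>\<^sup>+y'. h y y' * ((\<Sum>w\<in>?S. D (e w) y * b w y) * (\<Sum>w\<in>?S. D (e w) y' * b w y')) \<partial>L \<partial>L)"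
      by simp
  qed
  also have "\<dots> = (\<Sum>l\<in>r ` W. \<integral>\<^sup>+y. \<integral>\<^sup>+y'. h y y' * ((\<Sum>v\<in>e ` W. D v y * A l v y) * (\<Sum>v\<in>e ` W. D v y' * A l v y')) \<partial>L \<partial>L)"
    by (simp add: Nl)
  also have "\<dots> \<le> (\<Sum>l\<in>r ` W. H * (\<integral>\<^sup>+y. (\<Sum>v\<in>e ` W. D v y * A l v y)\<^sup>2 \<partial>L))"
    by (intro sum_mono schur_test[OF sfL h _ sym H]) measurable
  \<comment> \<open>The decoder weights at a fixed output sum to at most one, hence the cross terms
    between different announced messages cost nothing.\<close>
  also have "\<dots> \<le> (\<Sum>l\<in>r ` W. H * (\<integral>\<^sup>+y. (\<Sum>v\<in>e ` W. (A l v y)\<^sup>2) \<partial>L))"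
    by (intro sum_mono mult_left_mono nn_integral_mono weighted_sum_square_le D1) auto
  also have "\<dots> = H * (\<Sum>l\<in>r ` W. \<Sum>v\<in>e ` W. (\<integral>\<^sup>+y. (A l v y)\<^sup>2 \<partial>L))"
    by (subst nn_integral_sum) (auto simp: sum_distrib_left)
  \<comment> \<open>Label pairs attained by no message give empty sums, so the double sum runs over
    the values of the refined label.\<close>
  also have "(\<Sum>l\<in>r ` W. \<Sum>v\<in>e ` W. (\<integral>\<^sup>+y. (A l v y)\<^sup>2 \<partial>L)) =
      (\<Sum>l\<in>(\<lambda>w. (r w, e w)) ` W. \<integral>\<^sup>+y. (\<Sum>w\<in>{w\<in>W. (r w, e w) = l}. b w y)\<^sup>2 \<partial>L)"
  proof -
    have "(\<Sum>l\<in>r ` W. \<Sum>v\<in>e ` W. (\<integral>\<^sup>+y. (A l v y)\<^sup>2 \<partial>L)) =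
      (\<Sum>l\<in>r ` W \<times> e ` W. \<integral>\<^sup>+y. (\<Sum>w\<in>{w\<in>W. (r w, e w) = l}. b w y)\<^sup>2 \<partial>L)"
      by (simp add: sum.cartesian_product A_def split_def) (auto intro!: sum.cong simp: prod_eq_iff)
    also have "\<dots> = (\<Sum>l\<in>(\<lambda>w. (r w, e w)) ` W. \<integral>\<^sup>+y. (\<Sum>w\<in>{w\<in>W. (r w, e w) = l}. b w y)\<^sup>2 \<partial>L)"
    proof (rule sum.mono_neutral_right)
      show "\<forall>i\<in>r ` W \<times> e ` W - (\<lambda>w. (r w, e w)) ` W.
       (\<integral>\<^sup>+ y. (\<Sum>w\<in>{w\<in>W. (r w, e w) = i}. b w y)\<^sup>2 \<partial>L) = 0"
      proof
        fix i assume "i \<in> r ` W \<times> e ` W - (\<lambda>w. (r w, e w)) ` W"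
        then have "{w\<in>W. (r w, e w) = i} = {}" by (force simp: image_iff)
        then show "(\<integral>\<^sup>+ y. (\<Sum>w\<in>{w\<in>W. (r w, e w) = i}. b w y)\<^sup>2 \<partial>L) = 0"
          by (simp only: sum.empty) simp
      qed
    qed auto
    finally show ?thesis .
  qed
  also have "\<dots> = pair_energy W (\<lambda>w. (r w, e w)) N u (\<lambda>x x'. \<integral>\<^sup>+y. q y x * q y x' \<partial>L)"
    unfolding b_def by (rule pair_energy_product_form[OF sf _ sfL sets u q]) auto
  finally show ?thesis .
qed

text \<open>Used as a label: two messages with the same image agree at all receivers outside
  \<open>D\<close>. The erased coordinates get the default value 0, which is also the value outside
  the receiver range, so images can be counted as messages with trivial components.\<close>

definition forget :: "nat set \<Rightarrow> (nat \<Rightarrow> nat) \<Rightarrow> nat \<Rightarrow> nat" where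
  "forget D w = (\<lambda>k. if k \<in> D then 0 else w k)"

lemma pair_energy_cong_label:
  assumes "\<And>w w'. w \<in> W \<Longrightarrow> w' \<in> W \<Longrightarrow> r w = r w' \<longleftrightarrow> s w = s w'"
  shows "pair_energy W r N u \<kappa> = pair_energy W s N u \<kappa>"
  unfolding pair_energy_def using assms by (intro sum.cong refl Collect_cong) auto

text \<open>\<open>\<Gamma>\<close> is the law of the gains, \<open>p k g\<close> the transition
  density of receiver \<open>k\<close> and \<open>q k g\<close> a heavier one, \<open>D\<close> the
  decoders, and \<open>S k\<close> the transmitters heard by \<open>k\<close>. \<open>dom\<close>
  says that distant outputs require distant inputs or large noise; \<open>avg\<close> says that
  fading separates distant inputs. Together they let the kernel \<open>\<kappa> (S k)\<close> be
  spent and regained at every receiver at the price \<open>H * C\<close>. \<open>E\<close> is the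
  price of introducing the kernel at all, and \<open>good\<close> is the set of inputs on which this
  price is finite.\<close>

locale receiver_chain =
  fixes W :: "(nat \<Rightarrow> nat) set" and N :: "(nat \<Rightarrow> nat) \<Rightarrow> 'x measure" and X :: "'x measure"
    and L :: "'y measure" and \<Gamma> :: "'g measure"
    and p q :: "nat \<Rightarrow> 'g \<Rightarrow> 'y \<Rightarrow> 'x \<Rightarrow> ennreal"
    and D :: "nat \<Rightarrow> 'g \<Rightarrow> nat \<Rightarrow> 'y \<Rightarrow> ennreal"
    and h :: "'y \<Rightarrow> 'y \<Rightarrow> ennreal" and \<kappa> :: "nat set \<Rightarrow> 'x \<Rightarrow> 'x \<Rightarrow> ennreal"
    and S :: "nat \<Rightarrow> nat set" and good :: "'x set" and H C E :: ennreal and Ks :: "nat set"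
  assumes finite_W[simp]: "finite W"
    and sf_N: "\<And>w. w \<in> W \<Longrightarrow> sigma_finite_measure (N w)"
    and sets_N: "\<And>w. w \<in> W \<Longrightarrow> sets (N w) = sets X"
    and sf_L: "sigma_finite_measure L"
    and prob_\<Gamma>: "prob_space \<Gamma>"
    and p_meas: "\<And>k. k \<in> Ks \<Longrightarrow> (\<lambda>(g, y, x). p k g y x) \<in> borel_measurable (\<Gamma> \<Otimes>\<^sub>M L \<Otimes>\<^sub>M X)"
    and q_meas: "\<And>k. k \<in> Ks \<Longrightarrow> (\<lambda>(g, y, x). q k g y x) \<in> borel_measurable (\<Gamma> \<Otimes>\<^sub>M L \<Otimes>\<^sub>M X)"
    and D_meas: "\<And>k v. k \<in> Ks \<Longrightarrow> (\<lambda>(g, y). D k g v y) \<in> borel_measurable (\<Gamma> \<Otimes>\<^sub>M L)"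
    and h_meas[measurable]: "(\<lambda>(y, y'). h y y') \<in> borel_measurable (L \<Otimes>\<^sub>M L)"
    and h_sym: "\<And>y y'. h y y' = h y' y"
    and h_le: "\<And>y. y \<in> space L \<Longrightarrow> (\<integral>\<^sup>+y'. h y y' \<partial>L) \<le> H"
    and D_le: "\<And>k g y V. k \<in> Ks \<Longrightarrow> g \<in> space \<Gamma> \<Longrightarrow> y \<in> space L \<Longrightarrow> finite V \<Longrightarrow> (\<Sum>v\<in>V. D k g v y) \<le> 1"
    and dom: "\<And>k. k \<in> Ks \<Longrightarrow> AE g in \<Gamma>. \<forall>x\<in>space X. \<forall>x'\<in>space X. \<forall>y\<in>space L. \<forall>y'\<in>space L.
        p k g y x * p k g y' x' * \<kappa> (S k) x x' \<le> h y y' * (q k g y x * q k g y' x')"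
    and avg: "\<And>k x x'. k \<in> Ks \<Longrightarrow> x \<in> good \<inter> space X \<Longrightarrow> x' \<in> good \<inter> space X \<Longrightarrow>
        (\<integral>\<^sup>+g. \<integral>\<^sup>+y. q k g y x * q k g y x' \<partial>L \<partial>\<Gamma>) \<le> C * \<kappa> (S k) x x'"
    and \<kappa>_anti: "\<And>T T' x x'. T \<subseteq> T' \<Longrightarrow> \<kappa> T' x x' \<le> \<kappa> T x x'"
    and \<kappa>_lower: "\<And>T x x'. x \<in> good \<inter> space X \<Longrightarrow> x' \<in> good \<inter> space X \<Longrightarrow> 1 \<le> E * \<kappa> T x x'"
    and \<kappa>_meas[measurable]: "\<And>T. (\<lambda>(x, x'). \<kappa> T x x') \<in> borel_measurable (X \<Otimes>\<^sub>M X)"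
begin

lemma meas_raw[measurable (raw)]:
  assumes "k \<in> Ks" "a \<in> R \<rightarrow>\<^sub>M \<Gamma>" "b \<in> R \<rightarrow>\<^sub>M L"
  shows "c \<in> R \<rightarrow>\<^sub>M X \<Longrightarrow> (\<lambda>z. p k (a z) (b z) (c z)) \<in> borel_measurable R"
    and "c \<in> R \<rightarrow>\<^sub>M X \<Longrightarrow> (\<lambda>z. q k (a z) (b z) (c z)) \<in> borel_measurable R"
    and "(\<lambda>z. D k (a z) v (b z)) \<in> borel_measurable R"
  using assms measurable_compose[OF measurable_Pair[OF assms(2) measurable_Pair[OF assms(3)]] p_meas[OF assms(1)]]
   measurable_compose[OF measurable_Pair[OF assms(2) measurable_Pair[OF assms(3)]] q_meas[OF assms(1)]]
   measurable_compose[OF measurable_Pair[OF assms(2,3)] D_meas[OF assms(1)]]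
  by auto

definition succ_cond :: "nat \<Rightarrow> 'g \<Rightarrow> (nat \<Rightarrow> nat) \<Rightarrow> 'x \<Rightarrow> ennreal" where
  "succ_cond k g w x = (\<integral>\<^sup>+y. p k g y x * D k g (w k) y \<partial>L)"

definition succ :: "nat \<Rightarrow> (nat \<Rightarrow> nat) \<Rightarrow> 'x \<Rightarrow> ennreal" where
  "succ k w x = (\<integral>\<^sup>+g. succ_cond k g w x \<partial>\<Gamma>)"

lemma succ_cond_meas[measurable]:
  assumes k: "k \<in> Ks"
  shows "(\<lambda>(g, x). succ_cond k g w x) \<in> borel_measurable (\<Gamma> \<Otimes>\<^sub>M X)"
proof -
  interpret L: sigma_finite_measure L by (rule sf_L)
  note [measurable] = k
  show ?thesis unfolding succ_cond_def by measurable
qed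

lemma succ_meas[measurable]:
  assumes k: "k \<in> Ks"
  shows "(\<lambda>x. succ k w x) \<in> borel_measurable X"
proof -
  interpret \<Gamma>: prob_space \<Gamma> by (rule prob_\<Gamma>)
  note [measurable] = succ_cond_meas[OF k]
  show ?thesis unfolding succ_def by measurable
qed

lemma space_N[simp]: "w \<in> W \<Longrightarrow> space (N w) = space X"
  using sets_eq_imp_space_eq[OF sets_N] by auto

text \<open>Cauchy-Schwarz over the classes of the label produces the number of classes, and
  \<open>1 \<le> E * \<kappa>\<close> inserts the kernel. This is the only place where the large
  factor \<open>E\<close> is spent, independently of the length of the chain.\<close>

lemma chain_base:
  assumes um: "\<And>w. w \<in> W \<Longrightarrow> u w \<in> borel_measurable X"
    and u0: "\<And>w x. x \<notin> good \<Longrightarrow> u w x = 0"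
  shows "(\<Sum>w\<in>W. \<integral>\<^sup>+x. u w x \<partial>N w)\<^sup>2 \<le> of_nat (card (r ` W)) * (E * pair_energy W r N u (\<kappa> T))"
proof -
  note [measurable] = um
  note [measurable_cong] = sets_N
  have "(\<Sum>w\<in>W. \<integral>\<^sup>+x. u w x \<partial>N w)\<^sup>2 = (\<Sum>l\<in>r ` W. \<Sum>w\<in>{w\<in>W. r w = l}. \<integral>\<^sup>+x. u w x \<partial>N w)\<^sup>2"
    by (subst sum.image_gen[of _ _ r]) auto
  also have "\<dots> \<le> of_nat (card (r ` W)) * (\<Sum>l\<in>r ` W. (\<Sum>w\<in>{w\<in>W. r w = l}. \<integral>\<^sup>+x. u w x \<partial>N w)\<^sup>2)"
    by (rule sum_square_le_card)
  also have "(\<Sum>l\<in>r ` W. (\<Sum>w\<in>{w\<in>W. r w = l}. \<integral>\<^sup>+x. u w x \<partial>N w)\<^sup>2)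
     = (\<Sum>l\<in>r ` W. \<Sum>w\<in>{w\<in>W. r w = l}. \<Sum>w'\<in>{w'\<in>W. r w' = r w}. (\<integral>\<^sup>+x. u w x \<partial>N w) * (\<integral>\<^sup>+x. u w' x \<partial>N w'))"
    by (intro sum.cong refl) (auto simp: power2_eq_square sum_product)
  also have "\<dots> = (\<Sum>w\<in>W. \<Sum>w'\<in>{w'\<in>W. r w' = r w}. (\<integral>\<^sup>+x. u w x \<partial>N w) * (\<integral>\<^sup>+x. u w' x \<partial>N w'))"
    by (rule sum.image_gen[symmetric]) auto
  also have "\<dots> = (\<Sum>w\<in>W. \<Sum>w'\<in>{w'\<in>W. r w' = r w}. \<integral>\<^sup>+x. \<integral>\<^sup>+x'. u w x * u w' x' \<partial>N w' \<partial>N w)"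
    by (intro sum.cong refl) (auto simp: nn_integral_cmult nn_integral_multc)
  also have "\<dots> \<le> (\<Sum>w\<in>W. \<Sum>w'\<in>{w'\<in>W. r w' = r w}. \<integral>\<^sup>+x. \<integral>\<^sup>+x'. E * (u w x * u w' x' * \<kappa> T x x') \<partial>N w' \<partial>N w)"
  proof (intro sum_mono nn_integral_mono)
    fix w w' x x' assume w: "w \<in> W" "w' \<in> {w'\<in>W. r w' = r w}" and x: "x \<in> space (N w)" "x' \<in> space (N w')"
    show "u w x * u w' x' \<le> E * (u w x * u w' x' * \<kappa> T x x')"
    proof (cases "x \<in> good \<and> x' \<in> good")
      case True
      then have "u w x * u w' x' * 1 \<le> u w x * u w' x' * (E * \<kappa> T x x')"
        using w x by (intro mult_left_mono \<kappa>_lower) auto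
      then show ?thesis by (simp add: mult_ac)
    qed (auto simp: u0)
  qed
  also have "\<dots> = E * pair_energy W r N u (\<kappa> T)"
  proof -
    have "(\<integral>\<^sup>+x. \<integral>\<^sup>+x'. E * (u w x * u w' x' * \<kappa> T x x') \<partial>N w' \<partial>N w)
       = E * (\<integral>\<^sup>+x. \<integral>\<^sup>+x'. u w x * u w' x' * \<kappa> T x x' \<partial>N w' \<partial>N w)" if [simp]: "w \<in> W" "w' \<in> W" for w w'
    proof -
      interpret w': sigma_finite_measure "N w'" by (rule sf_N) fact
      have "(\<integral>\<^sup>+x. \<integral>\<^sup>+x'. E * (u w x * u w' x' * \<kappa> T x x') \<partial>N w' \<partial>N w)
         = (\<integral>\<^sup>+x. E * (\<integral>\<^sup>+x'. (u w x * u w' x' * \<kappa> T x x') \<partial>N w') \<partial>N w)"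
        by (intro nn_integral_cong nn_integral_cmult) measurable
      also have "\<dots> = E * (\<integral>\<^sup>+x. \<integral>\<^sup>+x'. u w x * u w' x' * \<kappa> T x x' \<partial>N w' \<partial>N w)"
        by (intro nn_integral_cmult) measurable
      finally show ?thesis .
    qed
    then show ?thesis
      unfolding pair_energy_def sum_distrib_left by (intro sum.cong refl) auto
  qed
  finally show ?thesis by (simp add: mult_left_mono)
qed

text \<open>For frozen gains \<open>pair_energy_step\<close> leaves the Gram kernel of
  \<open>q\<close>. Its average over the gains is again at most \<open>C\<close> times
  \<open>\<kappa> (S k)\<close>, and the nesting \<open>T \<subseteq> S k\<close> replaces this by
  the larger \<open>\<kappa> T\<close>, the kernel of the preceding receiver.\<close>

lemma chain_energy:
  assumes k: "k \<in> Ks" "k \<notin> Dn"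
    and um: "\<And>w. w \<in> W \<Longrightarrow> u w \<in> borel_measurable X"
    and u0: "\<And>w x. x \<notin> good \<Longrightarrow> u w x = 0"
    and T: "T \<subseteq> S k"
  shows "(\<integral>\<^sup>+g. pair_energy W (forget (insert k Dn)) N (\<lambda>w x. u w x * succ_cond k g w x) (\<kappa> (S k)) \<partial>\<Gamma>)
     \<le> H * C * pair_energy W (forget Dn) N u (\<kappa> T)"
proof -
  interpret L: sigma_finite_measure L by (rule sf_L)
  interpret \<Gamma>: prob_space \<Gamma> by (rule prob_\<Gamma>)
  note [measurable] = um k(1)
  note [measurable_cong] = sets_N
  let ?q = "\<lambda>g x x'. \<integral>\<^sup>+y. q k g y x * q k g y x' \<partial>L"
  have step: "AE g in \<Gamma>. pair_energy W (forget (insert k Dn)) N (\<lambda>w x. u w x * succ_cond k g w x) (\<kappa> (S k))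
      \<le> H * pair_energy W (forget Dn) N u (?q g)"
    using dom[OF k(1)] AE_space[of \<Gamma>]
  proof eventually_elim
    case (elim g)
    have [measurable]: "g \<in> space \<Gamma>" by (rule elim)
    have "pair_energy W (forget (insert k Dn)) N (\<lambda>w x. u w x * (\<integral>\<^sup>+y. p k g y x * D k g (w k) y \<partial>L)) (\<kappa> (S k))
       \<le> H * pair_energy W (\<lambda>w. (forget (insert k Dn) w, w k)) N u (?q g)"
    proof (rule pair_energy_step[OF sf_N finite_W sf_L sets_N um])
      show "\<And>x x' y y'. x \<in> space X \<Longrightarrow> x' \<in> space X \<Longrightarrow> y \<in> space L \<Longrightarrow> y' \<in> space L \<Longrightarrow>
        p k g y x * p k g y' x' * \<kappa> (S k) x x' \<le> h y y' * (q k g y x * q k g y' x')"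
        using elim by blast
      show "(\<Sum>v\<in>(\<lambda>w. w k) ` W. D k g v y) \<le> 1" if "y \<in> space L" for y
        using that elim k by (intro D_le) auto
    qed (auto intro: h_sym h_le)
    \<comment> \<open>Adding the message of \<open>k\<close> to a label that forgets
      \<open>k\<close> only because it was inserted gives back the label that does not forget
      it.\<close>
    also have "pair_energy W (\<lambda>w. (forget (insert k Dn) w, w k)) N u (?q g)
       = pair_energy W (forget Dn) N u (?q g)"
      using k(2) by (intro pair_energy_cong_label) (auto simp: forget_def fun_eq_iff split: if_splits)
    finally show ?case by (simp add: succ_cond_def)
  qed
  have qm[measurable]: "(\<lambda>(g, x, x'). ?q g x x') \<in> borel_measurable (\<Gamma> \<Otimes>\<^sub>M X \<Otimes>\<^sub>M X)"
    by measurable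
  have m1: "(\<lambda>g. \<integral>\<^sup>+x. \<integral>\<^sup>+x'. u w x * u w' x' * ?q g x x' \<partial>N w' \<partial>N w) \<in> borel_measurable \<Gamma>"
    if [simp]: "w \<in> W" "w' \<in> W" for w w'
  proof -
    interpret w: sigma_finite_measure "N w" by (rule sf_N) fact
    interpret w': sigma_finite_measure "N w'" by (rule sf_N) fact
    show ?thesis by measurable
  qed
  have "(\<integral>\<^sup>+g. pair_energy W (forget (insert k Dn)) N (\<lambda>w x. u w x * succ_cond k g w x) (\<kappa> (S k)) \<partial>\<Gamma>)
     \<le> (\<integral>\<^sup>+g. H * pair_energy W (forget Dn) N u (?q g) \<partial>\<Gamma>)"
    by (rule nn_integral_mono_AE[OF step])
  also have "\<dots> = H * (\<integral>\<^sup>+g. pair_energy W (forget Dn) N u (?q g) \<partial>\<Gamma>)"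
    unfolding pair_energy_def using m1 by (intro nn_integral_cmult borel_measurable_sum) auto
  also have "(\<integral>\<^sup>+g. pair_energy W (forget Dn) N u (?q g) \<partial>\<Gamma>)
     = (\<Sum>w\<in>W. \<Sum>w'\<in>{w'\<in>W. forget Dn w' = forget Dn w}. \<integral>\<^sup>+g. \<integral>\<^sup>+x. \<integral>\<^sup>+x'. u w x * u w' x' * ?q g x x' \<partial>N w' \<partial>N w \<partial>\<Gamma>)"
    unfolding pair_energy_def using m1 by (intro trans[OF nn_integral_sum] sum.cong refl nn_integral_sum borel_measurable_sum) auto
  also have "\<dots> = pair_energy W (forget Dn) N u (\<lambda>x x'. \<integral>\<^sup>+g. ?q g x x' \<partial>\<Gamma>)"
    unfolding pair_energy_def
  proof (intro sum.cong refl)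
    fix w w' assume w: "w \<in> W" "w' \<in> {w'\<in>W. forget Dn w' = forget Dn w}"
    then have [simp]: "w \<in> W" "w' \<in> W" by auto
    interpret w: sigma_finite_measure "N w" by (rule sf_N) fact
    interpret w': sigma_finite_measure "N w'" by (rule sf_N) fact
    interpret A: pair_sigma_finite "N w" \<Gamma> ..
    interpret A': pair_sigma_finite "N w'" \<Gamma> ..
    have "(\<integral>\<^sup>+g. \<integral>\<^sup>+x. \<integral>\<^sup>+x'. u w x * u w' x' * ?q g x x' \<partial>N w' \<partial>N w \<partial>\<Gamma>)
       = (\<integral>\<^sup>+x. \<integral>\<^sup>+g. \<integral>\<^sup>+x'. u w x * u w' x' * ?q g x x' \<partial>N w' \<partial>\<Gamma> \<partial>N w)"
      by (intro A.Fubini') measurable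
    also have "\<dots> = (\<integral>\<^sup>+x. \<integral>\<^sup>+x'. \<integral>\<^sup>+g. u w x * u w' x' * ?q g x x' \<partial>\<Gamma> \<partial>N w' \<partial>N w)"
      by (intro nn_integral_cong A'.Fubini') measurable
    also have "\<dots> = (\<integral>\<^sup>+x. \<integral>\<^sup>+x'. u w x * u w' x' * (\<integral>\<^sup>+g. ?q g x x' \<partial>\<Gamma>) \<partial>N w' \<partial>N w)"
      by (intro nn_integral_cong nn_integral_cmult) measurable
    finally show "(\<integral>\<^sup>+g. \<integral>\<^sup>+x. \<integral>\<^sup>+x'. u w x * u w' x' * ?q g x x' \<partial>N w' \<partial>N w \<partial>\<Gamma>)
       = (\<integral>\<^sup>+x. \<integral>\<^sup>+x'. u w x * u w' x' * (\<integral>\<^sup>+g. ?q g x x' \<partial>\<Gamma>) \<partial>N w' \<partial>N w)" .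
  qed
  also have "\<dots> \<le> (\<Sum>w\<in>W. \<Sum>w'\<in>{w'\<in>W. forget Dn w' = forget Dn w}. \<integral>\<^sup>+x. \<integral>\<^sup>+x'. C * (u w x * u w' x' * \<kappa> T x x') \<partial>N w' \<partial>N w)"
    unfolding pair_energy_def
  proof (intro sum_mono nn_integral_mono)
    fix w w' x x' assume w: "w \<in> W" "w' \<in> {w'\<in>W. forget Dn w' = forget Dn w}" and x: "x \<in> space (N w)" "x' \<in> space (N w')"
    show "u w x * u w' x' * (\<integral>\<^sup>+g. ?q g x x' \<partial>\<Gamma>) \<le> C * (u w x * u w' x' * \<kappa> T x x')"
    proof (cases "x \<in> good \<and> x' \<in> good")
      case True
      then have "(\<integral>\<^sup>+g. ?q g x x' \<partial>\<Gamma>) \<le> C * \<kappa> (S k) x x'"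
        using w x by (intro avg k) auto
      also have "\<dots> \<le> C * \<kappa> T x x'"
        by (intro mult_left_mono \<kappa>_anti T) auto
      finally have "u w x * u w' x' * (\<integral>\<^sup>+g. ?q g x x' \<partial>\<Gamma>) \<le> u w x * u w' x' * (C * \<kappa> T x x')"
        by (intro mult_left_mono) auto
      then show ?thesis by (simp add: mult_ac)
    qed (auto simp: u0)
  qed
  also have "\<dots> = C * pair_energy W (forget Dn) N u (\<kappa> T)"
  proof -
    have "(\<integral>\<^sup>+x. \<integral>\<^sup>+x'. C * (u w x * u w' x' * \<kappa> T x x') \<partial>N w' \<partial>N w)
       = C * (\<integral>\<^sup>+x. \<integral>\<^sup>+x'. u w x * u w' x' * \<kappa> T x x' \<partial>N w' \<partial>N w)" if [simp]: "w \<in> W" "w' \<in> W" for w w'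
    proof -
      interpret w': sigma_finite_measure "N w'" by (rule sf_N) fact
      have "(\<integral>\<^sup>+x. \<integral>\<^sup>+x'. C * (u w x * u w' x' * \<kappa> T x x') \<partial>N w' \<partial>N w)
         = (\<integral>\<^sup>+x. C * (\<integral>\<^sup>+x'. (u w x * u w' x' * \<kappa> T x x') \<partial>N w') \<partial>N w)"
        by (intro nn_integral_cong nn_integral_cmult) measurable
      also have "\<dots> = C * (\<integral>\<^sup>+x. \<integral>\<^sup>+x'. u w x * u w' x' * \<kappa> T x x' \<partial>N w' \<partial>N w)"
        by (intro nn_integral_cmult) measurable
      finally show ?thesis .
    qed
    then show ?thesis
      unfolding pair_energy_def sum_distrib_left by (intro sum.cong refl) auto
  qed
  finally show ?thesis by (simp add: mult_left_mono mult.assoc)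
qed

text \<open>The receiver with the smallest neighbourhood is peeled off first: its success
  probability is an average over gains, which Jensen's inequality moves outside the square. For
  frozen gains this factor joins the weight \<open>u\<close>, and the remaining receivers are
  handled by induction with \<open>S k\<close> in the role of \<open>T\<close>.\<close>

theorem chain_bound:
  assumes "distinct ks" "set ks \<subseteq> Ks" "set ks \<inter> Dn = {}"
    and "sorted_wrt (\<lambda>k k'. S k \<subseteq> S k') ks" "\<And>k. k \<in> set ks \<Longrightarrow> T \<subseteq> S k"
    and um: "\<And>w. w \<in> W \<Longrightarrow> u w \<in> borel_measurable X"
    and u0: "\<And>w x. x \<notin> good \<Longrightarrow> u w x = 0"
  shows "(\<Sum>w\<in>W. \<integral>\<^sup>+x. u w x * (\<Prod>k\<leftarrow>ks. succ k w x) \<partial>N w)\<^sup>2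
    \<le> of_nat (card (forget (Dn \<union> set ks) ` W)) * (E * (H * C) ^ length ks * pair_energy W (forget Dn) N u (\<kappa> T))"
  using assms
proof (induction ks arbitrary: Dn T u)
  case Nil
  then show ?case using chain_base[of u "forget Dn" T] by simp
next
  case (Cons k ks)
  interpret \<Gamma>: prob_space \<Gamma> by (rule prob_\<Gamma>)
  have k: "k \<in> Ks" "k \<notin> Dn" and T: "T \<subseteq> S k" using Cons.prems by auto
  note [measurable] = Cons.prems(6) succ_cond_meas[OF k(1)]
  note [measurable_cong] = sets_N
  have [measurable]: "(\<lambda>x. \<Prod>k\<leftarrow>ks. succ k w x) \<in> borel_measurable X" for w
    using Cons.prems(2) by (induction ks) auto
  let ?v = "\<lambda>g w x. u w x * succ_cond k g w x"
  let ?R = "of_nat (card (forget (Dn \<union> set (k # ks)) ` W)) * (E * (H * C) ^ length ks)"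
  have m1: "(\<lambda>g. \<integral>\<^sup>+x. ?v g w x * (\<Prod>k\<leftarrow>ks. succ k w x) \<partial>N w) \<in> borel_measurable \<Gamma>"
    if [simp]: "w \<in> W" for w
  proof -
    interpret w: sigma_finite_measure "N w" by (rule sf_N) fact
    show ?thesis by measurable
  qed
  have m2: "(\<lambda>g. pair_energy W (forget (insert k Dn)) N (?v g) (\<kappa> (S k))) \<in> borel_measurable \<Gamma>"
    unfolding pair_energy_def
  proof (intro borel_measurable_sum)
    fix w w' assume w: "w \<in> W" "w' \<in> {w'\<in>W. forget (insert k Dn) w' = forget (insert k Dn) w}"
    then have [simp]: "w \<in> W" "w' \<in> W" by auto
    interpret w: sigma_finite_measure "N w" by (rule sf_N) fact
    interpret w': sigma_finite_measure "N w'" by (rule sf_N) fact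
    show "(\<lambda>g. \<integral>\<^sup>+x. \<integral>\<^sup>+x'. ?v g w x * ?v g w' x' * \<kappa> (S k) x x' \<partial>N w' \<partial>N w) \<in> borel_measurable \<Gamma>"
      by measurable
  qed
  \<comment> \<open>With frozen gains the conditional success of \<open>k\<close> is simply part of
    the weight, which still vanishes outside \<open>good\<close>.\<close>
  have IH: "(\<Sum>w\<in>W. \<integral>\<^sup>+x. ?v g w x * (\<Prod>k\<leftarrow>ks. succ k w x) \<partial>N w)\<^sup>2
      \<le> ?R * pair_energy W (forget (insert k Dn)) N (?v g) (\<kappa> (S k))" if [measurable]: "g \<in> space \<Gamma>" for g
  proof -
    have "(\<Sum>w\<in>W. \<integral>\<^sup>+x. ?v g w x * (\<Prod>k\<leftarrow>ks. succ k w x) \<partial>N w)\<^sup>2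
      \<le> of_nat (card (forget (insert k Dn \<union> set ks) ` W)) * (E * (H * C) ^ length ks * pair_energy W (forget (insert k Dn)) N (?v g) (\<kappa> (S k)))"
      using Cons.prems by (intro Cons.IH) auto
    then show ?thesis by (simp add: mult.assoc)
  qed
  have "(\<Sum>w\<in>W. \<integral>\<^sup>+x. u w x * (\<Prod>k\<leftarrow>k # ks. succ k w x) \<partial>N w)
     = (\<Sum>w\<in>W. \<integral>\<^sup>+g. \<integral>\<^sup>+x. ?v g w x * (\<Prod>k\<leftarrow>ks. succ k w x) \<partial>N w \<partial>\<Gamma>)"
  proof (intro sum.cong refl)
    fix w assume [simp]: "w \<in> W"
    interpret w: sigma_finite_measure "N w" by (rule sf_N) fact
    interpret A: pair_sigma_finite "N w" \<Gamma> ..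
    have "(\<integral>\<^sup>+x. u w x * (\<Prod>k\<leftarrow>k # ks. succ k w x) \<partial>N w)
       = (\<integral>\<^sup>+x. (\<integral>\<^sup>+g. succ_cond k g w x \<partial>\<Gamma>) * (u w x * (\<Prod>k\<leftarrow>ks. succ k w x)) \<partial>N w)"
      by (simp add: succ_def mult_ac)
    also have "\<dots> = (\<integral>\<^sup>+x. \<integral>\<^sup>+g. succ_cond k g w x * (u w x * (\<Prod>k\<leftarrow>ks. succ k w x)) \<partial>\<Gamma> \<partial>N w)"
      by (intro nn_integral_cong nn_integral_multc[symmetric]) measurable
    also have "\<dots> = (\<integral>\<^sup>+g. \<integral>\<^sup>+x. succ_cond k g w x * (u w x * (\<Prod>k\<leftarrow>ks. succ k w x)) \<partial>N w \<partial>\<Gamma>)"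
      by (intro A.Fubini'[symmetric]) measurable
    finally show "(\<integral>\<^sup>+x. u w x * (\<Prod>k\<leftarrow>k # ks. succ k w x) \<partial>N w)
       = (\<integral>\<^sup>+g. \<integral>\<^sup>+x. ?v g w x * (\<Prod>k\<leftarrow>ks. succ k w x) \<partial>N w \<partial>\<Gamma>)"
      by (simp add: mult_ac)
  qed
  also have "\<dots> = (\<integral>\<^sup>+g. (\<Sum>w\<in>W. \<integral>\<^sup>+x. ?v g w x * (\<Prod>k\<leftarrow>ks. succ k w x) \<partial>N w) \<partial>\<Gamma>)"
    using m1 by (intro nn_integral_sum[symmetric])
  \<comment> \<open>Jensen's inequality for the probability measure \<open>\<Gamma>\<close>: the
    energies are quadratic in the weights, so the gains may be averaged only after squaring.\<close>
  finally have "(\<Sum>w\<in>W. \<integral>\<^sup>+x. u w x * (\<Prod>k\<leftarrow>k # ks. succ k w x) \<partial>N w)\<^sup>2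
     \<le> (\<integral>\<^sup>+g. (\<Sum>w\<in>W. \<integral>\<^sup>+x. ?v g w x * (\<Prod>k\<leftarrow>ks. succ k w x) \<partial>N w)\<^sup>2 \<partial>\<Gamma>)"
    using m1 by (simp only:, intro \<Gamma>.nn_integral_square_le borel_measurable_sum)
  also have "\<dots> \<le> (\<integral>\<^sup>+g. ?R * pair_energy W (forget (insert k Dn)) N (?v g) (\<kappa> (S k)) \<partial>\<Gamma>)"
    by (intro nn_integral_mono IH)
  also have "\<dots> = ?R * (\<integral>\<^sup>+g. pair_energy W (forget (insert k Dn)) N (?v g) (\<kappa> (S k)) \<partial>\<Gamma>)"
    using m2 by (rule nn_integral_cmult)
  also have "\<dots> \<le> ?R * (H * C * pair_energy W (forget Dn) N u (\<kappa> T))"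
    using Cons.prems by (intro mult_left_mono chain_energy k T) auto
  finally show ?case by (simp add: mult_ac)
qed

end

section \<open>Message sets and lower bounds for the success mass\<close>

lemma msg_set_eq: "msg_set K m = PiE_dflt {1..K} 0 (\<lambda>k. {..<m k})"
  by (auto simp: msg_set_def PiE_dflt_def)

lemma finite_msg_set[simp]: "finite (msg_set K m)"
  unfolding msg_set_eq by (intro finite_PiE_dflt) auto

lemma card_msg_set: "card (msg_set K m) = (\<Prod>k\<in>{1..K}. m k)"
  unfolding msg_set_eq by (subst card_PiE_dflt) auto

lemma card_forget_le:
  assumes "D \<subseteq> {1..K}"
  shows "card (forget D ` msg_set K m) \<le> (\<Prod>k\<in>{1..K} - D. m k)"
proof -
  have "forget D ` msg_set K m \<subseteq> msg_set K (\<lambda>k. if k \<in> D then 1 else m k)"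
    using assms by (auto simp: forget_def msg_set_def)
  then have "card (forget D ` msg_set K m) \<le> card (msg_set K (\<lambda>k. if k \<in> D then 1 else m k))"
    by (intro card_mono) auto
  also have "\<dots> = (\<Prod>k\<in>{1..K} - D. m k)"
    unfolding card_msg_set by (intro prod.mono_neutral_cong_right) auto
  finally show ?thesis .
qed

lemma one_minus_sum_le_prod_list:
  fixes c :: "'k \<Rightarrow> real"
  assumes "\<And>k. k \<in> set ks \<Longrightarrow> 0 \<le> c k \<and> c k \<le> 1"
  shows "1 - (\<Sum>k\<leftarrow>ks. 1 - c k) \<le> (\<Prod>k\<leftarrow>ks. c k)"
proof -
  have "1 - (\<Sum>k\<leftarrow>ks. 1 - c k) \<le> (\<Prod>k\<leftarrow>ks. c k) \<and> 0 \<le> (\<Prod>k\<leftarrow>ks. c k) \<and> (\<Prod>k\<leftarrow>ks. c k) \<le> 1"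
    using assms
  proof (induction ks)
    case (Cons k ks)
    let ?p = "\<Prod>k\<leftarrow>ks. c k"
    have k: "0 \<le> c k" "c k \<le> 1" and IH: "1 - (\<Sum>k\<leftarrow>ks. 1 - c k) \<le> ?p" "0 \<le> ?p" "?p \<le> 1"
      using Cons by auto
    have "(1 - c k) * (1 - ?p) \<ge> 0" using k IH by (intro mult_nonneg_nonneg) auto
    then have "c k + ?p - 1 \<le> c k * ?p" by (simp add: algebra_simps)
    moreover have "c k * ?p \<le> 1 * 1" using k IH by (intro mult_mono) auto
    moreover have "0 \<le> c k * ?p" using k IH by auto
    ultimately show ?case using IH by simp
  qed simp
  then show ?thesis by blast
qed

text \<open>The union bound in product form, integrated over the inputs. A negative left-hand side
  is sent to 0 by \<open>ennreal\<close>, so the positive part of the integrand is compared.\<close>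

lemma (in prob_space) success_mass_lower:
  fixes c :: "'k \<Rightarrow> 'a \<Rightarrow> real"
  assumes cm: "\<And>k. k \<in> set ks \<Longrightarrow> c k \<in> borel_measurable M"
    and c01: "\<And>k x. k \<in> set ks \<Longrightarrow> x \<in> space M \<Longrightarrow> 0 \<le> c k x \<and> c k x \<le> 1"
    and good: "good \<inter> space M \<in> sets M"
  shows "ennreal (1 - measure M (space M - good) - (\<Sum>k\<leftarrow>ks. 1 - (\<integral>x. c k x \<partial>M)))
    \<le> (\<integral>\<^sup>+x. indicator good x * (\<Prod>k\<leftarrow>ks. ennreal (c k x)) \<partial>M)"
proof -
  have bad[measurable]: "space M - good \<in> sets M"
    using good by (metis Diff_Int2 Diff_Int_distrib2 Int_commute sets.Diff sets.top Int_absorb Diff_Int)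
  have int: "integrable M (c k)" if "k \<in> set ks" for k
    using c01[OF that] by (intro integrable_const_bound[of _ 1] cm[OF that]) (auto intro!: AE_I2)
  let ?l = "\<lambda>x. 1 - indicator (space M - good) x - (\<Sum>k\<leftarrow>ks. 1 - c k x)"
  have ints: "integrable M (\<lambda>x. \<Sum>k\<leftarrow>ks. 1 - c k x) \<and> (\<integral>x. (\<Sum>k\<leftarrow>ks. 1 - c k x) \<partial>M) = (\<Sum>k\<leftarrow>ks. 1 - (\<integral>x. c k x \<partial>M))"
    using int
  proof (induction ks)
    case (Cons k ks)
    then show ?case by (simp add: prob_space)
  qed simp
  have intl: "integrable M ?l"
    using ints by (intro Bochner_Integration.integrable_diff) (auto simp: emeasure_eq_measure)
  have "(\<integral>x. ?l x \<partial>M) = 1 - measure M (space M - good) - (\<Sum>k\<leftarrow>ks. 1 - (\<integral>x. c k x \<partial>M))"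
    using ints by (simp add: emeasure_eq_measure prob_space)
  then have "ennreal (1 - measure M (space M - good) - (\<Sum>k\<leftarrow>ks. 1 - (\<integral>x. c k x \<partial>M))) = ennreal (\<integral>x. ?l x \<partial>M)"
    by simp
  also have "\<dots> \<le> ennreal (\<integral>x. max 0 (?l x) \<partial>M)"
    using intl by (intro ennreal_leI integral_mono) auto
  also have "\<dots> = (\<integral>\<^sup>+x. ennreal (max 0 (?l x)) \<partial>M)"
    using intl by (intro nn_integral_eq_integral[symmetric]) auto
  also have "\<dots> \<le> (\<integral>\<^sup>+x. indicator good x * (\<Prod>k\<leftarrow>ks. ennreal (c k x)) \<partial>M)"
  proof (intro nn_integral_mono)
    fix x assume x: "x \<in> space M"
    have pe: "(\<Prod>k\<leftarrow>ks. ennreal (c k x)) = ennreal (\<Prod>k\<leftarrow>ks. c k x) \<and> 0 \<le> (\<Prod>k\<leftarrow>ks. c k x)"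
      using c01[OF _ x] by (induction ks) (auto simp: ennreal_mult)
    have s0: "0 \<le> (\<Sum>k\<leftarrow>ks. 1 - c k x)"
      using c01[OF _ x] by (intro sum_list_nonneg) auto
    have "1 - (\<Sum>k\<leftarrow>ks. 1 - c k x) \<le> (\<Prod>k\<leftarrow>ks. c k x)"
      using c01[OF _ x] by (intro one_minus_sum_le_prod_list) auto
    then show "ennreal (max 0 (?l x)) \<le> indicator good x * (\<Prod>k\<leftarrow>ks. ennreal (c k x))"
      using x pe s0 by (cases "x \<in> good") (auto simp: max_def ennreal_neg intro!: ennreal_leI)
  qed
  finally show ?thesis .
qed

context receiver_chain
begin

text \<open>Write \<open>card W = R * Q\<close>, where \<open>Q\<close> counts the messages of the
  receivers in the chain. At least half of the mass succeeds on good inputs, so the chain bound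
  reads \<open>(R * Q / 2)\<^sup>2 \<le> R * Z * (R * Q)\<close> with
  \<open>Z = E * (H * C) ^ length ks\<close>; cancelling leaves
  \<open>Q \<le> 4 * Z\<close>.\<close>

theorem chain_converse:
  fixes c :: "nat \<Rightarrow> (nat \<Rightarrow> nat) \<Rightarrow> 'x \<Rightarrow> real"
  assumes W: "W = msg_set K m" and m: "\<And>k. k \<in> {1..K} \<Longrightarrow> 1 \<le> m k"
    and prob: "\<And>w. w \<in> W \<Longrightarrow> prob_space (N w)"
    and ks: "distinct ks" "set ks \<subseteq> Ks" "Ks \<subseteq> {1..K}" "sorted_wrt (\<lambda>k k'. S k \<subseteq> S k') ks"
    and \<kappa>1: "\<And>x x'. \<kappa> {} x x' \<le> 1"
    and good: "good \<inter> space X \<in> sets X"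
    and cm: "\<And>k w. k \<in> set ks \<Longrightarrow> w \<in> W \<Longrightarrow> c k w \<in> borel_measurable X"
    and c01: "\<And>k w x. k \<in> set ks \<Longrightarrow> w \<in> W \<Longrightarrow> x \<in> space X \<Longrightarrow> 0 \<le> c k w x \<and> c k w x \<le> 1"
    and c: "\<And>k w x. k \<in> set ks \<Longrightarrow> w \<in> W \<Longrightarrow> x \<in> space X \<Longrightarrow> succ k w x = ennreal (c k w x)"
    and bad: "(\<Sum>w\<in>W. measure (N w) (space X - good)) \<le> real (card W) / 4"
    and err: "(\<Sum>k\<in>set ks. 1 - (\<Sum>w\<in>W. \<integral>x. c k w x \<partial>N w) / real (card W)) \<le> 1 / 4"
  shows "of_nat (\<Prod>k\<in>set ks. m k) \<le> 4 * (E * (H * C) ^ length ks)"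
proof -
  note [measurable_cong] = sets_N
  define u where "u = (\<lambda>w::nat \<Rightarrow> nat. \<lambda>x::'x. indicator (good \<inter> space X) x :: ennreal)"
  define R where "R = (\<Prod>k\<in>{1..K} - set ks. m k)"
  define Q where "Q = (\<Prod>k\<in>set ks. m k)"
  have cardW: "card W = R * Q"
    using ks(2,3) unfolding W card_msg_set R_def Q_def by (intro prod.subset_diff) auto
  have Rpos: "0 < R" unfolding R_def using m by (intro prod_pos) force
  have "set ks \<subseteq> {1..K}" using ks by blast
  then have Qpos: "0 < Q" unfolding Q_def using m by (intro prod_pos) force
  have Wpos: "0 < card W" using cardW Rpos Qpos by simp
  have um: "u w \<in> borel_measurable X" for w
    unfolding u_def using good by (intro borel_measurable_indicator) auto
  have chain: "(\<Sum>w\<in>W. \<integral>\<^sup>+x. u w x * (\<Prod>k\<leftarrow>ks. succ k w x) \<partial>N w)\<^sup>2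
    \<le> of_nat (card (forget ({} \<union> set ks) ` W)) * (E * (H * C) ^ length ks * pair_energy W (forget {}) N u (\<kappa> {}))"
    by (rule chain_bound) (use ks um in \<open>auto simp: u_def\<close>)
  \<comment> \<open>Nothing is forgotten at the start, so every class is a single message and only
    the diagonal terms remain, each at most one.\<close>
  have pe: "pair_energy W (forget {}) N u (\<kappa> {}) \<le> of_nat (card W)"
  proof -
    have "pair_energy W (forget {}) N u (\<kappa> {}) \<le> (\<Sum>w\<in>W. \<Sum>w'\<in>{w'\<in>W. forget {} w' = forget {} w}.
        \<integral>\<^sup>+x. \<integral>\<^sup>+x'. 1 \<partial>N w' \<partial>N w)"
    proof (unfold pair_energy_def, intro sum_mono nn_integral_mono)
      fix w w' x x'
      have "u w x * u w' x' * \<kappa> {} x x' \<le> 1 * 1 * 1"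
        by (intro mult_mono \<kappa>1) (auto simp: u_def indicator_def)
      then show "u w x * u w' x' * \<kappa> {} x x' \<le> 1" by simp
    qed
    also have "\<dots> = (\<Sum>w\<in>W. \<Sum>w'\<in>{w'\<in>W. forget {} w' = forget {} w}. 1)"
      by (intro sum.cong refl) (auto simp: prob_space.emeasure_space_1[OF prob] simp del: space_N)
    also have "\<dots> = (\<Sum>w\<in>W. 1)"
    proof (intro sum.cong refl)
      fix w assume "w \<in> W"
      then have "{w'\<in>W. forget {} w' = forget {} w} = {w}" by (auto simp: forget_def)
      then show "(\<Sum>w'\<in>{w'\<in>W. forget {} w' = forget {} w}. 1) = (1::ennreal)" by simp
    qed
    finally show ?thesis by simp
  qed
  \<comment> \<open>At most a quarter of the mass lies on bad inputs and at most a quarter is lost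
    to decoding errors.\<close>
  have mass: "ennreal (real (card W) / 2) \<le> (\<Sum>w\<in>W. \<integral>\<^sup>+x. u w x * (\<Prod>k\<leftarrow>ks. succ k w x) \<partial>N w)"
  proof -
    let ?r = "\<lambda>w. 1 - measure (N w) (space X - good) - (\<Sum>k\<leftarrow>ks. 1 - (\<integral>x. c k w x \<partial>N w))"
    have "real (card W) / 2 \<le> (\<Sum>w\<in>W. ?r w)"
    proof -
      have sl: "(\<Sum>k\<leftarrow>ks. 1 - (\<integral>x. c k w x \<partial>N w)) = (\<Sum>k\<in>set ks. 1 - (\<integral>x. c k w x \<partial>N w))" for w
        using ks(1) by (simp add: sum_list_distinct_conv_sum_set)
      have "(\<Sum>w\<in>W. \<Sum>k\<in>set ks. 1 - (\<integral>x. c k w x \<partial>N w)) = (\<Sum>k\<in>set ks. \<Sum>w\<in>W. 1 - (\<integral>x. c k w x \<partial>N w))"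
        by (rule sum.swap)
      also have "\<dots> = real (card W) * (\<Sum>k\<in>set ks. 1 - (\<Sum>w\<in>W. \<integral>x. c k w x \<partial>N w) / real (card W))"
        unfolding sum_distrib_left using Wpos
        by (intro sum.cong refl) (simp add: sum_subtractf right_diff_distrib)
      also have "\<dots> \<le> real (card W) * (1 / 4)" using err by (rule mult_left_mono) simp
      finally show ?thesis using bad unfolding sl sum_subtractf by (simp add: field_simps)
    qed
    then have "ennreal (real (card W) / 2) \<le> ennreal (\<Sum>w\<in>W. ?r w)" by (rule ennreal_leI)
    also have "\<dots> \<le> ennreal (\<Sum>w\<in>W. max 0 (?r w))" by (intro ennreal_leI sum_mono) auto
    also have "\<dots> = (\<Sum>w\<in>W. ennreal (max 0 (?r w)))" by (intro sum_ennreal[symmetric]) auto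
    also have "\<dots> = (\<Sum>w\<in>W. ennreal (?r w))" by (intro sum.cong refl) (auto simp: max_def ennreal_neg)
    also have "\<dots> \<le> (\<Sum>w\<in>W. \<integral>\<^sup>+x. indicator good x * (\<Prod>k\<leftarrow>ks. ennreal (c k w x)) \<partial>N w)"
    proof (intro sum_mono)
      fix w assume w[simp]: "w \<in> W"
      interpret prob_space "N w" by (rule prob) fact
      have "ennreal (1 - measure (N w) (space (N w) - good) - (\<Sum>k\<leftarrow>ks. 1 - (\<integral>x. c k w x \<partial>N w)))
         \<le> (\<integral>\<^sup>+x. indicator good x * (\<Prod>k\<leftarrow>ks. ennreal (c k w x)) \<partial>N w)"
        by (rule success_mass_lower)
          (use cm[OF _ w] c01[OF _ w] good sets_N[OF w] space_N[OF w] in \<open>auto simp: measurable_cong_sets[OF sets_N[OF w] refl]\<close>)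
      then show "ennreal (?r w) \<le> (\<integral>\<^sup>+x. indicator good x * (\<Prod>k\<leftarrow>ks. ennreal (c k w x)) \<partial>N w)"
        by simp
    qed
    also have "\<dots> = (\<Sum>w\<in>W. \<integral>\<^sup>+x. u w x * (\<Prod>k\<leftarrow>ks. succ k w x) \<partial>N w)"
    proof (intro sum.cong refl nn_integral_cong)
      fix w x assume w: "w \<in> W" and x: "x \<in> space (N w)"
      have "(\<Prod>k\<leftarrow>ks. succ k w x) = (\<Prod>k\<leftarrow>ks. ennreal (c k w x))"
        using w x by (intro arg_cong[where f=prod_list] map_cong refl c) auto
      then show "indicator good x * (\<Prod>k\<leftarrow>ks. ennreal (c k w x)) = u w x * (\<Prod>k\<leftarrow>ks. succ k w x)"
        using w x by (simp add: u_def indicator_def)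
    qed
    finally show ?thesis .
  qed
  let ?Z = "E * (H * C) ^ length ks"
  have "(ennreal (real (card W) / 2))\<^sup>2 \<le> (\<Sum>w\<in>W. \<integral>\<^sup>+x. u w x * (\<Prod>k\<leftarrow>ks. succ k w x) \<partial>N w)\<^sup>2"
    using mass by (intro power_mono) auto
  also note chain
  also have "of_nat (card (forget ({} \<union> set ks) ` W)) * (?Z * pair_energy W (forget {}) N u (\<kappa> {}))
     \<le> of_nat R * (?Z * of_nat (card W))"
  proof (intro mult_mono mult_left_mono pe)
    show "of_nat (card (forget ({} \<union> set ks) ` W)) \<le> (of_nat R :: ennreal)"
      unfolding R_def W Un_empty_left using \<open>set ks \<subseteq> {1..K}\<close> by (intro of_nat_mono card_forget_le)
  qed auto
  finally have main: "(ennreal (real (card W) / 2))\<^sup>2 \<le> of_nat R * (?Z * of_nat (card W))" .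
  show ?thesis
  proof (cases "?Z = \<top>")
    case True
    then show ?thesis by (simp add: ennreal_mult_top)
  next
    case False
    then obtain z where z: "?Z = ennreal z" "0 \<le> z" by (cases ?Z) auto
    have "ennreal ((real (card W) / 2)\<^sup>2) \<le> ennreal (real R * (z * real (card W)))"
      using main z by (simp add: ennreal_power[symmetric] ennreal_mult ennreal_of_nat_eq_real_of_nat)
    then have "(real (card W) / 2)\<^sup>2 \<le> real R * (z * real (card W))"
      using z by (simp add: ennreal_le_iff)
    then have "real (R * Q) * (real (R * Q)) \<le> 4 * real R * z * real (R * Q)"
      unfolding cardW by (simp add: power2_eq_square)
    then have "real Q \<le> 4 * z"
      using Rpos Qpos by simp
    then have "ennreal (real Q) \<le> ennreal (4 * z)" by (rule ennreal_leI)
    then show ?thesis unfolding z Q_def[symmetric] using z(2) by (simp add: ennreal_of_nat_eq_real_of_nat ennreal_mult)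
  qed
qed

end

section \<open>The Gaussian channel\<close>

abbreviation gain_idx :: "nat \<Rightarrow> nat \<Rightarrow> nat \<Rightarrow> (nat \<times> nat \<times> nat) set" where
  "gain_idx n K B \<equiv> {..<n} \<times> {1..K} \<times> {1..B}"

abbreviation std_normal :: "real measure" where
  "std_normal \<equiv> density lborel (\<lambda>x. ennreal (std_normal_density x))"

text \<open>Both sides are the product of the translated one-dimensional laws, by uniqueness of
  product measures on boxes. It turns additive noise into a transition density relative to Lebesgue
  measure.\<close>

lemma PiM_shift_density:
  fixes \<phi> :: "real \<Rightarrow> ennreal" and s :: "'i \<Rightarrow> real"
  assumes [measurable]: "\<phi> \<in> borel_measurable borel" and prob: "(\<integral>\<^sup>+x. \<phi> x \<partial>lborel) = 1" and [simp]: "finite I"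
  shows "distr (\<Pi>\<^sub>M i\<in>I. density lborel \<phi>) (\<Pi>\<^sub>M i\<in>I. borel) (\<lambda>z. \<lambda>i\<in>I. s i + z i)
     = density (\<Pi>\<^sub>M i\<in>I. lborel) (\<lambda>y. \<Prod>i\<in>I. \<phi> (y i - s i))"
proof -
  let ?M = "\<lambda>i. density lborel (\<lambda>y. \<phi> (y - s i))"
  have tr: "(\<integral>\<^sup>+x. f (x - a) \<partial>lborel) = (\<integral>\<^sup>+x. f x \<partial>lborel)"
    if [measurable]: "f \<in> borel_measurable borel" for f :: "real \<Rightarrow> ennreal" and a
    using nn_integral_real_affine[of "\<lambda>x. f (x - a)" 1 a] by simp
  have ps: "prob_space (density lborel \<phi>)" and psM: "prob_space (?M i)" for i
    by (rule prob_spaceI; simp add: emeasure_density prob tr)+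
  interpret A: product_prob_space "\<lambda>i. density lborel \<phi>" I
    by (intro product_prob_spaceI ps)
  interpret L: product_sigma_finite "\<lambda>i::'i. lborel :: real measure" ..
  interpret P: product_prob_space ?M I
    by (intro product_prob_spaceI psM)
  have [measurable_cong]: "sets (\<Pi>\<^sub>M i\<in>I. density lborel \<phi>) = sets (\<Pi>\<^sub>M i\<in>I. borel)"
    by (intro sets_PiM_cong) auto
  have [measurable_cong]: "sets (\<Pi>\<^sub>M i\<in>I. lborel) = sets (\<Pi>\<^sub>M i\<in>I. borel)"
    by (intro sets_PiM_cong) auto
  have "distr (\<Pi>\<^sub>M i\<in>I. density lborel \<phi>) (\<Pi>\<^sub>M i\<in>I. borel) (\<lambda>z. \<lambda>i\<in>I. s i + z i) = (\<Pi>\<^sub>M i\<in>I. ?M i)"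
  proof (rule P.PiM_eqI)
    show "sets (distr (\<Pi>\<^sub>M i\<in>I. density lborel \<phi>) (\<Pi>\<^sub>M i\<in>I. borel) (\<lambda>z. \<lambda>i\<in>I. s i + z i)) = sets (\<Pi>\<^sub>M i\<in>I. ?M i)"
      by (simp, intro sets_PiM_cong) auto
    fix A assume "\<And>i. i \<in> I \<Longrightarrow> A i \<in> sets (?M i)"
    then have A[measurable]: "i \<in> I \<Longrightarrow> A i \<in> sets borel" for i by simp
    have E[measurable]: "Pi\<^sub>E I A \<in> sets (\<Pi>\<^sub>M i\<in>I. borel)"
      by (intro sets_PiM_I_finite) (auto intro: A)
    have "emeasure (distr (\<Pi>\<^sub>M i\<in>I. density lborel \<phi>) (\<Pi>\<^sub>M i\<in>I. borel) (\<lambda>z. \<lambda>i\<in>I. s i + z i)) (Pi\<^sub>E I A)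
       = emeasure (\<Pi>\<^sub>M i\<in>I. density lborel \<phi>) (\<Pi>\<^sub>E i\<in>I. (\<lambda>z. s i + z) -` A i)"
      by (subst emeasure_distr) (auto simp: space_PiM intro!: arg_cong[where f="emeasure _"])
    also have "\<dots> = (\<Prod>i\<in>I. emeasure (density lborel \<phi>) ((\<lambda>z. s i + z) -` A i))"
      using A by (intro A.emeasure_PiM) (auto intro: measurable_sets_borel[OF _ A])
    also have "\<dots> = (\<Prod>i\<in>I. emeasure (?M i) (A i))"
    proof (intro prod.cong refl)
      fix i assume i[simp, measurable]: "i \<in> I"
      have [measurable]: "(\<lambda>z. s i + z) -` A i \<in> sets borel" by (intro measurable_sets_borel[OF _ A]) auto
      have "emeasure (?M i) (A i) = (\<integral>\<^sup>+y. (\<lambda>z. \<phi> z * indicator ((\<lambda>z. s i + z) -` A i) z) (y - s i) \<partial>lborel)"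
        using A[OF i] by (subst emeasure_density) (auto simp: indicator_def intro!: nn_integral_cong)
      also have "\<dots> = emeasure (density lborel \<phi>) ((\<lambda>z. s i + z) -` A i)"
        by (subst tr) (auto simp: emeasure_density)
      finally show "emeasure (density lborel \<phi>) ((\<lambda>z. s i + z) -` A i) = emeasure (?M i) (A i)" by simp
    qed
    finally show "emeasure (distr (\<Pi>\<^sub>M i\<in>I. density lborel \<phi>) (\<Pi>\<^sub>M i\<in>I. borel) (\<lambda>z. \<lambda>i\<in>I. s i + z i)) (Pi\<^sub>E I A)
       = (\<Prod>i\<in>I. emeasure (?M i) (A i))" .
  qed simp
  also have "(\<Pi>\<^sub>M i\<in>I. ?M i) = density (\<Pi>\<^sub>M i\<in>I. lborel) (\<lambda>y. \<Prod>i\<in>I. \<phi> (y i - s i))"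
  proof (rule P.PiM_eqI[symmetric])
    show "sets (density (\<Pi>\<^sub>M i\<in>I. lborel) (\<lambda>y. \<Prod>i\<in>I. \<phi> (y i - s i))) = sets (\<Pi>\<^sub>M i\<in>I. ?M i)"
      by (simp, intro sets_PiM_cong) auto
    fix A assume "\<And>i. i \<in> I \<Longrightarrow> A i \<in> sets (?M i)"
    then have A[measurable]: "i \<in> I \<Longrightarrow> A i \<in> sets borel" for i by simp
    have E[measurable]: "Pi\<^sub>E I A \<in> sets (\<Pi>\<^sub>M i\<in>I. borel)"
      by (intro sets_PiM_I_finite) (auto intro: A)
    have "emeasure (density (\<Pi>\<^sub>M i\<in>I. lborel) (\<lambda>y. \<Prod>i\<in>I. \<phi> (y i - s i))) (Pi\<^sub>E I A)
       = (\<integral>\<^sup>+y. (\<Prod>i\<in>I. \<phi> (y i - s i)) * indicator (Pi\<^sub>E I A) y \<partial>(\<Pi>\<^sub>M i\<in>I. lborel))"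
      by (subst emeasure_density) auto
    also have "\<dots> = (\<integral>\<^sup>+y. (\<Prod>i\<in>I. \<phi> (y i - s i) * indicator (A i) (y i)) \<partial>(\<Pi>\<^sub>M i\<in>I. lborel))"
    proof (intro nn_integral_cong)
      fix y assume "y \<in> space (\<Pi>\<^sub>M i\<in>I. lborel :: real measure)"
      then have y: "y \<in> extensional I" by (auto simp: space_PiM PiE_def)
      have "indicator (Pi\<^sub>E I A) y = (\<Prod>i\<in>I. indicator (A i) (y i) :: ennreal)"
        using y by (auto simp: indicator_def PiE_iff prod_zero_iff)
      then show "(\<Prod>i\<in>I. \<phi> (y i - s i)) * indicator (Pi\<^sub>E I A) y = (\<Prod>i\<in>I. \<phi> (y i - s i) * indicator (A i) (y i))"
        by (simp add: prod.distrib)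
    qed
    also have "\<dots> = (\<Prod>i\<in>I. \<integral>\<^sup>+y. \<phi> (y - s i) * indicator (A i) y \<partial>lborel)"
      by (intro L.product_nn_integral_prod) auto
    also have "\<dots> = (\<Prod>i\<in>I. emeasure (?M i) (A i))"
      by (intro prod.cong refl emeasure_density[symmetric]) auto
    finally show "emeasure (density (\<Pi>\<^sub>M i\<in>I. lborel) (\<lambda>y. \<Prod>i\<in>I. \<phi> (y i - s i))) (Pi\<^sub>E I A)
       = (\<Prod>i\<in>I. emeasure (?M i) (A i))" .
  qed simp
  finally show ?thesis .
qed

section \<open>Gains, noise and the law of one observation\<close>

lemma measurable_PiM_apply:
  "a \<in> R \<rightarrow>\<^sub>M Pi\<^sub>M I M \<Longrightarrow> i \<in> I \<Longrightarrow> (\<lambda>z. a z i) \<in> R \<rightarrow>\<^sub>M M i"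
  by (rule measurable_compose[OF _ measurable_component_singleton])

text \<open>The first factor of \<open>gState\<close>, named separately so that the noise can be
  integrated out for fixed gains.\<close>

definition gGain :: "(nat \<Rightarrow> nat \<Rightarrow> bool) \<Rightarrow> nat \<Rightarrow> nat \<Rightarrow> nat \<Rightarrow> (real \<Rightarrow> real) \<Rightarrow> (nat \<times> nat \<times> nat \<Rightarrow> real) measure" where
  "gGain M K B n f = (\<Pi>\<^sub>M p\<in>gain_idx n K B.
        (case p of (t, k, j) \<Rightarrow> if M k j then density lborel (\<lambda>x. ennreal (f x)) else return borel 0))"

definition gNoise :: "nat \<Rightarrow> nat \<Rightarrow> (nat \<times> nat \<Rightarrow> real) measure" where
  "gNoise K n = (\<Pi>\<^sub>M p\<in>{..<n} \<times> {1..K}. std_normal)"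

definition gRecv :: "nat \<Rightarrow> (nat \<Rightarrow> real) measure" where
  "gRecv n = (\<Pi>\<^sub>M t\<in>{..<n}. lborel)"

lemma gState_eq: "gState M K B n f = gGain M K B n f \<Otimes>\<^sub>M gNoise K n"
  by (simp add: gState_def gGain_def gNoise_def)

definition gsig :: "nat \<Rightarrow> nat \<Rightarrow> (nat \<times> nat \<times> nat \<Rightarrow> real) \<Rightarrow> (nat \<times> nat \<Rightarrow> real) \<Rightarrow> nat \<Rightarrow> real" where
  "gsig B k g x t = (\<Sum>j\<in>{1..B}. g (t, k, j) * x (t, j))"

text \<open>The observation belonging to an output sequence \<open>y\<close>, so that a decoder can
  be integrated against the density of \<open>y\<close>.\<close>

definition gmk :: "nat \<Rightarrow> nat \<Rightarrow> nat \<Rightarrow> (nat \<times> nat \<times> nat \<Rightarrow> real) \<Rightarrow> (nat \<Rightarrow> real) \<Rightarrow> nat \<Rightarrow> real \<times> (nat \<Rightarrow> real)" where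
  "gmk n B k g y = (\<lambda>t\<in>{..<n}. (y t, \<lambda>j\<in>{1..B}. g (t, k, j)))"

text \<open>The noise profile \<open>\<psi>\<close> is left open: the standard normal density gives
  the true transition density, \<open>heavy_density\<close> the one that dominates it in the chain
  argument.\<close>

definition gkernel :: "(real \<Rightarrow> real) \<Rightarrow> nat \<Rightarrow> nat \<Rightarrow> nat \<Rightarrow> (nat \<times> nat \<times> nat \<Rightarrow> real) \<Rightarrow> (nat \<Rightarrow> real)
    \<Rightarrow> (nat \<times> nat \<Rightarrow> real) \<Rightarrow> ennreal" where
  "gkernel \<psi> n B k g y x = (\<Prod>t<n. ennreal (\<psi> (y t - gsig B k g x t)))"

lemma sets_gGain[measurable_cong]: "sets (gGain M K B n f) = sets (\<Pi>\<^sub>M p\<in>gain_idx n K B. borel)"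
  unfolding gGain_def by (intro sets_PiM_cong) (auto split: prod.splits)

lemma sets_gNoise[measurable_cong]: "sets (gNoise K n) = sets (\<Pi>\<^sub>M p\<in>{..<n} \<times> {1..K}. borel)"
  unfolding gNoise_def by (intro sets_PiM_cong) auto

lemma sets_gRecv[measurable_cong]: "sets (gRecv n) = sets (\<Pi>\<^sub>M t\<in>{..<n}. borel)"
  unfolding gRecv_def by (intro sets_PiM_cong) auto

lemma prob_space_std_normal: "prob_space std_normal"
  by (rule prob_space_normal_density) simp

lemma prob_space_density_f:
  assumes "admissible_density f c"
  shows "prob_space (density lborel (\<lambda>x. ennreal (f x)))"
  using assms by (intro prob_spaceI) (auto simp: admissible_density_def emeasure_density)

lemma prob_space_gGain:
  assumes "admissible_density f c"
  shows "prob_space (gGain M K B n f)"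
  unfolding gGain_def using prob_space_density_f[OF assms]
  by (intro prob_space_PiM) (auto split: prod.splits intro: prob_space_return)

lemma prob_space_gNoise: "prob_space (gNoise K n)"
  unfolding gNoise_def by (intro prob_space_PiM prob_space_std_normal)

lemma prob_space_gState:
  assumes "admissible_density f c"
  shows "prob_space (gState M K B n f)"
  unfolding gState_eq
proof -
  interpret A: prob_space "gGain M K B n f" by (rule prob_space_gGain[OF assms])
  interpret B: prob_space "gNoise K n" by (rule prob_space_gNoise)
  interpret pair_prob_space "gGain M K B n f" "gNoise K n" ..
  show "prob_space (gGain M K B n f \<Otimes>\<^sub>M gNoise K n)" by unfold_locales
qed

lemma sigma_finite_gRecv: "sigma_finite_measure (gRecv n)"
proof -
  interpret L: product_sigma_finite "\<lambda>i::nat. lborel :: real measure" ..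
  show ?thesis unfolding gRecv_def by (rule L.sigma_finite) simp
qed

lemma measurable_gsig[measurable (raw)]:
  assumes k: "k \<in> {1..K}" "t < n"
    and [measurable]: "a \<in> R \<rightarrow>\<^sub>M (\<Pi>\<^sub>M p\<in>gain_idx n K B. borel)" "b \<in> R \<rightarrow>\<^sub>M gX n B"
  shows "(\<lambda>z. gsig B k (a z) (b z) t) \<in> borel_measurable R"
proof -
  have [measurable]: "b \<in> R \<rightarrow>\<^sub>M (\<Pi>\<^sub>M p\<in>{..<n} \<times> {1..B}. borel)" using assms(4) by (simp add: gX_def)
  show ?thesis unfolding gsig_def
  proof (intro borel_measurable_sum borel_measurable_times)
    fix j assume j: "j \<in> {1..B}"
    show "(\<lambda>z. a z (t, k, j)) \<in> borel_measurable R" "(\<lambda>z. b z (t, j)) \<in> borel_measurable R"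
      using k j by (auto intro!: measurable_PiM_apply[OF assms(3)] measurable_PiM_apply[OF assms(4)[unfolded gX_def]])
  qed
qed


lemma measurable_gmk[measurable (raw)]:
  assumes k: "k \<in> {1..K}"
    and a: "a \<in> R \<rightarrow>\<^sub>M (\<Pi>\<^sub>M p\<in>gain_idx n K B. borel)"
    and b: "b \<in> R \<rightarrow>\<^sub>M (\<Pi>\<^sub>M t\<in>{..<n}. borel)"
  shows "(\<lambda>z. gmk n B k (a z) (b z)) \<in> R \<rightarrow>\<^sub>M gOM n B"
  unfolding gmk_def gOM_def
proof (intro measurable_restrict measurable_Pair)
  fix t assume t: "t \<in> {..<n}"
  show "(\<lambda>z. b z t) \<in> borel_measurable R"
    by (rule measurable_PiM_apply[OF b t])
  show "(\<lambda>z. a z (t, k, j)) \<in> borel_measurable R" if "j \<in> {1..B}" for j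
    by (rule measurable_PiM_apply[OF a]) (use t k that in auto)
qed

lemma measurable_gkernel[measurable (raw)]:
  assumes k: "k \<in> {1..K}" and [measurable]: "\<psi> \<in> borel_measurable borel"
    and a: "a \<in> R \<rightarrow>\<^sub>M (\<Pi>\<^sub>M p\<in>gain_idx n K B. borel)"
    and b: "b \<in> R \<rightarrow>\<^sub>M (\<Pi>\<^sub>M t\<in>{..<n}. borel)"
    and c: "c \<in> R \<rightarrow>\<^sub>M gX n B"
  shows "(\<lambda>z. gkernel \<psi> n B k (a z) (b z) (c z)) \<in> borel_measurable R"
  unfolding gkernel_def
proof (intro borel_measurable_prod_ennreal)
  fix t assume "t \<in> {..<n}"
  then have [measurable]: "(\<lambda>z. b z t) \<in> borel_measurable R"
    by (auto intro!: measurable_PiM_apply[OF b])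
  have [measurable]: "(\<lambda>z. gsig B k (a z) (c z) t) \<in> borel_measurable R"
    using \<open>t \<in> {..<n}\<close> k by (intro measurable_gsig[OF k _ a c]) auto
  show "(\<lambda>z. ennreal (\<psi> (b z t - gsig B k (a z) (c z) t))) \<in> borel_measurable R" by measurable
qed

text \<open>The noise at receiver \<open>k\<close> is a marginal of the noise of all receivers,
  obtained by reindexing the product along \<open>t \<mapsto> (t, k)\<close>; then the shifted
  product density applies.\<close>

lemma gNoise_shift:
  assumes k: "k \<in> {1..K}" and [measurable]: "H \<in> borel_measurable (\<Pi>\<^sub>M t\<in>{..<n}. borel)"
  shows "(\<integral>\<^sup>+z. H (\<lambda>t\<in>{..<n}. s t + z (t, k)) \<partial>gNoise K n)
    = (\<integral>\<^sup>+y. (\<Prod>t<n. ennreal (std_normal_density (y t - s t))) * H y \<partial>gRecv n)"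
proof -
  let ?N = "std_normal"
  interpret N: prob_space ?N by (rule prob_space_std_normal)
  have sets1[measurable_cong]: "sets (\<Pi>\<^sub>M t\<in>{..<n}. ?N) = sets (\<Pi>\<^sub>M t\<in>{..<n}. borel)"
    by (intro sets_PiM_cong) auto
  have sets2[measurable_cong]: "sets (\<Pi>\<^sub>M t\<in>{..<n}. lborel :: real measure) = sets (\<Pi>\<^sub>M t\<in>{..<n}. borel)"
    by (intro sets_PiM_cong) auto
  have m[measurable]: "(\<lambda>z. \<lambda>t\<in>{..<n}. z (t, k)) \<in> gNoise K n \<rightarrow>\<^sub>M (\<Pi>\<^sub>M t\<in>{..<n}. borel)"
    unfolding gNoise_def using k
    by (intro measurable_restrict) (auto intro!: measurable_component_singleton[of _ _ "\<lambda>_. ?N", simplified])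
  have m'[measurable]: "(\<lambda>z. \<lambda>t\<in>{..<n}. z (t, k)) \<in> gNoise K n \<rightarrow>\<^sub>M (\<Pi>\<^sub>M t\<in>{..<n}. ?N)"
    using m by (simp cong: measurable_cong_sets add: measurable_cong_sets[OF refl sets1])
  have re: "distr (gNoise K n) (\<Pi>\<^sub>M t\<in>{..<n}. ?N) (\<lambda>z. \<lambda>t\<in>{..<n}. z (t, k)) = (\<Pi>\<^sub>M t\<in>{..<n}. ?N)"
    unfolding gNoise_def using k
    by (intro distr_PiM_reindex[where f="\<lambda>t. (t, k)" and M="\<lambda>_. ?N"] prob_space_std_normal) (auto simp: inj_on_def)
  have "(\<integral>\<^sup>+z. H (\<lambda>t\<in>{..<n}. s t + z (t, k)) \<partial>gNoise K n)
    = (\<integral>\<^sup>+z. H (\<lambda>t\<in>{..<n}. s t + (\<lambda>t\<in>{..<n}. z (t, k)) t) \<partial>gNoise K n)"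
    by (intro nn_integral_cong arg_cong[where f=H]) auto
  also have "\<dots> = (\<integral>\<^sup>+z. H (\<lambda>t\<in>{..<n}. s t + z t) \<partial>distr (gNoise K n) (\<Pi>\<^sub>M t\<in>{..<n}. ?N) (\<lambda>z. \<lambda>t\<in>{..<n}. z (t, k)))"
    by (subst nn_integral_distr) auto
  also have "\<dots> = (\<integral>\<^sup>+z. H (\<lambda>t\<in>{..<n}. s t + z t) \<partial>(\<Pi>\<^sub>M t\<in>{..<n}. ?N))"
    by (simp only: re)
  also have "\<dots> = (\<integral>\<^sup>+y. H y \<partial>distr (\<Pi>\<^sub>M t\<in>{..<n}. ?N) (\<Pi>\<^sub>M t\<in>{..<n}. borel) (\<lambda>z. \<lambda>t\<in>{..<n}. s t + z t))"
    by (subst nn_integral_distr) auto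
  also have "\<dots> = (\<integral>\<^sup>+y. H y \<partial>density (\<Pi>\<^sub>M t\<in>{..<n}. lborel) (\<lambda>y. \<Prod>t\<in>{..<n}. ennreal (std_normal_density (y t - s t))))"
    using N.emeasure_space_1 by (subst PiM_shift_density) (auto simp: emeasure_density)
  also have "\<dots> = (\<integral>\<^sup>+y. (\<Prod>t<n. ennreal (std_normal_density (y t - s t))) * H y \<partial>gRecv n)"
    unfolding gRecv_def by (subst nn_integral_density) auto
  finally show ?thesis .
qed

lemma gobs_eq_gmk:
  "gobs n B x (g, z) k = gmk n B k g (\<lambda>t\<in>{..<n}. gsig B k g x t + z (t, k))"
  by (auto simp: gobs_def gmk_def gsig_def)

lemma measurable_gobs:
  assumes k: "k \<in> {1..K}"
  shows "(\<lambda>s. gobs n B x s k) \<in> gState M K B n f \<rightarrow>\<^sub>M gOM n B"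
proof -
  have a: "fst \<in> gState M K B n f \<rightarrow>\<^sub>M (\<Pi>\<^sub>M p\<in>gain_idx n K B. borel)"
    unfolding gState_eq by measurable
  have b: "snd \<in> gState M K B n f \<rightarrow>\<^sub>M (\<Pi>\<^sub>M p\<in>{..<n} \<times> {1..K}. borel)"
    unfolding gState_eq by measurable
  show ?thesis
    unfolding gobs_def gOM_def
  proof (intro measurable_restrict measurable_Pair)
    fix t assume t: "t \<in> {..<n}"
    have g[measurable]: "(\<lambda>s. fst s (t, k, j)) \<in> borel_measurable (gState M K B n f)" if "j \<in> {1..B}" for j
      by (rule measurable_PiM_apply[OF a]) (use t k that in auto)
    have z[measurable]: "(\<lambda>s. snd s (t, k)) \<in> borel_measurable (gState M K B n f)"
      by (rule measurable_PiM_apply[OF b]) (use t k in auto)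
    show "(\<lambda>s. (\<Sum>j\<in>{1..B}. fst s (t, k, j) * x (t, j)) + snd s (t, k)) \<in> borel_measurable (gState M K B n f)"
      by measurable
    show "(\<lambda>s. fst s (t, k, j)) \<in> borel_measurable (gState M K B n f)" if "j \<in> {1..B}" for j
      using that by (rule g)
  qed
qed

lemma measurable_gobs_pair:
  assumes k: "k \<in> {1..K}"
  shows "(\<lambda>(x, s). gobs n B x s k) \<in> gX n B \<Otimes>\<^sub>M gState M K B n f \<rightarrow>\<^sub>M gOM n B"
proof -
  let ?R = "gX n B \<Otimes>\<^sub>M gState M K B n f"
  have a: "(\<lambda>z. fst (snd z)) \<in> ?R \<rightarrow>\<^sub>M (\<Pi>\<^sub>M p\<in>gain_idx n K B. borel)"
    unfolding gState_eq by measurable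
  have b: "(\<lambda>z. snd (snd z)) \<in> ?R \<rightarrow>\<^sub>M (\<Pi>\<^sub>M p\<in>{..<n} \<times> {1..K}. borel)"
    unfolding gState_eq by measurable
  have c: "fst \<in> ?R \<rightarrow>\<^sub>M (\<Pi>\<^sub>M p\<in>{..<n} \<times> {1..B}. borel)"
    unfolding gX_def[symmetric] by measurable
  show ?thesis
    unfolding gobs_def gOM_def split_def
  proof (intro measurable_restrict measurable_Pair)
    fix t assume t: "t \<in> {..<n}"
    have g[measurable]: "(\<lambda>z. fst (snd z) (t, k, j)) \<in> borel_measurable ?R" if "j \<in> {1..B}" for j
      by (rule measurable_PiM_apply[OF a]) (use t k that in auto)
    have x[measurable]: "(\<lambda>z. fst z (t, j)) \<in> borel_measurable ?R" if "j \<in> {1..B}" for j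
      by (rule measurable_PiM_apply[OF c]) (use t k that in auto)
    have z[measurable]: "(\<lambda>z. snd (snd z) (t, k)) \<in> borel_measurable ?R"
      by (rule measurable_PiM_apply[OF b]) (use t k in auto)
    show "(\<lambda>z. (\<Sum>j\<in>{1..B}. fst (snd z) (t, k, j) * fst z (t, j)) + snd (snd z) (t, k)) \<in> borel_measurable ?R"
      by measurable
    show "(\<lambda>z. fst (snd z) (t, k, j)) \<in> borel_measurable ?R" if "j \<in> {1..B}" for j
      using that by (rule g)
  qed
qed

text \<open>Fubini with the noise innermost. The right-hand side is the iterated form over gains and
  outputs in which the success probabilities of \<open>receiver_chain\<close> are written.\<close>

lemma gobs_nn_integral:
  assumes adm: "admissible_density f c" and k: "k \<in> {1..K}" and [measurable]: "F \<in> borel_measurable (gOM n B)"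
  shows "(\<integral>\<^sup>+s. F (gobs n B x s k) \<partial>gState M K B n f)
    = (\<integral>\<^sup>+g. \<integral>\<^sup>+y. gkernel std_normal_density n B k g y x * F (gmk n B k g y) \<partial>gRecv n \<partial>gGain M K B n f)"
proof -
  interpret Z: prob_space "gNoise K n" by (rule prob_space_gNoise)
  note [measurable] = measurable_gobs[OF k] k
  have "(\<integral>\<^sup>+s. F (gobs n B x s k) \<partial>gState M K B n f)
     = (\<integral>\<^sup>+g. \<integral>\<^sup>+z. F (gobs n B x (g, z) k) \<partial>gNoise K n \<partial>gGain M K B n f)"
    unfolding gState_eq
    by (rule Z.nn_integral_fst[symmetric]) (use measurable_gobs[OF k] in \<open>auto simp: gState_eq\<close>)
  also have "\<dots> = (\<integral>\<^sup>+g. \<integral>\<^sup>+y. gkernel std_normal_density n B k g y x * F (gmk n B k g y) \<partial>gRecv n \<partial>gGain M K B n f)"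
  proof (intro nn_integral_cong)
    fix g assume g: "g \<in> space (gGain M K B n f)"
    have g': "g \<in> space (\<Pi>\<^sub>M p\<in>gain_idx n K B. borel)"
      using g sets_eq_imp_space_eq[OF sets_gGain] by metis
    have [measurable]: "(\<lambda>y. F (gmk n B k g y)) \<in> borel_measurable (\<Pi>\<^sub>M t\<in>{..<n}. borel)"
      by (rule measurable_compose[OF measurable_gmk[OF k]]) (use g' in auto)
    have "(\<integral>\<^sup>+z. F (gobs n B x (g, z) k) \<partial>gNoise K n)
      = (\<integral>\<^sup>+z. (\<lambda>y. F (gmk n B k g y)) (\<lambda>t\<in>{..<n}. gsig B k g x t + z (t, k)) \<partial>gNoise K n)"
      by (simp add: gobs_eq_gmk)
    also have "\<dots> = (\<integral>\<^sup>+y. gkernel std_normal_density n B k g y x * F (gmk n B k g y) \<partial>gRecv n)"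
      unfolding gkernel_def by (subst gNoise_shift[OF k]) auto
    finally show "(\<integral>\<^sup>+z. F (gobs n B x (g, z) k) \<partial>gNoise K n) = \<dots>" .
  qed
  finally show ?thesis .
qed

lemma AE_gGain_bound:
  assumes adm: "admissible_density f c"
  shows "AE g in gGain M K B n f. \<forall>p\<in>gain_idx n K B. \<bar>g p\<bar> \<le> c \<and>
     (case p of (t, k, j) \<Rightarrow> if M k j then 1 / c \<le> \<bar>g p\<bar> else g p = 0)"
proof (rule AE_finite_allI)
  fix p assume p: "p \<in> gain_idx n K B"
  obtain t k j where [simp]: "p = (t, k, j)" by (cases p) auto
  have c: "0 < c" using adm by (simp add: admissible_density_def)
  have "AE y in (if M k j then density lborel (\<lambda>x. ennreal (f x)) else return borel 0).
      \<bar>y\<bar> \<le> c \<and> (if M k j then 1 / c \<le> \<bar>y\<bar> else y = 0)"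
  proof (cases "M k j")
    case True
    have "AE x in lborel. f x \<noteq> 0 \<longrightarrow> 1 / c \<le> \<bar>x\<bar> \<and> \<bar>x\<bar> \<le> c" "f \<in> borel_measurable borel"
      using adm by (auto simp: admissible_density_def)
    then have "AE y in density lborel (\<lambda>x. ennreal (f x)). \<bar>y\<bar> \<le> c \<and> 1 / c \<le> \<bar>y\<bar>"
      by (subst AE_density) (auto elim!: eventually_mono simp: ennreal_eq_0_iff)
    then show ?thesis using True by simp
  next
    case False
    have "AE y in return borel (0::real). \<bar>y\<bar> \<le> c \<and> y = 0"
      using c by (subst AE_return) (auto intro: borel_measurable_pred_less)
    then show ?thesis using False by simp
  qed
  note comp = this
  show "AE g in gGain M K B n f. \<bar>g p\<bar> \<le> c \<and>
     (case p of (t, k, j) \<Rightarrow> if M k j then 1 / c \<le> \<bar>g p\<bar> else g p = 0)"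
    unfolding gGain_def prod.case \<open>p = (t, k, j)\<close>
  proof (rule AE_PiM_component[where P="\<lambda>y. \<bar>y\<bar> \<le> c \<and> (if M k j then 1 / c \<le> \<bar>y\<bar> else y = 0)"])
    show "prob_space (case i of (t, k, j) \<Rightarrow> if M k j then density lborel (\<lambda>x. ennreal (f x)) else return borel 0)" for i
      using prob_space_density_f[OF adm] by (auto split: prod.splits intro: prob_space_return)
    show "AE x in case (t, k, j) of (t, k, j) \<Rightarrow> if M k j then density lborel (\<lambda>x. ennreal (f x)) else return borel 0.
       \<bar>x\<bar> \<le> c \<and> (if M k j then 1 / c \<le> \<bar>x\<bar> else x = 0)"
      unfolding prod.case by (rule comp)
  qed (use p in auto)
qed simp

section \<open>The weighted normal density and its overlaps\<close>

text \<open>The factor \<open>1 + z\<^sup>2\<close> pays for large noise when the distance of two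
  outputs is compared with the distance of the signals behind them. The density stays bounded, and
  its total mass is 2.\<close>

definition heavy_density :: "real \<Rightarrow> real" where
  "heavy_density z = (1 + z\<^sup>2) * std_normal_density z"

lemma heavy_density_nonneg[simp]: "0 \<le> heavy_density z"
  by (simp add: heavy_density_def)

lemma heavy_density_measurable[measurable]: "heavy_density \<in> borel_measurable borel"
  unfolding heavy_density_def[abs_def] by measurable

lemma heavy_density_le_1: "heavy_density z \<le> 1"
proof -
  have "1 + z\<^sup>2 / 2 \<le> exp (z\<^sup>2 / 2)" by (rule exp_ge_add_one_self)
  then have "1 + z\<^sup>2 \<le> 2 * exp (z\<^sup>2 / 2)" by linarith
  then have "heavy_density z \<le> 2 * exp (z\<^sup>2 / 2) * std_normal_density z"
    unfolding heavy_density_def by (intro mult_right_mono) auto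
  also have "\<dots> = 2 / sqrt (2 * pi)"
    by (simp add: std_normal_density_def exp_minus field_simps)
  also have "\<dots> \<le> 1"
  proof -
    have "sqrt (2 * 2) \<le> sqrt (2 * pi)" using pi_ge_two by (intro real_sqrt_le_mono) simp
    then show ?thesis by (simp add: real_sqrt_mult[symmetric] divide_le_eq_1_pos)
  qed
  finally show ?thesis .
qed

lemma heavy_density_integral: "(\<integral>\<^sup>+z. ennreal (heavy_density z) \<partial>lborel) = 2"
proof -
  have 1: "has_bochner_integral lborel std_normal_density 1"
    using std_normal_moment_even[of 0] by simp
  have 2: "has_bochner_integral lborel (\<lambda>x. std_normal_density x * x\<^sup>2) 1"
    using std_normal_moment_even[of 1] by (simp add: numeral_2_eq_2)
  have "has_bochner_integral lborel heavy_density (1 + 1)"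
    using has_bochner_integral_add[OF 1 2] by (simp add: heavy_density_def[abs_def] algebra_simps)
  then have "(\<integral>\<^sup>+z. ennreal (heavy_density z) \<partial>lborel) = ennreal (1 + 1)"
    by (intro nn_integral_eq_integral[THEN trans]) (auto dest: has_bochner_integral_integral_eq integrable.intros)
  then show ?thesis by (simp del: ennreal_plus)
qed

lemma lborel_translate:
  assumes [measurable]: "f \<in> borel_measurable borel"
  shows "(\<integral>\<^sup>+x. f (x + (a::real)) \<partial>lborel) = (\<integral>\<^sup>+x. f x \<partial>lborel)"
  using nn_integral_real_affine[of f 1 a] by (simp add: add.commute)

text \<open>Correlation of two translated copies of the dominating output density. Its counterpart
  over a finite field is the probability that two inputs give the same output.\<close>

definition overlap :: "real \<Rightarrow> ennreal" where
  "overlap u = (\<integral>\<^sup>+y. ennreal (heavy_density y) * ennreal (heavy_density (y + u)) \<partial>lborel)"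

lemma overlap_measurable[measurable]: "overlap \<in> borel_measurable borel"
  unfolding overlap_def[abs_def] by measurable

lemma overlap_shift:
  "(\<integral>\<^sup>+y. ennreal (heavy_density (y - s)) * ennreal (heavy_density (y - s')) \<partial>lborel) = overlap (s - s')"
  unfolding overlap_def
  using lborel_translate[of "\<lambda>y. ennreal (heavy_density (y - s)) * ennreal (heavy_density (y - s'))" s]
  by (simp add: algebra_simps)

lemma overlap_le_2: "overlap u \<le> 2"
proof -
  have "overlap u \<le> (\<integral>\<^sup>+y. ennreal (heavy_density y) * 1 \<partial>lborel)"
    unfolding overlap_def by (intro nn_integral_mono mult_left_mono) (auto simp: heavy_density_le_1)
  then show ?thesis by (simp add: heavy_density_integral)
qed

text \<open>With the density of the gain bounded by \<open>fm\<close>, the substitution along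
  \<open>g * \<Delta> + v\<close> yields the Jacobian \<open>1 / \<bar>\<Delta>\<bar>\<close> and
  the square of the mass 2 of \<open>heavy_density\<close>. The offset \<open>v\<close> stands for
  the contribution of all other gains, on which the bound does not depend.\<close>

lemma overlap_density_le:
  assumes [measurable]: "f \<in> borel_measurable borel" and fm: "\<And>x. f x \<le> fm" and \<Delta>: "\<Delta> \<noteq> 0" and fm0: "0 \<le> fm"
  shows "(\<integral>\<^sup>+g. ennreal (f g) * overlap (g * \<Delta> + v) \<partial>lborel) \<le> ennreal (4 * fm / \<bar>\<Delta>\<bar>)"
proof -
  have I: "\<bar>\<Delta>\<bar> * (\<integral>\<^sup>+g. ennreal (heavy_density (y + (g * \<Delta> + v))) \<partial>lborel) = 2" for y
    using nn_integral_real_affine[of "\<lambda>x. ennreal (heavy_density x)" \<Delta> "y + v"] \<Delta>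
    by (simp add: heavy_density_integral algebra_simps)
  have I': "(\<integral>\<^sup>+g. ennreal (heavy_density (y + (g * \<Delta> + v))) \<partial>lborel) = ennreal (2 / \<bar>\<Delta>\<bar>)" for y
  proof -
    have "(\<integral>\<^sup>+g. ennreal (heavy_density (y + (g * \<Delta> + v))) \<partial>lborel)
       = ennreal (1 / \<bar>\<Delta>\<bar>) * (\<bar>\<Delta>\<bar> * (\<integral>\<^sup>+g. ennreal (heavy_density (y + (g * \<Delta> + v))) \<partial>lborel))"
      using \<Delta> by (simp add: mult.assoc[symmetric] ennreal_mult[symmetric])
    also have "\<dots> = ennreal (1 / \<bar>\<Delta>\<bar>) * ennreal 2" unfolding I by simp
    also have "\<dots> = ennreal (2 / \<bar>\<Delta>\<bar>)" by (subst ennreal_mult[symmetric]) auto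
    finally show ?thesis .
  qed
  have "(\<integral>\<^sup>+g. ennreal (f g) * overlap (g * \<Delta> + v) \<partial>lborel) \<le> (\<integral>\<^sup>+g. ennreal fm * overlap (g * \<Delta> + v) \<partial>lborel)"
    by (intro nn_integral_mono mult_right_mono ennreal_leI fm) auto
  also have "\<dots> = ennreal fm * (\<integral>\<^sup>+g. overlap (g * \<Delta> + v) \<partial>lborel)"
    by (rule nn_integral_cmult) measurable
  also have "(\<integral>\<^sup>+g. overlap (g * \<Delta> + v) \<partial>lborel)
     = (\<integral>\<^sup>+y. \<integral>\<^sup>+g. ennreal (heavy_density y) * ennreal (heavy_density (y + (g * \<Delta> + v))) \<partial>lborel \<partial>lborel)"
    unfolding overlap_def by (rule lborel_pair.Fubini') measurable
  also have "\<dots> = (\<integral>\<^sup>+y. ennreal (heavy_density y) * ennreal (2 / \<bar>\<Delta>\<bar>) \<partial>lborel)"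
    by (subst nn_integral_cmult) (auto simp: I')
  also have "\<dots> = 2 * ennreal (2 / \<bar>\<Delta>\<bar>)"
    by (subst nn_integral_multc) (auto simp: heavy_density_integral)
  also have "2 * ennreal (2 / \<bar>\<Delta>\<bar>) = ennreal (4 / \<bar>\<Delta>\<bar>)"
    by (subst ennreal_numeral[symmetric], subst ennreal_mult[symmetric]) auto
  also have "ennreal fm * ennreal (4 / \<bar>\<Delta>\<bar>) = ennreal (4 * fm / \<bar>\<Delta>\<bar>)"
    using fm0 by (subst ennreal_mult[symmetric]) (auto simp: mult_ac)
  finally show ?thesis .
qed

text \<open>This is the row integral of the Schur kernel. At \<open>a = 1/2\<close> it diverges
  logarithmically, which is why the kernel exponent must exceed the decay \<open>1/2\<close>
  provided by the fading.\<close>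

lemma inv_powr_integral_finite:
  assumes a: "1 / 2 < a"
  shows "(\<integral>\<^sup>+u. ennreal ((1 + u\<^sup>2) powr (-a)) \<partial>lborel) < \<infinity>"
proof -
  define b where "b = 2 * a"
  have b: "1 < b" using a by (simp add: b_def)
  \<comment> \<open>Powers of \<open>1 + \<bar>u\<bar>\<close> have an elementary antiderivative on
    each half-line.\<close>
  have le: "(1 + u\<^sup>2) powr (-a) \<le> 2 powr a * (1 + \<bar>u\<bar>) powr (-b)" for u :: real
  proof -
    have "(1 + \<bar>u\<bar>)\<^sup>2 \<le> 2 * (1 + u\<^sup>2)"
      using sum_squares_bound[of 1 "\<bar>u\<bar>"] by (simp add: power2_sum)
    then have "((1 + \<bar>u\<bar>)\<^sup>2 / 2) powr a \<le> (1 + u\<^sup>2) powr a"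
      using a by (intro powr_mono2) auto
    moreover have "((1 + \<bar>u\<bar>)\<^sup>2 / 2) powr a = (1 + \<bar>u\<bar>) powr b / 2 powr a"
      using a by (simp add: powr_divide powr_powr b_def powr_realpow[symmetric, of "1 + \<bar>u\<bar>" 2, simplified] powr_numeral[symmetric] del: powr_numeral)
    ultimately have "(1 + \<bar>u\<bar>) powr b / 2 powr a \<le> (1 + u\<^sup>2) powr a" by simp
    then have "inverse ((1 + u\<^sup>2) powr a) \<le> inverse ((1 + \<bar>u\<bar>) powr b / 2 powr a)"
      by (intro le_imp_inverse_le) (auto intro!: divide_pos_pos)
    then show ?thesis by (simp add: powr_minus field_simps)
  qed
  have half: "(\<integral>\<^sup>+u. ennreal ((1 + u) powr (-b)) * indicator {0..} u \<partial>lborel) = ennreal (0 - (1 + 0) powr (1 - b) / (1 - b))"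
  proof (rule nn_integral_FTC_atLeast)
    show "DERIV (\<lambda>u. (1 + u) powr (1 - b) / (1 - b)) u :> (1 + u) powr (-b)" if "0 \<le> u" for u
    proof -
      have "DERIV (\<lambda>u. (1 + u) powr (1 - b)) u :> (1 - b) * (1 + u) powr (1 - b - of_nat 1) * 1"
        using that by (intro DERIV_fun_powr) (auto intro!: derivative_eq_intros)
      from DERIV_cdivide[OF this, of "1 - b"] show ?thesis using b by simp
    qed
    show "((\<lambda>u. (1 + u) powr (1 - b) / (1 - b)) \<longlongrightarrow> 0) at_top"
      using b by real_asymp
  qed auto
  have fin: "(\<integral>\<^sup>+u. ennreal ((1 + \<bar>u\<bar>) powr (-b)) * indicator {0..} u \<partial>lborel) < \<infinity>"
  proof -
    have "(\<integral>\<^sup>+u. ennreal ((1 + \<bar>u\<bar>) powr (-b)) * indicator {0..} u \<partial>lborel)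
        = (\<integral>\<^sup>+u. ennreal ((1 + u) powr (-b)) * indicator {0..} u \<partial>lborel)"
      by (intro nn_integral_cong) (auto simp: indicator_def)
    then show ?thesis unfolding half by simp
  qed
  have fin': "(\<integral>\<^sup>+u. ennreal ((1 + \<bar>u\<bar>) powr (-b)) * indicator {..0} u \<partial>lborel) < \<infinity>"
  proof -
    have "(\<integral>\<^sup>+u. ennreal ((1 + \<bar>u\<bar>) powr (-b)) * indicator {..0} u \<partial>lborel)
        = (\<integral>\<^sup>+u. ennreal ((1 + \<bar>u\<bar>) powr (-b)) * indicator {0..} u \<partial>lborel)"
      by (subst nn_integral_real_affine[of _ "-1" 0]) (auto intro!: nn_integral_cong simp: indicator_def)
    then show ?thesis using fin by simp
  qed
  have "(\<integral>\<^sup>+u. ennreal ((1 + u\<^sup>2) powr (-a)) \<partial>lborel) \<le> (\<integral>\<^sup>+u. ennreal (2 powr a) *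
     (ennreal ((1 + \<bar>u\<bar>) powr (-b)) * indicator {0..} u + ennreal ((1 + \<bar>u\<bar>) powr (-b)) * indicator {..0} u) \<partial>lborel)"
  proof (intro nn_integral_mono)
    fix u :: real
    have "ennreal ((1 + u\<^sup>2) powr (-a)) \<le> ennreal (2 powr a) * ennreal ((1 + \<bar>u\<bar>) powr (-b))"
      using le[of u] by (simp add: ennreal_mult[symmetric] ennreal_leI)
    also have "\<dots> \<le> ennreal (2 powr a) *
     (ennreal ((1 + \<bar>u\<bar>) powr (-b)) * indicator {0..} u + ennreal ((1 + \<bar>u\<bar>) powr (-b)) * indicator {..0} u)"
      by (intro mult_left_mono) (auto simp: indicator_def)
    finally show "ennreal ((1 + u\<^sup>2) powr (-a)) \<le> \<dots>" .
  qed
  also have "\<dots> = ennreal (2 powr a) * ((\<integral>\<^sup>+u. ennreal ((1 + \<bar>u\<bar>) powr (-b)) * indicator {0..} u \<partial>lborel)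
     + (\<integral>\<^sup>+u. ennreal ((1 + \<bar>u\<bar>) powr (-b)) * indicator {..0} u \<partial>lborel))"
    by (subst nn_integral_cmult, measurable, subst nn_integral_add, auto)
  also have "\<dots> < \<infinity>" using fin fin' by (simp add: ennreal_mult_less_top)
  finally show ?thesis .
qed

text \<open>A form of the inequality of arithmetic and geometric means:
  \<open>1 + x \<le> exp x\<close> is applied to each factor divided by \<open>1 + s\<close>, and
  the exponents sum to at most 0.\<close>

lemma prod_one_plus_le:
  fixes b :: "nat \<Rightarrow> real"
  assumes "\<And>i. i < n \<Longrightarrow> 0 \<le> b i" "(\<Sum>i<n. b i) \<le> real n * s" "0 \<le> s"
  shows "(\<Prod>i<n. 1 + b i) \<le> (1 + s) ^ n"
proof -
  have "(\<Prod>i<n. 1 + b i) \<le> (\<Prod>i<n. (1 + s) * exp ((1 + b i) / (1 + s) - 1))"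
  proof (intro prod_mono conjI)
    fix i assume "i \<in> {..<n}"
    then show "0 \<le> 1 + b i" using assms(1) by (auto intro: add_nonneg_nonneg)
    have "(1 + b i) / (1 + s) \<le> exp ((1 + b i) / (1 + s) - 1)"
      using exp_ge_add_one_self[of "(1 + b i) / (1 + s) - 1"] by simp
    then have "(1 + s) * ((1 + b i) / (1 + s)) \<le> (1 + s) * exp ((1 + b i) / (1 + s) - 1)"
      using assms(3) by (intro mult_left_mono) auto
    then show "1 + b i \<le> (1 + s) * exp ((1 + b i) / (1 + s) - 1)" using assms(3) by simp
  qed
  also have "\<dots> = (1 + s) ^ n * exp (\<Sum>i<n. (1 + b i) / (1 + s) - 1)"
    by (simp add: prod.distrib exp_sum)
  also have "\<dots> \<le> (1 + s) ^ n * exp 0"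
  proof (intro mult_left_mono)
    have "(\<Sum>i<n. (1 + b i) / (1 + s) - 1) = (real n + (\<Sum>i<n. b i)) / (1 + s) - real n"
      by (simp add: sum_subtractf sum_divide_distrib[symmetric] sum.distrib)
    also have "\<dots> \<le> (real n + real n * s) / (1 + s) - real n"
      using assms by (intro diff_mono divide_right_mono) auto
    also have "\<dots> = real n * (1 + s) / (1 + s) - real n" by (simp add: algebra_simps)
    also have "\<dots> = 0" using assms(3) by simp
    finally show "exp (\<Sum>i<n. (1 + b i) / (1 + s) - 1) \<le> exp 0" by simp
  qed (use assms(3) in auto)
  finally show ?thesis by simp
qed

text \<open>Two outputs are far apart only if the signals are, or if one of the noise values is
  large. Quantitatively, \<open>1 + (p + q)\<^sup>2 \<le> 2 * ((1 + p\<^sup>2) * (1 +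
  q\<^sup>2))\<close> is used twice, whence the 4. Because \<open>a \<le> 1\<close>, the noise
  factors enter with power at most one, and this is exactly what \<open>heavy_density\<close>
  absorbs.\<close>

lemma slot_domination:
  fixes a z z' y y' s s' d e :: real
  assumes a: "0 \<le> a" "a \<le> 1" and d: "0 \<le> d" and e: "0 \<le> e" and s: "(s - s')\<^sup>2 \<le> e * d"
    and z: "z = y - s" "z' = y' - s'"
  shows "std_normal_density z * std_normal_density z' * (1 + d) powr (-a)
     \<le> 4 * (1 + e) * (1 + (y - y')\<^sup>2) powr (-a) * (heavy_density z * heavy_density z')"
proof -
  let ?F = "4 * (1 + e) * (1 + z\<^sup>2) * (1 + z'\<^sup>2)"
  have sq: "1 + (p + q)\<^sup>2 \<le> 2 * ((1 + p\<^sup>2) * (1 + q\<^sup>2))" for p q :: real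
  proof -
    have "(p + q)\<^sup>2 \<le> 2 * (p\<^sup>2 + q\<^sup>2)" using sum_squares_bound[of p q] by (simp add: power2_sum)
    moreover have pq: "0 \<le> p\<^sup>2 * q\<^sup>2" by simp
    ultimately have "1 + (p + q)\<^sup>2 \<le> 2 + 2 * p\<^sup>2 + 2 * q\<^sup>2 + 2 * (p\<^sup>2 * q\<^sup>2)"
      using pq unfolding distrib_left by linarith
    moreover have "2 * ((1 + p\<^sup>2) * (1 + q\<^sup>2)) = 2 + 2 * p\<^sup>2 + 2 * q\<^sup>2 + 2 * (p\<^sup>2 * q\<^sup>2)"
      by (simp add: algebra_simps)
    ultimately show ?thesis by (simp only:)
  qed
  have zz: "1 + (z - z')\<^sup>2 \<le> 2 * ((1 + z\<^sup>2) * (1 + z'\<^sup>2))" using sq[of z "- z'"] by simp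
  have ss: "1 + (s - s')\<^sup>2 \<le> (1 + e) * (1 + d)"
  proof -
    have "1 + (s - s')\<^sup>2 \<le> 1 + e * d" using s by simp
    also have "\<dots> \<le> (1 + e) * (1 + d)" using d e by (simp add: algebra_simps)
    finally show ?thesis .
  qed
  have "1 + (y - y')\<^sup>2 = 1 + ((s - s') + (z - z'))\<^sup>2" by (simp add: z)
  also have "\<dots> \<le> 2 * ((1 + (s - s')\<^sup>2) * (1 + (z - z')\<^sup>2))" by (rule sq)
  also have "\<dots> \<le> 2 * (((1 + e) * (1 + d)) * (2 * ((1 + z\<^sup>2) * (1 + z'\<^sup>2))))"
    using ss zz d e by (intro mult_left_mono mult_mono) auto
  also have "\<dots> = ?F * (1 + d)" by (simp add: algebra_simps)
  finally have le: "1 + (y - y')\<^sup>2 \<le> ?F * (1 + d)" .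
  have F1: "1 \<le> ?F"
  proof -
    have "1 * 1 * 1 \<le> (4 * (1 + e)) * (1 + z\<^sup>2) * (1 + z'\<^sup>2)"
      using e by (intro mult_mono) auto
    then show ?thesis by simp
  qed
  have "(1 + (y - y')\<^sup>2) powr a \<le> (?F * (1 + d)) powr a"
    using le a by (intro powr_mono2) auto
  also have "\<dots> = ?F powr a * (1 + d) powr a"
    by (rule powr_mult)
  also have "\<dots> \<le> ?F powr 1 * (1 + d) powr a"
    using F1 a by (intro mult_right_mono powr_mono) auto
  finally have "(1 + (y - y')\<^sup>2) powr a \<le> ?F * (1 + d) powr a" using F1 by simp
  moreover have "p \<le> F * q \<Longrightarrow> inverse q \<le> F * inverse p" if "0 < p" "0 < q" for p q F :: real
    using that by (simp add: field_simps)
  moreover have "0 < (1 + (y - y')\<^sup>2) powr a" "0 < (1 + d) powr a"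
    using d zero_le_power2[of "y - y'"] by (simp_all only: powr_gt_zero)
  ultimately have "(1 + d) powr (-a) \<le> ?F * (1 + (y - y')\<^sup>2) powr (-a)"
    unfolding powr_minus by blast
  then have "std_normal_density z * std_normal_density z' * (1 + d) powr (-a)
     \<le> std_normal_density z * std_normal_density z' * (?F * (1 + (y - y')\<^sup>2) powr (-a))"
    by (intro mult_left_mono) auto
  also have "\<dots> = 4 * (1 + e) * (1 + (y - y')\<^sup>2) powr (-a) * (heavy_density z * heavy_density z')"
    by (simp add: heavy_density_def mult_ac)
  finally show ?thesis .
qed

lemma gRecv_prod:
  assumes "\<And>t. t < n \<Longrightarrow> h t \<in> borel_measurable borel"
  shows "(\<integral>\<^sup>+y. (\<Prod>t<n. h t (y t)) \<partial>gRecv n) = (\<Prod>t<n. \<integral>\<^sup>+v. h t v \<partial>lborel)"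
proof -
  interpret L: product_sigma_finite "\<lambda>i::nat. lborel :: real measure" ..
  show ?thesis unfolding gRecv_def using assms by (intro L.product_nn_integral_prod) auto
qed

lemma gkernel_heavy_overlap:
  "(\<integral>\<^sup>+y. gkernel heavy_density n B k g y x * gkernel heavy_density n B k g y x' \<partial>gRecv n)
    = (\<Prod>t<n. overlap (\<Sum>j\<in>{1..B}. g (t, k, j) * (x (t, j) - x' (t, j))))"
proof -
  have "(\<integral>\<^sup>+y. gkernel heavy_density n B k g y x * gkernel heavy_density n B k g y x' \<partial>gRecv n)
    = (\<integral>\<^sup>+y. (\<Prod>t<n. ennreal (heavy_density (y t - gsig B k g x t)) * ennreal (heavy_density (y t - gsig B k g x' t))) \<partial>gRecv n)"
    by (simp add: gkernel_def prod.distrib)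
  also have "\<dots> = (\<Prod>t<n. \<integral>\<^sup>+v. ennreal (heavy_density (v - gsig B k g x t)) * ennreal (heavy_density (v - gsig B k g x' t)) \<partial>lborel)"
    by (rule gRecv_prod) measurable
  also have "\<dots> = (\<Prod>t<n. overlap (gsig B k g x t - gsig B k g x' t))"
    by (simp add: overlap_shift)
  also have "\<dots> = (\<Prod>t<n. overlap (\<Sum>j\<in>{1..B}. g (t, k, j) * (x (t, j) - x' (t, j))))"
    by (simp add: gsig_def sum_subtractf[symmetric] right_diff_distrib)
  finally show ?thesis .
qed

text \<open>In every slot the gain of one selected connected transmitter is integrated in the inner
  integral while all other gains are frozen. The selected gains are independent over the slots, so
  the product of overlaps factorises.\<close>

lemma gGain_overlap_prod_le:
  assumes adm: "admissible_density f c" and k: "k \<in> {1..K}"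
    and jj: "\<And>t. t < n \<Longrightarrow> jj t \<in> {1..B} \<and> M k (jj t)"
    and b: "\<And>t v. t < n \<Longrightarrow> (\<integral>\<^sup>+g. ennreal (f g) * overlap (g * \<Delta> t (jj t) + v) \<partial>lborel) \<le> b t"
  shows "(\<integral>\<^sup>+g. (\<Prod>t<n. overlap (\<Sum>j\<in>{1..B}. g (t, k, j) * \<Delta> t j)) \<partial>gGain M K B n f) \<le> (\<Prod>t<n. b t)"
proof -
  let ?Mm = "\<lambda>p. case p of (t::nat, k, j) \<Rightarrow> if M k j then density lborel (\<lambda>x. ennreal (f x)) else return borel 0"
  define J where "J = (\<lambda>t. (t, k, jj t)) ` {..<n}"
  define I where "I = gain_idx n K B - J"
  have IJ: "I \<union> J = gain_idx n K B" "I \<inter> J = {}" "finite I" "finite J"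
    using jj k by (auto simp: I_def J_def)
  have ps: "prob_space (?Mm p)" for p
    using prob_space_density_f[OF adm] by (auto split: prod.splits intro: prob_space_return)
  interpret P: product_prob_space ?Mm "I" by (intro product_prob_spaceI ps)
  have fm[measurable]: "f \<in> borel_measurable borel" using adm by (simp add: admissible_density_def)
  have setsI: "sets (PiM I' ?Mm) = sets (PiM I' (\<lambda>_. borel))" for I'
    by (intro sets_PiM_cong) (auto split: prod.splits)
  let ?h = "\<lambda>g. \<Prod>t<n. overlap (\<Sum>j\<in>{1..B}. g (t, k, j) * \<Delta> t j)"
  have hm: "?h \<in> borel_measurable (PiM (I \<union> J) ?Mm)"
  proof (intro borel_measurable_prod_ennreal)
    fix t assume t: "t \<in> {..<n}"
    have [measurable]: "(\<lambda>g. g (t, k, j)) \<in> borel_measurable (PiM (I \<union> J) ?Mm)" if "j \<in> {1..B}" for j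
      unfolding measurable_cong_sets[OF setsI refl]
      by (rule measurable_component_singleton) (use t that k IJ(1) in auto)
    show "(\<lambda>g. overlap (\<Sum>j\<in>{1..B}. g (t, k, j) * \<Delta> t j)) \<in> borel_measurable (PiM (I \<union> J) ?Mm)"
      by measurable
  qed
  have "(\<integral>\<^sup>+g. ?h g \<partial>gGain M K B n f) = integral\<^sup>N (PiM (I \<union> J) ?Mm) ?h"
    by (simp add: gGain_def IJ(1))
  also have "\<dots> = (\<integral>\<^sup>+x. \<integral>\<^sup>+y. ?h (merge I J (x, y)) \<partial>PiM J ?Mm \<partial>PiM I ?Mm)"
    by (rule P.product_nn_integral_fold) (use IJ hm in auto)
  also have "\<dots> \<le> (\<integral>\<^sup>+x. (\<Prod>t<n. b t) \<partial>PiM I ?Mm)"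
  proof (intro nn_integral_mono)
    fix x
    define v where "v = (\<lambda>t. \<Sum>j\<in>{1..B} - {jj t}. x (t, k, j) * \<Delta> t j)"
    define G where "G = (\<lambda>(t, k::nat, j) w. overlap (w * \<Delta> t j + v t))"
    have "?h (merge I J (x, y)) = (\<Prod>p\<in>J. G p (y p))" for y
    proof -
      have "?h (merge I J (x, y)) = (\<Prod>t<n. G (t, k, jj t) (y (t, k, jj t)))"
      proof (intro prod.cong refl)
        fix t assume t: "t \<in> {..<n}"
        have "(\<Sum>j\<in>{1..B}. merge I J (x, y) (t, k, j) * \<Delta> t j)
           = merge I J (x, y) (t, k, jj t) * \<Delta> t (jj t) + (\<Sum>j\<in>{1..B} - {jj t}. merge I J (x, y) (t, k, j) * \<Delta> t j)"
          using jj[of t] t by (intro sum.remove) auto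
        also have "merge I J (x, y) (t, k, jj t) = y (t, k, jj t)"
          using t IJ(2) by (auto simp: merge_def J_def)
        also have "(\<Sum>j\<in>{1..B} - {jj t}. merge I J (x, y) (t, k, j) * \<Delta> t j) = v t"
          unfolding v_def using t k by (intro sum.cong refl) (auto simp: merge_def I_def J_def)
        finally show "overlap (\<Sum>j\<in>{1..B}. merge I J (x, y) (t, k, j) * \<Delta> t j) = G (t, k, jj t) (y (t, k, jj t))"
          by (simp add: G_def)
      qed
      also have "\<dots> = (\<Prod>p\<in>J. G p (y p))"
        unfolding J_def by (subst prod.reindex) (auto simp: inj_on_def)
      finally show ?thesis .
    qed
    then have "(\<integral>\<^sup>+y. ?h (merge I J (x, y)) \<partial>PiM J ?Mm) = (\<integral>\<^sup>+y. (\<Prod>p\<in>J. G p (y p)) \<partial>PiM J ?Mm)"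
      by simp
    also have "\<dots> = (\<Prod>p\<in>J. integral\<^sup>N (?Mm p) (G p))"
      by (rule P.product_nn_integral_prod) (auto simp: IJ G_def split: prod.splits)
    also have "\<dots> = (\<Prod>t<n. integral\<^sup>N (?Mm (t, k, jj t)) (G (t, k, jj t)))"
      unfolding J_def by (subst prod.reindex) (auto simp: inj_on_def)
    also have "\<dots> = (\<Prod>t<n. \<integral>\<^sup>+g. ennreal (f g) * overlap (g * \<Delta> t (jj t) + v t) \<partial>lborel)"
      using jj by (intro prod.cong refl) (auto simp: G_def nn_integral_density)
    also have "\<dots> \<le> (\<Prod>t<n. b t)"
      by (intro prod_mono_ennreal b) auto
    finally show "(\<integral>\<^sup>+y. ?h (merge I J (x, y)) \<partial>PiM J ?Mm) \<le> (\<Prod>t<n. b t)" .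
  qed
  also have "\<dots> = (\<Prod>t<n. b t)" by (simp add: prob_space.emeasure_space_1[OF prob_space_PiM[OF ps]])
  finally show ?thesis .
qed

section \<open>The correlation kernel of Gaussian inputs\<close>

definition gdsq :: "nat \<Rightarrow> nat set \<Rightarrow> (nat \<times> nat \<Rightarrow> real) \<Rightarrow> (nat \<times> nat \<Rightarrow> real) \<Rightarrow> nat \<Rightarrow> real" where
  "gdsq B T x x' t = (\<Sum>j\<in>T \<inter> {1..B}. (x (t, j) - x' (t, j))\<^sup>2)"

text \<open>The exponent \<open>1/2\<close> would match the averaged overlaps exactly; a larger
  \<open>a\<close> makes the corresponding kernel on outputs integrable. A set \<open>T\<close> that
  is larger sees more differences and gives a smaller kernel.\<close>

definition gcorr :: "nat \<Rightarrow> nat \<Rightarrow> real \<Rightarrow> nat set \<Rightarrow> (nat \<times> nat \<Rightarrow> real) \<Rightarrow> (nat \<times> nat \<Rightarrow> real) \<Rightarrow> ennreal" where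
  "gcorr n B a T x x' = (\<Prod>t<n. ennreal ((1 + gdsq B T x x' t) powr (-a)))"

lemma gdsq_nonneg[simp]: "0 \<le> gdsq B T x x' t"
  by (auto simp: gdsq_def intro!: sum_nonneg)

lemma gdsq_mono: "T \<subseteq> T' \<Longrightarrow> gdsq B T x x' t \<le> gdsq B T' x x' t"
  unfolding gdsq_def by (intro sum_mono2) auto

text \<open>In each slot the gain of the connected transmitter with the largest difference does the
  work, because it carries at least the fraction \<open>1/B\<close> of the squared distance. In the
  constant, 4 covers small distances and \<open>8 * fm * real B\<close> the large ones.\<close>

lemma gGain_average_slots:
  assumes adm: "admissible_density f c" and k: "k \<in> {1..K}"
    and ne: "\<exists>j\<in>{1..B}. M k j" and fm: "\<And>x. f x \<le> fm" "0 \<le> fm"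
  shows "(\<integral>\<^sup>+g. \<integral>\<^sup>+y. gkernel heavy_density n B k g y x * gkernel heavy_density n B k g y x' \<partial>gRecv n \<partial>gGain M K B n f)
    \<le> (\<Prod>t<n. ennreal ((4 + 8 * fm * real B) * (1 + gdsq B {j. M k j} x x' t) powr (- 1 / 2)))"
proof -
  define S where "S = {j. M k j} \<inter> {1..B}"
  define \<Delta> where "\<Delta> = (\<lambda>t j. x (t, j) - x' (t, j))"
  let ?d = "\<lambda>t. gdsq B {j. M k j} x x' t"
  let ?C = "4 + 8 * fm * real B"
  have S: "finite S" "S \<noteq> {}" using ne by (auto simp: S_def)
  have B: "1 \<le> B" using ne by auto
  have C: "4 \<le> ?C" using fm by simp
  have [measurable]: "f \<in> borel_measurable borel" and f1: "(\<integral>\<^sup>+x. ennreal (f x) \<partial>lborel) = 1"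
    using adm by (auto simp: admissible_density_def)
  have "\<exists>j\<in>S. (\<Delta> t j)\<^sup>2 = Max ((\<lambda>j. (\<Delta> t j)\<^sup>2) ` S)" for t
    using S Max_in[of "(\<lambda>j. (\<Delta> t j)\<^sup>2) ` S"] by fastforce
  then obtain jj where jj: "\<And>t. jj t \<in> S" "\<And>t. (\<Delta> t (jj t))\<^sup>2 = Max ((\<lambda>j. (\<Delta> t j)\<^sup>2) ` S)"
    by metis
  have d_le: "?d t \<le> real B * (\<Delta> t (jj t))\<^sup>2" for t
  proof -
    have "(\<Delta> t j)\<^sup>2 \<le> (\<Delta> t (jj t))\<^sup>2" if "j \<in> S" for j
      unfolding jj(2) using S that by (intro Max_ge) auto
    then have "?d t \<le> (\<Sum>j\<in>S. (\<Delta> t (jj t))\<^sup>2)"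
      unfolding gdsq_def S_def[symmetric] \<Delta>_def by (intro sum_mono)
    also have "\<dots> = real (card S) * (\<Delta> t (jj t))\<^sup>2" by simp
    also have "\<dots> \<le> real B * (\<Delta> t (jj t))\<^sup>2"
      using card_mono[of "{1..B}" S] by (intro mult_right_mono) (auto simp: S_def)
    finally show ?thesis .
  qed
  \<comment> \<open>For \<open>?d t \<le> 1\<close> the trivial bound 2 on the overlap suffices,
    since the root of \<open>1 + ?d t\<close> is at most 2. Otherwise \<open>sqrt (1 + ?d t)\<close>
    is at most \<open>2 * B\<close> times the largest difference, which is what the density bound
    divides by.\<close>
  have bound: "(\<integral>\<^sup>+g. ennreal (f g) * overlap (g * \<Delta> t (jj t) + v) \<partial>lborel) \<le> ennreal (?C * (1 + ?d t) powr (- 1 / 2))" for t v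
  proof (cases "?d t \<le> 1")
    case True
    have "(\<integral>\<^sup>+g. ennreal (f g) * overlap (g * \<Delta> t (jj t) + v) \<partial>lborel) \<le> (\<integral>\<^sup>+g. ennreal (f g) * 2 \<partial>lborel)"
      by (intro nn_integral_mono mult_left_mono overlap_le_2) auto
    also have "\<dots> = ennreal 2" by (simp add: nn_integral_multc f1)
    also have "\<dots> \<le> ennreal (?C * (1 + ?d t) powr (- 1 / 2))"
    proof (rule ennreal_leI)
      have "(1 + ?d t) powr (1 / 2) \<le> 4 powr (1 / 2)"
        using True by (intro powr_mono2) auto
      also have "(4::real) powr (1/2) = 2" by (simp add: powr_half_sqrt)
      finally have le2: "(1 + ?d t) powr (1 / 2) \<le> 2" .
      have "2 * (1 + ?d t) powr (1 / 2) \<le> ?C" using le2 C by linarith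
      moreover have "0 < (1 + ?d t) powr (1/2)" using gdsq_nonneg[of B "{j. M k j}" x x' t] by (intro powr_gt_zero[THEN iffD2]) linarith
      ultimately show "2 \<le> ?C * (1 + ?d t) powr (- 1 / 2)"
        by (simp add: powr_minus_divide field_simps)
    qed
    finally show ?thesis .
  next
    case False
    then have D: "0 < real B * (\<Delta> t (jj t))\<^sup>2" using d_le[of t] by linarith
    then have nz: "\<Delta> t (jj t) \<noteq> 0" by auto
    have "(\<integral>\<^sup>+g. ennreal (f g) * overlap (g * \<Delta> t (jj t) + v) \<partial>lborel) \<le> ennreal (4 * fm / \<bar>\<Delta> t (jj t)\<bar>)"
      by (rule overlap_density_le) (use fm nz in auto)
    also have "\<dots> \<le> ennreal (?C * (1 + ?d t) powr (- 1 / 2))"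
    proof (rule ennreal_leI)
      have "1 + ?d t \<le> 2 * (real B * (\<Delta> t (jj t))\<^sup>2)" using False d_le[of t] by linarith
      also have "\<dots> \<le> (2 * real B * \<bar>\<Delta> t (jj t)\<bar>)\<^sup>2"
      proof -
        have "2 * real B \<le> (2 * real B)\<^sup>2" using B by (simp add: power2_eq_square)
        then have "2 * real B * (\<Delta> t (jj t))\<^sup>2 \<le> (2 * real B)\<^sup>2 * (\<Delta> t (jj t))\<^sup>2" by (rule mult_right_mono) auto
        then show ?thesis by (simp add: power_mult_distrib mult_ac)
      qed
      finally have "sqrt (1 + ?d t) \<le> sqrt ((2 * real B * \<bar>\<Delta> t (jj t)\<bar>)\<^sup>2)" by (rule real_sqrt_le_mono)
      then have sq: "sqrt (1 + ?d t) \<le> 2 * real B * \<bar>\<Delta> t (jj t)\<bar>" by (simp add: abs_mult)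
      have pos: "0 < sqrt (1 + ?d t)" using False by simp
      have "4 * fm * sqrt (1 + ?d t) \<le> 4 * fm * (2 * real B * \<bar>\<Delta> t (jj t)\<bar>)"
        using sq fm by (intro mult_left_mono) auto
      also have "\<dots> \<le> ?C * \<bar>\<Delta> t (jj t)\<bar>" by (simp add: algebra_simps)
      finally have "4 * fm / \<bar>\<Delta> t (jj t)\<bar> \<le> ?C / sqrt (1 + ?d t)"
        using nz pos by (simp add: field_simps)
      then show "4 * fm / \<bar>\<Delta> t (jj t)\<bar> \<le> ?C * (1 + ?d t) powr (- 1 / 2)"
        using False by (simp add: powr_minus_divide powr_half_sqrt)
    qed
    finally show ?thesis .
  qed
  have "(\<integral>\<^sup>+g. \<integral>\<^sup>+y. gkernel heavy_density n B k g y x * gkernel heavy_density n B k g y x' \<partial>gRecv n \<partial>gGain M K B n f)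
    = (\<integral>\<^sup>+g. (\<Prod>t<n. overlap (\<Sum>j\<in>{1..B}. g (t, k, j) * \<Delta> t j)) \<partial>gGain M K B n f)"
    by (simp add: gkernel_heavy_overlap \<Delta>_def)
  also have "\<dots> \<le> (\<Prod>t<n. ennreal (?C * (1 + ?d t) powr (- 1 / 2)))"
    by (rule gGain_overlap_prod_le[OF adm k, where jj=jj]) (use jj(1) bound in \<open>auto simp: S_def\<close>)
  finally show ?thesis .
qed

text \<open>The parallelogram bound
  \<open>(u - v)\<^sup>2 \<le> 2 * u\<^sup>2 + 2 * v\<^sup>2\<close> limits the sum of the distances
  by \<open>4 * P\<close> per slot, and the product is largest when they are equal.\<close>

lemma prod_gdsq_le:
  assumes "gpow n B x \<le> P" "gpow n B x' \<le> P" "0 \<le> P" "0 < n"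
  shows "(\<Prod>t<n. 1 + gdsq B T x x' t) \<le> (1 + 4 * P) ^ n"
proof (rule prod_one_plus_le)
  have sq: "(u - v)\<^sup>2 \<le> 2 * u\<^sup>2 + 2 * v\<^sup>2" for u v :: real
    using zero_le_power2[of "u + v"] by (simp add: power2_diff power2_sum)
  have "(\<Sum>t<n. gdsq B T x x' t) \<le> (\<Sum>t<n. \<Sum>j\<in>{1..B}. (x (t, j) - x' (t, j))\<^sup>2)"
    unfolding gdsq_def by (intro sum_mono sum_mono2) auto
  also have "\<dots> \<le> (\<Sum>t<n. \<Sum>j\<in>{1..B}. 2 * (x (t, j))\<^sup>2 + 2 * (x' (t, j))\<^sup>2)"
    by (intro sum_mono sq)
  also have "\<dots> = real n * (2 * gpow n B x + 2 * gpow n B x')"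
    using assms(4) by (simp add: gpow_def sum.distrib sum_distrib_left[symmetric] field_simps)
  also have "\<dots> \<le> real n * (4 * P)"
    using assms by (intro mult_left_mono) auto
  finally show "(\<Sum>t<n. gdsq B T x x' t) \<le> real n * (4 * P)" .
qed (use assms in auto)

lemma prod_powr_gdsq:
  "(\<Prod>t<n. (1 + gdsq B T x x' t) powr r) = (\<Prod>t<n. 1 + gdsq B T x x' t) powr r"
  by (rule prod_powr_distrib[symmetric])

text \<open>Passing from decay \<open>1/2\<close> to decay \<open>a\<close> costs the product of the
  \<open>1 + d\<close> to the power \<open>a - 1/2\<close>, which is bounded on inputs of limited
  power. This is the only way in which \<open>P\<close> enters the constant \<open>C\<close> of the
  chain.\<close>

lemma gGain_average:
  assumes adm: "admissible_density f c" and k: "k \<in> {1..K}"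
    and ne: "\<exists>j\<in>{1..B}. M k j" and fm: "\<And>x. f x \<le> fm" "0 \<le> fm"
    and x: "gpow n B x \<le> P" "gpow n B x' \<le> P" "0 \<le> P" "0 < n" and a: "1 / 2 \<le> a"
  shows "(\<integral>\<^sup>+g. \<integral>\<^sup>+y. gkernel heavy_density n B k g y x * gkernel heavy_density n B k g y x' \<partial>gRecv n \<partial>gGain M K B n f)
    \<le> ennreal (((4 + 8 * fm * real B) * (1 + 4 * P) powr (a - 1/2)) ^ n) * gcorr n B a {j. M k j} x x'"
proof -
  let ?d = "\<lambda>t. 1 + gdsq B {j. M k j} x x' t" and ?C = "4 + 8 * fm * real B"
  have pos: "0 < ?d t" for t by (simp add: add_pos_nonneg)
  have pp: "0 < (\<Prod>t<n. ?d t)" by (intro prod_pos) (use pos in auto)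
  note gGain_average_slots[where M=M and k=k and n=n and x=x and x'=x', OF adm k ne fm]
  also have "(\<Prod>t<n. ennreal (?C * ?d t powr (- 1 / 2))) = ennreal (\<Prod>t<n. ?C * ?d t powr (- 1 / 2))"
    using fm by (intro prod_ennreal) auto
  also have "(\<Prod>t<n. ?C * ?d t powr (- 1 / 2)) = ?C ^ n * ((\<Prod>t<n. ?d t) powr (a - 1/2) * (\<Prod>t<n. ?d t) powr (- a))"
    using pp by (simp add: prod.distrib prod_powr_gdsq powr_add[symmetric])
  also have "\<dots> \<le> ?C ^ n * (((1 + 4 * P) ^ n) powr (a - 1/2) * (\<Prod>t<n. ?d t) powr (- a))"
    using prod_gdsq_le[OF x, of "{j. M k j}"] pp fm a
    by (intro mult_left_mono mult_right_mono powr_mono2) auto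
  also have "\<dots> = (?C * (1 + 4 * P) powr (a - 1/2)) ^ n * (\<Prod>t<n. ?d t) powr (- a)"
    using x(3) by (simp add: power_mult_distrib powr_realpow[symmetric] powr_powr powr_gt_zero mult_ac)
  also have "ennreal \<dots> = ennreal ((?C * (1 + 4 * P) powr (a - 1/2)) ^ n) * gcorr n B a {j. M k j} x x'"
    using fm by (simp add: gcorr_def prod_ennreal prod_powr_gdsq ennreal_mult)
  finally show ?thesis by (simp add: ennreal_leI)
qed

text \<open>Inputs of limited power cannot be far apart in too many slots. For \<open>a\<close> near
  \<open>1/2\<close> the factor is about the square root of \<open>P\<close> per use: the cost of
  one whole receiver.\<close>

lemma gcorr_lower:
  assumes x: "gpow n B x \<le> P" "gpow n B x' \<le> P" "0 \<le> P" "0 < n" and a: "0 \<le> a"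
  shows "1 \<le> ennreal (((1 + 4 * P) powr a) ^ n) * gcorr n B a T x x'"
proof -
  let ?p = "\<Prod>t<n. 1 + gdsq B T x x' t"
  have pp: "0 < ?p" by (intro prod_pos) (simp add: add_pos_nonneg)
  have "?p powr a \<le> ((1 + 4 * P) ^ n) powr a"
    using prod_gdsq_le[OF x, of T] pp a by (intro powr_mono2) auto
  also have "\<dots> = ((1 + 4 * P) powr a) ^ n"
    using x(3) by (simp add: powr_realpow[symmetric] powr_powr powr_gt_zero mult_ac)
  finally have le: "?p powr a \<le> ((1 + 4 * P) powr a) ^ n" .
  have "1 = v powr a * v powr (- a)" if "0 < v" for v :: real
    using that by (simp add: powr_add[symmetric])
  from this[OF pp] have "1 = ?p powr a * ?p powr (- a)" .
  also have "\<dots> \<le> ((1 + 4 * P) powr a) ^ n * ?p powr (- a)" using le by (rule mult_right_mono) auto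
  finally have "1 \<le> ((1 + 4 * P) powr a) ^ n * ?p powr (- a)" .
  then have "ennreal 1 \<le> ennreal (((1 + 4 * P) powr a) ^ n * ?p powr (- a))" by (rule ennreal_leI)
  then show ?thesis by (simp add: gcorr_def prod_ennreal prod_powr_gdsq ennreal_mult)
qed

lemma gcorr_anti: "T \<subseteq> T' \<Longrightarrow> 0 \<le> a \<Longrightarrow> gcorr n B a T' x x' \<le> gcorr n B a T x x'"
  unfolding gcorr_def
  by (intro prod_mono_ennreal ennreal_leI powr_mono2') (auto simp: gdsq_mono add_pos_nonneg)

lemma gcorr_le_1: "0 \<le> a \<Longrightarrow> gcorr n B a T x x' \<le> 1"
  unfolding gcorr_def prod_ennreal[OF powr_ge_zero] prod_powr_gdsq
  by (simp add: powr_minus inverse_le_1_iff ge_one_powr_ge_zero prod_ge_1)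

text \<open>Slot by slot this is \<open>slot_domination\<close> with
  \<open>e = c\<^sup>2 * real B\<close>: Cauchy-Schwarz bounds the difference of the two received
  signals by the gains, each at most \<open>c\<close>, and the squared distance over the connected
  transmitters.\<close>

lemma gkernel_domination:
  assumes g: "\<And>t j. t < n \<Longrightarrow> j \<in> {1..B} \<Longrightarrow> \<bar>g (t, k, j)\<bar> \<le> c"
      "\<And>t j. t < n \<Longrightarrow> j \<in> {1..B} \<Longrightarrow> \<not> M k j \<Longrightarrow> g (t, k, j) = 0"
    and a: "0 \<le> a" "a \<le> 1"
  shows "gkernel std_normal_density n B k g y x * gkernel std_normal_density n B k g y' x' * gcorr n B a {j. M k j} x x'
    \<le> (\<Prod>t<n. ennreal (4 * (1 + c\<^sup>2 * real B) * (1 + (y t - y' t)\<^sup>2) powr (-a)))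
       * (gkernel heavy_density n B k g y x * gkernel heavy_density n B k g y' x')"
proof -
  let ?S = "{j. M k j} \<inter> {1..B}"
  have "gkernel std_normal_density n B k g y x * gkernel std_normal_density n B k g y' x' * gcorr n B a {j. M k j} x x'
     = (\<Prod>t<n. ennreal (std_normal_density (y t - gsig B k g x t) * std_normal_density (y' t - gsig B k g x' t)
          * (1 + gdsq B {j. M k j} x x' t) powr (-a)))"
    by (simp add: gkernel_def gcorr_def prod.distrib[symmetric] ennreal_mult)
  also have "\<dots> \<le> (\<Prod>t<n. ennreal (4 * (1 + c\<^sup>2 * real B) * (1 + (y t - y' t)\<^sup>2) powr (-a)
       * (heavy_density (y t - gsig B k g x t) * heavy_density (y' t - gsig B k g x' t))))"
  proof (intro prod_mono_ennreal ennreal_leI slot_domination a)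
    fix t assume t: "t \<in> {..<n}"
    have "gsig B k g x t - gsig B k g x' t = (\<Sum>j\<in>{1..B}. g (t, k, j) * (x (t, j) - x' (t, j)))"
      by (simp add: gsig_def sum_subtractf[symmetric] right_diff_distrib)
    also have "\<dots> = (\<Sum>j\<in>?S. g (t, k, j) * (x (t, j) - x' (t, j)))"
      using t g(2)[of t] by (intro sum.mono_neutral_right) (auto, metis atLeastAtMost_iff One_nat_def)
    finally have "(gsig B k g x t - gsig B k g x' t)\<^sup>2 = (\<Sum>j\<in>?S. g (t, k, j) * (x (t, j) - x' (t, j)))\<^sup>2" by simp
    also have "\<dots> \<le> (\<Sum>j\<in>?S. (g (t, k, j))\<^sup>2) * (\<Sum>j\<in>?S. (x (t, j) - x' (t, j))\<^sup>2)"
      by (rule Cauchy_Schwarz_ineq_sum)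
    also have "\<dots> \<le> (c\<^sup>2 * real B) * (\<Sum>j\<in>?S. (x (t, j) - x' (t, j))\<^sup>2)"
    proof (intro mult_right_mono sum_nonneg)
      have "(\<Sum>j\<in>?S. (g (t, k, j))\<^sup>2) \<le> (\<Sum>j\<in>?S. c\<^sup>2)"
        using t g(1) by (intro sum_mono) (metis IntD2 abs_ge_zero lessThan_iff power2_abs power_mono)
      also have "\<dots> = c\<^sup>2 * real (card ?S)" by simp
      also have "\<dots> \<le> c\<^sup>2 * real B"
        using card_mono[of "{1..B}" ?S] by (intro mult_left_mono) auto
      finally show "(\<Sum>j\<in>?S. (g (t, k, j))\<^sup>2) \<le> c\<^sup>2 * real B" .
    qed auto
    finally show "(gsig B k g x t - gsig B k g x' t)\<^sup>2 \<le> c\<^sup>2 * real B * gdsq B {j. M k j} x x' t"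
      by (simp add: gdsq_def)
  qed auto
  also have "\<dots> = (\<Prod>t<n. ennreal (4 * (1 + c\<^sup>2 * real B) * (1 + (y t - y' t)\<^sup>2) powr (-a)))
       * (gkernel heavy_density n B k g y x * gkernel heavy_density n B k g y' x')"
    by (simp add: gkernel_def prod.distrib[symmetric] ennreal_mult)
  finally show ?thesis .
qed

section \<open>Classical converse for the Gaussian channel\<close>

lemma gcorr_Int[simp]: "gcorr n B a (T \<inter> {1..B}) = gcorr n B a T"
proof -
  have "T \<inter> {1..B} \<inter> {1..B} = T \<inter> {1..B}" by auto
  then show ?thesis by (simp add: gcorr_def gdsq_def fun_eq_iff del: One_nat_def)
qed

lemma measurable_gcorr[measurable]:
  "(\<lambda>(x, x'). gcorr n B a T x x') \<in> borel_measurable (gX n B \<Otimes>\<^sub>M gX n B)"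
  unfolding gcorr_def split_def
proof (intro borel_measurable_prod_ennreal)
  fix t assume t: "t \<in> {..<n}"
  let ?R = "gX n B \<Otimes>\<^sub>M gX n B"
  have a: "fst \<in> ?R \<rightarrow>\<^sub>M (\<Pi>\<^sub>M p\<in>{..<n} \<times> {1..B}. borel)" "snd \<in> ?R \<rightarrow>\<^sub>M (\<Pi>\<^sub>M p\<in>{..<n} \<times> {1..B}. borel)"
    unfolding gX_def[symmetric] by measurable
  have [measurable]: "(\<lambda>z. fst z (t, j)) \<in> borel_measurable ?R" "(\<lambda>z. snd z (t, j)) \<in> borel_measurable ?R"
    if "j \<in> T \<inter> {1..B}" for j
    using t that by (auto intro!: measurable_PiM_apply[OF a(1)] measurable_PiM_apply[OF a(2)])
  show "(\<lambda>z. ennreal ((1 + gdsq B T (fst z) (snd z) t) powr - a)) \<in> borel_measurable ?R"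
    unfolding gdsq_def by measurable
qed

lemma measurable_gpow[measurable]: "gpow n B \<in> borel_measurable (gX n B)"
  unfolding gpow_def[abs_def]
proof (intro borel_measurable_divide borel_measurable_sum borel_measurable_power)
  fix t j assume "t \<in> {..<n}" "j \<in> {1..B}"
  then show "(\<lambda>x. x (t, j)) \<in> borel_measurable (gX n B)"
    unfolding gX_def by (intro measurable_component_singleton) auto
qed auto

lemma gpow_nonneg[simp]: "0 \<le> gpow n B x"
  by (auto simp: gpow_def intro!: divide_nonneg_nonneg sum_nonneg)

lemma sum_pmf_le_1: "finite V \<Longrightarrow> (\<Sum>v\<in>V. ennreal (pmf p v)) \<le> 1"
  using measure_pmf.prob_le_1[of p V] by (simp add: sum_ennreal measure_measure_pmf_finite)

lemma gRecv_h_integral: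
  assumes C1: "0 \<le> C1"
  shows "(\<integral>\<^sup>+y'. (\<Prod>t<n. ennreal (C1 * (1 + (y t - y' t)\<^sup>2) powr (-a))) \<partial>gRecv n)
     = (ennreal C1 * (\<integral>\<^sup>+u. ennreal ((1 + u\<^sup>2) powr (-a)) \<partial>lborel)) ^ n"
proof -
  have "(\<integral>\<^sup>+y'. (\<Prod>t<n. ennreal (C1 * (1 + (y t - y' t)\<^sup>2) powr (-a))) \<partial>gRecv n)
     = (\<Prod>t<n. \<integral>\<^sup>+v. ennreal (C1 * (1 + (y t - v)\<^sup>2) powr (-a)) \<partial>lborel)"
    by (rule gRecv_prod) measurable
  also have "\<dots> = (\<Prod>t<n. ennreal C1 * (\<integral>\<^sup>+u. ennreal ((1 + u\<^sup>2) powr (-a)) \<partial>lborel))"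
  proof (intro prod.cong refl)
    fix t
    have "(\<integral>\<^sup>+v. ennreal (C1 * (1 + (y t - v)\<^sup>2) powr (-a)) \<partial>lborel)
       = ennreal C1 * (\<integral>\<^sup>+v. ennreal ((1 + (v - y t)\<^sup>2) powr (-a)) \<partial>lborel)"
      using C1 by (subst nn_integral_cmult[symmetric]) (auto simp: ennreal_mult power2_commute)
    also have "(\<integral>\<^sup>+v. ennreal ((1 + (v - y t)\<^sup>2) powr (-a)) \<partial>lborel) = (\<integral>\<^sup>+u. ennreal ((1 + u\<^sup>2) powr (-a)) \<partial>lborel)"
      using lborel_translate[of "\<lambda>u. ennreal ((1 + u\<^sup>2) powr (-a))" "- y t"] by simp
    finally show "(\<integral>\<^sup>+v. ennreal (C1 * (1 + (y t - v)\<^sup>2) powr (-a)) \<partial>lborel)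
       = ennreal C1 * (\<integral>\<^sup>+u. ennreal ((1 + u\<^sup>2) powr (-a)) \<partial>lborel)" .
  qed
  also have "\<dots> = (ennreal C1 * (\<integral>\<^sup>+u. ennreal ((1 + u\<^sup>2) powr (-a)) \<partial>lborel)) ^ n"
    by simp
  finally show ?thesis .
qed

text \<open>The row integral of the Schur kernel as a real number. It is meaningful for
  \<open>a > 1/2\<close>; for a divergent integral \<open>enn2real\<close> would return 0.\<close>

definition gtail :: "real \<Rightarrow> real" where
  "gtail a = enn2real (\<integral>\<^sup>+u. ennreal ((1 + u\<^sup>2) powr (-a)) \<partial>lborel)"

lemma gtail: "1 / 2 < a \<Longrightarrow> (\<integral>\<^sup>+u. ennreal ((1 + u\<^sup>2) powr (-a)) \<partial>lborel) = ennreal (gtail a)"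
  unfolding gtail_def using inv_powr_integral_finite[of a] by (simp add: less_top)

text \<open>The factor of size about \<open>P powr a\<close> stands outside the power
  \<open>length ks\<close>; each receiver adds only a constant and the power \<open>a - 1/2\<close>
  of \<open>1 + 16 * P\<close>. The number 16 arises as 4 from Markov's inequality for the power
  times 4 from the parallelogram bound.\<close>

lemma gauss_cl_converse:
  fixes B K :: nat
  assumes adm: "admissible_density f c"
    and fm: "\<And>x. f x \<le> fm" "0 \<le> fm"
    and a: "1 / 2 < a" "a \<le> 1" and P: "0 < P" and n: "0 < n"
    and ks: "distinct ks" "set ks \<subseteq> {1..K}"
      "sorted_wrt (\<lambda>k k'. {j\<in>{1..B}. M k j} \<subseteq> {j\<in>{1..B}. M k' j}) ks"
    and ne: "\<And>k. k \<in> {1..K} \<Longrightarrow> \<exists>j\<in>{1..B}. M k j"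
    and scheme: "g_cl_scheme K B n P m enc dec"
    and err: "(\<Sum>k\<in>set ks. g_cl_err M K B f n m enc dec k) \<le> 1 / 4"
  shows "(\<Prod>k\<in>set ks. real (m k)) \<le> 4 * ((1 + 16 * P) powr a *
     ((4 * (1 + c\<^sup>2 * real B) * gtail a) * ((4 + 8 * fm * real B) * (1 + 16 * P) powr (a - 1/2))) ^ length ks) ^ n"
proof -
  define W where "W = msg_set K m"
  define \<Gamma> where "\<Gamma> = gGain M K B n f"
  define p where "p = (\<lambda>k g y x. gkernel std_normal_density n B k g y x)"
  define q where "q = (\<lambda>k g y x. gkernel heavy_density n B k g y x)"
  define D where "D = (\<lambda>k g v y. ennreal (pmf (dec k (gmk n B k g y)) v))"
  define C1 where "C1 = 4 * (1 + c\<^sup>2 * real B)"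
  define h where "h = (\<lambda>y y' :: nat \<Rightarrow> real. \<Prod>t<n. ennreal (C1 * (1 + (y t - y' t)\<^sup>2) powr (-a)))"
  \<comment> \<open>Four times the admissible power, so that Markov's inequality leaves at most a
    quarter of the mass outside.\<close>
  define good where "good = {x. gpow n B x \<le> 4 * P}"
  define H where "H = ennreal ((C1 * gtail a) ^ n)"
  define C where "C = ennreal (((4 + 8 * fm * real B) * (1 + 16 * P) powr (a - 1/2)) ^ n)"
  define E where "E = ennreal (((1 + 16 * P) powr a) ^ n)"
  define S where "S = (\<lambda>k. {j\<in>{1..B}. M k j})"
  have S_eq: "S k = {j. M k j} \<inter> {1..B}" for k by (auto simp: S_def)
  have C1: "0 \<le> C1" by (simp add: C1_def)
  have gt0: "0 \<le> gtail a" by (simp add: gtail_def)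
  have m1: "\<forall>k\<in>{1..K}. 1 \<le> m k"
    and enc: "\<And>w. w \<in> W \<Longrightarrow> enc w \<in> space (prob_algebra (gX n B))"
    and dec: "\<And>k v. k \<in> {1..K} \<Longrightarrow> (\<lambda>ob. pmf (dec k ob) v) \<in> borel_measurable (gOM n B)"
    and pow: "(\<Sum>w\<in>W. \<integral>\<^sup>+x. ennreal (gpow n B x) \<partial>enc w) \<le> ennreal (P * real (card W))"
    using scheme by (auto simp: g_cl_scheme_def W_def)
  have sets_enc: "sets (enc w) = sets (gX n B)" and prob_enc: "prob_space (enc w)" if "w \<in> W" for w
    using enc[OF that] by (auto simp: space_prob_algebra)
  have space_enc: "space (enc w) = space (gX n B)" if "w \<in> W" for w
    using sets_eq_imp_space_eq[OF sets_enc[OF that]] .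
  have Dm: "(\<lambda>(g, y). D k g v y) \<in> borel_measurable (\<Gamma> \<Otimes>\<^sub>M gRecv n)" if k: "k \<in> {1..K}" for k v
  proof -
    have "(\<lambda>z. gmk n B k (fst z) (snd z)) \<in> \<Gamma> \<Otimes>\<^sub>M gRecv n \<rightarrow>\<^sub>M gOM n B"
      unfolding \<Gamma>_def by (rule measurable_gmk[OF k]) measurable
    from measurable_compose[OF this dec[OF k, of v]]
    show ?thesis unfolding D_def split_def by measurable
  qed
  interpret \<Gamma>: prob_space \<Gamma> unfolding \<Gamma>_def by (rule prob_space_gGain[OF adm])
  interpret chain: receiver_chain W enc "gX n B" "gRecv n" \<Gamma> p q D h "gcorr n B a" S good H C E "{1..K}"
  proof (rule receiver_chain.intro)
    show "finite W" by (simp add: W_def)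
    show "sigma_finite_measure (enc w)" if "w \<in> W" for w
      using prob_enc[OF that] by (simp add: prob_space_imp_sigma_finite)
    show "sets (enc w) = sets (gX n B)" if "w \<in> W" for w by (rule sets_enc[OF that])
    show "sigma_finite_measure (gRecv n)" by (rule sigma_finite_gRecv)
    show "prob_space \<Gamma>" by unfold_locales
    fix k assume k: "k \<in> {1..K}"
    show "(\<lambda>(g, y, x). p k g y x) \<in> borel_measurable (\<Gamma> \<Otimes>\<^sub>M gRecv n \<Otimes>\<^sub>M gX n B)"
      unfolding p_def split_def \<Gamma>_def by (rule measurable_gkernel[OF k]) measurable
    show "(\<lambda>(g, y, x). q k g y x) \<in> borel_measurable (\<Gamma> \<Otimes>\<^sub>M gRecv n \<Otimes>\<^sub>M gX n B)"
      unfolding q_def split_def \<Gamma>_def by (rule measurable_gkernel[OF k]) measurable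
    show "(\<lambda>(g, y). D k g v y) \<in> borel_measurable (\<Gamma> \<Otimes>\<^sub>M gRecv n)" for v by (rule Dm[OF k])
    show "(\<Sum>v\<in>V. D k g v y) \<le> 1" if "finite V" for g y V
      unfolding D_def by (rule sum_pmf_le_1[OF that])
    show "AE g in \<Gamma>. \<forall>x\<in>space (gX n B). \<forall>x'\<in>space (gX n B). \<forall>y\<in>space (gRecv n). \<forall>y'\<in>space (gRecv n).
        p k g y x * p k g y' x' * gcorr n B a (S k) x x' \<le> h y y' * (q k g y x * q k g y' x')"
      using AE_gGain_bound[OF adm, where M=M and K=K and B=B and n=n] unfolding \<Gamma>_def
    proof eventually_elim
      case (elim g)
      show ?case unfolding p_def q_def h_def C1_def S_eq gcorr_Int
      proof (intro ballI gkernel_domination)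
        fix t j assume "t < n" "j \<in> {1..B}"
        then have "(t, k, j) \<in> gain_idx n K B" using k by auto
        with elim show "\<bar>g (t, k, j)\<bar> \<le> c" "\<not> M k j \<Longrightarrow> g (t, k, j) = 0" by fastforce+
      qed (use a in auto)
    qed
    show "(\<integral>\<^sup>+g. \<integral>\<^sup>+y. q k g y x * q k g y x' \<partial>gRecv n \<partial>\<Gamma>) \<le> C * gcorr n B a (S k) x x'"
      if "x \<in> good \<inter> space (gX n B)" "x' \<in> good \<inter> space (gX n B)" for x x'
      unfolding q_def C_def S_eq gcorr_Int \<Gamma>_def
      using gGain_average[where f=f and M=M and fm=fm and n=n and x=x and x'=x' and P="4 * P" and a=a, OF adm k ne[OF k] fm]
        that P n a by (simp add: good_def)
  next
    show "(\<lambda>(y, y'). h y y') \<in> borel_measurable (gRecv n \<Otimes>\<^sub>M gRecv n)"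
      unfolding h_def split_def
    proof (intro borel_measurable_prod_ennreal)
      fix t assume t: "t \<in> {..<n}"
      have f: "fst \<in> gRecv n \<Otimes>\<^sub>M gRecv n \<rightarrow>\<^sub>M (\<Pi>\<^sub>M t\<in>{..<n}. borel)" "snd \<in> gRecv n \<Otimes>\<^sub>M gRecv n \<rightarrow>\<^sub>M (\<Pi>\<^sub>M t\<in>{..<n}. borel)"
        by measurable
      note [measurable] = measurable_PiM_apply[OF f(1) t] measurable_PiM_apply[OF f(2) t]
      show "(\<lambda>z. ennreal (C1 * (1 + (fst z t - snd z t)\<^sup>2) powr (-a))) \<in> borel_measurable (gRecv n \<Otimes>\<^sub>M gRecv n)"
        by measurable
    qed
    show "h y y' = h y' y" for y y' by (simp add: h_def power2_commute)
    show "(\<integral>\<^sup>+y'. h y y' \<partial>gRecv n) \<le> H" for y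
      unfolding h_def gRecv_h_integral[OF C1] gtail[OF a(1)] H_def
      using C1 gt0 by (simp add: ennreal_mult[symmetric] ennreal_power)
    show "gcorr n B a T' x x' \<le> gcorr n B a T x x'" if "T \<subseteq> T'" for T T' x x'
      using that a by (intro gcorr_anti) auto
    show "1 \<le> E * gcorr n B a T x x'" if "x \<in> good \<inter> space (gX n B)" "x' \<in> good \<inter> space (gX n B)" for T x x'
      unfolding E_def using gcorr_lower[of n B x "4 * P" x' a T] that P n a by (simp add: good_def)
    show "(\<lambda>(x, x'). gcorr n B a T x x') \<in> borel_measurable (gX n B \<Otimes>\<^sub>M gX n B)" for T
      by measurable
  qed
  define cc where "cc = (\<lambda>k (w :: nat \<Rightarrow> nat) x. \<integral>s. pmf (dec k (gobs n B x s k)) (w k) \<partial>gState M K B n f)"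
  interpret St: prob_space "gState M K B n f" by (rule prob_space_gState[OF adm])
  have meas_dec: "(\<lambda>s. pmf (dec k (gobs n B x s k)) v) \<in> borel_measurable (gState M K B n f)" if k: "k \<in> {1..K}" for k x v
    by (rule measurable_compose[OF measurable_gobs[OF k] dec[OF k]])
  have int_dec: "integrable (gState M K B n f) (\<lambda>s. pmf (dec k (gobs n B x s k)) v)" if k: "k \<in> {1..K}" for k x v
    by (rule St.integrable_const_bound[of _ 1]) (auto simp: pmf_le_1 meas_dec[OF k])
  have succ: "chain.succ k w x = ennreal (cc k w x)" if k: "k \<in> {1..K}" for k w x
  proof -
    have "ennreal (cc k w x) = (\<integral>\<^sup>+s. ennreal (pmf (dec k (gobs n B x s k)) (w k)) \<partial>gState M K B n f)"
      unfolding cc_def by (rule nn_integral_eq_integral[symmetric]) (auto simp: int_dec[OF k])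
    also have "\<dots> = chain.succ k w x"
      unfolding chain.succ_def chain.succ_cond_def unfolding p_def D_def \<Gamma>_def
      by (rule gobs_nn_integral[OF adm k]) (use dec[OF k] in measurable)
    finally show ?thesis by simp
  qed
  have "of_nat (\<Prod>k\<in>set ks. m k) \<le> 4 * (E * (H * C) ^ length ks)"
  proof (rule chain.chain_converse[where c=cc])
    show "W = msg_set K m" by (simp add: W_def)
    show "\<And>k. k \<in> {1..K} \<Longrightarrow> 1 \<le> m k" using m1 by auto
    show "\<And>w. w \<in> W \<Longrightarrow> prob_space (enc w)" by (rule prob_enc)
    show "distinct ks" "set ks \<subseteq> {1..K}" "{1..K} \<subseteq> {1..K}" "sorted_wrt (\<lambda>k k'. S k \<subseteq> S k') ks"
      using ks by (auto simp: S_def)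
    show "gcorr n B a {} x x' \<le> 1" for x x' using a by (intro gcorr_le_1) auto
    have "good \<inter> space (gX n B) = {x \<in> space (gX n B). gpow n B x \<le> 4 * P}" by (auto simp: good_def)
    then show gm: "good \<inter> space (gX n B) \<in> sets (gX n B)" by simp
    show "cc k w \<in> borel_measurable (gX n B)" if "k \<in> set ks" "w \<in> W" for k w
    proof -
      have k: "k \<in> {1..K}" using that ks by auto
      have "(\<lambda>(x, s). pmf (dec k (gobs n B x s k)) (w k)) \<in> borel_measurable (gX n B \<Otimes>\<^sub>M gState M K B n f)"
        using measurable_compose[OF measurable_gobs_pair[OF k, where M=M and f=f] dec[OF k, of "w k"]] by (simp add: split_def)
      then show ?thesis unfolding cc_def by (rule St.borel_measurable_lebesgue_integral)
    qed
    show "0 \<le> cc k w x \<and> cc k w x \<le> 1" if "k \<in> set ks" for k w x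
    proof -
      have k: "k \<in> {1..K}" using that ks by auto
      have "cc k w x \<le> (\<integral>s. 1 \<partial>gState M K B n f)"
        unfolding cc_def by (rule integral_mono) (auto simp: int_dec[OF k] pmf_le_1)
      then show ?thesis by (simp add: cc_def St.prob_space)
    qed
    show "chain.succ k w x = ennreal (cc k w x)" if "k \<in> set ks" for k w x
      using that ks by (intro succ) auto
    \<comment> \<open>Markov's inequality is applied to the sum over messages, because the power
      constraint holds only on average over them.\<close>
    show "(\<Sum>w\<in>W. measure (enc w) (space (gX n B) - good)) \<le> real (card W) / 4"
    proof -
      have "ennreal (\<Sum>w\<in>W. measure (enc w) (space (gX n B) - good)) = (\<Sum>w\<in>W. emeasure (enc w) (space (gX n B) - good))"
      proof -
        have "emeasure (enc w) A = ennreal (measure (enc w) A)" if "w \<in> W" for w A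
          by (rule finite_measure.emeasure_eq_measure) (rule prob_space.finite_measure[OF prob_enc[OF that]])
        then have "(\<Sum>w\<in>W. emeasure (enc w) (space (gX n B) - good))
           = (\<Sum>w\<in>W. ennreal (measure (enc w) (space (gX n B) - good)))"
          by (intro sum.cong refl) blast
        then show ?thesis by (simp add: sum_ennreal)
      qed
      also have "\<dots> \<le> (\<Sum>w\<in>W. \<integral>\<^sup>+x. ennreal (1 / (4 * P)) * ennreal (gpow n B x) \<partial>enc w)"
      proof (intro sum_mono)
        fix w assume w: "w \<in> W"
        have [measurable]: "gpow n B \<in> borel_measurable (enc w)"
          using measurable_gpow measurable_cong_sets[OF sets_enc[OF w] refl] by blast
        have "space (gX n B) - good \<in> sets (enc w)"
        proof -
          have "space (gX n B) - good = space (gX n B) - good \<inter> space (gX n B)" by auto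
          then show ?thesis unfolding sets_enc[OF w] using sets.Diff[OF sets.top gm] by (simp only:)
        qed
        then have "emeasure (enc w) (space (gX n B) - good) = (\<integral>\<^sup>+x. indicator (space (gX n B) - good) x \<partial>enc w)"
          by simp
        also have "\<dots> \<le> (\<integral>\<^sup>+x. ennreal (1 / (4 * P)) * ennreal (gpow n B x) \<partial>enc w)"
        proof (intro nn_integral_mono)
          fix x show "indicator (space (gX n B) - good) x \<le> ennreal (1 / (4 * P)) * ennreal (gpow n B x)"
          proof (cases "x \<in> good")
            case False
            then have "1 \<le> 1 / (4 * P) * gpow n B x" using P by (simp add: good_def field_simps)
            then have "ennreal 1 \<le> ennreal (1 / (4 * P) * gpow n B x)" by (rule ennreal_leI)
            also have "ennreal (1 / (4 * P) * gpow n B x) = ennreal (1 / (4 * P)) * ennreal (gpow n B x)"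
              using P by (intro ennreal_mult) auto
            finally show ?thesis by (simp only: indicator_def ennreal_1 split: if_split) simp
          qed simp
        qed
        finally show "emeasure (enc w) (space (gX n B) - good) \<le> (\<integral>\<^sup>+x. ennreal (1 / (4 * P)) * ennreal (gpow n B x) \<partial>enc w)" .
      qed
      also have "\<dots> = ennreal (1 / (4 * P)) * (\<Sum>w\<in>W. \<integral>\<^sup>+x. ennreal (gpow n B x) \<partial>enc w)"
        unfolding sum_distrib_left
      proof (intro sum.cong refl nn_integral_cmult)
        fix w assume w: "w \<in> W"
        have [measurable]: "gpow n B \<in> borel_measurable (enc w)"
          using measurable_gpow measurable_cong_sets[OF sets_enc[OF w] refl] by blast
        show "(\<lambda>x. ennreal (gpow n B x)) \<in> borel_measurable (enc w)" by measurable
      qed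
      also have "\<dots> \<le> ennreal (1 / (4 * P)) * ennreal (P * real (card W))"
        using pow by (intro mult_left_mono) auto
      also have "\<dots> = ennreal (real (card W) / 4)"
        using P by (subst ennreal_mult[symmetric]) auto
      finally show ?thesis by (subst (asm) ennreal_le_iff) auto
    qed
    show "(\<Sum>k\<in>set ks. 1 - (\<Sum>w\<in>W. \<integral>x. cc k w x \<partial>enc w) / real (card W)) \<le> 1 / 4"
      using err by (simp add: g_cl_err_def cc_def W_def)
  qed
  also have "4 * (E * (H * C) ^ length ks) = ennreal (4 * (((1 + 16 * P) powr a) ^ n *
      ((C1 * gtail a) ^ n * ((4 + 8 * fm * real B) * (1 + 16 * P) powr (a - 1/2)) ^ n) ^ length ks))"
    unfolding E_def H_def C_def using C1 gt0 fm
    by (simp add: ennreal_mult ennreal_power[symmetric])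
  finally have "real (\<Prod>k\<in>set ks. m k) \<le> 4 * (((1 + 16 * P) powr a) ^ n *
      ((C1 * gtail a) ^ n * ((4 + 8 * fm * real B) * (1 + 16 * P) powr (a - 1/2)) ^ n) ^ length ks)"
    unfolding ennreal_of_nat_eq_real_of_nat
    by (subst (asm) ennreal_le_iff) (use C1 gt0 fm in \<open>auto intro!: mult_nonneg_nonneg\<close>)
  also have "\<dots> = 4 * ((1 + 16 * P) powr a *
     ((C1 * gtail a) * ((4 + 8 * fm * real B) * (1 + 16 * P) powr (a - 1/2))) ^ length ks) ^ n"
    by (simp only: power_mult_distrib power_mult[symmetric] mult.commute[of n])
  finally show ?thesis by (simp add: C1_def)
qed

section \<open>Classical converse over a finite field\<close>

text \<open>The law is placed on a finite set containing the support, not on the whole type.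
  Products of finite discrete spaces carry all subsets, so every function on them is
  measurable.\<close>

definition fin_meas :: "'a set \<Rightarrow> 'a pmf \<Rightarrow> 'a measure" where
  "fin_meas A p = density (count_space A) (\<lambda>x. ennreal (pmf p x))"

lemma sets_fin_meas[measurable_cong]: "sets (fin_meas A p) = sets (count_space A)"
  by (simp add: fin_meas_def)

lemma space_fin_meas[simp]: "space (fin_meas A p) = A"
  by (simp add: fin_meas_def)

lemma nn_integral_fin_meas:
  assumes "finite A" "set_pmf p \<subseteq> A"
  shows "(\<integral>\<^sup>+x. f x \<partial>fin_meas A p) = (\<integral>\<^sup>+x. f x \<partial>measure_pmf p)"
proof -
  have fs: "finite (set_pmf p)" using assms by (rule finite_subset[rotated])
  have "(\<integral>\<^sup>+x. f x \<partial>fin_meas A p) = (\<Sum>x\<in>A. ennreal (pmf p x) * f x)"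
    using assms unfolding fin_meas_def by (simp add: nn_integral_density nn_integral_count_space_finite)
  also have "\<dots> = (\<Sum>x\<in>set_pmf p. ennreal (pmf p x) * f x)"
    using assms by (intro sum.mono_neutral_right) (auto simp: set_pmf_iff)
  also have "\<dots> = (\<integral>\<^sup>+x. f x \<partial>measure_pmf p)"
    using nn_integral_measure_pmf_finite[OF fs, of f] by (simp add: mult.commute)
  finally show ?thesis .
qed

lemma prob_space_fin_meas:
  assumes "finite A" "set_pmf p \<subseteq> A"
  shows "prob_space (fin_meas A p)"
proof (rule prob_spaceI)
  have "emeasure (fin_meas A p) (space (fin_meas A p)) = (\<integral>\<^sup>+x. 1 \<partial>fin_meas A p)" by simp
  also have "\<dots> = 1" unfolding nn_integral_fin_meas[OF assms] by (simp add: measure_pmf.emeasure_space_1[simplified])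
  finally show "emeasure (fin_meas A p) (space (fin_meas A p)) = 1" .
qed

lemma integral_fin_meas:
  fixes f :: "'a \<Rightarrow> real"
  assumes "finite A" "set_pmf p \<subseteq> A"
  shows "(\<integral>x. f x \<partial>fin_meas A p) = measure_pmf.expectation p f"
proof -
  have "(\<integral>x. f x \<partial>fin_meas A p) = (\<Sum>x\<in>A. pmf p x * f x)"
    using assms unfolding fin_meas_def by (simp add: integral_density lebesgue_integral_count_space_finite)
  also have "\<dots> = measure_pmf.expectation p f"
    using assms by (subst integral_measure_pmf_real[of A]) (auto simp: mult.commute)
  finally show ?thesis .
qed

section \<open>Linear channels with random coefficients over a finite field\<close>

definition ff_Y :: "('a, 'b) ring_scheme \<Rightarrow> nat \<Rightarrow> (nat \<Rightarrow> 'a) set" where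
  "ff_Y F n = ({..<n} \<rightarrow>\<^sub>E carrier F)"

definition ff_sig :: "('a, 'b) ring_scheme \<Rightarrow> nat \<Rightarrow> nat \<Rightarrow> (nat \<times> nat \<times> nat \<Rightarrow> 'a) \<Rightarrow> (nat \<times> nat \<Rightarrow> 'a) \<Rightarrow> nat \<Rightarrow> 'a" where
  "ff_sig F B k G x t = finsum F (\<lambda>j. G (t, k, j) \<otimes>\<^bsub>F\<^esub> x (t, j)) {1..B}"

definition ff_mk :: "('a, 'b) ring_scheme \<Rightarrow> nat \<Rightarrow> nat \<Rightarrow> (nat \<times> nat \<times> nat \<Rightarrow> 'a) \<Rightarrow> (nat \<Rightarrow> 'a) \<Rightarrow> nat \<Rightarrow> 'a \<times> (nat \<Rightarrow> 'a)" where
  "ff_mk F n k G y = (\<lambda>t. if t < n then (y t, \<lambda>j. G (t, k, j)) else (\<zero>\<^bsub>F\<^esub>, \<lambda>_. \<zero>\<^bsub>F\<^esub>))"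

lemma ff_obs_eq_mk: "ff_obs F n B x G k = ff_mk F n k G (restrict (ff_sig F B k G x) {..<n})"
  by (auto simp: ff_obs_def ff_mk_def ff_sig_def)

lemma ff_X_eq: "ff_X F n B = PiE_dflt ({..<n} \<times> {1..B}) \<zero>\<^bsub>F\<^esub> (\<lambda>_. carrier F)"
  by (fastforce simp: ff_X_def PiE_dflt_def)

lemma PiE_dflt_value:
  "f \<in> PiE_dflt A d B \<Longrightarrow> (\<And>p. p \<in> A \<Longrightarrow> B p \<subseteq> C) \<Longrightarrow> d \<in> C \<Longrightarrow> f p \<in> C"
  by (cases "p \<in> A") (auto simp: PiE_dflt_def)

locale finite_field = field F for F :: "('a, 'b) ring_scheme" (structure) +
  assumes fin[simp]: "finite (carrier F)"
begin

lemma card_ge_2: "2 \<le> card (carrier F)"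
proof -
  have "card {\<zero>, \<one>} \<le> card (carrier F)" by (rule card_mono) auto
  then show ?thesis using one_not_zero by simp
qed

lemma card_units: "card (carrier F - {\<zero>}) = card (carrier F) - 1"
  by simp

lemma nonzero_nonempty: "carrier F - {\<zero>} \<noteq> {}"
  using one_not_zero by auto

lemma set_unif[simp]: "set_pmf (pmf_of_set (carrier F - {\<zero>})) = carrier F - {\<zero>}"
  by (intro set_pmf_of_set nonzero_nonempty) simp

lemma finite_ff_X[simp]: "finite (ff_X F n B)"
  unfolding ff_X_eq by (intro finite_PiE_dflt) auto

lemma set_ff_coef:
  "set_pmf (ff_coef F M K B n) = PiE_dflt (gain_idx n K B) \<zero>
     (\<lambda>(t, k, j). if M k j then carrier F - {\<zero>} else {\<zero>})"
proof -
  have "set_pmf \<circ> (\<lambda>(t, k, j). if M k j then pmf_of_set (carrier F - {\<zero>}) else return_pmf \<zero>)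
     = (\<lambda>(t::nat, k, j). if M k j then carrier F - {\<zero>} else {\<zero>})"
    by (auto simp: fun_eq_iff)
  then show ?thesis unfolding ff_coef_def by (subst set_Pi_pmf) auto
qed

lemma finite_set_ff_coef[simp]: "finite (set_pmf (ff_coef F M K B n))"
  unfolding set_ff_coef by (intro finite_PiE_dflt) auto

lemma ff_coef_carrier: "G \<in> set_pmf (ff_coef F M K B n) \<Longrightarrow> G p \<in> carrier F"
  unfolding set_ff_coef by (erule PiE_dflt_value) (auto split: if_splits)

lemma ff_coef_zero: "G \<in> set_pmf (ff_coef F M K B n) \<Longrightarrow> \<not> M k j \<Longrightarrow> G (t, k, j) = \<zero>"
  unfolding set_ff_coef by (cases "(t, k, j) \<in> gain_idx n K B") (fastforce simp: PiE_dflt_def)+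

lemma ff_coef_nonzero:
  "G \<in> set_pmf (ff_coef F M K B n) \<Longrightarrow> M k j \<Longrightarrow> t < n \<Longrightarrow> k \<in> {1..K} \<Longrightarrow> j \<in> {1..B} \<Longrightarrow> G (t, k, j) \<in> carrier F - {\<zero>}"
  unfolding set_ff_coef by (fastforce simp: PiE_dflt_def)

lemma ff_X_carrier: "x \<in> ff_X F n B \<Longrightarrow> x p \<in> carrier F"
  by (cases p) (auto simp: ff_X_def, metis zero_closed)

lemma ff_sig_closed: "(\<And>p. G p \<in> carrier F) \<Longrightarrow> (\<And>p. x p \<in> carrier F) \<Longrightarrow> ff_sig F B k G x t \<in> carrier F"
  unfolding ff_sig_def by (intro finsum_closed) auto

lemma ff_sig_cong:
  assumes "\<And>p. G p \<in> carrier F" "\<And>p. x p \<in> carrier F" "\<And>p. x' p \<in> carrier F"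
    and "\<And>j. j \<in> {1..B} \<Longrightarrow> \<not> M k j \<Longrightarrow> G (t, k, j) = \<zero>"
    and "\<And>j. j \<in> {1..B} \<Longrightarrow> M k j \<Longrightarrow> x (t, j) = x' (t, j)"
  shows "ff_sig F B k G x t = ff_sig F B k G x' t"
  unfolding ff_sig_def
proof (rule finsum_cong')
  fix j assume j: "j \<in> {1..B}"
  show "G (t, k, j) \<otimes> x (t, j) = G (t, k, j) \<otimes> x' (t, j)"
    using assms(1-3) assms(4)[OF j] assms(5)[OF j] by (cases "M k j") auto
qed (use assms in auto)

lemma diff_eq_zero_imp_eq: "a \<in> carrier F \<Longrightarrow> b \<in> carrier F \<Longrightarrow> a \<ominus> b = \<zero> \<Longrightarrow> a = b"
proof -
  assume ab: "a \<in> carrier F" "b \<in> carrier F" "a \<ominus> b = \<zero>"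
  have "a = (a \<ominus> b) \<oplus> b" using ab(1,2) by algebra
  then show "a = b" using ab by simp
qed

text \<open>Subtracting the two equations gives
  \<open>(g \<ominus> h) \<otimes> (a \<ominus> b) = \<zero>\<close> in a domain. Hence, with all
  other coefficients fixed, at most one value of a coefficient lets two different inputs
  collide.\<close>

lemma linear_eq_unique:
  assumes "a \<in> carrier F" "b \<in> carrier F" "a \<noteq> b" "g \<in> carrier F" "h \<in> carrier F" "u \<in> carrier F" "v \<in> carrier F"
    and "g \<otimes> a \<oplus> u = g \<otimes> b \<oplus> v" "h \<otimes> a \<oplus> u = h \<otimes> b \<oplus> v"
  shows "g = h"
proof -
  have "(g \<ominus> h) \<otimes> (a \<ominus> b) = (g \<otimes> a \<oplus> u \<ominus> (g \<otimes> b \<oplus> v)) \<ominus> (h \<otimes> a \<oplus> u \<ominus> (h \<otimes> b \<oplus> v))"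
    using assms(1-7) by algebra
  also have "\<dots> = \<zero>"
    using assms by (simp add: a_minus_def r_neg)
  finally have "g \<ominus> h = \<zero> \<or> a \<ominus> b = \<zero>"
    using assms(1-7) by (intro integral) auto
  moreover have "a \<ominus> b \<noteq> \<zero>" using assms(1-3) diff_eq_zero_imp_eq by blast
  ultimately show ?thesis using assms(4,5) diff_eq_zero_imp_eq by blast
qed

text \<open>In a slot where the inputs differ at some connected transmitter, all coefficients except
  that of one such transmitter are conditioned on; at most one of the \<open>q - 1\<close> nonzero
  values of the remaining coefficient leads to equal outputs. The selected coefficients of different
  slots are independent.\<close>

lemma ff_coef_collision_prob:
  assumes k: "k \<in> {1..K}" and x: "x \<in> ff_X F n B" "x' \<in> ff_X F n B"
  shows "measure_pmf.prob (ff_coef F M K B n) {G. \<forall>t<n. ff_sig F B k G x t = ff_sig F B k G x' t}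
    \<le> (\<Prod>t<n. if \<forall>j\<in>{j\<in>{1..B}. M k j}. x (t, j) = x' (t, j) then 1 else 1 / real (card (carrier F) - 1))"
proof -
  let ?S = "{j\<in>{1..B}. M k j}"
  let ?P = "\<lambda>(t::nat, k, j). if M k j then pmf_of_set (carrier F - {\<zero>}) else return_pmf \<zero>"
  define T where "T = {t\<in>{..<n}. \<exists>j\<in>?S. x (t, j) \<noteq> x' (t, j)}"
  have "\<forall>t. \<exists>j. t \<in> T \<longrightarrow> j \<in> ?S \<and> x (t, j) \<noteq> x' (t, j)" unfolding T_def by blast
  then obtain jj where jj: "\<And>t. t \<in> T \<Longrightarrow> jj t \<in> ?S \<and> x (t, jj t) \<noteq> x' (t, jj t)" by metis
  define J where "J = (\<lambda>t. (t, k, jj t)) ` T"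
  define I where "I = gain_idx n K B - J"
  have JT: "J \<subseteq> gain_idx n K B" 
  proof -
    have "(t, k, jj t) \<in> gain_idx n K B" if "t \<in> T" for t
      using jj[OF that] that k by (auto simp: T_def)
    then show ?thesis by (auto simp: J_def)
  qed
  have finT: "finite T" by (simp add: T_def)
  have IJ: "I \<union> J = gain_idx n K B" "I \<inter> J = {}" "finite I" "finite J"
    using JT finT by (auto simp: I_def J_def)
  let ?E = "{G. \<forall>t<n. ff_sig F B k G x t = ff_sig F B k G x' t}"
  let ?mrg = "\<lambda>f g p. if p \<in> I then f p else (g p :: 'a)"
  \<comment> \<open>The selected coefficients \<open>J\<close> are drawn last, given all the
    others.\<close>
  have coef: "ff_coef F M K B n = bind_pmf (Pi_pmf I \<zero> ?P) (\<lambda>f. map_pmf (\<lambda>g. ?mrg f g) (Pi_pmf J \<zero> ?P))"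
    unfolding ff_coef_def IJ(1)[symmetric] Pi_pmf_union[OF IJ(3,4,2)]
    by (simp add: pair_pmf_def map_bind_pmf map_pmf_def bind_assoc_pmf bind_return_pmf)
  let ?r = "1 / real (card (carrier F) - 1)"
  have inner: "measure_pmf.prob (map_pmf (\<lambda>g. ?mrg f g) (Pi_pmf J \<zero> ?P)) ?E \<le> ?r ^ card T"
    if f: "f \<in> set_pmf (Pi_pmf I \<zero> ?P)" for f
  proof -
    have fP: "f p \<in> carrier F" for p
      using f unfolding set_Pi_pmf[OF IJ(3)] by (rule PiE_dflt_value) (auto split: if_splits)
    define A where "A = (\<lambda>(t, k::nat, j). {a \<in> carrier F. ff_sig F B k (\<lambda>p. if p = (t, k, j) then a else f p) x t
        = ff_sig F B k (\<lambda>p. if p = (t, k, j) then a else f p) x' t})"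
    have "measure_pmf.prob (map_pmf (\<lambda>g. ?mrg f g) (Pi_pmf J \<zero> ?P)) ?E
      = measure_pmf.prob (Pi_pmf J \<zero> ?P) {g. ?mrg f g \<in> ?E}"
      by (simp add: vimage_def)
    also have "\<dots> \<le> measure_pmf.prob (Pi_pmf J \<zero> ?P) (PiE_dflt J \<zero> A)"
    proof (rule measure_pmf.finite_measure_mono_AE)
      show "AE g in Pi_pmf J \<zero> ?P. g \<in> {g. ?mrg f g \<in> ?E} \<longrightarrow> g \<in> PiE_dflt J \<zero> A"
        unfolding AE_measure_pmf_iff
      proof (intro ballI impI)
        fix g assume g: "g \<in> set_pmf (Pi_pmf J \<zero> ?P)" and E: "g \<in> {g. ?mrg f g \<in> ?E}"
        have gP: "g p \<in> carrier F" for p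
          using g unfolding set_Pi_pmf[OF IJ(4)] by (rule PiE_dflt_value) (auto split: if_splits)
        have g0: "g p = \<zero>" if "p \<notin> J" for p
          using g that unfolding set_Pi_pmf[OF IJ(4)] by (cases p) (auto simp: PiE_dflt_def)
        have "g (t, k, jj t) \<in> A (t, k, jj t)" if t: "t \<in> T" for t
        proof -
          \<comment> \<open>Only one selected position belongs to slot \<open>t\<close>, so
            inserting that single value into \<open>f\<close> reproduces the merged coefficients as
            far as this slot is concerned.\<close>
          have eq: "ff_sig F B k (?mrg f g) z t = ff_sig F B k (\<lambda>p. if p = (t, k, jj t) then g (t, k, jj t) else f p) z t"
            if "\<And>p. z p \<in> carrier F" for z
            unfolding ff_sig_def
          proof (rule finsum_cong')
            fix j assume j: "j \<in> {1..B}"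
            have "t < n" using t by (simp add: T_def)
            moreover have "(t, k, j) \<in> J \<longleftrightarrow> j = jj t" using t by (auto simp: J_def)
            ultimately have "(t, k, j) \<in> I \<longleftrightarrow> j \<noteq> jj t" using j k by (simp add: I_def)
            then show "?mrg f g (t, k, j) \<otimes> z (t, j) = (if (t, k, j) = (t, k, jj t) then g (t, k, jj t) else f (t, k, j)) \<otimes> z (t, j)"
              by auto
          qed (use fP gP that in auto)
          have "t < n" using t by (simp add: T_def)
          then have "ff_sig F B k (?mrg f g) x t = ff_sig F B k (?mrg f g) x' t" using E by simp
          then show ?thesis unfolding A_def using gP eq ff_X_carrier[OF x(1)] ff_X_carrier[OF x(2)] by simp
        qed
        then show "g \<in> PiE_dflt J \<zero> A" using g0 by (auto simp: PiE_dflt_def J_def)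
      qed
    qed auto
    also have "\<dots> = (\<Prod>p\<in>J. measure_pmf.prob (?P p) (A p))"
      by (rule measure_Pi_pmf_PiE_dflt[OF IJ(4)])
    also have "\<dots> = (\<Prod>t\<in>T. measure_pmf.prob (?P (t, k, jj t)) (A (t, k, jj t)))"
      unfolding J_def by (subst prod.reindex) (auto simp: inj_on_def)
    also have "\<dots> \<le> (\<Prod>t\<in>T. ?r)"
    proof (intro prod_mono conjI)
      fix t assume t: "t \<in> T"
      have M: "M k (jj t)" using jj[OF t] by auto
      let ?u = "\<lambda>z. finsum F (\<lambda>j. f (t, k, j) \<otimes> z (t, j)) ({1..B} - {jj t})"
      have split: "ff_sig F B k (\<lambda>p. if p = (t, k, jj t) then a else f p) z t = a \<otimes> z (t, jj t) \<oplus> ?u z"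
        if a: "a \<in> carrier F" and z: "\<And>p. z p \<in> carrier F" for a z
      proof -
        have "{1..B} = insert (jj t) ({1..B} - {jj t})" using jj[OF t] by auto
        then have "ff_sig F B k (\<lambda>p. if p = (t, k, jj t) then a else f p) z t
          = finsum F (\<lambda>j. (if (t, k, j) = (t, k, jj t) then a else f (t, k, j)) \<otimes> z (t, j)) (insert (jj t) ({1..B} - {jj t}))"
          unfolding ff_sig_def by simp
        also have "\<dots> = a \<otimes> z (t, jj t) \<oplus> finsum F (\<lambda>j. (if (t, k, j) = (t, k, jj t) then a else f (t, k, j)) \<otimes> z (t, j)) ({1..B} - {jj t})"
          using a z fP by (subst finsum_insert) auto
        also have "finsum F (\<lambda>j. (if (t, k, j) = (t, k, jj t) then a else f (t, k, j)) \<otimes> z (t, j)) ({1..B} - {jj t}) = ?u z"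
          using a z fP by (intro finsum_cong') auto
        finally show ?thesis .
      qed
      have u: "?u z \<in> carrier F" if "\<And>p. z p \<in> carrier F" for z
        using that fP by (intro finsum_closed) auto
      have A: "a \<in> carrier F \<and> a \<otimes> x (t, jj t) \<oplus> ?u x = a \<otimes> x' (t, jj t) \<oplus> ?u x'"
        if "a \<in> A (t, k, jj t)" for a
        using that split[of a x] split[of a x'] ff_X_carrier[OF x(1)] ff_X_carrier[OF x(2)] unfolding A_def by simp
      have "a = b" if "a \<in> A (t, k, jj t)" "b \<in> A (t, k, jj t)" for a b
        using A[OF that(1)] A[OF that(2)] ff_X_carrier[OF x(1)] ff_X_carrier[OF x(2)] jj[OF t]
          u[of x, OF ff_X_carrier[OF x(1)]] u[of x', OF ff_X_carrier[OF x(2)]]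
        by (intro linear_eq_unique[of "x (t, jj t)" "x' (t, jj t)" a b "?u x" "?u x'"]) auto
      then have "card (A (t, k, jj t) \<inter> (carrier F - {\<zero>})) \<le> 1"
        by (intro card_le_Suc0_iff_eq[THEN iffD2, folded One_nat_def]) (auto simp: A_def)
      then show "measure_pmf.prob (?P (t, k, jj t)) (A (t, k, jj t)) \<le> ?r"
        using M nonzero_nonempty by (simp add: measure_pmf_of_set Int_commute divide_right_mono card_units[simplified])
    qed auto
    also have "\<dots> = ?r ^ card T" by simp
    finally show ?thesis .
  qed
  have "ennreal (measure_pmf.prob (ff_coef F M K B n) ?E) = emeasure (ff_coef F M K B n) ?E"
    by (simp add: measure_pmf.emeasure_eq_measure)
  also have "\<dots> = (\<integral>\<^sup>+f. emeasure (map_pmf (\<lambda>g. ?mrg f g) (Pi_pmf J \<zero> ?P)) ?E \<partial>Pi_pmf I \<zero> ?P)"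
    unfolding coef by (rule emeasure_bind_pmf)
  also have "\<dots> \<le> (\<integral>\<^sup>+f. ennreal (?r ^ card T) \<partial>Pi_pmf I \<zero> ?P)"
  proof (rule nn_integral_mono_AE)
    show "AE f in Pi_pmf I \<zero> ?P. emeasure (map_pmf (\<lambda>g. ?mrg f g) (Pi_pmf J \<zero> ?P)) ?E \<le> ennreal (?r ^ card T)"
      unfolding AE_measure_pmf_iff measure_pmf.emeasure_eq_measure using inner by (auto intro!: ennreal_leI)
  qed
  also have "\<dots> = ennreal (?r ^ card T)" by simp
  finally have "measure_pmf.prob (ff_coef F M K B n) ?E \<le> ?r ^ card T"
    by (subst (asm) ennreal_le_iff) auto
  also have "\<dots> = (\<Prod>t<n. if \<forall>j\<in>?S. x (t, j) = x' (t, j) then 1 else ?r)"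
  proof -
    have "(\<Prod>t<n. if \<forall>j\<in>?S. x (t, j) = x' (t, j) then 1 else ?r) = (\<Prod>t\<in>T. ?r)"
      unfolding T_def by (rule prod.mono_neutral_cong_right) auto
    then show ?thesis by simp
  qed
  finally show ?thesis .
qed


text \<open>Each slot in which the inputs differ on \<open>T\<close> is weighted by the bound on its
  collision probability, so the averaged overlap of a receiver with neighbourhood \<open>T\<close>
  is at most this kernel.\<close>

definition ff_corr :: "nat \<Rightarrow> nat \<Rightarrow> nat set \<Rightarrow> (nat \<times> nat \<Rightarrow> 'a) \<Rightarrow> (nat \<times> nat \<Rightarrow> 'a) \<Rightarrow> ennreal" where
  "ff_corr n B T x x' = (\<Prod>t<n. ennreal (if \<forall>j\<in>T. x (t, j) = x' (t, j) then 1 else 1 / real (card (carrier F) - 1)))"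

lemma inv_units: "0 < 1 / real (card (carrier F) - 1)" "1 / real (card (carrier F) - 1) \<le> 1"
  using card_ge_2 by auto

text \<open>Per slot one equal value has weight 1 and the \<open>q - 1\<close> others share total
  weight 1. The row sum 2 does not depend on the field, which is why each receiver beyond the common
  factor costs only one bit per use.\<close>

lemma ff_Y_sum:
  assumes y: "y \<in> ff_Y F n"
  shows "(\<Sum>y'\<in>ff_Y F n. \<Prod>t<n. ennreal (if y t = y' t then 1 else 1 / real (card (carrier F) - 1))) = 2 ^ n"
proof -
  let ?r = "1 / real (card (carrier F) - 1)"
  have "(\<Sum>y'\<in>ff_Y F n. \<Prod>t<n. ennreal (if y t = y' t then 1 else ?r))
    = (\<Prod>t<n. \<Sum>v\<in>carrier F. ennreal (if y t = v then 1 else ?r))"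
    unfolding ff_Y_def by (rule prod_sum_PiE[symmetric]) auto
  also have "\<dots> = (\<Prod>t<n. 2)"
  proof (intro prod.cong refl)
    fix t assume "t \<in> {..<n}"
    then have yt: "y t \<in> carrier F" using y by (auto simp: ff_Y_def)
    have "(\<Sum>v\<in>carrier F. ennreal (if y t = v then 1 else ?r)) = ennreal (\<Sum>v\<in>carrier F. if y t = v then 1 else ?r)"
      by (intro sum_ennreal) auto
    also have "(\<Sum>v\<in>carrier F. if y t = v then 1 else ?r) = 1 + (\<Sum>v\<in>carrier F - {y t}. if y t = v then 1 else ?r)"
      using yt by (subst sum.remove[of _ "y t"]) auto
    also have "(\<Sum>v\<in>carrier F - {y t}. if y t = v then 1 else ?r) = (\<Sum>v\<in>carrier F - {y t}. ?r)"
      by (intro sum.cong) auto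
    also have "1 + \<dots> = 2" using yt card_ge_2 by simp
    finally show "(\<Sum>v\<in>carrier F. ennreal (if y t = v then 1 else ?r)) = 2" by simp
  qed
  finally show ?thesis by simp
qed

lemma finite_ff_Y[simp]: "finite (ff_Y F n)"
  unfolding ff_Y_def by (intro finite_PiE) auto

lemma meas2:
  assumes "finite A" "finite C"
  shows "f \<in> borel_measurable (fin_meas A p \<Otimes>\<^sub>M count_space C)"
proof -
  have "f \<in> borel_measurable (count_space A \<Otimes>\<^sub>M count_space C)"
    using assms by (simp add: pair_measure_countable countable_finite)
  then show ?thesis by (simp add: measurable_cong_sets[OF sets_pair_measure_cong[OF sets_fin_meas refl] refl])
qed

lemma meas3:
  assumes "finite A" "finite C" "finite D"
  shows "f \<in> borel_measurable (fin_meas A p \<Otimes>\<^sub>M count_space C \<Otimes>\<^sub>M count_space D)"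
proof -
  have "f \<in> borel_measurable (count_space A \<Otimes>\<^sub>M count_space C \<Otimes>\<^sub>M count_space D)"
    using assms by (simp add: pair_measure_countable countable_finite)
  then show ?thesis by (simp add: measurable_cong_sets[OF sets_pair_measure_cong[OF sets_fin_meas refl] refl])
qed

text \<open>Brings the error into the form of one minus an average of conditional success
  probabilities, as required by \<open>chain_converse\<close>.\<close>

lemma ff_cl_err_eq:
  assumes "\<And>k. k \<in> {1..K} \<Longrightarrow> 1 \<le> m k"
  shows "ff_cl_err F M K B n m enc dec k = 1 - (\<Sum>w\<in>msg_set K m. measure_pmf.expectation (enc w)
     (\<lambda>x. measure_pmf.expectation (ff_coef F M K B n) (\<lambda>G. pmf (dec k (ff_obs F n B x G k)) (w k)))) / real (card (msg_set K m))"
proof -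
  have ne: "msg_set K m \<noteq> {}"
    using assms by (auto simp: msg_set_def intro!: exI[of _ "\<lambda>_. 0"] Suc_le_lessD)
  then have cp: "0 < card (msg_set K m)" by (simp add: card_gt_0_iff)
  let ?c = "\<lambda>w x. measure_pmf.expectation (ff_coef F M K B n) (\<lambda>G. pmf (dec k (ff_obs F n B x G k)) (w k))"
  have c01: "0 \<le> ?c w x \<and> ?c w x \<le> 1" for w x
    by (auto intro!: measure_pmf.integral_le_const measure_pmf.integrable_const_bound[where B=1] simp: pmf_le_1)
  have 1: "pmf (map_pmf (\<lambda>v. v \<noteq> w k) (dec k ob)) True = 1 - pmf (dec k ob) (w k)" for w :: "nat \<Rightarrow> nat" and ob
  proof -
    have "pmf (map_pmf (\<lambda>v. v \<noteq> w k) (dec k ob)) True = measure_pmf.prob (dec k ob) (- {w k})"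
      unfolding pmf_map by (rule arg_cong[where f="measure_pmf.prob _"]) auto
    also have "\<dots> = 1 - pmf (dec k ob) (w k)"
      using measure_pmf.prob_compl[of "{w k}" "dec k ob"] by (simp add: measure_pmf_single Compl_eq_Diff_UNIV)
    finally show ?thesis .
  qed
  have 2: "pmf (bind_pmf (ff_coef F M K B n) (\<lambda>G. map_pmf (\<lambda>v. v \<noteq> w k) (dec k (ff_obs F n B x G k)))) True = 1 - ?c w x" for w x
    unfolding pmf_bind 1 by (subst Bochner_Integration.integral_diff)
      (auto intro!: measure_pmf.integrable_const_bound[where B=1] simp: pmf_le_1)
  have 3: "pmf (bind_pmf (enc w) (\<lambda>x. bind_pmf (ff_coef F M K B n) (\<lambda>G. map_pmf (\<lambda>v. v \<noteq> w k) (dec k (ff_obs F n B x G k))))) True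
     = 1 - measure_pmf.expectation (enc w) (?c w)" for w
    unfolding pmf_bind[of "enc w"] 2 using c01 by (subst Bochner_Integration.integral_diff)
      (auto intro!: measure_pmf.integrable_const_bound[where B=1])
  have "ff_cl_err F M K B n m enc dec k = (\<Sum>w\<in>msg_set K m. 1 - measure_pmf.expectation (enc w) (?c w)) / real (card (msg_set K m))"
    unfolding ff_cl_err_def measure_pmf_single msg_pmf_def
    unfolding pmf_bind[of "pmf_of_set (msg_set K m)"] 3
    using ne by (subst integral_pmf_of_set) auto
  then show ?thesis using cp ne by (simp add: sum_subtractf diff_divide_distrib)
qed

text \<open>Without noise the 0-1 transition kernel serves as its own dominating kernel. The
  constants of the chain are \<open>H = 2 ^ n\<close> from the row sums, \<open>C = 1\<close> from
  the collision probability, and \<open>E = q ^ n\<close>, which suffices because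
  \<open>q / (q - 1) \<ge> 1\<close> in every slot. All inputs are good.\<close>

theorem ff_cl_converse:
  assumes ks: "distinct ks" "set ks \<subseteq> {1..K}"
      "sorted_wrt (\<lambda>k k'. {j\<in>{1..B}. M k j} \<subseteq> {j\<in>{1..B}. M k' j}) ks"
    and scheme: "ff_cl_scheme F K B n m enc"
    and err: "(\<Sum>k\<in>set ks. ff_cl_err F M K B n m enc dec k) \<le> 1 / 4"
  shows "(\<Prod>k\<in>set ks. real (m k)) \<le> 4 * (real (card (carrier F)) * 2 ^ length ks) ^ n"
proof -
  define W where "W = msg_set K m"
  define XX where "XX = ff_X F n B"
  define coef where "coef = ff_coef F M K B n"
  define \<Gamma> where "\<Gamma> = fin_meas (set_pmf coef) coef"
  define N where "N = (\<lambda>w. fin_meas XX (enc w))"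
  define p where "p = (\<lambda>k (G :: nat \<times> nat \<times> nat \<Rightarrow> 'a) y x. if \<forall>t<n. y t = ff_sig F B k G x t then 1 else 0 :: ennreal)"
  define D where "D = (\<lambda>k G v y. ennreal (pmf (dec k (ff_mk F n k G y)) v))"
  define r where "r = 1 / real (card (carrier F) - 1)"
  define h where "h = (\<lambda>y y' :: nat \<Rightarrow> 'a. \<Prod>t<n. ennreal (if y t = y' t then 1 else r))"
  define E where "E = ennreal (real (card (carrier F)) ^ n)"
  define S where "S = (\<lambda>k. {j\<in>{1..B}. M k j})"
  have r: "0 < r" "r \<le> 1" using inv_units by (auto simp: r_def)
  have finXX[simp]: "finite XX" by (simp add: XX_def)
  have fincoef[simp]: "finite (set_pmf coef)" by (simp add: coef_def)
  have m1: "\<And>k. k \<in> {1..K} \<Longrightarrow> 1 \<le> m k" and enc: "\<And>w. w \<in> W \<Longrightarrow> set_pmf (enc w) \<subseteq> XX"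
    using scheme by (auto simp: ff_cl_scheme_def W_def XX_def)
  have prob: "prob_space (N w)" if "w \<in> W" for w
    unfolding N_def by (rule prob_space_fin_meas) (use enc[OF that] in auto)
  have sp: "prob_space \<Gamma>" unfolding \<Gamma>_def by (rule prob_space_fin_meas) auto
  have Gc: "G q \<in> carrier F" if "G \<in> set_pmf coef" for G q using that unfolding coef_def by (rule ff_coef_carrier)
  have Xc: "x q \<in> carrier F" if "x \<in> XX" for x q using that unfolding XX_def by (rule ff_X_carrier)
  interpret chain: receiver_chain W N "count_space XX" "count_space (ff_Y F n)" \<Gamma> p p D h "ff_corr n B" S UNIV "2 ^ n" 1 E "{1..K}"
  proof (rule receiver_chain.intro)
    show "finite W" by (simp add: W_def)
    show "sigma_finite_measure (N w)" if "w \<in> W" for w using prob[OF that] by (rule prob_space_imp_sigma_finite)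
    show "sets (N w) = sets (count_space XX)" for w by (simp add: N_def sets_fin_meas)
    show "sigma_finite_measure (count_space (ff_Y F n))" by (intro sigma_finite_measure_count_space_finite) simp
    show "prob_space \<Gamma>" by (rule sp)
    show "(\<lambda>(g, y, x). p k g y x) \<in> borel_measurable (\<Gamma> \<Otimes>\<^sub>M count_space (ff_Y F n) \<Otimes>\<^sub>M count_space XX)"
         "(\<lambda>(g, y, x). p k g y x) \<in> borel_measurable (\<Gamma> \<Otimes>\<^sub>M count_space (ff_Y F n) \<Otimes>\<^sub>M count_space XX)" for k
      unfolding \<Gamma>_def by (intro meas3; simp)+
    show "(\<lambda>(g, y). D k g v y) \<in> borel_measurable (\<Gamma> \<Otimes>\<^sub>M count_space (ff_Y F n))" for k v
      unfolding \<Gamma>_def by (intro meas2) auto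
    show "(\<lambda>(y, y'). h y y') \<in> borel_measurable (count_space (ff_Y F n) \<Otimes>\<^sub>M count_space (ff_Y F n))"
      by (simp add: pair_measure_countable countable_finite)
    show "h y y' = h y' y" for y y' by (simp add: h_def eq_commute)
    show "(\<integral>\<^sup>+y'. h y y' \<partial>count_space (ff_Y F n)) \<le> 2 ^ n" if "y \<in> space (count_space (ff_Y F n))" for y
      using that ff_Y_sum[of y n] unfolding h_def r_def by (simp add: nn_integral_count_space_finite)
    show "(\<Sum>v\<in>V. D k g v y) \<le> 1" if "finite V" for k g y V
      using measure_pmf.prob_le_1[of "dec k (ff_mk F n k g y)" V] that
      by (simp add: D_def sum_ennreal measure_measure_pmf_finite)
    show "ff_corr n B T' x x' \<le> ff_corr n B T x x'" if "T \<subseteq> T'" for T T' x x'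
      unfolding ff_corr_def r_def[symmetric] using that r by (intro prod_mono_ennreal ennreal_leI) auto
    show "(\<lambda>(x, x'). ff_corr n B T x x') \<in> borel_measurable (count_space XX \<Otimes>\<^sub>M count_space XX)" for T
      by (simp add: pair_measure_countable countable_finite)
    show "1 \<le> E * ff_corr n B T x x'" for T x x'
    proof -
      have "1 \<le> (\<Prod>t<n. real (card (carrier F)) * (if \<forall>j\<in>T. x (t, j) = x' (t, j) then 1 else r))"
        using card_ge_2 by (intro prod_ge_1) (auto simp: r_def field_simps)
      then have "ennreal 1 \<le> ennreal (\<Prod>t<n. real (card (carrier F)) * (if \<forall>j\<in>T. x (t, j) = x' (t, j) then 1 else r))"
        by (rule ennreal_leI)
      also have "\<dots> = E * ff_corr n B T x x'"
        unfolding E_def ff_corr_def r_def[symmetric]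
        using r by (simp add: prod.distrib prod_ennreal ennreal_mult prod_nonneg)
      finally show ?thesis by simp
    qed
  next
    fix k assume k: "k \<in> {1..K}"
    show "AE g in \<Gamma>. \<forall>x\<in>space (count_space XX). \<forall>x'\<in>space (count_space XX). \<forall>y\<in>space (count_space (ff_Y F n)). \<forall>y'\<in>space (count_space (ff_Y F n)).
        p k g y x * p k g y' x' * ff_corr n B (S k) x x' \<le> h y y' * (p k g y x * p k g y' x')"
    proof (rule AE_I2, intro ballI)
      fix g x x' y y' assume "g \<in> space \<Gamma>" "x \<in> space (count_space XX)" "x' \<in> space (count_space XX)"
      then have g: "g \<in> set_pmf coef" and x: "x \<in> XX" "x' \<in> XX" by (auto simp: \<Gamma>_def)
      show "p k g y x * p k g y' x' * ff_corr n B (S k) x x' \<le> h y y' * (p k g y x * p k g y' x')"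
      proof (cases "(\<forall>t<n. y t = ff_sig F B k g x t) \<and> (\<forall>t<n. y' t = ff_sig F B k g x' t)")
        case True
        \<comment> \<open>Inputs that agree on the neighbourhood in a slot give equal outputs there,
          so slotwise the kernel on outputs is at least the kernel on inputs.\<close>
        have "ff_corr n B (S k) x x' \<le> h y y'"
          unfolding ff_corr_def h_def r_def[symmetric]
        proof (intro prod_mono_ennreal ennreal_leI)
          fix t assume "t \<in> {..<n}"
          have "y t = y' t" if "\<forall>j\<in>S k. x (t, j) = x' (t, j)"
          proof -
            have "ff_sig F B k g x t = ff_sig F B k g x' t"
              using g that by (intro ff_sig_cong[where M=M] Gc[OF g] Xc[OF x(1)] Xc[OF x(2)]) (auto simp: S_def coef_def ff_coef_zero)
            then show ?thesis using True \<open>t \<in> {..<n}\<close> by simp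
          qed
          then show "(if \<forall>j\<in>S k. x (t, j) = x' (t, j) then 1 else r) \<le> (if y t = y' t then 1 else r)"
            using r by auto
        qed
        then show ?thesis using True by (simp add: p_def)
      qed (auto simp: p_def)
    qed
    show "(\<integral>\<^sup>+g. \<integral>\<^sup>+y. p k g y x * p k g y x' \<partial>count_space (ff_Y F n) \<partial>\<Gamma>) \<le> 1 * ff_corr n B (S k) x x'"
      if "x \<in> UNIV \<inter> space (count_space XX)" "x' \<in> UNIV \<inter> space (count_space XX)" for x x'
    proof -
      have x: "x \<in> XX" "x' \<in> XX" using that by auto
      let ?E = "{G. \<forall>t<n. ff_sig F B k G x t = ff_sig F B k G x' t}"
      have "(\<integral>\<^sup>+g. \<integral>\<^sup>+y. p k g y x * p k g y x' \<partial>count_space (ff_Y F n) \<partial>\<Gamma>)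
         \<le> (\<integral>\<^sup>+g. indicator ?E g \<partial>\<Gamma>)"
      proof (intro nn_integral_mono)
        fix g
        show "(\<integral>\<^sup>+y. p k g y x * p k g y x' \<partial>count_space (ff_Y F n)) \<le> indicator ?E g"
        proof (cases "g \<in> ?E")
          case True
          have "(\<integral>\<^sup>+y. p k g y x * p k g y x' \<partial>count_space (ff_Y F n))
             \<le> (\<Sum>y\<in>ff_Y F n. indicator {restrict (ff_sig F B k g x) {..<n}} y)"
            unfolding nn_integral_count_space_finite[OF finite_ff_Y]
          proof (intro sum_mono)
            fix y assume y: "y \<in> ff_Y F n"
            have "y = restrict (ff_sig F B k g x) {..<n}" if "\<forall>t<n. y t = ff_sig F B k g x t"
              using y that by (auto simp: ff_Y_def PiE_def extensional_def fun_eq_iff)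
            then show "p k g y x * p k g y x' \<le> indicator {restrict (ff_sig F B k g x) {..<n}} y"
              by (auto simp: p_def)
          qed
          also have "\<dots> \<le> 1"
            using card_mono[of "{restrict (ff_sig F B k g x) {..<n}}" "ff_Y F n \<inter> {restrict (ff_sig F B k g x) {..<n}}"]
            by (simp add: indicator_def sum.delta')
          finally show ?thesis using True by simp
        next
          case False
          then have z: "p k g y x * p k g y x' = 0" for y by (auto simp: p_def)
          show ?thesis unfolding z by simp
        qed
      qed
      also have "\<dots> = emeasure (measure_pmf coef) ?E"
        unfolding \<Gamma>_def by (subst nn_integral_fin_meas) auto
      also have "\<dots> = ennreal (measure_pmf.prob coef ?E)"
        by (simp add: measure_pmf.emeasure_eq_measure)
      also have "\<dots> \<le> ennreal (\<Prod>t<n. if \<forall>j\<in>S k. x (t, j) = x' (t, j) then 1 else r)"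
        unfolding coef_def S_def r_def using x k by (intro ennreal_leI ff_coef_collision_prob) (auto simp: XX_def)
      also have "\<dots> = ff_corr n B (S k) x x'"
        unfolding ff_corr_def r_def[symmetric] using r by (simp add: prod_ennreal)
      finally show ?thesis by simp
    qed
  qed
  define cc where "cc = (\<lambda>k (w :: nat \<Rightarrow> nat) x. measure_pmf.expectation coef (\<lambda>G. pmf (dec k (ff_obs F n B x G k)) (w k)))"
  have succ: "chain.succ k w x = ennreal (cc k w x)" if x: "x \<in> XX" for k w x
  proof -
    have "ennreal (cc k w x) = (\<integral>\<^sup>+G. ennreal (pmf (dec k (ff_obs F n B x G k)) (w k)) \<partial>measure_pmf coef)"
      unfolding cc_def by (rule nn_integral_eq_integral[symmetric])
        (auto intro!: measure_pmf.integrable_const_bound[where B=1] simp: pmf_le_1)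
    also have "\<dots> = (\<integral>\<^sup>+G. ennreal (pmf (dec k (ff_obs F n B x G k)) (w k)) \<partial>\<Gamma>)"
      unfolding \<Gamma>_def by (subst nn_integral_fin_meas) auto
    also have "\<dots> = chain.succ k w x"
      unfolding chain.succ_def chain.succ_cond_def
    proof (intro nn_integral_cong)
      fix g assume "g \<in> space \<Gamma>"
      then have g: "g \<in> set_pmf coef" by (simp add: \<Gamma>_def)
      let ?y = "restrict (ff_sig F B k g x) {..<n}"
      have y: "?y \<in> ff_Y F n" unfolding ff_Y_def by (auto intro!: ff_sig_closed Gc[OF g] Xc[OF x])
      have "(\<integral>\<^sup>+y. p k g y x * D k g (w k) y \<partial>count_space (ff_Y F n))
         = (\<Sum>y\<in>ff_Y F n. if y = ?y then D k g (w k) ?y else 0)"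
        unfolding nn_integral_count_space_finite[OF finite_ff_Y]
      proof (intro sum.cong refl)
        fix y assume y: "y \<in> ff_Y F n"
        have "(\<forall>t<n. y t = ff_sig F B k g x t) \<longleftrightarrow> y = ?y"
          using y by (auto simp: ff_Y_def PiE_def extensional_def fun_eq_iff)
        then show "p k g y x * D k g (w k) y = (if y = ?y then D k g (w k) ?y else 0)"
          by (auto simp: p_def)
      qed
      also have "\<dots> = D k g (w k) ?y" using y by (simp add: sum.delta')
      finally show "ennreal (pmf (dec k (ff_obs F n B x g k)) (w k)) = (\<integral>\<^sup>+y. p k g y x * D k g (w k) y \<partial>count_space (ff_Y F n))"
        by (simp add: D_def ff_obs_eq_mk)
    qed
    finally show ?thesis by simp
  qed
  have "of_nat (\<Prod>k\<in>set ks. m k) \<le> 4 * (E * (2 ^ n * 1) ^ length ks)"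
  proof (rule chain.chain_converse[where c=cc])
    show "W = msg_set K m" by (simp add: W_def)
    show "\<And>k. k \<in> {1..K} \<Longrightarrow> 1 \<le> m k" by (rule m1)
    show "\<And>w. w \<in> W \<Longrightarrow> prob_space (N w)" by (rule prob)
    show "distinct ks" "set ks \<subseteq> {1..K}" "{1..K} \<subseteq> {1..K}" "sorted_wrt (\<lambda>k k'. S k \<subseteq> S k') ks"
      using ks by (auto simp: S_def)
    show "ff_corr n B {} x x' \<le> 1" for x x' by (simp add: ff_corr_def)
    show "UNIV \<inter> space (count_space XX) \<in> sets (count_space XX)" by simp
    show "cc k w \<in> borel_measurable (count_space XX)" for k w by simp
    show "0 \<le> cc k w x \<and> cc k w x \<le> 1" for k w x
      unfolding cc_def by (auto intro!: measure_pmf.integral_le_const measure_pmf.integrable_const_bound[where B=1] simp: pmf_le_1)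
    show "chain.succ k w x = ennreal (cc k w x)" if "x \<in> space (count_space XX)" for k w x
      using that by (intro succ) auto
    show "(\<Sum>w\<in>W. measure (N w) (space (count_space XX) - UNIV)) \<le> real (card W) / 4" by simp
    have "(\<integral>x. cc k w x \<partial>N w) = measure_pmf.expectation (enc w) (cc k w)" if "w \<in> W" for k w
      unfolding N_def using enc[OF that] by (intro integral_fin_meas) auto
    then have exps: "(\<Sum>w\<in>W. \<integral>x. cc k w x \<partial>N w) = (\<Sum>w\<in>W. measure_pmf.expectation (enc w) (cc k w))" for k
      by (intro sum.cong refl) auto
    have "1 - (\<Sum>w\<in>W. \<integral>x. cc k w x \<partial>N w) / real (card W) = ff_cl_err F M K B n m enc dec k" for k
      unfolding exps unfolding cc_def W_def coef_def by (rule ff_cl_err_eq[symmetric]) (rule m1)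
    then show "(\<Sum>k\<in>set ks. 1 - (\<Sum>w\<in>W. \<integral>x. cc k w x \<partial>N w) / real (card W)) \<le> 1 / 4"
      using err by simp
  qed
  also have "4 * (E * (2 ^ n * 1) ^ length ks) = ennreal (4 * (real (card (carrier F)) ^ n * (2 ^ n) ^ length ks))"
    unfolding E_def by (simp add: ennreal_mult ennreal_power[symmetric])
  finally have "real (\<Prod>k\<in>set ks. m k) \<le> 4 * (real (card (carrier F)) ^ n * (2 ^ n) ^ length ks)"
    unfolding ennreal_of_nat_eq_real_of_nat by (subst (asm) ennreal_le_iff) auto
  also have "\<dots> = 4 * (real (card (carrier F)) * 2 ^ length ks) ^ n"
    by (simp only: power_mult_distrib power_mult[symmetric] mult.commute[of n])
  finally show ?thesis by simp
qed

end

section \<open>Converse for non-signalling boxes\<close>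

text \<open>An event that factors through the outputs of the parties in \<open>S\<close> has a
  probability determined by the inputs of \<open>S\<close> alone. The following lemmas choose
  \<open>S\<close> and the factorisation \<open>Q\<close>.\<close>

lemma ns_box_prob_eq:
  assumes ns: "ns_box K nsb" and S: "S \<subseteq> {0..K}" and i: "0 \<in> S \<Longrightarrow> i = i'" and ob: "\<And>k. k \<in> S - {0} \<Longrightarrow> ob k = ob' k"
    and P: "\<And>x v. P x v \<longleftrightarrow> Q (ns_restr S (x, v))"
  shows "measure_pmf.prob (nsb (i, ob)) {(x, v). P x v} = measure_pmf.prob (nsb (i', ob')) {(x, v). P x v}"
proof -
  have eq: "map_pmf (ns_restr S) (nsb (i, ob)) = map_pmf (ns_restr S) (nsb (i', ob'))"
    using ns S i ob unfolding ns_box_def by blast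
  have "{(x, v). P x v} = ns_restr S -` Collect Q" using P by auto
  then have "measure_pmf.prob (nsb j) {(x, v). P x v} = measure_pmf.prob (map_pmf (ns_restr S) (nsb j)) (Collect Q)" for j
    by simp
  from this[of "(i, ob)"] this[of "(i', ob')"] show ?thesis using eq by (simp only:)
qed

text \<open>Only the transmitter and one receiver take part in the event, so the observations of all
  other receivers may be replaced at will.\<close>

lemma ns_box_tx_rx:
  assumes ns: "ns_box K nsb" and k: "k \<in> {1..K}" and ob: "ob k = ob' k"
  shows "measure_pmf.prob (nsb (i, ob)) {(x, v). x = x0 \<and> R (v k)} = measure_pmf.prob (nsb (i, ob')) {(x, v). x = x0 \<and> R (v k)}"
  using k ob by (intro ns_box_prob_eq[OF ns, where S="{0, k}" and Q="\<lambda>(x, v). x = Some x0 \<and> R (v k)"])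
    (auto simp: ns_restr_def)

lemma ns_box_tx:
  assumes ns: "ns_box K nsb"
  shows "measure_pmf.prob (nsb (i, ob)) {(x, v). x = x0} = measure_pmf.prob (nsb (i, ob')) {(x, v). x = x0}"
  by (intro ns_box_prob_eq[OF ns, where S="{0}" and Q="\<lambda>(x, v). x = Some x0"])
    (auto simp: ns_restr_def)

lemma ns_box_rx:
  assumes ns: "ns_box K nsb" and S: "S \<subseteq> {1..K}"
  shows "measure_pmf.prob (nsb (i, ob)) {(x, v). \<forall>k\<in>S. v k = u k} = measure_pmf.prob (nsb (i', ob)) {(x, v). \<forall>k\<in>S. v k = u k}"
proof -
  have "k \<noteq> 0" if "k \<in> S" for k using S that by auto
  then show ?thesis
    using S by (intro ns_box_prob_eq[OF ns, where S=S and Q="\<lambda>(x, v). \<forall>k\<in>S. v k = u k"]) (auto simp: ns_restr_def)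
qed

text \<open>Without the transmitter's input, the receivers in S output a guess that is independent of the message.\<close>

lemma ns_box_guess_sum:
  assumes ns: "ns_box K nsb" and S: "S \<subseteq> {1..K}"
  shows "(\<Sum>w\<in>msg_set K m. measure_pmf.prob (nsb (w, ob)) {(x, v). \<forall>k\<in>S. v k = w k}) \<le> real (\<Prod>k\<in>{1..K} - S. m k)"
proof -
  let ?p = "nsb (\<lambda>_. 0, ob)"
  have "(\<Sum>w\<in>msg_set K m. measure_pmf.prob (nsb (w, ob)) {(x, v). \<forall>k\<in>S. v k = w k})
    = (\<Sum>w\<in>msg_set K m. measure_pmf.prob ?p {(x, v). \<forall>k\<in>S. v k = w k})"
    by (intro sum.cong refl ns_box_rx[OF ns S])
  also have "\<dots> = measure_pmf.expectation ?p (\<lambda>(x, v). \<Sum>w\<in>msg_set K m. indicator {(x, v). \<forall>k\<in>S. v k = w k} (x, v))"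
    by (simp add: split_def Bochner_Integration.integral_sum measure_pmf.emeasure_eq_measure)
  also have "\<dots> \<le> real (\<Prod>k\<in>{1..K} - S. m k)"
  proof (rule measure_pmf.integral_le_const)
    show "AE xv in ?p. (case xv of (x, v) \<Rightarrow> \<Sum>w\<in>msg_set K m. indicator {(x, v). \<forall>k\<in>S. v k = w k} (x, v)) \<le> real (\<Prod>k\<in>{1..K} - S. m k)"
    proof (rule AE_pmfI, clarify)
      fix x v
      have "(\<Sum>w\<in>msg_set K m. indicator {(x, v). \<forall>k\<in>S. v k = w k} (x, v)) = real (card {w\<in>msg_set K m. \<forall>k\<in>S. v k = w k})"
        by (simp add: indicator_def sum.If_cases Int_def)
      \<comment> \<open>For a fixed joint guess the compatible messages are pinned down on
        \<open>S\<close>, hence determined by their coordinates outside \<open>S\<close>.\<close>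
      also have "card {w\<in>msg_set K m. \<forall>k\<in>S. v k = w k} \<le> card (forget S ` msg_set K m)"
      proof (rule card_inj_on_le)
        show "inj_on (forget S) {w\<in>msg_set K m. \<forall>k\<in>S. v k = w k}"
        proof (rule inj_onI, rule ext)
          fix a b k assume a: "a \<in> {w\<in>msg_set K m. \<forall>k\<in>S. v k = w k}" and b: "b \<in> {w\<in>msg_set K m. \<forall>k\<in>S. v k = w k}"
            and ab: "forget S a = forget S b"
          show "a k = b k"
          proof (cases "k \<in> S")
            case True
            then have "v k = a k" "v k = b k" using a b by blast+
            then show ?thesis by simp
          next
            case False
            then show ?thesis using fun_cong[OF ab, of k] by (simp add: forget_def)
          qed
        qed
      qed auto
      also have "\<dots> \<le> (\<Prod>k\<in>{1..K} - S. m k)" by (rule card_forget_le[OF S])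
      finally show "(\<Sum>w\<in>msg_set K m. indicator {(x, v). \<forall>k\<in>S. v k = w k} (x, v)) \<le> real (\<Prod>k\<in>{1..K} - S. m k)"
        by simp
    qed
    show "integrable ?p (\<lambda>(x, v). \<Sum>w\<in>msg_set K m. indicator {(x, v). \<forall>k\<in>S. v k = w k} (x, v) :: real)"
    proof (rule measure_pmf.integrable_const_bound)
      have "\<bar>\<Sum>w\<in>msg_set K m. indicator {(x, v). \<forall>k\<in>S. v k = w k} xv :: real\<bar> \<le> (\<Sum>w\<in>msg_set K m. 1)" for xv :: "'b \<times> (nat \<Rightarrow> nat)"
        by (rule order_trans[OF sum_abs], rule sum_mono) (simp add: indicator_def)
      then show "AE xv in ?p. norm (case xv of (x, v) \<Rightarrow> (\<Sum>w\<in>msg_set K m. indicator {(x, v). \<forall>k\<in>S. v k = w k} (x, v) :: real)) \<le> (\<Sum>w\<in>msg_set K m. 1)"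
        by (intro AE_I2) (simp only: split_beta prod.collapse real_norm_def)
    qed simp
  qed
  finally show ?thesis .
qed

lemma ns_box_union_bound:
  fixes nsb :: "'i \<times> (nat \<Rightarrow> 'o) \<Rightarrow> ('x \<times> (nat \<Rightarrow> nat)) pmf"
  assumes "finite S"
  shows "measure_pmf.prob (nsb i) {(x, v). x = x0} \<le> measure_pmf.prob (nsb i) {(x, v). x = x0 \<and> (\<forall>k\<in>S. v k = w k)}
     + (\<Sum>k\<in>S. measure_pmf.prob (nsb i) {(x, v). x = x0 \<and> v k \<noteq> w k})"
proof -
  have "measure_pmf.prob (nsb i) {(x, v). x = x0} \<le> measure_pmf.prob (nsb i)
      ({(x, v). x = x0 \<and> (\<forall>k\<in>S. v k = w k)} \<union> (\<Union>k\<in>S. {(x, v). x = x0 \<and> v k \<noteq> w k}))"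
    by (intro measure_pmf.finite_measure_mono) auto
  also have "\<dots> \<le> measure_pmf.prob (nsb i) {(x, v). x = x0 \<and> (\<forall>k\<in>S. v k = w k)}
      + measure_pmf.prob (nsb i) (\<Union>k\<in>S. {(x, v). x = x0 \<and> v k \<noteq> w k})"
    by (rule measure_Un_le) auto
  also have "measure_pmf.prob (nsb i) (\<Union>k\<in>S. {(x, v). x = x0 \<and> v k \<noteq> w k})
     \<le> (\<Sum>k\<in>S. measure_pmf.prob (nsb i) {(x, v). x = x0 \<and> v k \<noteq> w k})"
    using assms by (intro measure_UNION_le) auto
  finally show ?thesis by simp
qed

section \<open>Exchangeable receivers and the finite-field converse\<close>

text \<open>An involution on coefficient indices that exchanges two receivers. It preserves the
  product law of the coefficients when the two receivers have the same neighbourhood, since then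
  matching coordinates have the same distribution.\<close>

definition row_swap :: "nat \<Rightarrow> nat \<Rightarrow> nat \<times> nat \<times> nat \<Rightarrow> nat \<times> nat \<times> nat" where
  "row_swap k k' = (\<lambda>(t, i, j). (t, if i = k then k' else if i = k' then k else i, j))"

lemma row_swap_involution[simp]: "row_swap k k' (row_swap k k' p) = p"
  by (cases p) (auto simp: row_swap_def)

lemma row_swap_bij: "bij (row_swap k k')"
  by (rule involuntory_imp_bij) simp

lemma row_swap_mem:
  assumes "k \<in> {1..K}" "k' \<in> {1..K}"
  shows "row_swap k k' p \<in> gain_idx n K B \<longleftrightarrow> p \<in> gain_idx n K B"
  using assms by (cases p) (auto simp: row_swap_def)

context finite_field
begin

lemma ff_coef_row_swap:
  assumes k: "k \<in> {1..K}" "k' \<in> {1..K}" and M: "\<And>j. j \<in> {1..B} \<Longrightarrow> M k j = M k' j"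
  shows "map_pmf (\<lambda>G. G \<circ> row_swap k k') (ff_coef F M K B n) = ff_coef F M K B n"
proof (rule pmf_eqI)
  fix G :: "nat \<times> nat \<times> nat \<Rightarrow> 'a"
  let ?\<pi> = "row_swap k k'" and ?A = "gain_idx n K B"
  let ?p = "\<lambda>(t::nat, k, j). if M k j then pmf_of_set (carrier F - {\<zero>}) else return_pmf \<zero>"
  have inj: "inj (\<lambda>G :: nat \<times> nat \<times> nat \<Rightarrow> 'a. G \<circ> ?\<pi>)"
    by (rule inj_on_inverseI[where g="\<lambda>G. G \<circ> ?\<pi>"]) (auto simp: fun_eq_iff)
  have p: "?p (?\<pi> x) = ?p x" if "x \<in> ?A" for x
    using that M by (cases x) (auto simp: row_swap_def)
  have "pmf (map_pmf (\<lambda>G. G \<circ> ?\<pi>) (ff_coef F M K B n)) ((G \<circ> ?\<pi>) \<circ> ?\<pi>) = pmf (ff_coef F M K B n) (G \<circ> ?\<pi>)"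
    by (rule pmf_map_inj'[OF inj])
  also have "(G \<circ> ?\<pi>) \<circ> ?\<pi> = G" by (auto simp: fun_eq_iff)
  also have "pmf (ff_coef F M K B n) (G \<circ> ?\<pi>) = pmf (ff_coef F M K B n) G"
  proof (cases "\<forall>x. x \<notin> ?A \<longrightarrow> G x = \<zero>")
    case True
    then have T2: "(G \<circ> ?\<pi>) x = \<zero>" if "x \<notin> ?A" for x
      using that unfolding comp_apply by (metis row_swap_mem[OF k])
    have "pmf (ff_coef F M K B n) (G \<circ> ?\<pi>) = (\<Prod>x\<in>?A. pmf (?p x) (G (?\<pi> x)))"
      unfolding ff_coef_def using T2 by (subst pmf_Pi) auto
    also have "\<dots> = (\<Prod>x\<in>?A. pmf (?p (?\<pi> x)) (G (?\<pi> x)))"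
      by (intro prod.cong refl arg_cong2[where f=pmf] p[symmetric])
    also have "\<dots> = (\<Prod>x\<in>?A. pmf (?p x) (G x))"
      by (rule prod.reindex_bij_witness[of _ ?\<pi> ?\<pi>]) (simp_all only: row_swap_involution row_swap_mem[OF k])
    also have "\<dots> = pmf (ff_coef F M K B n) G"
      unfolding ff_coef_def using True by (subst pmf_Pi) auto
    finally show ?thesis .
  next
    case False
    then obtain x where x: "x \<notin> ?A" "G x \<noteq> \<zero>" by blast
    then have "?\<pi> x \<notin> ?A" "(G \<circ> ?\<pi>) (?\<pi> x) \<noteq> \<zero>" by (simp_all only: row_swap_mem[OF k] comp_apply row_swap_involution not_False_eq_True)
    then have "\<exists>x. x \<notin> ?A \<and> (G \<circ> ?\<pi>) x \<noteq> \<zero>" by blast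
    then have "pmf (ff_coef F M K B n) (G \<circ> ?\<pi>) = 0"
      unfolding ff_coef_def by (rule pmf_Pi_outside[rotated]) simp
    moreover have "\<exists>x. x \<notin> ?A \<and> G x \<noteq> \<zero>" using x by blast
    then have "pmf (ff_coef F M K B n) G = 0"
      unfolding ff_coef_def by (rule pmf_Pi_outside[rotated]) simp
    ultimately show ?thesis by simp
  qed
  finally show "pmf (map_pmf (\<lambda>G. G \<circ> ?\<pi>) (ff_coef F M K B n)) G = pmf (ff_coef F M K B n) G" .
qed

lemma ff_obs_row_swap: "ff_obs F n B x (G \<circ> row_swap k k') k = ff_obs F n B x G k'"
  by (simp add: ff_obs_def row_swap_def fun_eq_iff)

text \<open>The error of a receiver involves only it and the transmitter, so all receivers of
  \<open>S\<close> may be fed the observation of \<open>k0\<close> without changing any of these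
  errors. With a common observation the joint success is enlarged by summing over all
  \<open>q ^ n\<close> output sequences; this cuts the dependence of the observation on the input,
  and for each output sequence the receivers merely guess.\<close>

theorem ff_ns_converse:
  assumes scheme: "ff_ns_scheme F K B n m nsb"
    and S: "S \<subseteq> {1..K}" "k0 \<in> S" and M: "\<And>k j. k \<in> S \<Longrightarrow> j \<in> {1..B} \<Longrightarrow> M k j = M k0 j"
    and err: "(\<Sum>k\<in>S. ff_ns_err F M K B n m nsb k) \<le> 1 / 2"
  shows "(\<Prod>k\<in>S. real (m k)) \<le> 2 * real (card (carrier F)) ^ n"
proof -
  define W where "W = msg_set K m"
  define coef where "coef = ff_coef F M K B n"
  define R where "R = (\<Prod>k\<in>{1..K} - S. m k)"
  have ns: "ns_box K nsb" and m1: "\<And>k. k \<in> {1..K} \<Longrightarrow> 1 \<le> m k"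
    and X: "\<And>i. fst ` set_pmf (nsb i) \<subseteq> ff_X F n B"
    using scheme unfolding ff_ns_scheme_def by blast+
  have finS: "finite S" using S by (auto intro: finite_subset)
  have cardW: "card W = R * (\<Prod>k\<in>S. m k)"
    unfolding W_def card_msg_set R_def using S by (intro prod.subset_diff) auto
  have Rpos: "0 < R" unfolding R_def using m1 by (intro prod_pos) force
  have Qpos: "0 < (\<Prod>k\<in>S. m k)" using m1 S by (intro prod_pos) force
  have Wpos: "0 < card W" using cardW Rpos Qpos by simp
  let ?pr = "\<lambda>w G x E. measure_pmf.prob (nsb (w, \<lambda>_. ff_obs F n B x G k0)) {(x', v). x' = x \<and> E v}"
  have intg: "integrable coef (\<lambda>G. measure_pmf.prob (p G) (E' G))" for p :: "_ \<Rightarrow> ('x \<times> (nat \<Rightarrow> nat)) pmf" and E'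
    by (rule measure_pmf.integrable_const_bound[where B=1]) auto
  \<comment> \<open>First no-signalling gives every party the observation of \<open>k\<close>, then
    exchanging the two rows of coefficients turns it into that of \<open>k0\<close>.\<close>
  have errk: "measure_pmf.expectation coef (\<lambda>G. measure_pmf.prob (nsb (w, \<lambda>k'. ff_obs F n B x G k')) {(x', v). x' = x \<and> v k \<noteq> w k})
     = measure_pmf.expectation coef (\<lambda>G. ?pr w G x (\<lambda>v. v k \<noteq> w k))" if k: "k \<in> S" for w x k
  proof -
    have kK: "k \<in> {1..K}" and k0K: "k0 \<in> {1..K}" using k S by auto
    have "measure_pmf.expectation coef (\<lambda>G. measure_pmf.prob (nsb (w, \<lambda>k'. ff_obs F n B x G k')) {(x', v). x' = x \<and> v k \<noteq> w k})
       = measure_pmf.expectation coef (\<lambda>G. measure_pmf.prob (nsb (w, \<lambda>_. ff_obs F n B x G k)) {(x', v). x' = x \<and> v k \<noteq> w k})"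
      by (intro Bochner_Integration.integral_cong refl ns_box_tx_rx[OF ns kK])
    also have "\<dots> = measure_pmf.expectation (map_pmf (\<lambda>G. G \<circ> row_swap k k0) coef)
        (\<lambda>G. measure_pmf.prob (nsb (w, \<lambda>_. ff_obs F n B x G k)) {(x', v). x' = x \<and> v k \<noteq> w k})"
      unfolding coef_def using M[OF k] by (subst ff_coef_row_swap[OF kK k0K]) auto
    also have "\<dots> = measure_pmf.expectation coef (\<lambda>G. ?pr w G x (\<lambda>v. v k \<noteq> w k))"
      unfolding integral_map_pmf ff_obs_row_swap ..
    finally show ?thesis .
  qed
  \<comment> \<open>The probability of emitting \<open>x\<close> does not depend on the
    observations, even though the observation inserted in each term is the one caused by
    \<open>x\<close>. Hence the terms add up to one.\<close>
  have total: "(\<Sum>x\<in>ff_X F n B. measure_pmf.expectation coef (\<lambda>G. ?pr w G x (\<lambda>_. True))) = 1" for w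
  proof -
    have "(\<Sum>x\<in>ff_X F n B. measure_pmf.expectation coef (\<lambda>G. ?pr w G x (\<lambda>_. True)))
      = (\<Sum>x\<in>ff_X F n B. pmf (map_pmf fst (nsb (w, \<lambda>_. undefined))) x)"
    proof (intro sum.cong refl)
      fix x
      have "?pr w G x (\<lambda>_. True) = pmf (map_pmf fst (nsb (w, \<lambda>_. undefined))) x" for G
        unfolding pmf_map using ns_box_tx[OF ns, of w "\<lambda>_. ff_obs F n B x G k0" x "\<lambda>_. undefined"]
        by (simp add: vimage_def split_def)
      then show "measure_pmf.expectation coef (\<lambda>G. ?pr w G x (\<lambda>_. True)) = pmf (map_pmf fst (nsb (w, \<lambda>_. undefined))) x"
        by simp
    qed
    also have "\<dots> = 1" using X by (intro sum_pmf_eq_1) auto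
    finally show ?thesis .
  qed
  have "real (card W) = (\<Sum>w\<in>W. \<Sum>x\<in>ff_X F n B. measure_pmf.expectation coef (\<lambda>G. ?pr w G x (\<lambda>_. True)))"
    by (simp only: total) simp
  also have "\<dots> \<le> (\<Sum>w\<in>W. \<Sum>x\<in>ff_X F n B. measure_pmf.expectation coef (\<lambda>G. ?pr w G x (\<lambda>v. \<forall>k\<in>S. v k = w k) + (\<Sum>k\<in>S. ?pr w G x (\<lambda>v. v k \<noteq> w k))))"
    by (intro sum_mono integral_mono Bochner_Integration.integrable_add Bochner_Integration.integrable_sum intg)
      (use ns_box_union_bound[OF finS] in simp)
  also have "\<dots> = (\<Sum>w\<in>W. \<Sum>x\<in>ff_X F n B. measure_pmf.expectation coef (\<lambda>G. ?pr w G x (\<lambda>v. \<forall>k\<in>S. v k = w k)))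
      + (\<Sum>k\<in>S. \<Sum>w\<in>W. \<Sum>x\<in>ff_X F n B. measure_pmf.expectation coef (\<lambda>G. ?pr w G x (\<lambda>v. v k \<noteq> w k)))"
    (is "_ = ?good + ?bad")
  proof -
    have "measure_pmf.expectation coef (\<lambda>G. ?pr w G x (\<lambda>v. \<forall>k\<in>S. v k = w k) + (\<Sum>k\<in>S. ?pr w G x (\<lambda>v. v k \<noteq> w k)))
      = measure_pmf.expectation coef (\<lambda>G. ?pr w G x (\<lambda>v. \<forall>k\<in>S. v k = w k)) + (\<Sum>k\<in>S. measure_pmf.expectation coef (\<lambda>G. ?pr w G x (\<lambda>v. v k \<noteq> w k)))" for w x
      by (subst Bochner_Integration.integral_add) (auto intro!: intg Bochner_Integration.integrable_sum simp: Bochner_Integration.integral_sum[OF intg])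
    then show ?thesis
      by (simp add: sum.distrib sum.swap[of _ _ S])
  qed
  also have "?bad = (\<Sum>k\<in>S. real (card W) * ff_ns_err F M K B n m nsb k)"
  proof (intro sum.cong refl)
    fix k assume k: "k \<in> S"
    show "(\<Sum>w\<in>W. \<Sum>x\<in>ff_X F n B. measure_pmf.expectation coef (\<lambda>G. ?pr w G x (\<lambda>v. v k \<noteq> w k))) = real (card W) * ff_ns_err F M K B n m nsb k"
      unfolding ff_ns_err_def W_def[symmetric] coef_def[symmetric] errk[OF k] using Wpos by simp
  qed
  also have "\<dots> \<le> real (card W) * (1 / 2)"
    unfolding sum_distrib_left[symmetric] using err by (intro mult_left_mono) auto
  also have "?good = measure_pmf.expectation coef (\<lambda>G. \<Sum>w\<in>W. \<Sum>x\<in>ff_X F n B. ?pr w G x (\<lambda>v. \<forall>k\<in>S. v k = w k))"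
    by (simp add: Bochner_Integration.integral_sum Bochner_Integration.integrable_sum intg)
  also have "\<dots> \<le> real (card (carrier F)) ^ n * real R"
  proof (rule measure_pmf.integral_le_const)
    show "integrable coef (\<lambda>G. \<Sum>w\<in>W. \<Sum>x\<in>ff_X F n B. ?pr w G x (\<lambda>v. \<forall>k\<in>S. v k = w k))"
      by (intro Bochner_Integration.integrable_sum intg)
    show "AE G in coef. (\<Sum>w\<in>W. \<Sum>x\<in>ff_X F n B. ?pr w G x (\<lambda>v. \<forall>k\<in>S. v k = w k)) \<le> real (card (carrier F)) ^ n * real R"
    proof (rule AE_pmfI)
      fix G assume G: "G \<in> set_pmf coef"
      let ?q = "\<lambda>w y x. measure_pmf.prob (nsb (w, \<lambda>_. ff_mk F n k0 G y)) {(x', v). x' = x \<and> (\<forall>k\<in>S. v k = w k)}"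
      \<comment> \<open>The actual output is one of the sequences in \<open>ff_Y F n\<close>; after
        summing over all of them the observation no longer depends on \<open>x\<close>, and the
        events for different \<open>x\<close> are disjoint.\<close>
      have "(\<Sum>w\<in>W. \<Sum>x\<in>ff_X F n B. ?pr w G x (\<lambda>v. \<forall>k\<in>S. v k = w k)) \<le> (\<Sum>w\<in>W. \<Sum>x\<in>ff_X F n B. \<Sum>y\<in>ff_Y F n. ?q w y x)"
      proof (intro sum_mono)
        fix w x assume x: "x \<in> ff_X F n B"
        have y: "restrict (ff_sig F B k0 G x) {..<n} \<in> ff_Y F n"
          using G x unfolding ff_Y_def coef_def by (auto intro!: ff_sig_closed dest: ff_coef_carrier ff_X_carrier)
        show "?pr w G x (\<lambda>v. \<forall>k\<in>S. v k = w k) \<le> (\<Sum>y\<in>ff_Y F n. ?q w y x)"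
          unfolding ff_obs_eq_mk by (rule member_le_sum[OF y]) auto
      qed
      also have "\<dots> = (\<Sum>y\<in>ff_Y F n. \<Sum>w\<in>W. \<Sum>x\<in>ff_X F n B. ?q w y x)"
        by (subst (2) sum.swap, subst sum.swap) simp
      also have "\<dots> \<le> (\<Sum>y\<in>ff_Y F n. real R)"
      proof (intro sum_mono)
        fix y
        have "(\<Sum>w\<in>W. \<Sum>x\<in>ff_X F n B. ?q w y x) \<le> (\<Sum>w\<in>W. measure_pmf.prob (nsb (w, \<lambda>_. ff_mk F n k0 G y)) {(x', v). \<forall>k\<in>S. v k = w k})"
        proof (intro sum_mono)
          fix w
          have "(\<Sum>x\<in>ff_X F n B. ?q w y x) = measure_pmf.prob (nsb (w, \<lambda>_. ff_mk F n k0 G y)) (\<Union>x\<in>ff_X F n B. {(x', v). x' = x \<and> (\<forall>k\<in>S. v k = w k)})"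
            by (intro measure_pmf.finite_measure_finite_Union[symmetric]) (auto simp: disjoint_family_on_def)
          also have "\<dots> \<le> measure_pmf.prob (nsb (w, \<lambda>_. ff_mk F n k0 G y)) {(x', v). \<forall>k\<in>S. v k = w k}"
            by (intro measure_pmf.finite_measure_mono) auto
          finally show "(\<Sum>x\<in>ff_X F n B. ?q w y x) \<le> \<dots>" .
        qed
        also have "\<dots> \<le> real R" unfolding W_def R_def by (rule ns_box_guess_sum[OF ns S(1)])
        finally show "(\<Sum>w\<in>W. \<Sum>x\<in>ff_X F n B. ?q w y x) \<le> real R" .
      qed
      also have "\<dots> = real (card (carrier F)) ^ n * real R"
        by (simp add: ff_Y_def card_PiE)
      finally show "(\<Sum>w\<in>W. \<Sum>x\<in>ff_X F n B. ?pr w G x (\<lambda>v. \<forall>k\<in>S. v k = w k)) \<le> real (card (carrier F)) ^ n * real R" .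
    qed
  qed
  finally have "real (card W) \<le> real (card (carrier F)) ^ n * real R + real (card W) * (1 / 2)" by simp
  then have "real R * real (\<Prod>k\<in>S. m k) \<le> real R * (2 * real (card (carrier F)) ^ n)"
    unfolding cardW by (simp add: algebra_simps)
  then show ?thesis using Rpos by simp
qed

end

section \<open>The converse with non-signalling boxes for the Gaussian channel\<close>

lemma gGain_row_swap:
  assumes adm: "admissible_density f c" and k: "k \<in> {1..K}" "k' \<in> {1..K}" and M: "\<And>j. j \<in> {1..B} \<Longrightarrow> M k j = M k' j"
    and H: "H \<in> borel_measurable (\<Pi>\<^sub>M p\<in>gain_idx n K B. borel)"
  shows "(\<integral>\<^sup>+g. H g \<partial>gGain M K B n f) = (\<integral>\<^sup>+g. H (\<lambda>p\<in>gain_idx n K B. g (row_swap k k' p)) \<partial>gGain M K B n f)"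
proof -
  let ?I = "gain_idx n K B" and ?\<pi> = "row_swap k k'"
  let ?Mm = "\<lambda>p. case p of (\<tau>::nat, k, j) \<Rightarrow> if M k j then density lborel (\<lambda>x. ennreal (f x)) else return borel 0"
  have ps: "prob_space (?Mm p)" for p
    using prob_space_density_f[OF adm] by (auto split: prod.splits intro: prob_space_return)
  have sets_Mm: "sets (?Mm p) = sets borel" for p by (auto split: prod.splits)
  have Mm: "?Mm (?\<pi> p) = ?Mm p" if "p \<in> ?I" for p
    using that M by (cases p) (auto simp: row_swap_def)
  have "distr (PiM ?I ?Mm) (\<Pi>\<^sub>M p\<in>?I. ?Mm (?\<pi> p)) (\<lambda>g. \<lambda>p\<in>?I. g (?\<pi> p)) = (\<Pi>\<^sub>M p\<in>?I. ?Mm (?\<pi> p))"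
  proof (rule distr_PiM_reindex[OF ps])
    show "inj_on ?\<pi> ?I" using row_swap_bij by (auto simp: bij_def intro: inj_on_subset)
    show "?\<pi> \<in> ?I \<rightarrow> ?I" by (simp only: Pi_iff row_swap_mem[OF k]) simp
  qed
  moreover have "(\<Pi>\<^sub>M p\<in>?I. ?Mm (?\<pi> p)) = PiM ?I ?Mm"
    by (intro PiM_cong refl Mm)
  ultimately have eq: "distr (PiM ?I ?Mm) (PiM ?I ?Mm) (\<lambda>g. \<lambda>p\<in>?I. g (?\<pi> p)) = PiM ?I ?Mm"
    by (simp only:)
  have setsI: "sets (PiM ?I ?Mm) = sets (\<Pi>\<^sub>M p\<in>?I. borel)" by (intro sets_PiM_cong refl sets_Mm)
  have m: "(\<lambda>g. \<lambda>p\<in>?I. g (?\<pi> p)) \<in> PiM ?I ?Mm \<rightarrow>\<^sub>M PiM ?I ?Mm"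
    unfolding measurable_cong_sets[OF setsI setsI]
  proof (intro measurable_restrict measurable_component_singleton)
    show "?\<pi> p \<in> ?I" if "p \<in> ?I" for p using that by (simp only: row_swap_mem[OF k])
  qed
  have Hm: "H \<in> borel_measurable (PiM ?I ?Mm)" using H by (simp only: measurable_cong_sets[OF setsI refl])
  have "(\<integral>\<^sup>+g. H g \<partial>PiM ?I ?Mm) = (\<integral>\<^sup>+g. H g \<partial>distr (PiM ?I ?Mm) (PiM ?I ?Mm) (\<lambda>g. \<lambda>p\<in>?I. g (?\<pi> p)))"
    by (simp only: eq)
  also have "\<dots> = (\<integral>\<^sup>+g. H (\<lambda>p\<in>?I. g (?\<pi> p)) \<partial>PiM ?I ?Mm)"
    by (subst nn_integral_distr[OF m]) (use Hm in simp_all)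
  finally show ?thesis by (simp only: gGain_def)
qed

text \<open>Once the noise is integrated out against its density, the two receivers differ only in
  their row of gains, and those rows are exchangeable.\<close>

lemma gobs_row_swap:
  assumes adm: "admissible_density f c" and k: "k \<in> {1..K}" "k' \<in> {1..K}" and M: "\<And>j. j \<in> {1..B} \<Longrightarrow> M k j = M k' j"
    and F[measurable]: "F \<in> borel_measurable (gOM n B)"
  shows "(\<integral>\<^sup>+s. F (gobs n B x s k) \<partial>gState M K B n f) = (\<integral>\<^sup>+s. F (gobs n B x s k') \<partial>gState M K B n f)"
proof -
  let ?I = "gain_idx n K B"
  interpret L: sigma_finite_measure "gRecv n" by (rule sigma_finite_gRecv)
  let ?H = "\<lambda>g. \<integral>\<^sup>+y. gkernel std_normal_density n B k g y x * F (gmk n B k g y) \<partial>gRecv n"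
  \<comment> \<open>\<open>x\<close> is an arbitrary function here. The kernel reads it only on the
    index set, and its restriction is a point of \<open>gX\<close>, as measurability
    demands.\<close>
  have xr: "gkernel \<psi> n B k g y x = gkernel \<psi> n B k g y (restrict x ({..<n} \<times> {1..B}))" for \<psi> g y
    by (simp add: gkernel_def gsig_def)
  have xm: "restrict x ({..<n} \<times> {1..B}) \<in> space (gX n B)" by (simp add: gX_def space_PiM)
  have Hm: "?H \<in> borel_measurable (\<Pi>\<^sub>M p\<in>?I. borel)"
    unfolding xr
  proof (rule L.borel_measurable_nn_integral)
    let ?R = "(\<Pi>\<^sub>M p\<in>?I. borel) \<Otimes>\<^sub>M gRecv n"
    have [measurable]: "(\<lambda>z. gkernel std_normal_density n B k (fst z) (snd z) (restrict x ({..<n} \<times> {1..B}))) \<in> borel_measurable ?R"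
      by (rule measurable_gkernel[OF k(1)]) (use xm in measurable)
    have [measurable]: "(\<lambda>z. F (gmk n B k (fst z) (snd z))) \<in> borel_measurable ?R"
      by (rule measurable_compose[OF measurable_gmk[OF k(1)] F]) measurable
    show "(\<lambda>(g, y). gkernel std_normal_density n B k g y (restrict x ({..<n} \<times> {1..B})) * F (gmk n B k g y)) \<in> borel_measurable ?R"
      unfolding split_def by measurable
  qed
  have "(\<integral>\<^sup>+s. F (gobs n B x s k) \<partial>gState M K B n f) = (\<integral>\<^sup>+g. ?H g \<partial>gGain M K B n f)"
    by (rule gobs_nn_integral[OF adm k(1) F])
  also have "\<dots> = (\<integral>\<^sup>+g. ?H (\<lambda>p\<in>?I. g (row_swap k k' p)) \<partial>gGain M K B n f)"
    using M by (rule gGain_row_swap[OF adm k _ Hm])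
  also have "\<dots> = (\<integral>\<^sup>+g. \<integral>\<^sup>+y. gkernel std_normal_density n B k' g y x * F (gmk n B k' g y) \<partial>gRecv n \<partial>gGain M K B n f)"
  proof (intro nn_integral_cong arg_cong2[where f="(*)"] arg_cong[where f=F])
    fix g :: "nat \<times> nat \<times> nat \<Rightarrow> real" and y
    have sw: "(\<lambda>p\<in>?I. g (row_swap k k' p)) (\<tau>, k, j) = g (\<tau>, k', j)" if "\<tau> < n" "j \<in> {1..B}" for \<tau> j
    proof -
      have "(\<tau>, k, j) \<in> ?I" using that k by auto
      then show ?thesis by (simp add: row_swap_def del: mem_Sigma_iff)
    qed
    show "gkernel std_normal_density n B k (\<lambda>p\<in>?I. g (row_swap k k' p)) y x = gkernel std_normal_density n B k' g y x"
    proof -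
      have "gsig B k (\<lambda>p\<in>?I. g (row_swap k k' p)) x \<tau> = gsig B k' g x \<tau>" if "\<tau> < n" for \<tau>
        unfolding gsig_def by (intro sum.cong refl arg_cong2[where f="(*)"] sw that)
      then show ?thesis unfolding gkernel_def by (intro prod.cong refl) (simp only: lessThan_iff)
    qed
    show "gmk n B k (\<lambda>p\<in>?I. g (row_swap k k' p)) y = gmk n B k' g y"
      unfolding gmk_def
    proof (intro restrict_ext)
      fix \<tau> assume \<tau>: "\<tau> \<in> {..<n}"
      have "(\<lambda>j\<in>{1..B}. (\<lambda>p\<in>?I. g (row_swap k k' p)) (\<tau>, k, j)) = (\<lambda>j\<in>{1..B}. g (\<tau>, k', j))"
        using \<tau> by (intro restrict_ext sw) auto
      then show "(y \<tau>, \<lambda>j\<in>{1..B}. (\<lambda>p\<in>?I. g (row_swap k k' p)) (\<tau>, k, j)) = (y \<tau>, \<lambda>j\<in>{1..B}. g (\<tau>, k', j))"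
        by (simp only:)
    qed
  qed
  also have "\<dots> = (\<integral>\<^sup>+s. F (gobs n B x s k') \<partial>gState M K B n f)"
    by (rule gobs_nn_integral[OF adm k(2) F, symmetric])
  finally show ?thesis .
qed

text \<open>From \<open>y\<^sup>2 \<le> 2 * u\<^sup>2 + 2 * (y - u)\<^sup>2\<close>; the variance at
  least 2 lets the exponent of the shifted unit normal absorb the last term. A single wide normal
  law thus dominates the output laws of all signals.\<close>

lemma std_normal_shift_le:
  assumes s: "2 \<le> \<sigma>\<^sup>2" "0 < \<sigma>"
  shows "std_normal_density (y - u) \<le> \<sigma> * exp (u\<^sup>2 / \<sigma>\<^sup>2) * normal_density 0 \<sigma> y"
proof -
  have "y\<^sup>2 \<le> 2 * u\<^sup>2 + 2 * (y - u)\<^sup>2"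
    using sum_squares_bound[of u "y - u"] by (simp add: power2_eq_square algebra_simps)
  then have "y\<^sup>2 / (2 * \<sigma>\<^sup>2) \<le> (2 * u\<^sup>2 + 2 * (y - u)\<^sup>2) / (2 * \<sigma>\<^sup>2)"
    using s by (intro divide_right_mono) auto
  also have "\<dots> = u\<^sup>2 / \<sigma>\<^sup>2 + (y - u)\<^sup>2 / \<sigma>\<^sup>2" using s by (simp add: field_simps)
  also have "(y - u)\<^sup>2 / \<sigma>\<^sup>2 \<le> (y - u)\<^sup>2 / 2" using s by (intro divide_left_mono) auto
  finally have e: "- (y - u)\<^sup>2 / 2 \<le> u\<^sup>2 / \<sigma>\<^sup>2 + - (y\<^sup>2 / (2 * \<sigma>\<^sup>2))" by simp
  have "std_normal_density (y - u) = 1 / sqrt (2 * pi) * exp (- (y - u)\<^sup>2 / 2)"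
    by (simp add: std_normal_density_def)
  also have "\<dots> \<le> 1 / sqrt (2 * pi) * exp (u\<^sup>2 / \<sigma>\<^sup>2 + - (y\<^sup>2 / (2 * \<sigma>\<^sup>2)))"
    using e by (intro mult_left_mono) auto
  also have "\<dots> = \<sigma> * exp (u\<^sup>2 / \<sigma>\<^sup>2) * normal_density 0 \<sigma> y"
    using s by (simp add: normal_density_def real_sqrt_mult mult_exp_exp)
  finally show ?thesis .
qed

text \<open>The variance \<open>2 + P\<close> is at least 2, for the preceding comparison, and at
  least \<open>P\<close>, so that the total signal energy divided by it is at most
  \<open>4 * c\<^sup>2 * real B\<close> per use. The factor grows like the square root of
  \<open>P\<close>.\<close>

lemma gkernel_le_reference:
  assumes g: "\<And>\<tau> j. \<tau> < n \<Longrightarrow> j \<in> {1..B} \<Longrightarrow> \<bar>g (\<tau>, k, j)\<bar> \<le> c"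
    and P: "0 < P" and x: "gpow n B x \<le> 4 * P" and n: "0 < n"
  shows "gkernel std_normal_density n B k g y x
    \<le> ennreal ((sqrt (2 + P) * exp (4 * c\<^sup>2 * real B)) ^ n) * (\<Prod>\<tau><n. ennreal (normal_density 0 (sqrt (2 + P)) (y \<tau>)))"
proof -
  let ?s = "sqrt (2 + P)"
  have s2: "?s\<^sup>2 = 2 + P" "0 < ?s" using P by auto
  let ?u = "gsig B k g x"
  have slot: "(?u \<tau>)\<^sup>2 \<le> c\<^sup>2 * real B * (\<Sum>j\<in>{1..B}. (x (\<tau>, j))\<^sup>2)" if \<tau>: "\<tau> < n" for \<tau>
  proof -
    have "(?u \<tau>)\<^sup>2 \<le> (\<Sum>j\<in>{1..B}. (g (\<tau>, k, j))\<^sup>2) * (\<Sum>j\<in>{1..B}. (x (\<tau>, j))\<^sup>2)"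
      unfolding gsig_def by (rule Cauchy_Schwarz_ineq_sum)
    also have "\<dots> \<le> (c\<^sup>2 * real B) * (\<Sum>j\<in>{1..B}. (x (\<tau>, j))\<^sup>2)"
    proof (intro mult_right_mono sum_nonneg)
      have "(\<Sum>j\<in>{1..B}. (g (\<tau>, k, j))\<^sup>2) \<le> (\<Sum>j\<in>{1..B}. c\<^sup>2)"
        using \<tau> g by (intro sum_mono) (metis abs_ge_zero power2_abs power_mono)
      then show "(\<Sum>j\<in>{1..B}. (g (\<tau>, k, j))\<^sup>2) \<le> c\<^sup>2 * real B" by (simp add: mult.commute)
    qed auto
    finally show ?thesis .
  qed
  have "(\<Sum>\<tau><n. (?u \<tau>)\<^sup>2) \<le> (\<Sum>\<tau><n. c\<^sup>2 * real B * (\<Sum>j\<in>{1..B}. (x (\<tau>, j))\<^sup>2))"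
    by (intro sum_mono slot) auto
  also have "\<dots> = c\<^sup>2 * real B * (real n * gpow n B x)"
  proof -
    have "real n * gpow n B x = (\<Sum>\<tau><n. \<Sum>j\<in>{1..B}. (x (\<tau>, j))\<^sup>2)" using n by (simp add: gpow_def)
    then show ?thesis by (simp only: sum_distrib_left[symmetric])
  qed
  also have "\<dots> \<le> c\<^sup>2 * real B * (real n * (4 * P))"
    using x by (intro mult_left_mono) auto
  finally have tot: "(\<Sum>\<tau><n. (?u \<tau>)\<^sup>2) \<le> 4 * c\<^sup>2 * real B * real n * P" by (simp add: mult_ac)
  have "(\<Sum>\<tau><n. (?u \<tau>)\<^sup>2 / (2 + P)) = (\<Sum>\<tau><n. (?u \<tau>)\<^sup>2) / (2 + P)"
    by (simp add: sum_divide_distrib)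
  also have "\<dots> \<le> 4 * c\<^sup>2 * real B * real n * P / (2 + P)"
    using tot P by (intro divide_right_mono) auto
  also have "\<dots> \<le> 4 * c\<^sup>2 * real B * real n * 1"
    unfolding times_divide_eq_right[symmetric] using P by (intro mult_left_mono) auto
  finally have ex: "(\<Sum>\<tau><n. (?u \<tau>)\<^sup>2 / (2 + P)) \<le> real n * (4 * c\<^sup>2 * real B)" by (simp add: mult_ac)
  have "gkernel std_normal_density n B k g y x \<le> (\<Prod>\<tau><n. ennreal (?s * exp ((?u \<tau>)\<^sup>2 / (2 + P)) * normal_density 0 ?s (y \<tau>)))"
    unfolding gkernel_def
    by (intro prod_mono_ennreal ennreal_leI) (use std_normal_shift_le[of ?s] s2 P in simp)
  also have "\<dots> = ennreal (?s ^ n * exp (\<Sum>\<tau><n. (?u \<tau>)\<^sup>2 / (2 + P))) * (\<Prod>\<tau><n. ennreal (normal_density 0 ?s (y \<tau>)))"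
    using P by (simp add: prod_ennreal prod.distrib exp_sum ennreal_mult[symmetric] prod_nonneg)
  also have "\<dots> \<le> ennreal ((?s * exp (4 * c\<^sup>2 * real B)) ^ n) * (\<Prod>\<tau><n. ennreal (normal_density 0 ?s (y \<tau>)))"
    using ex P unfolding power_mult_distrib exp_of_nat_mult[symmetric]
    by (intro mult_right_mono ennreal_leI mult_left_mono) auto
  finally show ?thesis .
qed

text \<open>The sum over all outputs of the finite-field argument becomes an integral against the
  product of wide normal laws, which is a probability. Of the total mass a quarter is lost to inputs
  of power above \<open>4 * P\<close> and a quarter to errors, so half remains to be bounded by
  guessing.\<close>

theorem gauss_ns_converse:
  assumes adm: "admissible_density f c"
    and P: "0 < P" and n: "0 < n"
    and scheme: "g_ns_scheme K B n P m f M nsb A"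
    and S: "S \<subseteq> {1..K}" "k0 \<in> S" and M: "\<And>k j. k \<in> S \<Longrightarrow> j \<in> {1..B} \<Longrightarrow> M k j = M k0 j"
    and err: "(\<Sum>k\<in>S. g_ns_err M K B f n m nsb A k) \<le> 1 / 4"
  shows "(\<Prod>k\<in>S. real (m k)) \<le> 2 * (sqrt (2 + P) * exp (4 * c\<^sup>2 * real B)) ^ n"
proof -
  define W where "W = msg_set K m"
  define R where "R = (\<Prod>k\<in>{1..K} - S. m k)"
  define St where "St = gState M K B n f"
  define XA where "XA = fst ` A"
  define \<Gamma> where "\<Gamma> = (sqrt (2 + P) * exp (4 * c\<^sup>2 * real B)) ^ n"
  have ns: "ns_box K nsb" and m1: "\<And>k. k \<in> {1..K} \<Longrightarrow> 1 \<le> m k" and finA: "finite A"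
    and A: "\<And>i. set_pmf (nsb i) \<subseteq> A"
    and meas: "\<And>w a. (\<lambda>ob. pmf (nsb (w, ob)) a) \<in> borel_measurable (\<Pi>\<^sub>M k\<in>{1..K}. gOM n B)"
    and pow: "(\<Sum>w\<in>W. \<Sum>x\<in>XA. \<integral>s. measure_pmf.prob (nsb (w, \<lambda>k\<in>{1..K}. gobs n B x s k)) {p. fst p = x} * gpow n B x \<partial>St)
       \<le> P * real (card W)"
    using scheme unfolding g_ns_scheme_def W_def XA_def St_def by blast+
  have k0: "k0 \<in> {1..K}" using S by auto
  have finS: "finite S" using S by (auto intro: finite_subset)
  have finX: "finite XA" by (simp add: XA_def finA)
  have cardW: "card W = R * (\<Prod>k\<in>S. m k)"
    unfolding W_def card_msg_set R_def using S by (intro prod.subset_diff) auto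
  have Rpos: "0 < R" unfolding R_def using m1 by (intro prod_pos) force
  have Qpos: "0 < (\<Prod>k\<in>S. m k)" using m1 S by (intro prod_pos) force
  have Wpos: "0 < card W" using cardW Rpos Qpos by simp
  interpret St: prob_space St unfolding St_def by (rule prob_space_gState[OF adm])
  \<comment> \<open>With finite output alphabet every event probability is a finite sum of point
    masses, whose measurability in the observations is part of the scheme.\<close>
  have prob_eq: "measure_pmf.prob (nsb i) E = (\<Sum>a\<in>A \<inter> E. pmf (nsb i) a)" for i E
  proof -
    have "measure_pmf.prob (nsb i) E = measure_pmf.prob (nsb i) (A \<inter> E)"
      by (rule measure_prob_cong_0) (use A[of i] in \<open>auto simp: set_pmf_iff\<close>)
    also have "\<dots> = (\<Sum>a\<in>A \<inter> E. pmf (nsb i) a)"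
      using finA by (simp add: measure_measure_pmf_finite)
    finally show ?thesis .
  qed
  have pm: "(\<lambda>ob. measure_pmf.prob (nsb (w, ob)) E) \<in> borel_measurable (\<Pi>\<^sub>M k\<in>{1..K}. gOM n B)" for w E
    unfolding prob_eq by (intro borel_measurable_sum meas)
  \<comment> \<open>Feeds one observation to all receivers.\<close>
  have diag: "(\<lambda>o'. \<lambda>k\<in>{1..K}. o') \<in> gOM n B \<rightarrow>\<^sub>M (\<Pi>\<^sub>M k\<in>{1..K}. gOM n B)"
    by (intro measurable_restrict) simp
  have obsm: "(\<lambda>s. \<lambda>k\<in>{1..K}. gobs n B x s k) \<in> St \<rightarrow>\<^sub>M (\<Pi>\<^sub>M k\<in>{1..K}. gOM n B)" for x
    unfolding St_def by (intro measurable_restrict measurable_gobs)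
  let ?F = "\<lambda>w E o'. ennreal (measure_pmf.prob (nsb (w, \<lambda>k\<in>{1..K}. o')) E)"
  have Fm: "?F w E \<in> borel_measurable (gOM n B)" for w E
    using measurable_compose[OF diag pm[of w E]] by measurable
  have Fs: "(\<lambda>s. ?F w E (gobs n B x s k)) \<in> borel_measurable St" if "k \<in> {1..K}" for w E x k
    unfolding St_def by (rule measurable_compose[OF measurable_gobs[OF that] Fm])
  let ?ev = "\<lambda>x E. {(x', v). x' = x \<and> E v}"
  let ?T = "\<lambda>w x E. \<integral>\<^sup>+s. ?F w (?ev x E) (gobs n B x s k0) \<partial>St"
  have pms: "(\<lambda>s. measure_pmf.prob (nsb (w, \<lambda>k\<in>{1..K}. gobs n B x s k)) E) \<in> borel_measurable St" for w x E
    by (rule measurable_compose[OF obsm pm])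
  have ns_int: "(\<integral>s. measure_pmf.prob (nsb (w, \<lambda>k\<in>{1..K}. gobs n B x s k)) E \<partial>St) \<ge> 0" for w x E
    by (rule Bochner_Integration.integral_nonneg) simp
  have nn_int: "ennreal (\<integral>s. measure_pmf.prob (nsb (w, \<lambda>k\<in>{1..K}. gobs n B x s k)) E \<partial>St)
      = (\<integral>\<^sup>+s. ennreal (measure_pmf.prob (nsb (w, \<lambda>k\<in>{1..K}. gobs n B x s k)) E) \<partial>St)" for w x E
    by (rule nn_integral_eq_integral[symmetric], rule St.integrable_const_bound[where B=1, OF _ pms]) auto
  have errk: "(\<Sum>w\<in>W. \<Sum>x\<in>XA. ?T w x (\<lambda>v. v k \<noteq> w k)) = ennreal (real (card W) * g_ns_err M K B f n m nsb A k)"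
    if k: "k \<in> S" for k
  proof -
    have kK: "k \<in> {1..K}" using k S by auto
    have "?T w x (\<lambda>v. v k \<noteq> w k) = ennreal (\<integral>s. measure_pmf.prob (nsb (w, \<lambda>k'\<in>{1..K}. gobs n B x s k')) (?ev x (\<lambda>v. v k \<noteq> w k)) \<partial>St)" for w x
    proof -
      have "?T w x (\<lambda>v. v k \<noteq> w k) = (\<integral>\<^sup>+s. ?F w (?ev x (\<lambda>v. v k \<noteq> w k)) (gobs n B x s k) \<partial>St)"
        unfolding St_def using M[OF k] by (intro gobs_row_swap[OF adm k0 kK _ Fm]) auto
      also have "\<dots> = (\<integral>\<^sup>+s. ennreal (measure_pmf.prob (nsb (w, \<lambda>k'\<in>{1..K}. gobs n B x s k')) (?ev x (\<lambda>v. v k \<noteq> w k))) \<partial>St)"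
        by (intro nn_integral_cong arg_cong[where f=ennreal] ns_box_tx_rx[OF ns kK]) (use kK in simp)
      finally show ?thesis by (simp only: nn_int)
    qed
    then have "(\<Sum>w\<in>W. \<Sum>x\<in>XA. ?T w x (\<lambda>v. v k \<noteq> w k))
      = (\<Sum>w\<in>W. \<Sum>x\<in>XA. ennreal (\<integral>s. measure_pmf.prob (nsb (w, \<lambda>k'\<in>{1..K}. gobs n B x s k')) (?ev x (\<lambda>v. v k \<noteq> w k)) \<partial>St))"
      by (simp only:)
    also have "\<dots> = ennreal (\<Sum>w\<in>W. \<Sum>x\<in>XA. \<integral>s. measure_pmf.prob (nsb (w, \<lambda>k'\<in>{1..K}. gobs n B x s k')) (?ev x (\<lambda>v. v k \<noteq> w k)) \<partial>St)"
      using ns_int by (simp add: sum_ennreal sum_nonneg)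
    also have "(\<Sum>w\<in>W. \<Sum>x\<in>XA. \<integral>s. measure_pmf.prob (nsb (w, \<lambda>k'\<in>{1..K}. gobs n B x s k')) (?ev x (\<lambda>v. v k \<noteq> w k)) \<partial>St)
       = real (card W) * g_ns_err M K B f n m nsb A k"
      using Wpos by (simp add: g_ns_err_def W_def[symmetric] XA_def[symmetric] St_def[symmetric])
    finally show ?thesis .
  qed
  \<comment> \<open>The emission probability is the same for every observation; this evaluates both
    the total mass and the power constraint.\<close>
  have tot1: "measure_pmf.prob (nsb (w, ob)) (?ev x (\<lambda>_. True)) = pmf (map_pmf fst (nsb (w, \<lambda>_. undefined))) x" for w ob x
    unfolding pmf_map using ns_box_tx[OF ns, of w ob x "\<lambda>_. undefined"]
    by (simp add: vimage_def split_def)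
  have tot2: "(\<Sum>x\<in>XA. pmf (map_pmf fst (nsb (w, \<lambda>_. undefined))) x) = 1" for w
    using A by (intro sum_pmf_eq_1 finX) (auto simp: XA_def)
  let ?t = "\<lambda>w x. pmf (map_pmf fst (nsb (w, \<lambda>_. undefined))) x"
  define G where "G = {x\<in>XA. gpow n B x \<le> 4 * P}"
  have bad: "(\<Sum>w\<in>W. \<Sum>x\<in>XA - G. ?t w x) \<le> real (card W) / 4"
  proof -
    have "(\<Sum>w\<in>W. \<Sum>x\<in>XA - G. ?t w x) \<le> (\<Sum>w\<in>W. \<Sum>x\<in>XA. ?t w x * gpow n B x / (4 * P))"
    proof (intro sum_mono)
      fix w
      have "(\<Sum>x\<in>XA - G. ?t w x) \<le> (\<Sum>x\<in>XA - G. ?t w x * gpow n B x / (4 * P))"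
      proof (intro sum_mono)
        fix x assume "x \<in> XA - G"
        then have "?t w x * 1 \<le> ?t w x * (gpow n B x / (4 * P))"
          using P by (intro mult_left_mono) (auto simp: G_def)
        then show "?t w x \<le> ?t w x * gpow n B x / (4 * P)" by simp
      qed
      also have "\<dots> \<le> (\<Sum>x\<in>XA. ?t w x * gpow n B x / (4 * P))"
        using P by (intro sum_mono2 finX) (auto intro!: divide_nonneg_nonneg mult_nonneg_nonneg)
      finally show "(\<Sum>x\<in>XA - G. ?t w x) \<le> \<dots>" .
    qed
    also have "\<dots> = (\<Sum>w\<in>W. \<Sum>x\<in>XA. ?t w x * gpow n B x) / (4 * P)"
      by (simp add: sum_divide_distrib)
    also have "(\<Sum>w\<in>W. \<Sum>x\<in>XA. ?t w x * gpow n B x)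
       = (\<Sum>w\<in>W. \<Sum>x\<in>XA. \<integral>s. measure_pmf.prob (nsb (w, \<lambda>k\<in>{1..K}. gobs n B x s k)) {p. fst p = x} * gpow n B x \<partial>St)"
    proof (intro sum.cong refl)
      fix w and x :: "nat \<times> nat \<Rightarrow> real"
      have "measure_pmf.prob (nsb (w, ob)) {p. fst p = x} = ?t w x" for ob
        using tot1[of w ob x] by (simp add: split_def)
      then show "?t w x * gpow n B x = (\<integral>s. measure_pmf.prob (nsb (w, \<lambda>k\<in>{1..K}. gobs n B x s k)) {p. fst p = x} * gpow n B x \<partial>St)"
        by (simp add: St.prob_space)
    qed
    also have "\<dots> / (4 * P) \<le> P * real (card W) / (4 * P)"
      using pow P by (intro divide_right_mono) auto
    also have "\<dots> = real (card W) / 4" using P by simp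
    finally show ?thesis .
  qed
  have good_upper: "(\<Sum>w\<in>W. \<Sum>x\<in>G. ?T w x (\<lambda>v. \<forall>k\<in>S. v k = w k)) \<le> ennreal (\<Gamma> * real R)"
  proof -
    \<comment> \<open>The reference law of the outputs; it depends neither on the input nor on the
      gains, so the guessing bound can be applied under it.\<close>
    let ?Q = "\<lambda>y. \<Prod>\<tau><n. ennreal (normal_density 0 (sqrt (2 + P)) (y \<tau>))"
    let ?Gm = "gGain M K B n f"
    interpret Gm: prob_space ?Gm by (rule prob_space_gGain[OF adm])
    interpret L: sigma_finite_measure "gRecv n" by (rule sigma_finite_gRecv)
    let ?f = "\<lambda>w x g y. ?F w (?ev x (\<lambda>v. \<forall>k\<in>S. v k = w k)) (gmk n B k0 g y)"
    have fm: "(\<lambda>(g, y). ?f w x g y) \<in> borel_measurable (?Gm \<Otimes>\<^sub>M gRecv n)" for w x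
      unfolding split_def by (rule measurable_compose[OF measurable_gmk[OF k0] Fm]) measurable
    have Qm: "(\<lambda>(g, y). ?Q y) \<in> borel_measurable (?Gm \<Otimes>\<^sub>M gRecv n)"
      unfolding split_def
    proof (intro borel_measurable_prod_ennreal)
      fix \<tau> assume \<tau>: "\<tau> \<in> {..<n}"
      have "snd \<in> ?Gm \<Otimes>\<^sub>M gRecv n \<rightarrow>\<^sub>M (\<Pi>\<^sub>M \<tau>\<in>{..<n}. borel)" by measurable
      note [measurable] = measurable_PiM_apply[OF this \<tau>]
      show "(\<lambda>z. ennreal (normal_density 0 (sqrt (2 + P)) (snd z \<tau>))) \<in> borel_measurable (?Gm \<Otimes>\<^sub>M gRecv n)" by measurable
    qed
    have m1: "(\<lambda>y. ?f w x g y) \<in> borel_measurable (gRecv n)" if "g \<in> space ?Gm" for w x g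
      using measurable_compose[OF measurable_Pair1'[OF that] fm[of w x]] by (simp only: prod.case)
    have m2: "?Q \<in> borel_measurable (gRecv n)"
      using measurable_compose[OF measurable_Pair1'[OF Gm.not_empty[THEN some_in_eq[THEN iffD2]]] Qm] by (simp only: prod.case)
    have m3: "(\<lambda>g. \<integral>\<^sup>+y. ?Q y * ?f w x g y \<partial>gRecv n) \<in> borel_measurable ?Gm" for w x
      using borel_measurable_times_ennreal[OF Qm fm[of w x]]
      by (intro L.borel_measurable_nn_integral) (simp only: split_def)
    have Q1: "(\<integral>\<^sup>+y. ?Q y \<partial>gRecv n) = 1"
    proof -
      have "(\<integral>\<^sup>+y. ?Q y \<partial>gRecv n) = (\<Prod>\<tau><n. \<integral>\<^sup>+v. ennreal (normal_density 0 (sqrt (2 + P)) v) \<partial>lborel)"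
        by (rule gRecv_prod) measurable
      also have "(\<integral>\<^sup>+v. ennreal (normal_density 0 (sqrt (2 + P)) v) \<partial>lborel) = 1"
        using P prob_space.emeasure_space_1[OF prob_space_normal_density[of "sqrt (2 + P)" 0]] by (simp add: emeasure_density)
      finally show ?thesis by simp
    qed
    have "(\<Sum>w\<in>W. \<Sum>x\<in>G. ?T w x (\<lambda>v. \<forall>k\<in>S. v k = w k))
      \<le> (\<Sum>w\<in>W. \<Sum>x\<in>G. ennreal \<Gamma> * (\<integral>\<^sup>+g. \<integral>\<^sup>+y. ?Q y * ?f w x g y \<partial>gRecv n \<partial>?Gm))"
    proof (intro sum_mono)
      fix w x assume x: "x \<in> G"
      have "?T w x (\<lambda>v. \<forall>k\<in>S. v k = w k) = (\<integral>\<^sup>+g. \<integral>\<^sup>+y. gkernel std_normal_density n B k0 g y x * ?f w x g y \<partial>gRecv n \<partial>?Gm)"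
        unfolding St_def by (rule gobs_nn_integral[OF adm k0 Fm])
      also have "\<dots> \<le> (\<integral>\<^sup>+g. ennreal \<Gamma> * (\<integral>\<^sup>+y. ?Q y * ?f w x g y \<partial>gRecv n) \<partial>?Gm)"
      proof (rule nn_integral_mono_AE)
        show "AE g in ?Gm. (\<integral>\<^sup>+y. gkernel std_normal_density n B k0 g y x * ?f w x g y \<partial>gRecv n)
           \<le> ennreal \<Gamma> * (\<integral>\<^sup>+y. ?Q y * ?f w x g y \<partial>gRecv n)"
          using AE_gGain_bound[OF adm, where M=M and K=K and B=B and n=n] AE_space
        proof eventually_elim
          case (elim g)
          have "(\<integral>\<^sup>+y. gkernel std_normal_density n B k0 g y x * ?f w x g y \<partial>gRecv n)
             \<le> (\<integral>\<^sup>+y. ennreal \<Gamma> * (?Q y * ?f w x g y) \<partial>gRecv n)"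
            unfolding mult.assoc[symmetric]
          proof (intro nn_integral_mono mult_right_mono)
            show "gkernel std_normal_density n B k0 g y x \<le> ennreal \<Gamma> * ?Q y" for y
              unfolding \<Gamma>_def
            proof (rule gkernel_le_reference[OF _ P _ n])
              fix \<tau> j assume "\<tau> < n" "j \<in> {1..B}"
              then have "(\<tau>, k0, j) \<in> gain_idx n K B" using k0 by auto
              with elim(1) show "\<bar>g (\<tau>, k0, j)\<bar> \<le> c" by blast
            qed (use x in \<open>simp add: G_def\<close>)
          qed auto
          also have "\<dots> = ennreal \<Gamma> * (\<integral>\<^sup>+y. ?Q y * ?f w x g y \<partial>gRecv n)"
            by (rule nn_integral_cmult) (intro borel_measurable_times_ennreal m1[OF elim(2)] m2)
          finally show ?case .
        qed
      qed
      also have "\<dots> = ennreal \<Gamma> * (\<integral>\<^sup>+g. \<integral>\<^sup>+y. ?Q y * ?f w x g y \<partial>gRecv n \<partial>?Gm)"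
        by (rule nn_integral_cmult[OF m3])
      finally show "?T w x (\<lambda>v. \<forall>k\<in>S. v k = w k) \<le> \<dots>" .
    qed
    also have "\<dots> = ennreal \<Gamma> * (\<integral>\<^sup>+g. \<integral>\<^sup>+y. ?Q y * (\<Sum>w\<in>W. \<Sum>x\<in>G. ?f w x g y) \<partial>gRecv n \<partial>?Gm)"
    proof -
      have "(\<integral>\<^sup>+g. \<integral>\<^sup>+y. ?Q y * (\<Sum>w\<in>W. \<Sum>x\<in>G. ?f w x g y) \<partial>gRecv n \<partial>?Gm)
        = (\<integral>\<^sup>+g. (\<Sum>w\<in>W. \<Sum>x\<in>G. \<integral>\<^sup>+y. ?Q y * ?f w x g y \<partial>gRecv n) \<partial>?Gm)"
      proof (intro nn_integral_cong)
        fix g assume g: "g \<in> space ?Gm"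
        show "(\<integral>\<^sup>+y. ?Q y * (\<Sum>w\<in>W. \<Sum>x\<in>G. ?f w x g y) \<partial>gRecv n) = (\<Sum>w\<in>W. \<Sum>x\<in>G. \<integral>\<^sup>+y. ?Q y * ?f w x g y \<partial>gRecv n)"
          unfolding sum_distrib_left
          by (intro trans[OF nn_integral_sum] sum.cong refl nn_integral_sum borel_measurable_sum borel_measurable_times_ennreal m1[OF g] m2)
      qed
      also have "\<dots> = (\<Sum>w\<in>W. \<Sum>x\<in>G. \<integral>\<^sup>+g. \<integral>\<^sup>+y. ?Q y * ?f w x g y \<partial>gRecv n \<partial>?Gm)"
        by (intro trans[OF nn_integral_sum] sum.cong refl nn_integral_sum borel_measurable_sum m3)
      finally show ?thesis by (simp only: sum_distrib_left)
    qed
    also have "\<dots> \<le> ennreal \<Gamma> * (\<integral>\<^sup>+g. \<integral>\<^sup>+y. ?Q y * ennreal (real R) \<partial>gRecv n \<partial>?Gm)"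
    proof (intro mult_left_mono nn_integral_mono)
      fix g y
      have "(\<Sum>w\<in>W. \<Sum>x\<in>G. ?f w x g y) = ennreal (\<Sum>w\<in>W. \<Sum>x\<in>G. measure_pmf.prob (nsb (w, \<lambda>k\<in>{1..K}. gmk n B k0 g y)) (?ev x (\<lambda>v. \<forall>k\<in>S. v k = w k)))"
        by (simp add: sum_ennreal sum_nonneg)
      also have "\<dots> \<le> ennreal (\<Sum>w\<in>W. measure_pmf.prob (nsb (w, \<lambda>k\<in>{1..K}. gmk n B k0 g y)) {(x', v). \<forall>k\<in>S. v k = w k})"
      proof (intro ennreal_leI sum_mono)
        fix w
        have "(\<Sum>x\<in>G. measure_pmf.prob (nsb (w, \<lambda>k\<in>{1..K}. gmk n B k0 g y)) (?ev x (\<lambda>v. \<forall>k\<in>S. v k = w k)))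
           = measure_pmf.prob (nsb (w, \<lambda>k\<in>{1..K}. gmk n B k0 g y)) (\<Union>x\<in>G. ?ev x (\<lambda>v. \<forall>k\<in>S. v k = w k))"
          using finX by (intro measure_pmf.finite_measure_finite_Union[symmetric]) (auto simp: disjoint_family_on_def G_def)
        also have "\<dots> \<le> measure_pmf.prob (nsb (w, \<lambda>k\<in>{1..K}. gmk n B k0 g y)) {(x', v). \<forall>k\<in>S. v k = w k}"
          by (intro measure_pmf.finite_measure_mono) auto
        finally show "(\<Sum>x\<in>G. measure_pmf.prob (nsb (w, \<lambda>k\<in>{1..K}. gmk n B k0 g y)) (?ev x (\<lambda>v. \<forall>k\<in>S. v k = w k))) \<le> \<dots>" .
      qed
      also have "\<dots> \<le> ennreal (real R)"
        unfolding W_def R_def by (intro ennreal_leI ns_box_guess_sum[OF ns S(1)])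
      finally show "(\<Sum>w\<in>W. \<Sum>x\<in>G. ?f w x g y) \<le> ennreal (real R)" .
    qed auto
    also have "\<dots> = ennreal \<Gamma> * (\<integral>\<^sup>+g. ennreal (real R) \<partial>?Gm)"
      by (intro arg_cong2[where f="(*)"] refl nn_integral_cong) (simp add: nn_integral_multc[OF m2] Q1)
    also have "\<dots> = ennreal (\<Gamma> * real R)"
      using P by (simp add: Gm.emeasure_space_1 \<Gamma>_def ennreal_mult)
    finally show ?thesis .
  qed
  \<comment> \<open>Emission probabilities sum to one for each message, and Markov's inequality has
    removed at most a quarter on average.\<close>
  have "real (card W) - real (card W) / 4 \<le> (\<Sum>w\<in>W. \<Sum>x\<in>G. ?t w x)"
  proof -
    have "(\<Sum>x\<in>XA. ?t w x) = (\<Sum>x\<in>XA - G. ?t w x) + (\<Sum>x\<in>G. ?t w x)" for w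
      by (rule sum.subset_diff) (auto simp: G_def finX)
    then have "(\<Sum>w\<in>W. 1) = (\<Sum>w\<in>W. \<Sum>x\<in>XA - G. ?t w x) + (\<Sum>w\<in>W. \<Sum>x\<in>G. ?t w x)"
      unfolding sum.distrib[symmetric] by (simp only: tot2)
    then show ?thesis using bad by simp
  qed
  then have "ennreal (real (card W) * (3 / 4)) \<le> ennreal (\<Sum>w\<in>W. \<Sum>x\<in>G. ?t w x)" by (intro ennreal_leI) simp
  also have "\<dots> = (\<Sum>w\<in>W. \<Sum>x\<in>G. ?T w x (\<lambda>_. True))"
    unfolding tot1 by (simp add: St.emeasure_space_1 sum_ennreal sum_nonneg)
  also have "\<dots> \<le> (\<Sum>w\<in>W. \<Sum>x\<in>G. ?T w x (\<lambda>v. \<forall>k\<in>S. v k = w k) + (\<Sum>k\<in>S. ?T w x (\<lambda>v. v k \<noteq> w k)))"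
  proof (intro sum_mono)
    fix w x
    have "?T w x (\<lambda>_. True) \<le> (\<integral>\<^sup>+s. ?F w (?ev x (\<lambda>v. \<forall>k\<in>S. v k = w k)) (gobs n B x s k0) + (\<Sum>k\<in>S. ?F w (?ev x (\<lambda>v. v k \<noteq> w k)) (gobs n B x s k0)) \<partial>St)"
    proof (intro nn_integral_mono)
      fix s
      have "?F w (?ev x (\<lambda>_. True)) (gobs n B x s k0) \<le> ennreal (measure_pmf.prob (nsb (w, \<lambda>k\<in>{1..K}. gobs n B x s k0)) (?ev x (\<lambda>v. \<forall>k\<in>S. v k = w k))
         + (\<Sum>k\<in>S. measure_pmf.prob (nsb (w, \<lambda>k\<in>{1..K}. gobs n B x s k0)) (?ev x (\<lambda>v. v k \<noteq> w k))))"
        using ns_box_union_bound[OF finS, of nsb "(w, \<lambda>k\<in>{1..K}. gobs n B x s k0)" x w] by (intro ennreal_leI) simp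
      then show "?F w (?ev x (\<lambda>_. True)) (gobs n B x s k0) \<le> ?F w (?ev x (\<lambda>v. \<forall>k\<in>S. v k = w k)) (gobs n B x s k0) + (\<Sum>k\<in>S. ?F w (?ev x (\<lambda>v. v k \<noteq> w k)) (gobs n B x s k0))"
        by (simp add: sum_ennreal sum_nonneg)
    qed
    also have "\<dots> = ?T w x (\<lambda>v. \<forall>k\<in>S. v k = w k) + (\<Sum>k\<in>S. ?T w x (\<lambda>v. v k \<noteq> w k))"
      by (subst nn_integral_add, intro Fs k0, intro borel_measurable_sum Fs k0, subst nn_integral_sum, intro Fs k0, rule refl)
    finally show "?T w x (\<lambda>_. True) \<le> \<dots>" .
  qed
  also have "\<dots> = (\<Sum>w\<in>W. \<Sum>x\<in>G. ?T w x (\<lambda>v. \<forall>k\<in>S. v k = w k)) + (\<Sum>k\<in>S. \<Sum>w\<in>W. \<Sum>x\<in>G. ?T w x (\<lambda>v. v k \<noteq> w k))"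
    by (simp add: sum.distrib sum.swap[of _ _ S])
  also have "\<dots> \<le> ennreal (\<Gamma> * real R) + (\<Sum>k\<in>S. \<Sum>w\<in>W. \<Sum>x\<in>XA. ?T w x (\<lambda>v. v k \<noteq> w k))"
    by (intro add_mono good_upper sum_mono sum_mono2 finX) (auto simp: G_def)
  also have "(\<Sum>k\<in>S. \<Sum>w\<in>W. \<Sum>x\<in>XA. ?T w x (\<lambda>v. v k \<noteq> w k)) = (\<Sum>k\<in>S. ennreal (real (card W) * g_ns_err M K B f n m nsb A k))"
    by (intro sum.cong refl errk)
  also have "\<dots> = ennreal (\<Sum>k\<in>S. real (card W) * g_ns_err M K B f n m nsb A k)"
  proof (intro sum_ennreal mult_nonneg_nonneg)
    show "0 \<le> g_ns_err M K B f n m nsb A k" for k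
      unfolding g_ns_err_def by (intro divide_nonneg_nonneg sum_nonneg Bochner_Integration.integral_nonneg) auto
  qed simp
  also have "\<dots> \<le> ennreal (real (card W) / 4)"
    unfolding sum_distrib_left[symmetric] using mult_left_mono[OF err, of "real (card W)"] by (intro ennreal_leI) simp
  also have "ennreal (\<Gamma> * real R) + ennreal (real (card W) / 4) = ennreal (\<Gamma> * real R + real (card W) / 4)"
    using P by (intro ennreal_plus[symmetric]) (auto simp: \<Gamma>_def)
  finally have "ennreal (real (card W) * (3 / 4)) \<le> ennreal (\<Gamma> * real R + real (card W) / 4)"
    by (blast intro: add_left_mono)
  then have "real (card W) * (3 / 4) \<le> \<Gamma> * real R + real (card W) / 4"
    using P by (subst (asm) ennreal_le_iff) (auto simp: \<Gamma>_def)
  then have "real R * real (\<Prod>k\<in>S. m k) \<le> real R * (2 * \<Gamma>)"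
    unfolding cardW by (simp add: algebra_simps)
  then show ?thesis using Rpos by (simp add: \<Gamma>_def)
qed

section \<open>Tree networks, slot allocation and codes\<close>

locale tree_network =
  fixes K B :: nat and par :: "nat \<Rightarrow> nat" and M :: "nat \<Rightarrow> nat \<Rightarrow> bool"
  assumes tree: "tree_net K B par M"
begin

abbreviation anc :: "nat \<Rightarrow> nat \<Rightarrow> bool" where "anc \<equiv> anc_eq par"
abbreviation tx :: "nat \<Rightarrow> nat" where "tx \<equiv> txof B par M"
abbreviation dep :: "nat \<Rightarrow> nat" where "dep \<equiv> depth par"

lemma par_range: "j \<in> {1..B} \<Longrightarrow> par j \<in> {0..B}"
  and reach_Tx: "j \<in> {1..B} \<Longrightarrow> \<exists>t. (par ^^ t) j = 0"
  using tree unfolding tree_net_def by blast+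

lemma anc_refl: "anc j j"
  unfolding anc_eq_def by (rule exI[of _ 0]) simp

text \<open>\<open>par 0\<close> is unconstrained, so the ancestor relation must not continue
  through the root; hence the recursion is restricted to \<open>j \<noteq> 0\<close>, and
  \<open>anc_root\<close> closes it.\<close>

lemma anc_step: "j \<noteq> 0 \<Longrightarrow> anc i j \<longleftrightarrow> i = j \<or> anc i (par j)"
proof
  assume j: "j \<noteq> 0" and "anc i j"
  then obtain t where t: "(par ^^ t) j = i" "\<forall>s<t. (par ^^ s) j \<noteq> 0" by (auto simp: anc_eq_def)
  show "i = j \<or> anc i (par j)"
  proof (cases t)
    case (Suc u)
    have "(par ^^ u) (par j) = i" "\<forall>s<u. (par ^^ s) (par j) \<noteq> 0"
      using t unfolding Suc by (auto simp: funpow_swap1 dest: spec[of _ "Suc _"])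
    then show ?thesis by (auto simp: anc_eq_def)
  qed (use t in simp)
next
  assume j: "j \<noteq> 0" and h: "i = j \<or> anc i (par j)"
  from h show "anc i j"
  proof
    assume "anc i (par j)"
    then obtain t where t: "(par ^^ t) (par j) = i" "\<forall>s<t. (par ^^ s) (par j) \<noteq> 0" by (auto simp: anc_eq_def)
    have a: "(par ^^ Suc t) j = i" using t(1) by (simp add: funpow_swap1)
    have b: "(par ^^ s) j \<noteq> 0" if "s < Suc t" for s
      using that j t(2) by (cases s) (auto simp: funpow_swap1)
    show ?thesis unfolding anc_eq_def by (intro exI[of _ "Suc t"] conjI allI impI) (rule a, rule b)
  qed (simp add: anc_refl)
qed

lemma anc_root: "anc i 0 \<Longrightarrow> i = 0"
proof -
  assume "anc i 0"
  then obtain t where t: "(par ^^ t) 0 = i" "\<forall>s<t. (par ^^ s) 0 \<noteq> 0" unfolding anc_eq_def by blast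
  have "t = 0" using spec[OF t(2), of 0] by (cases t) auto
  then show "i = 0" using t(1) by simp
qed

lemma anc_trans: "anc i j \<Longrightarrow> anc j k \<Longrightarrow> anc i k"
proof -
  assume "anc i j" "anc j k"
  then obtain t u where t: "(par ^^ t) j = i" "\<forall>s<t. (par ^^ s) j \<noteq> 0"
    and u: "(par ^^ u) k = j" "\<forall>s<u. (par ^^ s) k \<noteq> 0" by (auto simp: anc_eq_def)
  have a: "(par ^^ (t + u)) k = i" using t u by (simp add: funpow_add)
  have b: "(par ^^ s) k \<noteq> 0" if "s < t + u" for s
  proof (cases "s < u")
    case False
    then have "(par ^^ s) k = (par ^^ (s - u + u)) k" by simp
    also have "\<dots> = (par ^^ (s - u)) j" by (simp only: funpow_add comp_apply u(1))
    finally have "(par ^^ s) k = (par ^^ (s - u)) j" .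
    moreover have "s - u < t" using False that by simp
    ultimately show ?thesis using t(2) by simp
  qed (use u in simp)
  show ?thesis unfolding anc_eq_def by (intro exI[of _ "t + u"] conjI allI impI) (rule a, rule b)
qed

lemma dep_step: "j \<in> {1..B} \<Longrightarrow> dep j = Suc (dep (par j))"
proof -
  assume j: "j \<in> {1..B}"
  obtain t where "(par ^^ t) j = 0" using reach_Tx[OF j] by blast
  then have "(LEAST t. (par ^^ t) j = 0) = Suc (LEAST u. (par ^^ Suc u) j = 0)"
    using j by (intro Least_Suc) auto
  then show ?thesis by (simp add: depth_def funpow_swap1)
qed

lemma anc_dep:
  assumes "j \<in> {1..B}" "anc i j" "i \<noteq> j"
  shows "dep i < dep j"
proof -
  have "anc i j \<Longrightarrow> i \<noteq> j \<Longrightarrow> dep i < dep j" if "dep j = d" "j \<in> {1..B}" for d j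
    using that
  proof (induction d arbitrary: j)
    case 0
    then show ?case using dep_step[of j] by simp
  next
    case (Suc d)
    then have p: "anc i (par j)" "dep (par j) = d" using anc_step[of j i] dep_step[of j] by auto
    show ?case
    proof (cases "i = par j")
      case False
      have "par j \<noteq> 0" using p(1) False anc_root[of i] by metis
      then have "par j \<in> {1..B}" using par_range[OF Suc.prems(4)] by simp
      then show ?thesis using Suc.IH[of "par j"] p False Suc.prems by simp
    qed (use p Suc.prems in simp)
  qed
  then show ?thesis using assms by blast
qed

lemma nbhd_comparable: "k \<in> {1..K} \<Longrightarrow> i \<in> {1..B} \<Longrightarrow> j \<in> {1..B} \<Longrightarrow> M k i \<Longrightarrow> M k j \<Longrightarrow> anc i j \<or> anc j i"
  and nbhd_anc: "k \<in> {1..K} \<Longrightarrow> j \<in> {1..B} \<Longrightarrow> i \<in> {1..B} \<Longrightarrow> M k j \<Longrightarrow> anc i j \<Longrightarrow> M k i"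
  and nbhd_ne: "k \<in> {1..K} \<Longrightarrow> \<exists>j\<in>{1..B}. M k j"
  using tree unfolding tree_net_def by blast+

lemma KB_pos: "0 < K" "0 < B" using tree by (auto simp: tree_net_def)

text \<open>The transmitters heard by a receiver are pairwise comparable, and depth is strictly
  increasing along ancestors. So the deepest one is unique, which gives \<open>THE\<close> its
  meaning, and all others are its ancestors.\<close>

lemma tx_props:
  assumes k: "k \<in> {1..K}"
  shows "tx k \<in> {1..B}" "M k (tx k)" "\<And>i. i \<in> {1..B} \<Longrightarrow> M k i \<Longrightarrow> anc i (tx k)"
proof -
  let ?N = "{j\<in>{1..B}. M k j}"
  have fin: "finite ?N" "?N \<noteq> {}" using nbhd_ne[OF k] by auto
  then have "Max (dep ` ?N) \<in> dep ` ?N" by (intro Max_in) auto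
  then obtain b where b: "b \<in> ?N" "dep b = Max (dep ` ?N)" by auto
  have mx: "dep i \<le> dep b" if "i \<in> ?N" for i using that fin b(2) by simp
  have uniq: "anc i b" if "i \<in> ?N" for i
  proof (rule ccontr)
    assume na: "\<not> anc i b"
    then have "anc b i" using nbhd_comparable[OF k, of i b] that b by auto
    then show False using anc_dep[of i b] mx[OF that] that na anc_refl by auto
  qed
  have "tx k = b" unfolding txof_def
  proof (rule the_equality)
    show "b \<in> {1..B} \<and> M k b \<and> (\<forall>i\<in>{1..B}. M k i \<longrightarrow> dep i \<le> dep b)" using b mx by auto
    fix j assume j: "j \<in> {1..B} \<and> M k j \<and> (\<forall>i\<in>{1..B}. M k i \<longrightarrow> dep i \<le> dep j)"
    then have "anc j b" "dep b \<le> dep j" using uniq b by auto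
    then show "j = b" using anc_dep[of b j] b by (cases "j = b") auto
  qed
  then show "tx k \<in> {1..B}" "M k (tx k)" "\<And>i. i \<in> {1..B} \<Longrightarrow> M k i \<Longrightarrow> anc i (tx k)"
    using b uniq by auto
qed

text \<open>The chain condition gives one direction and the closure under ancestors the other. A
  neighbourhood is thus determined by the associated transmitter.\<close>

lemma M_iff_anc: "k \<in> {1..K} \<Longrightarrow> j \<in> {1..B} \<Longrightarrow> M k j \<longleftrightarrow> anc j (tx k)"
  using tx_props[of k] nbhd_anc[of k "tx k" j] by blast

lemma nbhd_mono:
  assumes "k \<in> {1..K}" "k' \<in> {1..K}" "anc (tx k) (tx k')"
  shows "{j\<in>{1..B}. M k j} \<subseteq> {j\<in>{1..B}. M k' j}"
proof
  fix j assume "j \<in> {j\<in>{1..B}. M k j}"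
  then have "j \<in> {1..B}" "anc j (tx k)" using M_iff_anc[OF assms(1)] by auto
  then show "j \<in> {j\<in>{1..B}. M k' j}" using anc_trans[OF _ assms(3)] M_iff_anc[OF assms(2)] by auto
qed

text \<open>\<open>rtl_path\<close> without the leaf condition: a path from the root that may stop
  at an inner vertex, hence suited to induction.\<close>

definition ppath :: "nat list \<Rightarrow> bool" where
  "ppath bs \<longleftrightarrow> bs \<noteq> [] \<and> set bs \<subseteq> {1..B} \<and> par (hd bs) = 0 \<and> (\<forall>i. Suc i < length bs \<longrightarrow> par (bs ! Suc i) = bs ! i)"

lemma rtl_path_iff: "rtl_path B par bs \<longleftrightarrow> ppath bs \<and> (\<forall>j\<in>{1..B}. par j \<noteq> last bs)"
  by (auto simp: rtl_path_def ppath_def)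

lemma ppath_nth: "ppath bs \<Longrightarrow> i < length bs \<Longrightarrow> bs ! i \<in> {1..B}"
  unfolding ppath_def using nth_mem[of i bs] by (meson subsetD)

lemma ppath_anc:
  assumes "ppath bs" "i \<le> j" "j < length bs"
  shows "anc (bs ! i) (bs ! j)"
  using assms(2,3)
proof (induction j)
  case (Suc j)
  show ?case
  proof (cases "i = Suc j")
    case False
    have "bs ! Suc j \<in> {1..B}" "par (bs ! Suc j) = bs ! j"
      using Suc.prems assms(1) ppath_nth by (blast, simp add: ppath_def)
    then show ?thesis using Suc False anc_step[of "bs ! Suc j" "bs ! i"] by auto
  qed (simp add: anc_refl)
qed (simp add: anc_refl)

text \<open>Positions start at 0 and the root is not listed, hence the shift by one. Distinctness
  and the order of receivers along a path are read off from this.\<close>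

lemma ppath_dep:
  assumes "ppath bs" "i < length bs"
  shows "dep (bs ! i) = Suc i"
  using assms(2)
proof (induction i)
  case 0
  have "bs ! 0 \<in> {1..B}" "par (bs ! 0) = 0"
    using 0 assms(1) ppath_nth by (blast, simp add: ppath_def hd_conv_nth)
  moreover have "dep 0 = 0" by (simp add: depth_def)
  ultimately show ?case using dep_step by simp
next
  case (Suc i)
  have "bs ! Suc i \<in> {1..B}" "par (bs ! Suc i) = bs ! i"
    using Suc.prems assms(1) ppath_nth by (blast, simp add: ppath_def)
  then show ?case using Suc dep_step by simp
qed

lemma ppath_distinct: "ppath bs \<Longrightarrow> distinct bs"
  unfolding distinct_conv_nth
proof (intro allI impI notI)
  fix i j assume "ppath bs" "i < length bs" "j < length bs" "i \<noteq> j" "bs ! i = bs ! j"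
  then show False using ppath_dep[of bs i] ppath_dep[of bs j] by simp
qed

lemma ppath_append:
  assumes "ppath bs" "j \<in> {1..B}" "par j = last bs"
  shows "ppath (bs @ [j])"
  unfolding ppath_def
proof (intro conjI allI impI)
  show "set (bs @ [j]) \<subseteq> {1..B}" "par (hd (bs @ [j])) = 0"
    using assms by (auto simp: ppath_def)
  fix i assume i: "Suc i < length (bs @ [j])"
  show "par ((bs @ [j]) ! Suc i) = (bs @ [j]) ! i"
  proof (cases "Suc i < length bs")
    case True
    then show ?thesis using assms(1) by (simp add: ppath_def nth_append)
  next
    case False
    then have "Suc i = length bs" using i by simp
    then have "length bs - 1 = i" "Suc i = length bs" by simp_all
    moreover have "last bs = bs ! (length bs - 1)" using assms(1) by (intro last_conv_nth) (simp add: ppath_def)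
    ultimately show ?thesis using assms(3) by (simp add: nth_append)
  qed
qed simp

lemma ppath_to:
  assumes "b \<in> {1..B}"
  shows "\<exists>bs. ppath bs \<and> last bs = b \<and> {i\<in>{1..B}. anc i b} \<subseteq> set bs"
proof -
  have "\<exists>bs. ppath bs \<and> last bs = b \<and> {i\<in>{1..B}. anc i b} \<subseteq> set bs" if "dep b = d" "b \<in> {1..B}" for d b
    using that
  proof (induction d arbitrary: b)
    case 0
    then show ?case using dep_step[of b] by simp
  next
    case (Suc d)
    have b: "b \<in> {1..B}" "b \<noteq> 0" using Suc.prems by auto
    show ?case
    proof (cases "par b = 0")
      case True
      have "{i\<in>{1..B}. anc i b} \<subseteq> {b}" using anc_step[OF b(2)] True anc_root by auto
      then show ?thesis using b True by (intro exI[of _ "[b]"]) (auto simp: ppath_def)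
    next
      case False
      then have "par b \<in> {1..B}" "dep (par b) = d" using par_range[OF b(1)] dep_step[OF b(1)] Suc.prems by auto
      then obtain bs where bs: "ppath bs" "last bs = par b" "{i\<in>{1..B}. anc i (par b)} \<subseteq> set bs" using Suc.IH by blast
      then show ?thesis using ppath_append[OF bs(1) b(1)] anc_step[OF b(2)]
        by (intro exI[of _ "bs @ [b]"]) auto
    qed
  qed
  then show ?thesis using assms by blast
qed

lemma ppath_length: "ppath bs \<Longrightarrow> length bs \<le> B"
proof -
  assume p: "ppath bs"
  then have "set bs \<subseteq> {1..B}" unfolding ppath_def by blast
  then have "card (set bs) \<le> card {1..B}" by (intro card_mono) auto
  then show ?thesis using distinct_card[OF ppath_distinct[OF p]] by simp
qed

text \<open>A path has distinct vertices among \<open>B\<close>, so appending children must end, and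
  it ends in a leaf.\<close>

lemma ppath_extend: "ppath bs \<Longrightarrow> \<exists>bs'. rtl_path B par bs' \<and> set bs \<subseteq> set bs'"
proof (induction "B - length bs" arbitrary: bs rule: less_induct)
  case less
  show ?case
  proof (cases "\<forall>j\<in>{1..B}. par j \<noteq> last bs")
    case False
    then obtain j where j: "j \<in> {1..B}" "par j = last bs" by blast
    have p: "ppath (bs @ [j])" by (rule ppath_append[OF less.prems j])
    then have "B - length (bs @ [j]) < B - length bs" using ppath_length[OF p] by simp
    from less.hyps[OF this p] show ?thesis by auto
  qed (use less.prems in \<open>auto simp: rtl_path_iff\<close>)
qed

lemma rtl_path_through:
  assumes "b \<in> {1..B}"
  shows "\<exists>bs. rtl_path B par bs \<and> {i\<in>{1..B}. anc i b} \<subseteq> set bs"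
proof -
  obtain bs where bs: "ppath bs" "{i\<in>{1..B}. anc i b} \<subseteq> set bs" using ppath_to[OF assms] by blast
  obtain bs' where "rtl_path B par bs'" "set bs \<subseteq> set bs'" using ppath_extend[OF bs(1)] by blast
  then show ?thesis using bs(2) by blast
qed

abbreviation path_rx :: "nat list \<Rightarrow> nat set" where "path_rx bs \<equiv> {k\<in>{1..K}. tx k \<in> set bs}"

lemma path_sum:
  assumes "rtl_path B par bs"
  shows "(\<Sum>b\<leftarrow>bs. txsum K B par M d b) = (\<Sum>k\<in>path_rx bs. d k)"
proof -
  have "distinct bs" using assms ppath_distinct by (simp add: rtl_path_iff)
  then have "(\<Sum>b\<leftarrow>bs. txsum K B par M d b) = (\<Sum>b\<in>set bs. \<Sum>k\<in>{k\<in>path_rx bs. tx k = b}. d k)"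
    by (simp add: sum_list_distinct_conv_sum_set txsum_def) (intro sum.cong refl, auto)
  also have "\<dots> = (\<Sum>k\<in>path_rx bs. d k)"
    by (rule sum.group) auto
  finally show ?thesis .
qed

text \<open>Along a path, greater depth means a larger set of ancestors, so sorting the receivers by
  the depth of their transmitters nests their neighbourhoods as the chain argument requires.\<close>

lemma path_receivers_sorted:
  assumes "rtl_path B par bs"
  shows "\<exists>ks. distinct ks \<and> set ks = path_rx bs \<and>
     sorted_wrt (\<lambda>k k'. {j\<in>{1..B}. M k j} \<subseteq> {j\<in>{1..B}. M k' j}) ks"
proof -
  let ?C = "path_rx bs"
  define ks where "ks = sort_key (\<lambda>k. dep (tx k)) (sorted_list_of_set ?C)"
  have pp: "ppath bs" using assms by (simp add: rtl_path_iff)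
  have set: "set ks = ?C" and dist: "distinct ks" by (simp_all add: ks_def)
  have "sorted (map (\<lambda>k. dep (tx k)) ks)" by (simp add: ks_def)
  then have "sorted_wrt (\<lambda>k k'. dep (tx k) \<le> dep (tx k')) ks" by (simp add: sorted_map)
  then have "sorted_wrt (\<lambda>k k'. {j\<in>{1..B}. M k j} \<subseteq> {j\<in>{1..B}. M k' j}) ks"
  proof (rule sorted_wrt_mono_rel[rotated])
    fix k k' assume k: "k \<in> set ks" "k' \<in> set ks" and d: "dep (tx k) \<le> dep (tx k')"
    obtain i j where i: "i < length bs" "bs ! i = tx k" and j: "j < length bs" "bs ! j = tx k'"
      using k set by (fastforce simp: in_set_conv_nth)
    have "i \<le> j" using d ppath_dep[OF pp i(1)] ppath_dep[OF pp j(1)] i j by simp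
    then have "anc (tx k) (tx k')" using ppath_anc[OF pp _ j(1)] i j by metis
    then show "{j\<in>{1..B}. M k j} \<subseteq> {j\<in>{1..B}. M k' j}" using k set by (intro nbhd_mono) auto
  qed
  then show ?thesis using set dist by blast
qed

lemma tx_same_nbhd:
  assumes "k \<in> {1..K}" "k' \<in> {1..K}" "tx k = tx k'" "j \<in> {1..B}"
  shows "M k j = M k' j"
  using M_iff_anc[OF assms(1,4)] M_iff_anc[OF assms(2,4)] assms(3) by simp

end

section \<open>Slot allocation and block codes\<close>

text \<open>Each \<open>k\<close> receives the interval that starts after the total length of its
  predecessors. By transitivity the predecessors of \<open>k'\<close> and \<open>k'\<close> itself
  are among those of \<open>k\<close>, so comparable elements get disjoint intervals, while
  incomparable ones may share slots.\<close>

lemma ex_slot_allocation: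
  fixes len :: "nat \<Rightarrow> nat" and rel :: "nat \<Rightarrow> nat \<Rightarrow> bool"
  assumes trans: "\<And>i j k. rel i j \<Longrightarrow> rel j k \<Longrightarrow> rel i k" and irr: "\<And>k. \<not> rel k k"
    and fin: "finite C" and load: "\<And>k. k \<in> C \<Longrightarrow> (\<Sum>i\<in>{i\<in>C. rel i k \<or> i = k}. len i) \<le> n"
  shows "\<exists>T. (\<forall>k\<in>C. T k \<subseteq> {..<n} \<and> card (T k) = len k) \<and> (\<forall>k\<in>C. \<forall>k'\<in>C. rel k' k \<longrightarrow> T k' \<inter> T k = {})"
proof -
  define \<alpha> where "\<alpha> = (\<lambda>k. \<Sum>i\<in>{i\<in>C. rel i k}. len i)"
  have ins: "(\<Sum>i\<in>{i\<in>C. rel i k \<or> i = k}. len i) = \<alpha> k + len k" if "k \<in> C" for k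
  proof -
    have "{i\<in>C. rel i k \<or> i = k} = insert k {i\<in>C. rel i k}" using that by auto
    then show ?thesis using fin irr by (simp add: \<alpha>_def)
  qed
  have mono: "\<alpha> k' + len k' \<le> \<alpha> k" if "k \<in> C" "k' \<in> C" "rel k' k" for k k'
  proof -
    have "\<alpha> k' + len k' = (\<Sum>i\<in>{i\<in>C. rel i k' \<or> i = k'}. len i)" by (rule ins[OF that(2), symmetric])
    also have "\<dots> \<le> \<alpha> k" unfolding \<alpha>_def
    proof (rule sum_mono2)
      show "{i\<in>C. rel i k' \<or> i = k'} \<subseteq> {i\<in>C. rel i k}" using that trans by blast
    qed (use fin in auto)
    finally show ?thesis .
  qed
  show ?thesis
  proof (intro exI[of _ "\<lambda>k. {\<alpha> k ..< \<alpha> k + len k}"] conjI ballI impI)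
    show "{\<alpha> k..<\<alpha> k + len k} \<subseteq> {..<n}" if "k \<in> C" for k
      using load[OF that] ins[OF that] by auto
    show "{\<alpha> k'..<\<alpha> k' + len k'} \<inter> {\<alpha> k..<\<alpha> k + len k} = {}" if "k \<in> C" "k' \<in> C" "rel k' k" for k k'
      using mono[OF that] by auto
  qed simp
qed

text \<open>Gilbert--Varshamov: the balls of radius 2r around a maximal code of minimum distance 2r+1 cover all words.\<close>

lemma ex_code:
  fixes \<A> :: "'s set" and T :: "'t set"
  assumes fin: "finite \<A>" "\<A> \<noteq> {}" "finite T"
  shows "\<exists>(m::nat) enc dec. 1 \<le> m \<and> card \<A> ^ card T \<le> m * (card {U. U \<subseteq> T \<and> card U \<le> 2 * r} * card \<A> ^ (2 * r)) \<and>
     (\<forall>w. enc w \<in> T \<rightarrow>\<^sub>E \<A>) \<and>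
     (\<forall>w<m. \<forall>s. card {\<tau>\<in>T. s \<tau> \<noteq> enc w \<tau>} \<le> r \<longrightarrow> dec s = (w::nat)) \<and>
     (\<forall>s s'. (\<forall>\<tau>\<in>T. s \<tau> = s' \<tau>) \<longrightarrow> dec s = dec s') \<and> (\<forall>s. dec s < m)"
proof -
  define X where "X = (T \<rightarrow>\<^sub>E \<A>)"
  define hd where "hd = (\<lambda>s s' :: 't \<Rightarrow> 's. card {\<tau>\<in>T. s \<tau> \<noteq> s' \<tau>})"
  have finX: "finite X" unfolding X_def using fin by (intro finite_PiE) auto
  have Xne: "X \<noteq> {}" unfolding X_def using fin by (simp add: PiE_eq_empty_iff)
  have hd_sym: "hd s s' = hd s' s" for s s' by (simp add: hd_def eq_commute)
  have hd_tri: "hd s u \<le> hd s v + hd v u" for s u v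
  proof -
    have "card {\<tau>\<in>T. s \<tau> \<noteq> u \<tau>} \<le> card ({\<tau>\<in>T. s \<tau> \<noteq> v \<tau>} \<union> {\<tau>\<in>T. v \<tau> \<noteq> u \<tau>})"
      using fin by (intro card_mono) auto
    then show ?thesis unfolding hd_def using card_Un_le order_trans by blast
  qed
  define codes where "codes = {C. C \<subseteq> X \<and> (\<forall>c\<in>C. \<forall>c'\<in>C. c \<noteq> c' \<longrightarrow> 2 * r < hd c c')}"
  have "finite codes" unfolding codes_def using finX by simp
  moreover obtain x0 where x0: "x0 \<in> X" using Xne by blast
  then have "{x0} \<in> codes" by (auto simp: codes_def)
  ultimately have "\<exists>C\<in>codes. {x0} \<subseteq> C \<and> (\<forall>C'\<in>codes. C \<subseteq> C' \<longrightarrow> C = C')"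
    using finite_has_maximal2[of codes "{x0}"] by auto
  then obtain C where C: "C \<in> codes" "x0 \<in> C" "\<And>C'. C' \<in> codes \<Longrightarrow> C \<subseteq> C' \<Longrightarrow> C = C'" by auto
  have CX: "C \<subseteq> X" using C by (auto simp: codes_def)
  have finC: "finite C" using CX finX by (rule finite_subset)
  have cover: "\<exists>c\<in>C. hd c s \<le> 2 * r" if s: "s \<in> X" for s
  proof (rule ccontr)
    assume "\<not> ?thesis"
    then have far: "2 * r < hd c s" if "c \<in> C" for c using that by force
    then have "insert s C \<in> codes" using C(1) s hd_sym by (auto simp: codes_def)
    then have "s \<in> C" using C(3)[of "insert s C"] by auto
    then show False using far[of s] by (simp add: hd_def)
  qed
  define Us where "Us = {U. U \<subseteq> T \<and> card U \<le> 2 * r}"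
  have finU: "finite Us" unfolding Us_def using fin by simp
  have ball: "card {s\<in>X. hd c s \<le> 2 * r} \<le> card Us * card \<A> ^ (2 * r)" if c: "c \<in> X" for c
  proof -
    have "{s\<in>X. hd c s \<le> 2 * r} \<subseteq> (\<Union>U\<in>Us. {s\<in>X. \<forall>\<tau>\<in>T - U. s \<tau> = c \<tau>})"
    proof
      fix s assume s: "s \<in> {s\<in>X. hd c s \<le> 2 * r}"
      then have "{\<tau>\<in>T. c \<tau> \<noteq> s \<tau>} \<in> Us" by (auto simp: Us_def hd_def)
      then show "s \<in> (\<Union>U\<in>Us. {s\<in>X. \<forall>\<tau>\<in>T - U. s \<tau> = c \<tau>})"
        using s by (intro UN_I[of "{\<tau>\<in>T. c \<tau> \<noteq> s \<tau>}"]) auto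
    qed
    then have "card {s\<in>X. hd c s \<le> 2 * r} \<le> card (\<Union>U\<in>Us. {s\<in>X. \<forall>\<tau>\<in>T - U. s \<tau> = c \<tau>})"
      using finU finX by (intro card_mono) auto
    also have "\<dots> \<le> (\<Sum>U\<in>Us. card {s\<in>X. \<forall>\<tau>\<in>T - U. s \<tau> = c \<tau>})"
      by (rule card_UN_le[OF finU])
    also have "\<dots> \<le> (\<Sum>U\<in>Us. card \<A> ^ (2 * r))"
    proof (intro sum_mono)
      fix U assume U: "U \<in> Us"
      then have finU': "finite U" "U \<subseteq> T" "card U \<le> 2 * r" using fin by (auto simp: Us_def intro: finite_subset)
      have "card {s\<in>X. \<forall>\<tau>\<in>T - U. s \<tau> = c \<tau>} \<le> card (U \<rightarrow>\<^sub>E \<A>)"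
      proof (rule card_inj_on_le[where f="\<lambda>s. restrict s U"])
        show "inj_on (\<lambda>s. restrict s U) {s\<in>X. \<forall>\<tau>\<in>T - U. s \<tau> = c \<tau>}"
        proof (rule inj_onI, rule ext)
          fix s s' \<tau> assume s: "s \<in> {s\<in>X. \<forall>\<tau>\<in>T - U. s \<tau> = c \<tau>}" "s' \<in> {s\<in>X. \<forall>\<tau>\<in>T - U. s \<tau> = c \<tau>}"
            and eq: "restrict s U = restrict s' U"
          show "s \<tau> = s' \<tau>"
          proof (cases "\<tau> \<in> U")
            case True
            then show ?thesis using fun_cong[OF eq, of \<tau>] by simp
          next
            case False
            then show ?thesis using s by (cases "\<tau> \<in> T") (auto simp: X_def PiE_def extensional_def)
          qed
        qed
        show "(\<lambda>s. restrict s U) ` {s\<in>X. \<forall>\<tau>\<in>T - U. s \<tau> = c \<tau>} \<subseteq> U \<rightarrow>\<^sub>E \<A>"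
          using finU'(2) by (auto simp: X_def)
      qed (use fin finU' in \<open>auto intro: finite_PiE\<close>)
      also have "\<dots> = card \<A> ^ card U" using finU' by (simp add: card_PiE)
      also have "\<dots> \<le> card \<A> ^ (2 * r)" using finU' fin by (intro power_increasing) (auto simp: Suc_le_eq card_gt_0_iff)
      finally show "card {s\<in>X. \<forall>\<tau>\<in>T - U. s \<tau> = c \<tau>} \<le> card \<A> ^ (2 * r)" .
    qed
    also have "\<dots> = card Us * card \<A> ^ (2 * r)" by simp
    finally show ?thesis .
  qed
  have "card \<A> ^ card T = card X" using fin by (simp add: X_def card_PiE)
  also have "\<dots> \<le> card (\<Union>c\<in>C. {s\<in>X. hd c s \<le> 2 * r})"
  proof (rule card_mono)
    show "finite (\<Union>c\<in>C. {s\<in>X. hd c s \<le> 2 * r})" using finC finX by simp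
    show "X \<subseteq> (\<Union>c\<in>C. {s\<in>X. hd c s \<le> 2 * r})" using cover by blast
  qed
  also have "\<dots> \<le> (\<Sum>c\<in>C. card {s\<in>X. hd c s \<le> 2 * r})" by (rule card_UN_le[OF finC])
  also have "\<dots> \<le> (\<Sum>c\<in>C. card Us * card \<A> ^ (2 * r))" using CX by (intro sum_mono ball) auto
  also have "\<dots> = card C * (card Us * card \<A> ^ (2 * r))" by simp
  finally have size: "card \<A> ^ card T \<le> card C * (card Us * card \<A> ^ (2 * r))" .
  obtain e where e: "bij_betw e {0..<card C} C" using ex_bij_betw_nat_finite[OF finC] by blast
  define enc where "enc = (\<lambda>w. if w < card C then e w else x0)"
  \<comment> \<open>Bounded-distance decoding. Words in no ball receive the message 0, so the
    decoder is total with values below the number of codewords.\<close>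
  define dec where "dec = (\<lambda>s. if \<exists>w. w < card C \<and> hd s (enc w) \<le> r then SOME w. w < card C \<and> hd s (enc w) \<le> r else 0)"
  have encC: "enc w \<in> C" for w using e C(2) by (auto simp: enc_def bij_betw_def)
  have uniq: "w = w'" if "w < card C" "w' < card C" "hd s (enc w) \<le> r" "hd s (enc w') \<le> r" for s w w'
  proof -
    have "hd (enc w) (enc w') \<le> 2 * r" using hd_tri[of "enc w" "enc w'" s] hd_sym[of s "enc w"] that by simp
    moreover have "enc w = enc w' \<or> 2 * r < hd (enc w) (enc w')"
      using C(1) encC[of w] encC[of w'] unfolding codes_def by blast
    ultimately have "enc w = enc w'" by linarith
    then show ?thesis using e that by (auto simp: enc_def bij_betw_def inj_on_def)
  qed
  show ?thesis
  proof (intro exI[of _ "card C"] exI[of _ enc] exI[of _ dec] conjI allI impI)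
    show "1 \<le> card C" using finC C(2) by (auto simp: Suc_le_eq card_gt_0_iff)
    show "card \<A> ^ card T \<le> card C * (card {U. U \<subseteq> T \<and> card U \<le> 2 * r} * card \<A> ^ (2 * r))"
      using size by (simp add: Us_def)
    show "enc w \<in> T \<rightarrow>\<^sub>E \<A>" for w using encC CX by (auto simp: X_def)
    show "dec s = w" if "w < card C" "card {\<tau>\<in>T. s \<tau> \<noteq> enc w \<tau>} \<le> r" for s w
    proof -
      have w: "w < card C \<and> hd s (enc w) \<le> r" using that by (simp add: hd_def)
      then have ex: "\<exists>w. w < card C \<and> hd s (enc w) \<le> r" by blast
      from someI_ex[OF this] have "dec s < card C \<and> hd s (enc (dec s)) \<le> r" unfolding dec_def if_P[OF ex] .
      then show ?thesis using uniq w by blast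
    qed
    show "dec s = dec s'" if "\<forall>\<tau>\<in>T. s \<tau> = s' \<tau>" for s s'
    proof -
      have "hd s c = hd s' c" for c unfolding hd_def using that by (intro arg_cong[where f=card]) auto
      then show ?thesis unfolding dec_def by (simp only:)
    qed
    show "dec s < card C" for s
    proof (cases "\<exists>w. w < card C \<and> hd s (enc w) \<le> r")
      case True
      from someI_ex[OF this] show ?thesis unfolding dec_def if_P[OF True] by blast
    next
      case False
      then show ?thesis unfolding dec_def if_not_P[OF False] using finC C(2) by (auto simp: card_gt_0_iff)
    qed
  qed
qed

text \<open>Shared randomness x, uniform on X, is used as one-time pad: the receivers' outputs without x are a fixed
  function of a bijective image of x, hence carry no information on the inputs.\<close>

lemma ns_box_one_time_pad:
  fixes X :: "'s set" and emb :: "'s \<Rightarrow> 'x" and dd :: "nat \<Rightarrow> 'i \<Rightarrow> 'o \<Rightarrow> 's \<Rightarrow> nat"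
  assumes X: "finite X" "X \<noteq> {}"
    and pad: "\<And>i ob. \<exists>T. inj_on T X \<and> T ` X \<subseteq> X \<and> (\<forall>x\<in>X. \<forall>k\<in>{1..K}. dd k i (ob k) x = D k (T x))"
  shows "ns_box K (\<lambda>(i, ob). map_pmf (\<lambda>x. (emb x, \<lambda>k. if k \<in> {1..K} then dd k i (ob k) x else 0)) (pmf_of_set X))"
  unfolding ns_box_def
proof (intro allI impI)
  fix S and i :: 'i and ob :: "nat \<Rightarrow> 'o" and i' ob' assume S: "S \<subseteq> {0..K}" and eq: "(0 \<in> S \<longrightarrow> i = i') \<and> (\<forall>k\<in>S - {0}. ob k = ob' k)"
  let ?o = "\<lambda>i ob x. (emb x, \<lambda>k. if k \<in> {1..K} then dd k i (ob k) x else 0)"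
  show "map_pmf (ns_restr S) (case (i, ob) of (i, ob) \<Rightarrow> map_pmf (?o i ob) (pmf_of_set X))
      = map_pmf (ns_restr S) (case (i', ob') of (i, ob) \<Rightarrow> map_pmf (?o i ob) (pmf_of_set X))"
  proof (cases "0 \<in> S")
    case True
    then have "ns_restr S (?o i ob x) = ns_restr S (?o i' ob' x)" for x
      using eq by (auto simp: ns_restr_def fun_eq_iff)
    then show ?thesis by (simp add: map_pmf_comp)
  next
    case False
    define g :: "'s \<Rightarrow> 'x option \<times> (nat \<Rightarrow> nat)"
      where "g = (\<lambda>z. (None, \<lambda>k. if k \<in> S - {0} \<and> k \<in> {1..K} then D k z else 0))"
    have "map_pmf (\<lambda>x. ns_restr S (?o i ob x)) (pmf_of_set X) = map_pmf g (pmf_of_set X)" for i ob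
    proof -
      obtain T where T: "inj_on T X" "T ` X \<subseteq> X" "\<forall>x\<in>X. \<forall>k\<in>{1..K}. dd k i (ob k) x = D k (T x)" using pad by blast
      have "bij_betw T X X" using T X by (simp add: bij_betw_def endo_inj_surj)
      then have U: "map_pmf T (pmf_of_set X) = pmf_of_set X" using X by (intro map_pmf_of_set_bij_betw)
      have "map_pmf (\<lambda>x. ns_restr S (?o i ob x)) (pmf_of_set X) = map_pmf (\<lambda>x. g (T x)) (pmf_of_set X)"
      proof (rule map_pmf_cong[OF refl])
        fix x assume "x \<in> set_pmf (pmf_of_set X)"
        then have "x \<in> X" using X by simp
        then show "ns_restr S (?o i ob x) = g (T x)"
          using T(3) False by (auto simp: ns_restr_def fun_eq_iff g_def)
      qed
      also have "\<dots> = map_pmf g (map_pmf T (pmf_of_set X))" by (simp only: map_pmf_comp)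
      also have "\<dots> = map_pmf g (pmf_of_set X)" by (simp only: U)
      finally show ?thesis .
    qed
    then show ?thesis by (simp add: map_pmf_comp)
  qed
qed

section \<open>Limits of rates and closed regions\<close>

abbreviation liminf_rate :: "(nat \<Rightarrow> nat \<Rightarrow> nat) \<Rightarrow> nat \<Rightarrow> ereal" where
  "liminf_rate m k \<equiv> liminf (\<lambda>n. ereal (log 2 (real (m n k)) / real n))"

text \<open>The lower bounds hold eventually, so an upper bound that holds merely frequently can be
  met at a common point. Over finite fields the upper bound will be established only for prime
  orders.\<close>

lemma sum_le_of_Liminf:
  fixes g :: "'k \<Rightarrow> 'x \<Rightarrow> real"
  assumes fin: "finite S" and d: "\<And>k. k \<in> S \<Longrightarrow> ereal (d k) \<le> Liminf F (\<lambda>x. ereal (g k x))"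
    and L: "\<And>e. 0 < e \<Longrightarrow> \<exists>\<^sub>F x in F. (\<Sum>k\<in>S. g k x) \<le> L + e"
  shows "(\<Sum>k\<in>S. d k) \<le> L"
proof (rule field_le_epsilon)
  fix e :: real assume e: "0 < e"
  define \<delta> where "\<delta> = e / (2 * (real (card S) + 1))"
  have \<delta>: "0 < \<delta>" "real (card S) * \<delta> \<le> e / 2" using e by (auto simp: \<delta>_def field_simps)
  have "\<forall>\<^sub>F x in F. d k - \<delta> < g k x" if k: "k \<in> S" for k
  proof -
    have "ereal (d k - \<delta>) < ereal (d k)" using \<delta> by simp
    also note d[OF k]
    finally have "\<forall>\<^sub>F x in F. ereal (d k - \<delta>) < ereal (g k x)" by (rule less_LiminfD)
    then show ?thesis by simp
  qed
  then have "\<forall>\<^sub>F x in F. \<forall>k\<in>S. d k - \<delta> < g k x" using fin by (intro eventually_ball_finite) auto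
  moreover have "\<exists>\<^sub>F x in F. (\<Sum>k\<in>S. g k x) \<le> L + e / 2" using e by (intro L) auto
  ultimately have "\<exists>\<^sub>F x in F. (\<Sum>k\<in>S. g k x) \<le> L + e / 2 \<and> (\<forall>k\<in>S. d k - \<delta> < g k x)"
    by (rule frequently_eventually_frequently[rotated])
  then obtain x where x: "(\<Sum>k\<in>S. g k x) \<le> L + e / 2" "\<forall>k\<in>S. d k - \<delta> < g k x" by (auto dest: frequently_ex)
  have "(\<Sum>k\<in>S. d k - \<delta>) \<le> (\<Sum>k\<in>S. g k x)" using x(2) by (intro sum_mono) auto
  then have "(\<Sum>k\<in>S. d k) - real (card S) * \<delta> \<le> L + e / 2" using x(1) by (simp add: sum_subtractf)
  then show "(\<Sum>k\<in>S. d k) \<le> L + e" using \<delta>(2) by linarith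
qed

lemma le_Liminf_of_tendsto:
  fixes g u :: "'x \<Rightarrow> real"
  assumes "\<forall>\<^sub>F x in F. u x \<le> g x" "(u \<longlongrightarrow> c) F"
  shows "ereal c \<le> Liminf F (\<lambda>x. ereal (g x))"
proof (cases "F = bot")
  case False
  have "ereal c = Liminf F (\<lambda>x. ereal (u x))"
    using assms(2) False by (intro lim_imp_Liminf[symmetric]) auto
  also have "\<dots> \<le> Liminf F (\<lambda>x. ereal (g x))"
    using assms(1) by (intro Liminf_mono) auto
  finally show ?thesis .
qed (simp add: top_ereal_def)

lemma closed_rplus: "closed (rplus K)"
proof -
  have "rplus K = (\<Inter>k\<in>-{1..K}. {d. d k = 0}) \<inter> (\<Inter>k\<in>{1..K}. {d. 0 \<le> d k})"
    by (auto simp: rplus_def)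
  moreover have "closed {d::nat \<Rightarrow> real. d k = 0}" "closed {d::nat \<Rightarrow> real. 0 \<le> d k}" for k
    by (intro closed_Collect_eq closed_Collect_le continuous_on_product_coordinates continuous_on_const)+
  ultimately show ?thesis by (auto intro!: closed_Int closed_INT)
qed

lemma closed_sum_le: "closed {d::nat \<Rightarrow> real. (\<Sum>k\<in>S. d k) \<le> L}"
  by (intro closed_Collect_le continuous_on_sum continuous_on_product_coordinates continuous_on_const)

lemma closure_sum_bound:
  assumes "R \<in> closure A" "A \<subseteq> rplus K" "\<And>d. d \<in> A \<Longrightarrow> (\<Sum>k\<in>S. d k) \<le> L"
  shows "R \<in> rplus K" "(\<Sum>k\<in>S. R k) \<le> L"
proof -
  have "closure A \<subseteq> rplus K \<inter> {d. (\<Sum>k\<in>S. d k) \<le> L}"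
    using assms(2,3) by (intro closure_minimal closed_Int closed_rplus closed_sum_le) auto
  then show "R \<in> rplus K" "(\<Sum>k\<in>S. R k) \<le> L" using assms(1) by auto
qed

text \<open>The logarithm of \<open>C\<close> divided by the blocklength tends to 0, so constants in
  the finite-length converses leave no trace.\<close>

lemma rate_sum_bound:
  fixes m :: "nat \<Rightarrow> nat \<Rightarrow> nat"
  assumes fin: "finite S" and m: "\<And>n k. k \<in> S \<Longrightarrow> 1 \<le> m n k"
    and R: "\<And>k. k \<in> S \<Longrightarrow> ereal (R k) \<le> liminf_rate m k"
    and le: "\<forall>\<^sub>F n in sequentially. (\<Prod>k\<in>S. real (m n k)) \<le> C * G ^ n" and C: "0 < C" and G: "0 < G"
  shows "(\<Sum>k\<in>S. R k) \<le> log 2 G"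
proof (rule sum_le_of_Liminf[OF fin R])
  fix e :: real assume e: "0 < e"
  have "(\<lambda>n. log 2 C / real n) \<longlonglongrightarrow> 0" by real_asymp
  then have "\<forall>\<^sub>F n in sequentially. log 2 C / real n < e" using e by (rule order_tendstoD)
  then have "\<forall>\<^sub>F n in sequentially. (\<Sum>k\<in>S. log 2 (real (m n k)) / real n) \<le> log 2 G + e"
    using le eventually_gt_at_top[of 0]
  proof eventually_elim
    case (elim n)
    have pos: "0 < real (m n k)" if "k \<in> S" for k using m[OF that, of n] by simp
    have "(\<Sum>k\<in>S. log 2 (real (m n k)) / real n) = log 2 (\<Prod>k\<in>S. real (m n k)) / real n"
      using pos by (simp add: log_def ln_prod sum_divide_distrib fin)
    also have "\<dots> \<le> log 2 (C * G ^ n) / real n"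
      using elim pos C G by (intro divide_right_mono log_mono prod_pos) auto
    also have "\<dots> = log 2 G + log 2 C / real n"
      using elim C G by (simp add: log_mult log_nat_power field_simps)
    finally show ?case using elim by linarith
  qed
  then show "\<exists>\<^sub>F n in sequentially. (\<Sum>k\<in>S. log 2 (real (m n k)) / real n) \<le> log 2 G + e"
    by (rule eventually_frequently[rotated]) simp
qed

lemma eventually_sum_err_le:
  fixes e :: "nat \<Rightarrow> nat \<Rightarrow> real"
  assumes "(\<lambda>n. Max ((\<lambda>k. e n k) ` {1..K})) \<longlonglongrightarrow> 0" "S \<subseteq> {1..K}"
  shows "\<forall>\<^sub>F n in sequentially. (\<Sum>k\<in>S. e n k) \<le> 1 / 4"
proof -
  have "\<forall>\<^sub>F n in sequentially. Max ((\<lambda>k. e n k) ` {1..K}) < 1 / (4 * (real K + 1))"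
    using assms(1) by (rule order_tendstoD) simp
  then show ?thesis
  proof eventually_elim
    case (elim n)
    have "e n k \<le> 1 / (4 * (real K + 1))" if "k \<in> S" for k
      using elim assms(2) that Max_ge[of "(\<lambda>k. e n k) ` {1..K}" "e n k"] by fastforce
    then have "(\<Sum>k\<in>S. e n k) \<le> (\<Sum>k\<in>S. 1 / (4 * (real K + 1)))" by (rule sum_mono)
    also have "\<dots> = real (card S) * (1 / (4 * (real K + 1)))" by simp
    also have "\<dots> \<le> (real K + 1) * (1 / (4 * (real K + 1)))"
      using card_mono[OF _ assms(2)] by (intro mult_right_mono) auto
    also have "\<dots> = 1 / 4" by (simp add: field_simps)
    finally show ?case .
  qed
qed

lemma Max_err_tendsto:
  fixes e :: "nat \<Rightarrow> nat \<Rightarrow> real"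
  assumes "0 < K" "\<And>n k. k \<in> {1..K} \<Longrightarrow> 0 \<le> e n k" "\<And>n k. k \<in> {1..K} \<Longrightarrow> e n k \<le> b n" "b \<longlonglongrightarrow> 0"
  shows "(\<lambda>n. Max ((\<lambda>k. e n k) ` {1..K})) \<longlonglongrightarrow> 0"
proof (rule tendsto_sandwich[OF _ _ tendsto_const assms(4)])
  have ne: "(\<lambda>k. e n k) ` {1..K} \<noteq> {}" for n using assms(1) by auto
  show "\<forall>\<^sub>F n in sequentially. Max ((\<lambda>k. e n k) ` {1..K}) \<le> b n"
    using ne assms(3) by (intro always_eventually allI) (auto simp: Max_le_iff)
  show "\<forall>\<^sub>F n in sequentially. 0 \<le> Max ((\<lambda>k. e n k) ` {1..K})"
  proof (intro always_eventually allI)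
    fix n
    have "e n 1 \<le> Max ((\<lambda>k. e n k) ` {1..K})" using assms(1) by (intro Max_ge) auto
    moreover have "0 \<le> e n 1" using assms(2)[of 1 n] assms(1) by simp
    ultimately show "0 \<le> Max ((\<lambda>k. e n k) ` {1..K})" by (rule order_trans[rotated])
  qed
qed

lemma floor_load:
  fixes d :: "nat \<Rightarrow> real"
  assumes "finite A" "\<And>k. k \<in> A \<Longrightarrow> 0 \<le> d k" "(\<Sum>k\<in>A. d k) \<le> 1"
  shows "(\<Sum>k\<in>A. nat \<lfloor>real n * d k\<rfloor>) \<le> n"
proof -
  have "real (\<Sum>k\<in>A. nat \<lfloor>real n * d k\<rfloor>) \<le> (\<Sum>k\<in>A. real n * d k)"
    unfolding of_nat_sum using assms(2) by (intro sum_mono) (auto intro!: of_nat_floor)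
  also have "\<dots> = real n * (\<Sum>k\<in>A. d k)" by (simp add: sum_distrib_left)
  also have "\<dots> \<le> real n * 1" using assms(3) by (intro mult_left_mono) auto
  finally have "real (\<Sum>k\<in>A. nat \<lfloor>real n * d k\<rfloor>) \<le> real n" by simp
  then show ?thesis by (simp only: of_nat_le_iff)
qed

section \<open>Slots along the tree\<close>

context tree_network
begin

text \<open>Receivers of one transmitter never share a slot. With a non-signalling box these are the
  only conflicts.\<close>

definition slots_ok :: "nat \<Rightarrow> (nat \<Rightarrow> real) \<Rightarrow> (nat \<Rightarrow> nat set) \<Rightarrow> bool" where
  "slots_ok n d T \<longleftrightarrow> (\<forall>k\<in>{1..K}. T k \<subseteq> {..<n} \<and> card (T k) = nat \<lfloor>real n * d k\<rfloor>) \<and>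
     (\<forall>k\<in>{1..K}. \<forall>k'\<in>{1..K}. tx k = tx k' \<and> k \<noteq> k' \<longrightarrow> T k \<inter> T k' = {})"

text \<open>The additional classical demand: in the slots of \<open>k\<close> no strict ancestor of
  its transmitter serves anybody. Descendants may be active, since \<open>k\<close> does not hear
  them.\<close>

definition quiet_above :: "(nat \<Rightarrow> nat set) \<Rightarrow> bool" where
  "quiet_above T \<longleftrightarrow> (\<forall>k\<in>{1..K}. \<forall>k'\<in>{1..K}. anc (tx k') (tx k) \<and> tx k' \<noteq> tx k \<longrightarrow> T k \<inter> T k' = {})"

lemma slots_okD:
  assumes "slots_ok n d T"
  shows "k \<in> {1..K} \<Longrightarrow> T k \<subseteq> {..<n}" "k \<in> {1..K} \<Longrightarrow> card (T k) = nat \<lfloor>real n * d k\<rfloor>"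
    "k \<in> {1..K} \<Longrightarrow> finite (T k)"
proof -
  show "T k \<subseteq> {..<n}" "card (T k) = nat \<lfloor>real n * d k\<rfloor>" if "k \<in> {1..K}"
    using assms that unfolding slots_ok_def by blast+
  then show "finite (T k)" if "k \<in> {1..K}" using that finite_subset by blast
qed

lemma ex_ns_slots:
  assumes d: "d \<in> ns_dof_region K B par M"
  shows "\<exists>T. slots_ok n d T"
proof -
  have "\<exists>T. (\<forall>k\<in>{1..K}. T k \<subseteq> {..<n} \<and> card (T k) = nat \<lfloor>real n * d k\<rfloor>) \<and>
     (\<forall>k\<in>{1..K}. \<forall>k'\<in>{1..K}. tx k' = tx k \<and> k' < k \<longrightarrow> T k' \<inter> T k = {})"
  proof (rule ex_slot_allocation[where rel="\<lambda>k' k. tx k' = tx k \<and> k' < k"])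
    fix k assume k: "k \<in> {1..K}"
    have "(\<Sum>i\<in>{i\<in>{1..K}. (tx i = tx k \<and> i < k) \<or> i = k}. nat \<lfloor>real n * d i\<rfloor>) \<le> (\<Sum>i\<in>{i\<in>{1..K}. tx i = tx k}. nat \<lfloor>real n * d i\<rfloor>)"
      by (intro sum_mono2) auto
    also have "\<dots> \<le> n"
      using d tx_props(1)[OF k] by (intro floor_load) (auto simp: ns_dof_region_def rplus_def txsum_def)
    finally show "(\<Sum>i\<in>{i\<in>{1..K}. (tx i = tx k \<and> i < k) \<or> i = k}. nat \<lfloor>real n * d i\<rfloor>) \<le> n" .
  qed auto
  then obtain T where T: "\<forall>k\<in>{1..K}. T k \<subseteq> {..<n} \<and> card (T k) = nat \<lfloor>real n * d k\<rfloor>"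
     "\<And>k k'. k \<in> {1..K} \<Longrightarrow> k' \<in> {1..K} \<Longrightarrow> tx k' = tx k \<Longrightarrow> k' < k \<Longrightarrow> T k' \<inter> T k = {}" by blast
  have "T k \<inter> T k' = {}" if "k \<in> {1..K}" "k' \<in> {1..K}" "tx k = tx k'" "k \<noteq> k'" for k k'
    using T(2)[of k k'] T(2)[of k' k] that by (cases "k < k'") auto
  then show ?thesis using T(1) unfolding slots_ok_def by (intro exI[of _ T]) blast
qed

lemma anc_antisym: "b \<in> {1..B} \<Longrightarrow> b' \<in> {1..B} \<Longrightarrow> anc b b' \<Longrightarrow> anc b' b \<Longrightarrow> b = b'"
  using anc_dep[of b' b] anc_dep[of b b'] by (cases "b = b'") simp_all

text \<open>Receivers are ordered by ancestry of their transmitters, ties broken by index. All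
  predecessors of a receiver lie on a root-to-leaf path through its transmitter, so the inequality
  for that path bounds their total length by \<open>n\<close>.\<close>

lemma ex_cl_slots:
  assumes d: "d \<in> tree_dof_region K B par M"
  shows "\<exists>T. slots_ok n d T \<and> quiet_above T"
proof -
  let ?rel = "\<lambda>k' k. k' \<in> {1..K} \<and> k \<in> {1..K} \<and> anc (tx k') (tx k) \<and> (tx k' = tx k \<longrightarrow> k' < k)"
  have d0: "\<And>k. k \<in> {1..K} \<Longrightarrow> 0 \<le> d k" using d by (auto simp: tree_dof_region_def rplus_def)
  have "\<exists>T. (\<forall>k\<in>{1..K}. T k \<subseteq> {..<n} \<and> card (T k) = nat \<lfloor>real n * d k\<rfloor>) \<and>
     (\<forall>k\<in>{1..K}. \<forall>k'\<in>{1..K}. ?rel k' k \<longrightarrow> T k' \<inter> T k = {})"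
  proof (rule ex_slot_allocation)
    show "?rel i k" if ij: "?rel i j" and jk: "?rel j k" for i j k
    proof -
      have "anc (tx i) (tx k)" using ij jk anc_trans by blast
      moreover have "i < k" if eq: "tx i = tx k"
      proof -
        have p: "j \<in> {1..K}" "k \<in> {1..K}" "anc (tx j) (tx k)" "anc (tx k) (tx j)" using ij jk eq by auto
        have "tx j = tx k" by (rule anc_antisym[OF tx_props(1)[OF p(1)] tx_props(1)[OF p(2)] p(3,4)])
        then have "i < j" "j < k" using ij jk eq by simp_all
        then show ?thesis by simp
      qed
      ultimately show ?thesis using ij jk by simp
    qed
    fix k assume k: "k \<in> {1..K}"
    obtain bs where bs: "rtl_path B par bs" "{i\<in>{1..B}. anc i (tx k)} \<subseteq> set bs"
      using rtl_path_through[OF tx_props(1)[OF k]] by blast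
    have "(\<Sum>i\<in>{i\<in>{1..K}. ?rel i k \<or> i = k}. nat \<lfloor>real n * d i\<rfloor>) \<le> (\<Sum>i\<in>{i\<in>{1..K}. tx i \<in> set bs}. nat \<lfloor>real n * d i\<rfloor>)"
    proof (rule sum_mono2)
      show "{i\<in>{1..K}. ?rel i k \<or> i = k} \<subseteq> {i\<in>{1..K}. tx i \<in> set bs}"
      proof
        fix i assume "i \<in> {i\<in>{1..K}. ?rel i k \<or> i = k}"
        then have "i \<in> {1..K}" "anc (tx i) (tx k)" using anc_refl by auto
        then show "i \<in> {i\<in>{1..K}. tx i \<in> set bs}" using bs(2) tx_props(1)[of i] by auto
      qed
    qed auto
    also have "\<dots> \<le> n"
    proof (rule floor_load)
      show "(\<Sum>k\<in>path_rx bs. d k) \<le> 1"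
        using d bs(1) path_sum[OF bs(1), of d] by (auto simp: tree_dof_region_def)
    qed (use d0 in auto)
    finally show "(\<Sum>i\<in>{i\<in>{1..K}. ?rel i k \<or> i = k}. nat \<lfloor>real n * d i\<rfloor>) \<le> n" .
  qed auto
  then obtain T where T: "\<forall>k\<in>{1..K}. T k \<subseteq> {..<n} \<and> card (T k) = nat \<lfloor>real n * d k\<rfloor>"
     "\<And>k k'. k \<in> {1..K} \<Longrightarrow> k' \<in> {1..K} \<Longrightarrow> ?rel k' k \<Longrightarrow> T k' \<inter> T k = {}" by blast
  have "T k \<inter> T k' = {}" if "k \<in> {1..K}" "k' \<in> {1..K}" "tx k = tx k'" "k \<noteq> k'" for k k'
    using T(2)[of k k'] T(2)[of k' k] that anc_refl by (cases "k < k'") auto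
  moreover have "T k \<inter> T k' = {}" if "k \<in> {1..K}" "k' \<in> {1..K}" "anc (tx k') (tx k)" "tx k' \<noteq> tx k" for k k'
    using T(2)[of k k'] that by auto
  ultimately show ?thesis using T(1) unfolding slots_ok_def quiet_above_def by (intro exI[of _ T]) blast
qed

text \<open>\<open>SOME\<close> picks the receiver of transmitter \<open>b\<close> that owns slot
  \<open>t\<close>, which is unique under \<open>slots_ok\<close>; \<open>z\<close> is sent when the
  transmitter is idle.\<close>

definition place :: "(nat \<Rightarrow> nat set) \<Rightarrow> (nat \<Rightarrow> nat \<Rightarrow> 's) \<Rightarrow> 's \<Rightarrow> nat \<Rightarrow> nat \<Rightarrow> 's" where
  "place T v z t b = (if \<exists>k\<in>{1..K}. tx k = b \<and> t \<in> T k then v (SOME k. k \<in> {1..K} \<and> tx k = b \<and> t \<in> T k) t else z)"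

lemma place_active:
  assumes T: "slots_ok n d T" and k: "k \<in> {1..K}" "t \<in> T k"
  shows "place T v z t (tx k) = v k t"
proof -
  let ?P = "\<lambda>k'. k' \<in> {1..K} \<and> tx k' = tx k \<and> t \<in> T k'"
  have "?P (SOME k. ?P k)" using k by (intro someI[of ?P k]) auto
  moreover have "k' = k" if "?P k'" for k'
  proof (rule ccontr)
    assume "k' \<noteq> k"
    then have "T k' \<inter> T k = {}" using T k(1) that unfolding slots_ok_def by blast
    then show False using k(2) that by blast
  qed
  ultimately have "(SOME k. ?P k) = k" by blast
  then show ?thesis using k unfolding place_def by (subst if_P) auto
qed

lemma place_quiet:
  assumes T: "quiet_above T" and k: "k \<in> {1..K}" "t \<in> T k" and j: "anc j (tx k)" "j \<noteq> tx k"
  shows "place T v z t j = z"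
proof -
  have "\<not> (k' \<in> {1..K} \<and> tx k' = j \<and> t \<in> T k')" for k'
  proof
    assume k': "k' \<in> {1..K} \<and> tx k' = j \<and> t \<in> T k'"
    then have "T k \<inter> T k' = {}" using T k(1) j unfolding quiet_above_def by blast
    then show False using k' k(2) by blast
  qed
  then show ?thesis unfolding place_def by (subst if_not_P) blast+
qed

end

section \<open>Achievability over a finite field\<close>

lemma of_nat_floor_tendsto_rate:
  fixes d q :: real
  shows "(\<lambda>n. (real n * d - 1) / real n * log 2 q) \<longlonglongrightarrow> d * log 2 q"
proof -
  have "(\<lambda>n. (real n * d - 1) / real n) \<longlonglongrightarrow> d" by real_asymp
  then show ?thesis by (rule tendsto_mult_right)
qed

lemma zero_error_rate:
  assumes len: "\<And>n. real q ^ nat \<lfloor>real n * d\<rfloor> \<le> real (m n)" and q: "2 \<le> q" and d: "0 \<le> d"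
  shows "ereal (d * log 2 (real q)) \<le> liminf (\<lambda>n. ereal (log 2 (real (m n)) / real n))"
proof (rule le_Liminf_of_tendsto[OF _ of_nat_floor_tendsto_rate])
  show "\<forall>\<^sub>F n in sequentially. (real n * d - 1) / real n * log 2 (real q) \<le> log 2 (real (m n)) / real n"
    using eventually_gt_at_top[of 0]
  proof eventually_elim
    case (elim n)
    let ?l = "nat \<lfloor>real n * d\<rfloor>"
    have "real n * d - 1 \<le> real ?l" using d by linarith
    then have "(real n * d - 1) * log 2 (real q) \<le> real ?l * log 2 (real q)"
      using q by (intro mult_right_mono) auto
    also have "\<dots> = log 2 (real q ^ ?l)" using q by (simp add: log_nat_power)
    also have "\<dots> \<le> log 2 (real (m n))" using len[of n] q by (intro log_mono) auto
    finally have "(real n * d - 1) * log 2 (real q) / real n \<le> log 2 (real (m n)) / real n" by (rule divide_right_mono) simp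
    then show ?case by (simp only: times_divide_eq_left)
  qed
qed

text \<open>The conclusion of \<open>ex_code\<close> for fixed witnesses. The last clauses,
  dependence on the positions in \<open>T\<close> only and values below \<open>m\<close>, are what
  non-signalling, measurability and finite output alphabets will need.\<close>

definition hcode :: "'s set \<Rightarrow> 't set \<Rightarrow> nat \<Rightarrow> nat \<Rightarrow> (nat \<Rightarrow> 't \<Rightarrow> 's) \<Rightarrow> (('t \<Rightarrow> 's) \<Rightarrow> nat) \<Rightarrow> bool" where
  "hcode \<A> T r m enc dec \<longleftrightarrow> 1 \<le> m \<and> card \<A> ^ card T \<le> m * (card {U. U \<subseteq> T \<and> card U \<le> 2 * r} * card \<A> ^ (2 * r)) \<and>
     (\<forall>w. enc w \<in> T \<rightarrow>\<^sub>E \<A>) \<and> (\<forall>w<m. \<forall>s. card {t\<in>T. s t \<noteq> enc w t} \<le> r \<longrightarrow> dec s = w) \<and>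
     (\<forall>s s'. (\<forall>t\<in>T. s t = s' t) \<longrightarrow> dec s = dec s') \<and> (\<forall>s. dec s < m)"

lemma ex_hcodes:
  assumes fin: "finite \<A>" "\<A> \<noteq> {}" "\<And>k. k \<in> S \<Longrightarrow> finite (T k)"
  obtains m enc dec where "\<And>k. k \<in> S \<Longrightarrow> hcode \<A> (T k) r (m k) (enc k) (dec k)"
proof -
  have "\<forall>k\<in>S. \<exists>c. hcode \<A> (T k) r (fst c) (fst (snd c)) (snd (snd c))"
  proof
    fix k assume "k \<in> S"
    then have "\<exists>m enc dec. hcode \<A> (T k) r m enc dec" unfolding hcode_def by (intro ex_code fin)
    then obtain m enc dec where "hcode \<A> (T k) r m enc dec" by blast
    then show "\<exists>c. hcode \<A> (T k) r (fst c) (fst (snd c)) (snd (snd c))"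
      by (intro exI[of _ "(m, enc, dec)"]) simp
  qed
  then obtain c where "\<forall>k\<in>S. hcode \<A> (T k) r (fst (c k)) (fst (snd (c k))) (snd (snd (c k)))" by (rule bchoice[THEN exE])
  then show ?thesis by (intro that[of "\<lambda>k. fst (c k)" "\<lambda>k. fst (snd (c k))" "\<lambda>k. snd (snd (c k))"]) blast
qed

lemma hcodeD:
  assumes "hcode \<A> T r m enc dec"
  shows "1 \<le> m" "t \<in> T \<Longrightarrow> enc w t \<in> \<A>" "w < m \<Longrightarrow> card {t\<in>T. s t \<noteq> enc w t} \<le> r \<Longrightarrow> dec s = w"
    "(\<And>t. t \<in> T \<Longrightarrow> s t = s' t) \<Longrightarrow> dec s = dec s'" "dec s < m"
    "card \<A> ^ card T \<le> m * (card {U. U \<subseteq> T \<and> card U \<le> 2 * r} * card \<A> ^ (2 * r))"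
proof -
  note c = assms[unfolded hcode_def]
  show "1 \<le> m" "card \<A> ^ card T \<le> m * (card {U. U \<subseteq> T \<and> card U \<le> 2 * r} * card \<A> ^ (2 * r))" using c by blast+
  show "enc w t \<in> \<A>" if "t \<in> T" using c that by blast
  show "dec s = w" if "w < m" "card {t\<in>T. s t \<noteq> enc w t} \<le> r" using c that by blast
  show "dec s = dec s'" if "\<And>t. t \<in> T \<Longrightarrow> s t = s' t" using c that by blast
  show "dec s < m" using c by blast
qed

text \<open>For \<open>r = 0\<close> the only error set is empty, so the code must contain as many
  words as there are sequences, and no rate is lost.\<close>

lemma hcode_exact:
  assumes c: "hcode \<A> T 0 m enc dec" and T: "finite T"
  shows "card \<A> ^ card T \<le> m" "w < m \<Longrightarrow> (\<And>t. t \<in> T \<Longrightarrow> s t = enc w t) \<Longrightarrow> dec s = w"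
proof -
  have U: "{U. U \<subseteq> T \<and> card U \<le> 2 * 0} = {{}}"
    using finite_subset[OF _ T] by auto
  show "card \<A> ^ card T \<le> m" using hcodeD(6)[OF c] unfolding U by simp
  assume w: "w < m" and s: "\<And>t. t \<in> T \<Longrightarrow> s t = enc w t"
  then have "{t\<in>T. s t \<noteq> enc w t} = {}" by blast
  then have "card {t\<in>T. s t \<noteq> enc w t} \<le> 0" by (simp only: card.empty)
  then show "dec s = w" by (rule hcodeD(3)[OF c w])
qed

locale ff_tree = tree_network K B par M + finite_field F
  for K B :: nat and par M and F :: "('a, 'b) ring_scheme" (structure)
begin

lemma pad_cancel:
  assumes "a \<in> carrier F" "a' \<in> carrier F" "r \<in> carrier F" "u \<in> carrier F" "y \<in> carrier F"
    and e: "u \<oplus> (y \<ominus> (a \<oplus> r)) = u \<oplus> (y \<ominus> (a' \<oplus> r))"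
  shows "a = a'"
proof -
  have "y \<ominus> (a \<oplus> r) = y \<ominus> (a' \<oplus> r)" using e assms(1-5) by simp
  then have "\<ominus> (a \<oplus> r) = \<ominus> (a' \<oplus> r)" using assms(1-5) unfolding a_minus_def by simp
  then have "\<ominus> (\<ominus> (a \<oplus> r)) = \<ominus> (\<ominus> (a' \<oplus> r))" by simp
  then have "a \<oplus> r = a' \<oplus> r" using assms(1-3) by (simp only: minus_minus add.m_closed)
  then show ?thesis using assms(1-3) by simp
qed

lemma ff_obs_nbhd:
  assumes G: "\<And>p. G p \<in> carrier F" and x: "\<And>p. x p \<in> carrier F" and G0: "\<And>j. j \<in> {1..B} \<Longrightarrow> \<not> M k j \<Longrightarrow> G (t, k, j) = \<zero>"
  shows "ff_sig F B k G x t = finsum F (\<lambda>j. G (t, k, j) \<otimes> x (t, j)) {j\<in>{1..B}. M k j}"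
proof -
  have "finsum F (\<lambda>j. G (t, k, j) \<otimes> x (t, j)) {1..B} = finsum F (\<lambda>j. G (t, k, j) \<otimes> x (t, j)) {j\<in>{1..B}. M k j}"
    by (rule add.finprod_mono_neutral_cong_right) (use G x G0 in auto)
  then show ?thesis by (simp add: ff_sig_def)
qed

text \<open>In a slot of \<open>k\<close> its own transmitter is the only active one that it hears,
  so the output is a nonzero coefficient times the code symbol, and division recovers it without
  error.\<close>

lemma ff_cl_zero_error:
  assumes T: "slots_ok n d T" "quiet_above T"
  shows "\<exists>m enc dec. ff_cl_scheme F K B n m enc \<and> (\<forall>k\<in>{1..K}. ff_cl_err F M K B n m enc dec k = 0) \<and>
     (\<forall>k\<in>{1..K}. card (carrier F) ^ nat \<lfloor>real n * d k\<rfloor> \<le> m k)"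
proof -
  have ne: "carrier F \<noteq> {}" by auto
  obtain m ce cd where c: "\<And>k. k \<in> {1..K} \<Longrightarrow> hcode (carrier F) (T k) 0 (m k) (ce k) (cd k)"
    using ex_hcodes[OF fin ne, of "{1..K}" T 0] slots_okD(3)[OF T(1)] by blast
  define X where "X = (\<lambda>w (t, b). if t < n \<and> b \<in> {1..B} then place T (\<lambda>k. ce k (w k)) \<zero> t b else \<zero>)"
  define enc where "enc = (\<lambda>w. return_pmf (X w))"
  define dec where "dec = (\<lambda>k (ob :: nat \<Rightarrow> 'a \<times> (nat \<Rightarrow> 'a)). return_pmf (cd k (\<lambda>t. m_inv F (snd (ob t) (tx k)) \<otimes> fst (ob t))))"
  have XX: "X w \<in> ff_X F n B" for w :: "nat \<Rightarrow> nat"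
  proof -
    have "place T (\<lambda>k. ce k (w k)) \<zero> t b \<in> carrier F" for t b
    proof (cases "\<exists>k\<in>{1..K}. tx k = b \<and> t \<in> T k")
      case True
      then obtain k where k: "k \<in> {1..K}" "tx k = b" "t \<in> T k" by blast
      have "place T (\<lambda>k. ce k (w k)) \<zero> t b = ce k (w k) t" using place_active[OF T(1) k(1,3)] k(2) by simp
      moreover have "ce k (w k) t \<in> carrier F" by (rule hcodeD(2)[OF c[OF k(1)] k(3)])
      ultimately show ?thesis by simp
    next
      case False
      then show ?thesis unfolding place_def by (subst if_not_P) auto
    qed
    then show ?thesis unfolding ff_X_def X_def by auto
  qed
  have scheme: "ff_cl_scheme F K B n m enc"
    unfolding ff_cl_scheme_def using hcodeD(1)[OF c] XX by (auto simp: enc_def)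
  have correct: "cd k (\<lambda>t. m_inv F (snd (ff_obs F n B (X w) G k t) (tx k)) \<otimes> fst (ff_obs F n B (X w) G k t)) = w k"
    if k: "k \<in> {1..K}" and w: "w \<in> msg_set K m" and G: "G \<in> set_pmf (ff_coef F M K B n)" for k w G
  proof -
    have "m_inv F (snd (ff_obs F n B (X w) G k t) (tx k)) \<otimes> fst (ff_obs F n B (X w) G k t) = ce k (w k) t" if t: "t \<in> T k" for t
    proof -
      have tn: "t < n" using slots_okD(1)[OF T(1) k] t by auto
      note Gc = ff_coef_carrier[OF G] and Xc = ff_X_carrier[OF XX[of w]]
      have g: "G (t, k, tx k) \<in> carrier F - {\<zero>}"
        using tx_props[OF k] k tn by (intro ff_coef_nonzero[OF G]) auto
      have xq: "X w (t, j) = \<zero>" if "j \<in> {j\<in>{1..B}. M k j}" "j \<noteq> tx k" for j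
        using that tn place_quiet[OF T(2) k t, of j "\<lambda>k. ce k (w k)" \<zero>] M_iff_anc[OF k] by (auto simp: X_def)
      have xa: "X w (t, tx k) = ce k (w k) t"
        using tn tx_props(1)[OF k] place_active[OF T(1) k t, of "\<lambda>k. ce k (w k)" \<zero>] by (auto simp: X_def)
      have "ff_sig F B k G (X w) t = finsum F (\<lambda>j. G (t, k, j) \<otimes> X w (t, j)) {j\<in>{1..B}. M k j}"
        by (rule ff_obs_nbhd) (simp_all add: Gc Xc ff_coef_zero[OF G])
      also have "\<dots> = finsum F (\<lambda>j. G (t, k, j) \<otimes> X w (t, j)) {tx k}"
        by (rule add.finprod_mono_neutral_cong_right) (use xq tx_props[OF k] Gc Xc in auto)
      also have "\<dots> = G (t, k, tx k) \<otimes> X w (t, tx k)" using Gc Xc by simp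
      also have "\<dots> = G (t, k, tx k) \<otimes> ce k (w k) t" by (simp only: xa)
      finally have "ff_sig F B k G (X w) t = G (t, k, tx k) \<otimes> ce k (w k) t" .
      moreover have "ff_obs F n B (X w) G k t = (ff_sig F B k G (X w) t, \<lambda>j. G (t, k, j))"
        using tn by (simp add: ff_obs_def ff_sig_def)
      ultimately show ?thesis using g Xc[of "(t, tx k)"] xa
        by (simp add: m_assoc[symmetric] field_Units)
    qed
    then show ?thesis using w k by (intro hcode_exact(2)[OF c[OF k] slots_okD(3)[OF T(1) k]]) (auto simp: msg_set_def)
  qed
  have "ff_cl_err F M K B n m enc dec k = 0" if k: "k \<in> {1..K}" for k
  proof -
    have one: "measure_pmf.expectation (enc w) (\<lambda>x. measure_pmf.expectation (ff_coef F M K B n) (\<lambda>G. pmf (dec k (ff_obs F n B x G k)) (w k))) = 1"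
      if w: "w \<in> msg_set K m" for w
    proof -
      have "measure_pmf.expectation (ff_coef F M K B n) (\<lambda>G. pmf (dec k (ff_obs F n B (X w) G k)) (w k))
         = measure_pmf.expectation (ff_coef F M K B n) (\<lambda>G. 1)"
        by (intro integral_cong_AE AE_pmfI) (auto simp: dec_def correct[OF k w])
      then show ?thesis by (simp add: enc_def)
    qed
    have m1: "\<And>k. k \<in> {1..K} \<Longrightarrow> 1 \<le> m k" using hcodeD(1)[OF c] by blast
    have "0 < card (msg_set K m)" unfolding card_msg_set using m1 by (intro prod_pos) force
    moreover have "ff_cl_err F M K B n m enc dec k = 1 - (\<Sum>w\<in>msg_set K m. 1) / real (card (msg_set K m))"
      using one by (subst ff_cl_err_eq[OF m1]) (simp_all cong: sum.cong)
    ultimately show ?thesis by (auto simp: card_gt_0_iff)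
  qed
  moreover have "card (carrier F) ^ nat \<lfloor>real n * d k\<rfloor> \<le> m k" if "k \<in> {1..K}" for k
    using hcode_exact(1)[OF c[OF that] slots_okD(3)[OF T(1) that]] slots_okD(2)[OF T(1) that] by simp
  ultimately show ?thesis using scheme by blast
qed

theorem ff_cl_achievable:
  assumes d: "d \<in> tree_dof_region K B par M"
  shows "(\<lambda>k. d k * log 2 (real (card (carrier F)))) \<in> ff_cl_cap F M K B"
proof -
  let ?q = "card (carrier F)"
  have d0: "d \<in> rplus K" using d by (simp add: tree_dof_region_def)
  define P where "P = (\<lambda>n c. ff_cl_scheme F K B n (fst c) (fst (snd c)) \<and>
     (\<forall>k\<in>{1..K}. ff_cl_err F M K B n (fst c) (fst (snd c)) (snd (snd c)) k = 0) \<and> (\<forall>k\<in>{1..K}. ?q ^ nat \<lfloor>real n * d k\<rfloor> \<le> fst c k))"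
  have "\<forall>n. \<exists>c. P n c"
  proof
    fix n
    obtain T where "slots_ok n d T" "quiet_above T" using ex_cl_slots[OF d] by blast
    then have "\<exists>m enc dec. P n (m, enc, dec)" unfolding P_def fst_conv snd_conv by (rule ff_cl_zero_error)
    then obtain m enc dec where "P n (m, enc, dec)" by (elim exE)
    then show "\<exists>c. P n c" by (rule exI[of "P n"])
  qed
  then obtain c where c: "\<forall>n. P n (c n)" using choice[of P] by blast
  define m enc dec where "m = (\<lambda>n. fst (c n))" and "enc = (\<lambda>n. fst (snd (c n)))" and "dec = (\<lambda>n. snd (snd (c n)))"
  have s: "ff_cl_scheme F K B n (m n) (enc n)"
    and e: "\<And>k. k \<in> {1..K} \<Longrightarrow> ff_cl_err F M K B n (m n) (enc n) (dec n) k = 0"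
    and r: "\<And>k. k \<in> {1..K} \<Longrightarrow> ?q ^ nat \<lfloor>real n * d k\<rfloor> \<le> m n k" for n
    using c[THEN spec, of n] unfolding P_def m_def enc_def dec_def by blast+
  show ?thesis unfolding ff_cl_cap_def
  proof (intro subsetD[OF closure_subset] CollectI conjI exI[of _ m] exI[of _ enc] exI[of _ dec] allI ballI)
    show "(\<lambda>k. d k * log 2 (real ?q)) \<in> rplus K"
      using d0 card_ge_2 by (auto simp: rplus_def intro!: mult_nonneg_nonneg)
    show "(\<lambda>n. Max ((\<lambda>k. ff_cl_err F M K B n (m n) (enc n) (dec n) k) ` {1..K})) \<longlonglongrightarrow> 0"
      by (rule Max_err_tendsto[OF KB_pos(1), where b="\<lambda>_. 0"]) (use e in auto)
    show "ereal (d k * log 2 (real ?q)) \<le> liminf_rate m k" if k: "k \<in> {1..K}" for k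
    proof (rule zero_error_rate[OF _ card_ge_2])
      show "real ?q ^ nat \<lfloor>real n * d k\<rfloor> \<le> real (m n k)" for n
        using of_nat_mono[OF r[OF k, of n], where ?'a=real] by simp
      show "0 \<le> d k" using d0 k by (simp add: rplus_def)
    qed
  qed (rule s)
qed

text \<open>The box draws the whole channel input uniformly, independently of the messages. Inside
  the box, receiver \<open>k\<close> obtains its code symbol plus its output minus the noiseless
  output computed from the true input; over the channel this difference is zero. For arbitrary box
  inputs the resulting symbols are a bijective image of the uniform input, so without the
  transmitter's output they reveal nothing.\<close>

lemma ff_ns_zero_error:
  assumes T: "slots_ok n d T"
  shows "\<exists>m nsb. ff_ns_scheme F K B n m nsb \<and> (\<forall>k\<in>{1..K}. ff_ns_err F M K B n m nsb k = 0) \<and>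
     (\<forall>k\<in>{1..K}. card (carrier F) ^ nat \<lfloor>real n * d k\<rfloor> \<le> m k)"
proof -
  have ne: "carrier F \<noteq> {}" by auto
  obtain m ce cd where c: "\<And>k. k \<in> {1..K} \<Longrightarrow> hcode (carrier F) (T k) 0 (m k) (ce k) (cd k)"
    using ex_hcodes[OF fin ne, of "{1..K}" T 0] slots_okD(3)[OF T] by blast
  let ?N = "\<lambda>k. {j\<in>{1..B}. M k j}"
  \<comment> \<open>A box must be non-signalling for every observation, also for those the channel
    never produces: values outside the field or a vanishing coefficient of the own transmitter. In
    that case \<open>\<phi>\<close> passes the pad symbol through unchanged, which keeps the map
    invertible.\<close>
  define ok where "ok = (\<lambda>k (ob :: nat \<Rightarrow> 'a \<times> (nat \<Rightarrow> 'a)) t. fst (ob t) \<in> carrier F \<and> (\<forall>j\<in>{1..B}. snd (ob t) j \<in> carrier F) \<and> snd (ob t) (tx k) \<noteq> \<zero>)"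
  define \<phi> where "\<phi> = (\<lambda>k (w :: nat \<Rightarrow> nat) ob (x :: nat \<times> nat \<Rightarrow> 'a) t.
     if ok k ob t then ce k (w k) t \<oplus> (fst (ob t) \<ominus> finsum F (\<lambda>j. snd (ob t) j \<otimes> x (t, j)) (?N k)) else x (t, tx k))"
  define dd where "dd = (\<lambda>k w ob x. cd k (\<phi> k w ob x))"
  define nsb where "nsb = (\<lambda>(w, ob). map_pmf (\<lambda>x. (x, \<lambda>k. if k \<in> {1..K} then dd k w (ob k) x else 0)) (pmf_of_set (ff_X F n B)))"
  have cec: "ce k v t \<in> carrier F" if "k \<in> {1..K}" "t \<in> T k" for k v t
    by (rule hcodeD(2)[OF c[OF that(1)] that(2)])
  have zX: "(\<lambda>_. \<zero>) \<in> ff_X F n B" by (simp add: ff_X_def)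
  have \<phi>c: "\<phi> k w ob x t \<in> carrier F" if "k \<in> {1..K}" "t \<in> T k" "x \<in> ff_X F n B" for k w ob x t
    using that cec ff_X_carrier[OF that(3)] unfolding \<phi>_def ok_def by (auto intro!: finsum_closed)
  have ns: "ns_box K nsb"
    unfolding nsb_def
  proof (rule ns_box_one_time_pad[where D="\<lambda>k z. cd k (\<lambda>t. z (t, tx k))"])
    show "finite (ff_X F n B)" by simp
    show "ff_X F n B \<noteq> {}" using zX by blast
    fix w :: "nat \<Rightarrow> nat" and ob :: "nat \<Rightarrow> nat \<Rightarrow> 'a \<times> (nat \<Rightarrow> 'a)"
    \<comment> \<open>Active positions are overwritten by the symbols that the receivers see; idle
      positions keep the pad. Distinct receivers occupy distinct positions, so nothing is
      lost.\<close>
    define Tr where "Tr = (\<lambda>x (t, b). if t < n \<and> b \<in> {1..B} then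
        (if \<exists>k\<in>{1..K}. tx k = b \<and> t \<in> T k then place T (\<lambda>k. \<phi> k w (ob k) x) \<zero> t b else x (t, b)) else \<zero>)"
    have Tr_active: "Tr x (t, tx k) = \<phi> k w (ob k) x t" if k: "k \<in> {1..K}" "t \<in> T k" for x k t
    proof -
      have "t < n" using slots_okD(1)[OF T k(1)] k(2) by auto
      moreover have "\<exists>k'\<in>{1..K}. tx k' = tx k \<and> t \<in> T k'" using k by blast
      ultimately show ?thesis using tx_props(1)[OF k(1)] place_active[OF T k, of "\<lambda>k. \<phi> k w (ob k) x" \<zero>]
        by (simp add: Tr_def)
    qed
    have into: "Tr x \<in> ff_X F n B" if x: "x \<in> ff_X F n B" for x
    proof -
      have "Tr x (t, b) \<in> carrier F" if "t < n" "b \<in> {1..B}" for t b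
      proof (cases "\<exists>k\<in>{1..K}. tx k = b \<and> t \<in> T k")
        case True
        then obtain k where k: "k \<in> {1..K}" "tx k = b" "t \<in> T k" by blast
        then show ?thesis using Tr_active[OF k(1,3), of x] \<phi>c[OF k(1,3) x] by simp
      next
        case False
        then have "Tr x (t, b) = x (t, b)" using that unfolding Tr_def by (simp only: prod.case if_False simp_thms if_True)
        then show ?thesis using ff_X_carrier[OF x] by simp
      qed
      then show ?thesis unfolding ff_X_def by (auto simp: Tr_def)
    qed
    have "inj_on Tr (ff_X F n B)"
    proof (rule inj_onI)
      fix x x' assume x: "x \<in> ff_X F n B" "x' \<in> ff_X F n B" and eq: "Tr x = Tr x'"
      note xc = ff_X_carrier[OF x(1)] and xc' = ff_X_carrier[OF x(2)]
      \<comment> \<open>Triangularity along the tree: the symbol at \<open>b\<close> involves the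
        pad at \<open>b\<close> with a nonzero coefficient and otherwise only at strict ancestors of
        \<open>b\<close>, which are already known to agree by induction on the depth.\<close>
      have "x (t, b) = x' (t, b)" if "t < n" "b \<in> {1..B}" for t b
        using that(2)
      proof (induction "dep b" arbitrary: b rule: less_induct)
        case less
        show ?case
        proof (cases "\<exists>k\<in>{1..K}. tx k = b \<and> t \<in> T k")
          case False
          then have "Tr z (t, b) = z (t, b)" for z using that(1) less.prems unfolding Tr_def by (simp only: prod.case if_False simp_thms if_True)
          then show ?thesis using fun_cong[OF eq, of "(t, b)"] by simp
        next
          case True
          then obtain k where k: "k \<in> {1..K}" "tx k = b" "t \<in> T k" by blast
          have e: "\<phi> k w (ob k) x t = \<phi> k w (ob k) x' t"
            using Tr_active[OF k(1,3), of x] Tr_active[OF k(1,3), of x'] eq by simp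
          show ?thesis
          proof (cases "ok k (ob k) t")
            case False
            then show ?thesis using e k(2) by (simp add: \<phi>_def)
          next
            case True
            define y where "y = fst (ob k t)"
            define g where "g = snd (ob k t)"
            have yg: "y \<in> carrier F" "\<And>j. j \<in> {1..B} \<Longrightarrow> g j \<in> carrier F" "g b \<noteq> \<zero>"
              using True k(2) by (auto simp: ok_def y_def g_def)
            let ?R = "\<lambda>x. finsum F (\<lambda>j. g j \<otimes> x (t, j)) (?N k - {b})"
            have bN: "b \<in> ?N k" using tx_props[OF k(1)] k(2) by auto
            have split: "finsum F (\<lambda>j. g j \<otimes> z (t, j)) (?N k) = g b \<otimes> z (t, b) \<oplus> ?R z" if "\<And>p. z p \<in> carrier F" for z
            proof -
              have "?N k = insert b (?N k - {b})" using bN by auto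
              then have "finsum F (\<lambda>j. g j \<otimes> z (t, j)) (?N k) = finsum F (\<lambda>j. g j \<otimes> z (t, j)) (insert b (?N k - {b}))" by simp
              also have "\<dots> = g b \<otimes> z (t, b) \<oplus> ?R z"
                using that yg(2) bN by (subst finsum_insert) auto
              finally show ?thesis .
            qed
            have Rc: "?R z \<in> carrier F" if "\<And>p. z p \<in> carrier F" for z using that yg(2) by (intro finsum_closed) auto
            have "?R x = ?R x'"
            proof (rule finsum_cong')
              fix j assume j: "j \<in> ?N k - {b}"
              then have "anc j b" "j \<noteq> b" "j \<in> {1..B}" using M_iff_anc[OF k(1)] k(2) by auto
              then have "x (t, j) = x' (t, j)" using anc_dep[OF less.prems] by (intro less.hyps) auto
              then show "g j \<otimes> x (t, j) = g j \<otimes> x' (t, j)" by simp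
            qed (use yg(2) xc' in auto)
            moreover have "ce k (w k) t \<oplus> (y \<ominus> (g b \<otimes> x (t, b) \<oplus> ?R x)) = ce k (w k) t \<oplus> (y \<ominus> (g b \<otimes> x' (t, b) \<oplus> ?R x'))"
              using e True split[of x] split[of x'] xc xc' by (simp add: \<phi>_def y_def[symmetric] g_def[symmetric])
            ultimately have h: "ce k (w k) t \<oplus> (y \<ominus> (g b \<otimes> x (t, b) \<oplus> ?R x')) = ce k (w k) t \<oplus> (y \<ominus> (g b \<otimes> x' (t, b) \<oplus> ?R x'))" by simp
            have "g b \<otimes> x (t, b) = g b \<otimes> x' (t, b)"
              by (rule pad_cancel[OF _ _ _ _ _ h])
                (use cec[OF k(1,3), of "w k"] yg(1) yg(2)[of b] less.prems xc[of "(t, b)"] xc'[of "(t, b)"] Rc[of x'] xc' in auto)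
            then show ?thesis using yg(2)[OF less.prems] yg(3) xc[of "(t, b)"] xc'[of "(t, b)"] by (simp add: m_lcancel)
          qed
        qed
      qed
      moreover have "x (t, b) = x' (t, b)" if "\<not> (t < n \<and> b \<in> {1..B})" for t b
        using x that unfolding ff_X_def by auto
      ultimately show "x = x'" by (intro ext) (metis surj_pair)
    qed
    moreover have "dd k w (ob k) x = cd k (\<lambda>t. Tr x (t, tx k))" if "k \<in> {1..K}" for k x
    proof -
      have "\<forall>t\<in>T k. \<phi> k w (ob k) x t = Tr x (t, tx k)" using Tr_active[OF that] by simp
      then show ?thesis unfolding dd_def by (intro hcodeD(4)[OF c[OF that]]) blast
    qed
    ultimately show "\<exists>Tr. inj_on Tr (ff_X F n B) \<and> Tr ` ff_X F n B \<subseteq> ff_X F n B \<and>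
        (\<forall>x\<in>ff_X F n B. \<forall>k\<in>{1..K}. dd k w (ob k) x = cd k (\<lambda>t. Tr x (t, tx k)))"
      using into by (intro exI[of _ Tr]) auto
  qed
  have set_nsb: "set_pmf (nsb i) = (\<lambda>x. (x, \<lambda>k. if k \<in> {1..K} then dd k (fst i) (snd i k) x else 0)) ` ff_X F n B" for i
  proof -
    have "set_pmf (pmf_of_set (ff_X F n B)) = ff_X F n B" using zX by (intro set_pmf_of_set) auto
    then show ?thesis by (simp add: nsb_def split_def)
  qed
  have scheme: "ff_ns_scheme F K B n m nsb"
    unfolding ff_ns_scheme_def
  proof (intro conjI ns)
    show "\<forall>k\<in>{1..K}. 1 \<le> m k" using hcodeD(1)[OF c] by blast
    have "set_pmf (nsb i) \<subseteq> ff_X F n B \<times> msg_set K m" for i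
      unfolding set_nsb msg_set_def dd_def using hcodeD(5)[OF c] by auto
    then show "\<exists>A. finite A \<and> (\<forall>i. set_pmf (nsb i) \<subseteq> A)"
      by (intro exI[of _ "ff_X F n B \<times> msg_set K m"]) auto
    show "\<forall>i. fst ` set_pmf (nsb i) \<subseteq> ff_X F n B" unfolding set_nsb by auto
  qed
  have "ff_ns_err F M K B n m nsb k = 0" if k: "k \<in> {1..K}" for k
  proof -
    have z: "measure_pmf.prob (nsb (w, \<lambda>k'. ff_obs F n B x G k')) {(x', v). x' = x \<and> v k \<noteq> w k} = 0"
      if w: "w \<in> msg_set K m" and x: "x \<in> ff_X F n B" and G: "G \<in> set_pmf (ff_coef F M K B n)" for w x G
    proof -
      note Gc = ff_coef_carrier[OF G] and xc = ff_X_carrier[OF x]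
      have "\<phi> k w (ff_obs F n B x G k) x t = ce k (w k) t" if t: "t \<in> T k" for t
      proof -
        have tn: "t < n" using slots_okD(1)[OF T k] t by auto
        have g: "G (t, k, tx k) \<in> carrier F - {\<zero>}"
          using tx_props[OF k] k tn by (intro ff_coef_nonzero[OF G]) auto
        have sigc: "ff_sig F B k G x t \<in> carrier F" by (rule ff_sig_closed[OF Gc xc])
        have obs: "ff_obs F n B x G k t = (ff_sig F B k G x t, \<lambda>j. G (t, k, j))"
          using tn by (simp add: ff_obs_def ff_sig_def)
        have "ok k (ff_obs F n B x G k) t" using g Gc sigc by (simp add: ok_def obs)
        then have "\<phi> k w (ff_obs F n B x G k) x t = ce k (w k) t \<oplus> (ff_sig F B k G x t \<ominus> finsum F (\<lambda>j. G (t, k, j) \<otimes> x (t, j)) (?N k))"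
          by (simp add: \<phi>_def obs)
        also have "finsum F (\<lambda>j. G (t, k, j) \<otimes> x (t, j)) (?N k) = ff_sig F B k G x t"
          by (rule ff_obs_nbhd[symmetric]) (simp_all add: Gc xc ff_coef_zero[OF G])
        finally show ?thesis using sigc cec[OF k t] by (simp add: a_minus_def r_neg)
      qed
      then have "dd k w (ff_obs F n B x G k) x = w k"
        using w k unfolding dd_def by (intro hcode_exact(2)[OF c[OF k] slots_okD(3)[OF T k]]) (auto simp: msg_set_def)
      then show ?thesis unfolding measure_pmf_zero_iff set_nsb using k by auto
    qed
    have "measure_pmf.expectation (ff_coef F M K B n) (\<lambda>G. measure_pmf.prob (nsb (w, \<lambda>k'. ff_obs F n B x G k')) {(x', v). x' = x \<and> v k \<noteq> w k}) = 0"
      if w: "w \<in> msg_set K m" and x: "x \<in> ff_X F n B" for w x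
    proof -
      have "measure_pmf.expectation (ff_coef F M K B n) (\<lambda>G. measure_pmf.prob (nsb (w, \<lambda>k'. ff_obs F n B x G k')) {(x', v). x' = x \<and> v k \<noteq> w k})
         = measure_pmf.expectation (ff_coef F M K B n) (\<lambda>G. 0)"
        by (intro integral_cong_AE AE_pmfI z[OF w x]) simp_all
      then show ?thesis by simp
    qed
    then show ?thesis unfolding ff_ns_err_def by (simp only: sum.neutral_const div_0 cong: sum.cong)
  qed
  moreover have "card (carrier F) ^ nat \<lfloor>real n * d k\<rfloor> \<le> m k" if "k \<in> {1..K}" for k
    using hcode_exact(1)[OF c[OF that] slots_okD(3)[OF T that]] slots_okD(2)[OF T that] by simp
  ultimately show ?thesis using scheme by blast
qed

theorem ff_ns_achievable:
  assumes d: "d \<in> ns_dof_region K B par M"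
  shows "(\<lambda>k. d k * log 2 (real (card (carrier F)))) \<in> ff_ns_cap F M K B"
proof -
  let ?q = "card (carrier F)"
  have d0: "d \<in> rplus K" using d by (simp add: ns_dof_region_def)
  define P where "P = (\<lambda>n c. ff_ns_scheme F K B n (fst c) (snd c) \<and>
     (\<forall>k\<in>{1..K}. ff_ns_err F M K B n (fst c) (snd c) k = 0) \<and> (\<forall>k\<in>{1..K}. ?q ^ nat \<lfloor>real n * d k\<rfloor> \<le> fst c k))"
  have "\<forall>n. \<exists>c. P n c"
  proof
    fix n
    obtain T where "slots_ok n d T" using ex_ns_slots[OF d] by blast
    then have "\<exists>m nsb. P n (m, nsb)" unfolding P_def fst_conv snd_conv by (rule ff_ns_zero_error)
    then obtain m nsb where "P n (m, nsb)" by (elim exE)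
    then show "\<exists>c. P n c" by (rule exI[of "P n"])
  qed
  then obtain c where c: "\<forall>n. P n (c n)" using choice[of P] by blast
  define m nsb where "m = (\<lambda>n. fst (c n))" and "nsb = (\<lambda>n. snd (c n))"
  have s: "ff_ns_scheme F K B n (m n) (nsb n)"
    and e: "\<And>k. k \<in> {1..K} \<Longrightarrow> ff_ns_err F M K B n (m n) (nsb n) k = 0"
    and r: "\<And>k. k \<in> {1..K} \<Longrightarrow> ?q ^ nat \<lfloor>real n * d k\<rfloor> \<le> m n k" for n
    using c[THEN spec, of n] unfolding P_def m_def nsb_def by blast+
  show ?thesis unfolding ff_ns_cap_def
  proof (intro subsetD[OF closure_subset] CollectI conjI exI[of _ m] exI[of _ nsb] allI ballI)
    show "(\<lambda>k. d k * log 2 (real ?q)) \<in> rplus K"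
      using d0 card_ge_2 by (auto simp: rplus_def intro!: mult_nonneg_nonneg)
    show "(\<lambda>n. Max ((\<lambda>k. ff_ns_err F M K B n (m n) (nsb n) k) ` {1..K})) \<longlonglongrightarrow> 0"
      by (rule Max_err_tendsto[OF KB_pos(1), where b="\<lambda>_. 0"]) (use e in auto)
    show "ereal (d k * log 2 (real ?q)) \<le> liminf_rate m k" if k: "k \<in> {1..K}" for k
    proof (rule zero_error_rate[OF _ card_ge_2])
      show "real ?q ^ nat \<lfloor>real n * d k\<rfloor> \<le> real (m n k)" for n
        using of_nat_mono[OF r[OF k, of n], where ?'a=real] by simp
      show "0 \<le> d k" using d0 k by (simp add: rplus_def)
    qed
  qed (rule s)
qed

end

section \<open>Achievability for the Gaussian channel\<close>

text \<open>The expected energy is \<open>n\<close>; the threshold \<open>4 * n\<close> is chosen so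
  that its quarter cancels against \<open>exp (- n)\<close> in the exponential moment bound.\<close>

definition noise_ok :: "nat \<Rightarrow> nat \<Rightarrow> (nat \<times> nat \<Rightarrow> real) \<Rightarrow> bool" where
  "noise_ok n k z \<longleftrightarrow> (\<Sum>t<n. (z (t, k))\<^sup>2) \<le> 4 * real n"

text \<open>Multiplying the standard normal density by \<open>exp (z\<^sup>2 / 4)\<close> gives
  \<open>sqrt 2\<close> times the normal density of variance 2.\<close>

lemma exp_square_std_normal:
  "(\<integral>\<^sup>+z. ennreal (exp (z\<^sup>2 / 4)) \<partial>std_normal) = ennreal (sqrt 2)"
proof -
  have e: "std_normal_density z * exp (z\<^sup>2 / 4) = sqrt 2 * normal_density 0 (sqrt 2) z" for z :: real
  proof -
    have "exp (- z\<^sup>2 / 2) * exp (z\<^sup>2 / 4) = exp (- z\<^sup>2 / 4)" by (simp add: exp_add[symmetric])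
    moreover have "sqrt (2 * pi * 2) = sqrt 2 * sqrt (2 * pi)" by (simp add: real_sqrt_mult)
    ultimately show ?thesis by (simp add: normal_density_def field_simps)
  qed
  have "(\<integral>\<^sup>+z. ennreal (exp (z\<^sup>2 / 4)) \<partial>std_normal)
      = (\<integral>\<^sup>+z. ennreal (sqrt 2 * normal_density 0 (sqrt 2) z) \<partial>lborel)"
    by (subst nn_integral_density) (auto simp: e ennreal_mult[symmetric])
  also have "\<dots> = ennreal (\<integral>z. sqrt 2 * normal_density 0 (sqrt 2) z \<partial>lborel)"
    by (intro nn_integral_eq_integral integrable_mult_right integrable_normal_density) auto
  also have "\<dots> = ennreal (sqrt 2)" by simp
  finally show ?thesis .
qed

lemma gNoise_prod_integral:
  assumes k: "k \<in> {1..K}" and [measurable]: "g \<in> borel_measurable borel"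
  shows "(\<integral>\<^sup>+z. (\<Prod>t<n. g (z (t, k))) \<partial>gNoise K n) = (\<integral>\<^sup>+z. g z \<partial>std_normal) ^ n"
proof -
  let ?D = "std_normal"
  interpret N: prob_space ?D by (rule prob_space_std_normal)
  interpret product_sigma_finite "\<lambda>_::nat \<times> nat. ?D" ..
  define h where "h = (\<lambda>(p::nat \<times> nat) y. if snd p = k then g y else 1)"
  have [measurable]: "h p \<in> borel_measurable borel" for p by (cases "snd p = k") (auto simp: h_def)
  have eq: "(\<Prod>t<n. u t) = (\<Prod>p\<in>{..<n} \<times> {1..K}. if snd p = k then u (fst p) else 1)" for u :: "nat \<Rightarrow> ennreal"
  proof -
    have "(\<Prod>p\<in>{..<n} \<times> {1..K}. if snd p = k then u (fst p) else 1) = (\<Prod>t<n. \<Prod>i\<in>{1..K}. if i = k then u t else 1)"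
      by (subst prod.cartesian_product) (intro prod.cong, auto)
    also have "\<dots> = (\<Prod>t<n. u t)" using k by (intro prod.cong) auto
    finally show ?thesis by simp
  qed
  have "(\<integral>\<^sup>+z. (\<Prod>t<n. g (z (t, k))) \<partial>gNoise K n) = (\<integral>\<^sup>+z. (\<Prod>p\<in>{..<n} \<times> {1..K}. h p (z p)) \<partial>gNoise K n)"
  proof (rule nn_integral_cong)
    fix z
    have "(\<Prod>p\<in>{..<n} \<times> {1..K}. h p (z p)) = (\<Prod>p\<in>{..<n} \<times> {1..K}. if snd p = k then g (z (fst p, k)) else 1)"
      by (intro prod.cong) (auto simp: h_def)
    then show "(\<Prod>t<n. g (z (t, k))) = (\<Prod>p\<in>{..<n} \<times> {1..K}. h p (z p))"
      by (simp add: eq[of "\<lambda>t. g (z (t, k))"])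
  qed
  also have "\<dots> = (\<Prod>p\<in>{..<n} \<times> {1..K}. \<integral>\<^sup>+y. h p y \<partial>?D)"
    unfolding gNoise_def by (rule product_nn_integral_prod) auto
  also have "\<dots> = (\<Prod>p\<in>{..<n} \<times> {1..K}. if snd p = k then (\<integral>\<^sup>+y. g y \<partial>?D) else 1)"
    using N.emeasure_space_1 by (intro prod.cong) (auto simp: h_def)
  also have "\<dots> = (\<Prod>t<n. \<integral>\<^sup>+y. g y \<partial>?D)" by (rule eq[symmetric])
  finally show ?thesis by simp
qed

lemma measurable_gNoise_component:
  assumes "t < n" "k \<in> {1..K}"
  shows "(\<lambda>z. z (t, k)) \<in> borel_measurable (gNoise K n)"
proof -
  have "(\<lambda>z. z (t, k)) \<in> borel_measurable (\<Pi>\<^sub>M p\<in>{..<n} \<times> {1..K}. borel)"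
    using assms by (intro measurable_component_singleton) auto
  then show ?thesis by (simp cong: measurable_cong_sets add: sets_gNoise)
qed

lemma measurable_noise_ok:
  assumes "k \<in> {1..K}"
  shows "{z \<in> space (gNoise K n). noise_ok n k z} \<in> sets (gNoise K n)"
proof -
  have [measurable]: "(\<lambda>z. z (t, k)) \<in> borel_measurable (gNoise K n)" if "t \<in> {..<n}" for t
    using that assms by (intro measurable_gNoise_component) auto
  show ?thesis unfolding noise_ok_def by measurable
qed

text \<open>Chernoff's bound with parameter \<open>1/4\<close>: on the bad event the exponent
  \<open>- n + (\<Sum>t<n. (z (t, k))\<^sup>2) / 4\<close> is positive, and independence gives the
  factor \<open>sqrt 2\<close> per slot. Since \<open>sqrt 2 < exp 1\<close> the bound decays
  exponentially.\<close>

lemma noise_ok_prob: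
  assumes k: "k \<in> {1..K}"
  shows "measure (gNoise K n) {z \<in> space (gNoise K n). \<not> noise_ok n k z} \<le> (sqrt 2 / exp 1) ^ n"
proof -
  interpret N: prob_space "gNoise K n" by (rule prob_space_gNoise)
  let ?S = "{z \<in> space (gNoise K n). \<not> noise_ok n k z}"
  have S: "?S = space (gNoise K n) - {z \<in> space (gNoise K n). noise_ok n k z}" by blast
  have [measurable]: "?S \<in> sets (gNoise K n)" unfolding S using measurable_noise_ok[OF k] by blast
  have [measurable]: "(\<lambda>z. z (t, k)) \<in> borel_measurable (gNoise K n)" if "t \<in> {..<n}" for t
    using that k by (intro measurable_gNoise_component) auto
  have "emeasure (gNoise K n) ?S = (\<integral>\<^sup>+z. indicator ?S z \<partial>gNoise K n)" by simp
  also have "\<dots> \<le> (\<integral>\<^sup>+z. ennreal (exp (- real n)) * (\<Prod>t<n. ennreal (exp ((z (t, k))\<^sup>2 / 4))) \<partial>gNoise K n)"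
  proof (rule nn_integral_mono)
    fix z
    have p: "(\<Prod>t<n. ennreal (exp ((z (t, k))\<^sup>2 / 4))) = ennreal (exp ((\<Sum>t<n. (z (t, k))\<^sup>2) / 4))"
      by (simp add: prod_ennreal exp_sum sum_divide_distrib)
    show "indicator ?S z \<le> ennreal (exp (- real n)) * (\<Prod>t<n. ennreal (exp ((z (t, k))\<^sup>2 / 4)))"
    proof (cases "z \<in> ?S")
      case True
      then have "1 \<le> exp (- real n + (\<Sum>t<n. (z (t, k))\<^sup>2) / 4)" by (simp add: noise_ok_def)
      then show ?thesis using True unfolding p exp_add by (simp add: ennreal_mult[symmetric] ennreal_ge_1)
    qed simp
  qed
  also have "\<dots> = ennreal (exp (- real n)) * ennreal (sqrt 2) ^ n"
    by (subst nn_integral_cmult) (auto simp: gNoise_prod_integral[OF k, of "\<lambda>y. ennreal (exp (y\<^sup>2 / 4))"] exp_square_std_normal)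
  also have "\<dots> = ennreal ((sqrt 2 / exp 1) ^ n)"
    by (simp add: ennreal_power ennreal_mult[symmetric] exp_minus power_divide field_simps exp_of_nat_mult[symmetric])
  finally show ?thesis unfolding N.emeasure_eq_measure by simp
qed

lemma gState_noise_prob:
  assumes adm: "admissible_density f c" and k: "k \<in> {1..K}"
  shows "measure (gState M K B n f) {s \<in> space (gState M K B n f). \<not> noise_ok n k (snd s)} \<le> (sqrt 2 / exp 1) ^ n"
    "{s \<in> space (gState M K B n f). \<not> noise_ok n k (snd s)} \<in> sets (gState M K B n f)"
proof -
  interpret A: prob_space "gGain M K B n f" by (rule prob_space_gGain[OF adm])
  interpret N: prob_space "gNoise K n" by (rule prob_space_gNoise)
  let ?S = "{z \<in> space (gNoise K n). \<not> noise_ok n k z}"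
  have S: "?S = space (gNoise K n) - {z \<in> space (gNoise K n). noise_ok n k z}" by blast
  have Sm: "?S \<in> sets (gNoise K n)" unfolding S using measurable_noise_ok[OF k] by blast
  have eq: "{s \<in> space (gState M K B n f). \<not> noise_ok n k (snd s)} = space (gGain M K B n f) \<times> ?S"
    by (auto simp: gState_eq space_pair_measure)
  show "{s \<in> space (gState M K B n f). \<not> noise_ok n k (snd s)} \<in> sets (gState M K B n f)"
    unfolding eq using Sm by (auto simp: gState_eq)
  have "emeasure (gState M K B n f) (space (gGain M K B n f) \<times> ?S) = emeasure (gNoise K n) ?S"
    unfolding gState_eq using Sm by (subst N.emeasure_pair_measure_Times) (auto simp: A.emeasure_space_1)
  then show "measure (gState M K B n f) {s \<in> space (gState M K B n f). \<not> noise_ok n k (snd s)} \<le> (sqrt 2 / exp 1) ^ n"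
    using noise_ok_prob[OF k, of n] unfolding eq measure_def by simp
qed

lemma AE_gState_gain:
  assumes adm: "admissible_density f c"
  shows "AE s in gState M K B n f. \<forall>p\<in>gain_idx n K B. \<bar>fst s p\<bar> \<le> c \<and>
     (case p of (t, k, j) \<Rightarrow> if M k j then 1 / c \<le> \<bar>fst s p\<bar> else fst s p = 0)"
proof -
  interpret N: prob_space "gNoise K n" by (rule prob_space_gNoise)
  have "distr (gState M K B n f) (gGain M K B n f) fst = gGain M K B n f"
    unfolding gState_eq by (rule N.distr_pair_fst)
  then have "AE g in distr (gState M K B n f) (gGain M K B n f) fst. \<forall>p\<in>gain_idx n K B. \<bar>g p\<bar> \<le> c \<and>
     (case p of (t, k, j) \<Rightarrow> if M k j then 1 / c \<le> \<bar>g p\<bar> else g p = 0)"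
    using AE_gGain_bound[OF adm, of n K B M] by (simp only:)
  then show ?thesis by (rule AE_distrD[rotated]) (simp add: gState_eq)
qed

text \<open>Almost surely the gains satisfy their bounds, so an error quantity that vanishes for
  such gains and moderate noise is supported on the event of atypical noise.\<close>

lemma gState_error_bound:
  assumes adm: "admissible_density f c" and k: "k \<in> {1..K}"
    and H: "H \<in> borel_measurable (gState M K B n f)" "\<And>s. 0 \<le> H s" "\<And>s. H s \<le> (b::real)"
    and ok: "\<And>g z. (\<And>t j. t < n \<Longrightarrow> j \<in> {1..B} \<Longrightarrow> if M k j then 1 / c \<le> \<bar>g (t, k, j)\<bar> else g (t, k, j) = 0)
       \<Longrightarrow> noise_ok n k z \<Longrightarrow> H (g, z) = 0"
  shows "(\<integral>s. H s \<partial>gState M K B n f) \<le> b * (sqrt 2 / exp 1) ^ n"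
proof -
  interpret G: prob_space "gState M K B n f" by (rule prob_space_gState[OF adm])
  let ?S = "{s \<in> space (gState M K B n f). \<not> noise_ok n k (snd s)}"
  have b: "0 \<le> b" using H(2,3)[of undefined] by linarith
  note Sm = gState_noise_prob(2)[OF adm k, of M B n]
  have "(\<integral>s. H s \<partial>gState M K B n f) \<le> (\<integral>s. b * indicator ?S s \<partial>gState M K B n f)"
  proof (rule integral_mono_AE)
    show "integrable (gState M K B n f) H"
      by (rule G.integrable_const_bound[of _ b]) (use H in auto)
    show "integrable (gState M K B n f) (\<lambda>s. b * indicator ?S s)"
      by (rule G.integrable_const_bound[of _ b]) (use Sm b in \<open>auto simp: indicator_def\<close>)
    show "AE s in gState M K B n f. H s \<le> b * indicator ?S s"
      using AE_gState_gain[OF adm, of n K B M] AE_space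
    proof eventually_elim
      case (elim s)
      obtain g z where s: "s = (g, z)" by (cases s)
      show ?case
      proof (cases "noise_ok n k z")
        case True
        have "H (g, z) = 0"
        proof (rule ok[OF _ True])
          show "if M k j then 1 / c \<le> \<bar>g (t, k, j)\<bar> else g (t, k, j) = 0" if "t < n" "j \<in> {1..B}" for t j
            using elim(1)[THEN bspec, of "(t, k, j)"] k that by (simp add: s split: if_splits)
        qed
        then show ?thesis using b s by simp
      next
        case False
        then show ?thesis using elim(2) H(3)[of s] s by simp
      qed
    qed
  qed
  also have "\<dots> = b * measure (gState M K B n f) ?S" using Sm by simp
  also have "\<dots> \<le> b * (sqrt 2 / exp 1) ^ n"
    using gState_noise_prob(1)[OF adm k, of M B n] b by (rule mult_left_mono)
  finally show ?thesis .
qed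

section \<open>Measurability of finite-valued estimates\<close>

text \<open>The decoder \<open>h\<close> is an arbitrary function, but it reads finitely many
  coordinates with finitely many values, so its preimages are finite unions of measurable
  cylinders.\<close>

lemma measurable_of_finite_vector:
  fixes h :: "('t \<Rightarrow> 's) \<Rightarrow> nat"
  assumes T: "finite T" and A: "finite A" "\<And>ob t. t \<in> T \<Longrightarrow> \<phi> ob t \<in> A"
    and m: "\<And>t. t \<in> T \<Longrightarrow> (\<lambda>ob. \<phi> ob t) \<in> N \<rightarrow>\<^sub>M count_space UNIV"
    and h: "\<And>s s'. (\<And>t. t \<in> T \<Longrightarrow> s t = s' t) \<Longrightarrow> h s = h s'"
  shows "(\<lambda>ob. h (\<phi> ob)) \<in> N \<rightarrow>\<^sub>M count_space UNIV"
proof -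
  have fin: "finite (T \<rightarrow>\<^sub>E A)" using T A by (intro finite_PiE) auto
  have "(\<lambda>ob. h (\<phi> ob)) -` {v} \<inter> space N \<in> sets N" for v
  proof -
    have "(\<lambda>ob. h (\<phi> ob)) -` {v} \<inter> space N = (\<Union>u\<in>{u \<in> T \<rightarrow>\<^sub>E A. h u = v}. {ob \<in> space N. \<forall>t\<in>T. \<phi> ob t = u t})" (is "?L = ?R")
    proof
      show "?L \<subseteq> ?R"
      proof
        fix ob assume ob: "ob \<in> ?L"
        have "h (restrict (\<phi> ob) T) = h (\<phi> ob)" by (rule h) simp
        then show "ob \<in> ?R" using ob A(2) by (intro UN_I[of "restrict (\<phi> ob) T"]) auto
      qed
      show "?R \<subseteq> ?L"
      proof
        fix ob assume "ob \<in> ?R"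
        then obtain u where u: "h u = v" "ob \<in> space N" "\<forall>t\<in>T. \<phi> ob t = u t" by blast
        have "h (\<phi> ob) = h u" by (rule h) (use u in blast)
        then show "ob \<in> ?L" using u by simp
      qed
    qed
    moreover have "{ob \<in> space N. \<forall>t\<in>T. \<phi> ob t = u t} \<in> sets N" for u
    proof (rule sets.sets_Collect_finite_All[OF _ T])
      fix t assume "t \<in> T"
      from measurable_sets[OF m[OF this], of "{u t}"]
      show "{ob \<in> space N. \<phi> ob t = u t} \<in> sets N"
        by (simp add: vimage_def Int_def conj_commute)
    qed
    ultimately show ?thesis using fin by (auto intro!: sets.finite_UN)
  qed
  then show ?thesis by (simp add: measurable_count_space_eq2_countable)
qed

lemma measurable_gOM_components:
  assumes "t < n"
  shows "(\<lambda>ob. fst (ob t)) \<in> borel_measurable (gOM n B)" "j \<in> {1..B} \<Longrightarrow> (\<lambda>ob. snd (ob t) j) \<in> borel_measurable (gOM n B)"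
proof -
  have m: "(\<lambda>ob. ob t) \<in> gOM n B \<rightarrow>\<^sub>M borel \<Otimes>\<^sub>M (\<Pi>\<^sub>M j\<in>{1..B}. borel)"
    unfolding gOM_def using assms by (intro measurable_component_singleton) auto
  show "(\<lambda>ob. fst (ob t)) \<in> borel_measurable (gOM n B)" by (rule measurable_compose[OF m measurable_fst])
  have "(\<lambda>ob. snd (ob t)) \<in> gOM n B \<rightarrow>\<^sub>M (\<Pi>\<^sub>M j\<in>{1..B}. borel)" by (rule measurable_compose[OF m measurable_snd])
  then show "(\<lambda>ob. snd (ob t) j) \<in> borel_measurable (gOM n B)" if "j \<in> {1..B}"
    using that by (rule measurable_PiM_apply)
qed

lemma measurable_round[measurable]: "(round :: real \<Rightarrow> int) \<in> borel \<rightarrow>\<^sub>M count_space UNIV"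
  unfolding round_def[abs_def] by measurable

lemma card_few_le:
  assumes "finite T" "card T \<le> n"
  shows "card {U. U \<subseteq> T \<and> card U \<le> r} \<le> 2 ^ n"
proof -
  have "card {U. U \<subseteq> T \<and> card U \<le> r} \<le> card (Pow T)" using assms(1) by (intro card_mono) auto
  also have "\<dots> \<le> 2 ^ n" using assms by (simp add: card_Pow)
  finally show ?thesis .
qed

lemma gpow_le:
  assumes B: "0 < B" and P: "0 \<le> P" and x: "\<And>t j. t < n \<Longrightarrow> j \<in> {1..B} \<Longrightarrow> \<bar>x (t, j)\<bar> \<le> sqrt (P / real B)"
  shows "gpow n B x \<le> P"
proof (cases "n = 0")
  case False
  have "(\<Sum>t<n. \<Sum>j\<in>{1..B}. (x (t, j))\<^sup>2) \<le> (\<Sum>t<n. \<Sum>j\<in>{1..B}. P / real B)"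
  proof (intro sum_mono)
    fix t j assume "t \<in> {..<n}" "j \<in> {1..B}"
    then have "\<bar>x (t, j)\<bar>\<^sup>2 \<le> (sqrt (P / real B))\<^sup>2" by (intro power_mono x) auto
    then show "(x (t, j))\<^sup>2 \<le> P / real B" using P by simp
  qed
  also have "\<dots> = real n * P" using B by simp
  finally show ?thesis using False by (simp add: gpow_def divide_le_eq mult.commute)
qed (use P in \<open>simp add: gpow_def\<close>)

section \<open>Lattice signalling over the Gaussian tree network\<close>

text \<open>Symbols \<open>0, ..., Q - 1\<close> are sent with spacing \<open>a\<close>, and
  \<open>aQ\<close> keeps every amplitude below \<open>sqrt (P / real B)\<close>, so the power
  constraint holds for each codeword. A symbol is misread only if the noise reaches
  \<open>a / (2 * c)\<close>; the choice of \<open>a\<close> makes the square of this threshold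
  \<open>4 / \<delta>\<close>, so noise of energy at most \<open>4 * n\<close> causes at most
  \<open>\<delta> * n\<close> wrong symbols.\<close>

locale gauss_tree = tree_network K B par M
  for K B :: nat and par M +
  fixes f :: "real \<Rightarrow> real" and c \<delta> P a :: real and Q :: nat
  assumes adm: "admissible_density f c" and \<delta>: "0 < \<delta>" and P: "0 < P" and Q: "1 \<le> Q"
    and a_def: "a = 4 * c / sqrt \<delta>" and aQ: "a * (real Q - 1) \<le> sqrt (P / real B)"
begin

lemma c_pos: "0 < c" using adm by (simp add: admissible_density_def)
lemma a_pos: "0 < a" using c_pos \<delta> by (simp add: a_def)

abbreviation syms :: "int set" where "syms \<equiv> {0..<int Q}"

definition radius :: "nat \<Rightarrow> nat" where "radius n = nat \<lfloor>\<delta> * real n\<rfloor>"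

lemma syms_props: "finite syms" "syms \<noteq> {}" "card syms = Q" "0 \<in> syms" using Q by auto

lemma amplitude: "s \<in> syms \<Longrightarrow> \<bar>a * of_int s\<bar> \<le> sqrt (P / real B)"
proof -
  assume "s \<in> syms"
  then have "0 \<le> (of_int s :: real)" "of_int s \<le> real Q - 1" by auto
  then have "\<bar>a * of_int s\<bar> \<le> a * (real Q - 1)" using a_pos by (simp add: abs_mult)
  then show ?thesis using aQ by linarith
qed

lemma round_estimate:
  assumes g: "1 / c \<le> \<bar>g\<bar>" and z: "\<bar>z\<bar> < a / (2 * c)"
  shows "round ((g * (a * of_int s) + z) / (a * g)) = s"
proof -
  have g0: "0 < \<bar>g\<bar>" using g c_pos by (smt (verit) divide_pos_pos)
  have "\<bar>z / (a * g)\<bar> < 1 / 2"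
  proof -
    have "\<bar>z\<bar> < a * (1 / c) / 2" using z by (simp add: mult.commute)
    also have "\<dots> \<le> a * \<bar>g\<bar> / 2" using g a_pos by (intro divide_right_mono mult_left_mono) auto
    finally show ?thesis using g0 a_pos by (simp add: abs_mult divide_less_eq)
  qed
  moreover have "(g * (a * of_int s) + z) / (a * g) = of_int s + z / (a * g)"
    using g0 a_pos by (simp add: add_divide_distrib)
  ultimately show ?thesis by (intro round_unique) linarith+
qed

text \<open>Every wrong symbol consumes at least \<open>4 / \<delta>\<close> of the noise energy, of
  which only \<open>4 * n\<close> is available.\<close>

lemma few_symbol_errors:
  assumes ok: "noise_ok n k z" and T: "T \<subseteq> {..<n}"
    and s: "\<And>t. t \<in> T \<Longrightarrow> \<bar>z (t, k)\<bar> < a / (2 * c) \<Longrightarrow> s t = v t"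
  shows "card {t\<in>T. s t \<noteq> v t} \<le> radius n"
proof -
  let ?E = "{t\<in>T. s t \<noteq> v t}"
  have fin: "finite T" using T finite_subset by blast
  have sq: "(a / (2 * c))\<^sup>2 = 4 / \<delta>" using \<delta> c_pos by (simp add: a_def power_divide power_mult_distrib)
  have "real (card ?E) * (4 / \<delta>) = (\<Sum>t\<in>?E. 4 / \<delta>)" by simp
  also have "\<dots> \<le> (\<Sum>t\<in>?E. (z (t, k))\<^sup>2)"
  proof (rule sum_mono)
    fix t assume "t \<in> ?E"
    then have "a / (2 * c) \<le> \<bar>z (t, k)\<bar>" using s by force
    then have "(a / (2 * c))\<^sup>2 \<le> \<bar>z (t, k)\<bar>\<^sup>2" using a_pos c_pos by (intro power_mono) auto
    then show "4 / \<delta> \<le> (z (t, k))\<^sup>2" by (simp add: sq)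
  qed
  also have "\<dots> \<le> (\<Sum>t<n. (z (t, k))\<^sup>2)" using T by (intro sum_mono2) auto
  also have "\<dots> \<le> 4 * real n" using ok by (simp add: noise_ok_def)
  finally have "real (card ?E) \<le> \<delta> * real n" using \<delta> by (simp add: field_simps)
  then show ?thesis unfolding radius_def by linarith
qed

lemma gobs_nth:
  assumes "t < n" "k \<in> {1..K}" and g0: "\<forall>j\<in>{1..B}. \<not> M k j \<longrightarrow> g (t, k, j) = 0"
  shows "fst (gobs n B x (g, z) k t) = (\<Sum>j\<in>{j\<in>{1..B}. M k j}. g (t, k, j) * x (t, j)) + z (t, k)"
    "j \<in> {1..B} \<Longrightarrow> snd (gobs n B x (g, z) k t) j = g (t, k, j)"
proof -
  have "(\<Sum>j\<in>{1..B}. g (t, k, j) * x (t, j)) = (\<Sum>j\<in>{j\<in>{1..B}. M k j}. g (t, k, j) * x (t, j))"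
    by (rule sum.mono_neutral_right) (use g0 in auto)
  then show "fst (gobs n B x (g, z) k t) = (\<Sum>j\<in>{j\<in>{1..B}. M k j}. g (t, k, j) * x (t, j)) + z (t, k)"
    using assms(1) by (simp add: gobs_def)
  show "snd (gobs n B x (g, z) k t) j = g (t, k, j)" if "j \<in> {1..B}" using assms(1) that by (simp add: gobs_def)
qed

text \<open>All subsets of the slots are counted as possible error sets. The factor
  \<open>2 ^ n\<close> costs one bit per use whatever the alphabet size, which is negligible against
  \<open>log 2 (real Q)\<close> for large \<open>P\<close>.\<close>

lemma code_size:
  assumes T: "slots_ok n d T" and k: "k \<in> {1..K}" and c: "hcode syms (T k) (radius n) m e dd"
  shows "Q ^ nat \<lfloor>real n * d k\<rfloor> \<le> m * (2 ^ n * Q ^ (2 * radius n))"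
proof -
  have "card (T k) \<le> n" using card_mono[OF _ slots_okD(1)[OF T k]] by simp
  then have "card {U. U \<subseteq> T k \<and> card U \<le> 2 * radius n} \<le> 2 ^ n" by (rule card_few_le[OF slots_okD(3)[OF T k]])
  then have "m * (card {U. U \<subseteq> T k \<and> card U \<le> 2 * radius n} * Q ^ (2 * radius n)) \<le> m * (2 ^ n * Q ^ (2 * radius n))"
    by (intro mult_le_mono) auto
  then show ?thesis using hcodeD(6)[OF c] unfolding syms_props(3) slots_okD(2)[OF T k] by linarith
qed

end

context gauss_tree
begin

lemma mod_cancel_left:
  assumes "(C - s) mod int Q = (C - s') mod int Q" "s \<in> syms" "s' \<in> syms"
  shows "s = s'"
proof -
  have "int Q dvd (C - s) - (C - s')" using assms(1) by (simp only: mod_eq_dvd_iff)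
  then have "int Q dvd s' - s" by simp
  moreover have "\<bar>s' - s\<bar> < int Q" using assms(2,3) by auto
  ultimately show ?thesis using dvd_imp_le_int[of "s' - s" "int Q"] by (cases "s' = s") auto
qed

text \<open>The pad is a uniform array of integer symbols. Receiver \<open>k\<close> subtracts the
  interference of the strict ancestors, whose symbols the box knows, rounds to an estimate of its
  own pad symbol, and adds code symbol plus estimate minus true pad symbol modulo \<open>Q\<close>.
  A correct estimate leaves the code symbol; for any observation the map stays triangular in the
  pad.\<close>

lemma gauss_ns_code:
  assumes T: "slots_ok n d T"
  shows "\<exists>m nsb A. g_ns_scheme K B n P m f M nsb A \<and>
     (\<forall>k\<in>{1..K}. 0 \<le> g_ns_err M K B f n m nsb A k \<and> g_ns_err M K B f n m nsb A k \<le> (sqrt 2 / exp 1) ^ n) \<and>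
     (\<forall>k\<in>{1..K}. Q ^ nat \<lfloor>real n * d k\<rfloor> \<le> m k * (2 ^ n * Q ^ (2 * radius n)))"
proof -
  obtain m ce cd where c: "\<And>k. k \<in> {1..K} \<Longrightarrow> hcode syms (T k) (radius n) (m k) (ce k) (cd k)"
    using ex_hcodes[OF syms_props(1,2), of "{1..K}" T "radius n"] slots_okD(3)[OF T] by blast
  define Sy where "Sy = ({..<n} \<times> {1..B} \<rightarrow>\<^sub>E syms)"
  let ?N = "\<lambda>k. {j\<in>{1..B}. M k j}"
  define emb where "emb = (\<lambda>x :: nat \<times> nat \<Rightarrow> int. \<lambda>p\<in>{..<n} \<times> {1..B}. a * of_int (x p))"
  \<comment> \<open>The sum omits the own transmitter, so for a given observation the estimate
    depends on the pad only at strict ancestors.\<close>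
  define res where "res = (\<lambda>k (ob :: nat \<Rightarrow> real \<times> (nat \<Rightarrow> real)) (x :: nat \<times> nat \<Rightarrow> int) t.
     round ((fst (ob t) - (\<Sum>j\<in>?N k - {tx k}. snd (ob t) j * (a * of_int (x (t, j))))) / (a * snd (ob t) (tx k))))"
  \<comment> \<open>The remainder modulo \<open>Q\<close> keeps the values in the alphabet, and
    subtracting the own pad symbol is a bijection of the residues.\<close>
  define \<phi> where "\<phi> = (\<lambda>k (w :: nat \<Rightarrow> nat) ob x t. (ce k (w k) t + res k ob x t - x (t, tx k)) mod int Q)"
  define dd where "dd = (\<lambda>k w ob x. cd k (\<phi> k w ob x))"
  define nsb where "nsb = (\<lambda>(w, ob). map_pmf (\<lambda>x. (emb x, \<lambda>k. if k \<in> {1..K} then dd k w (ob k) x else 0)) (pmf_of_set Sy))"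
  define A where "A = emb ` Sy \<times> msg_set K m"
  have m1: "1 \<le> m k" if "k \<in> {1..K}" for k by (rule hcodeD(1)[OF c[OF that]])
  have finS: "finite Sy" unfolding Sy_def using syms_props(1) by (intro finite_PiE) auto
  have neS: "Sy \<noteq> {}" unfolding Sy_def using syms_props(2) by (simp add: PiE_eq_empty_iff)
  have cS: "0 < real (card Sy)" using finS neS by (simp add: card_gt_0_iff)
  have Sy_syms: "x (t, b) \<in> syms" if "x \<in> Sy" "t < n" "b \<in> {1..B}" for x t b
    using that unfolding Sy_def by (auto dest: PiE_mem)
  have \<phi>s: "\<phi> k w ob x t \<in> syms" for k w ob x t using Q by (simp add: \<phi>_def)
  have inj: "inj_on emb Sy"
  proof (rule inj_onI)
    fix x x' assume x: "x \<in> Sy" "x' \<in> Sy" and eq: "emb x = emb x'"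
    show "x = x'"
    proof (rule PiE_ext)
      show "x \<in> {..<n} \<times> {1..B} \<rightarrow>\<^sub>E syms" "x' \<in> {..<n} \<times> {1..B} \<rightarrow>\<^sub>E syms" using x by (simp_all add: Sy_def)
      show "x p = x' p" if "p \<in> {..<n} \<times> {1..B}" for p
        using fun_cong[OF eq, of p] that a_pos by (simp add: emb_def)
    qed
  qed
  have neM: "msg_set K m \<noteq> {}"
  proof -
    have "0 < card (msg_set K m)" unfolding card_msg_set using m1 by (simp add: prod_pos Suc_le_eq)
    then show ?thesis by auto
  qed
  have fstA: "fst ` A = emb ` Sy" using neM by (auto simp: A_def fst_image_times)
  have ns: "ns_box K nsb"
    unfolding nsb_def
  proof (rule ns_box_one_time_pad[where D="\<lambda>k z. cd k (\<lambda>t. z (t, tx k))", OF finS neS])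
    fix w :: "nat \<Rightarrow> nat" and ob :: "nat \<Rightarrow> nat \<Rightarrow> real \<times> (nat \<Rightarrow> real)"
    define Tr where "Tr = (\<lambda>x. \<lambda>p\<in>{..<n} \<times> {1..B}.
        if \<exists>k\<in>{1..K}. tx k = snd p \<and> fst p \<in> T k then place T (\<lambda>k. \<phi> k w (ob k) x) 0 (fst p) (snd p) else x p)"
    have Tr_active: "Tr x (t, tx k) = \<phi> k w (ob k) x t" if k: "k \<in> {1..K}" "t \<in> T k" for x k t
    proof -
      have "t < n" using slots_okD(1)[OF T k(1)] k(2) by auto
      moreover have "\<exists>k'\<in>{1..K}. tx k' = tx k \<and> t \<in> T k'" using k by blast
      ultimately show ?thesis using tx_props(1)[OF k(1)] place_active[OF T k, of "\<lambda>k. \<phi> k w (ob k) x" 0]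
        by (simp add: Tr_def)
    qed
    have Tr_idle: "Tr x (t, b) = x (t, b)" if "t < n" "b \<in> {1..B}" "\<not> (\<exists>k\<in>{1..K}. tx k = b \<and> t \<in> T k)" for x t b
      using that by (simp only: Tr_def restrict_apply' mem_Times_iff fst_conv snd_conv lessThan_iff if_False simp_thms)
    have into: "Tr x \<in> Sy" if x: "x \<in> Sy" for x
    proof -
      have "Tr x (t, b) \<in> syms" if "t < n" "b \<in> {1..B}" for t b
      proof (cases "\<exists>k\<in>{1..K}. tx k = b \<and> t \<in> T k")
        case True
        then obtain k where k: "k \<in> {1..K}" "tx k = b" "t \<in> T k" by blast
        then show ?thesis using Tr_active[OF k(1,3), of x] \<phi>s[of k w "ob k" x t] by (simp only:)
      next
        case False
        then show ?thesis using Tr_idle[OF that False, of x] Sy_syms[OF x that] by (simp only:)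
      qed
      moreover have "Tr x \<in> extensional ({..<n} \<times> {1..B})" unfolding Tr_def by (rule restrict_extensional)
      ultimately show ?thesis unfolding Sy_def by (auto simp: PiE_def)
    qed
    have "inj_on Tr Sy"
    proof (rule inj_onI)
      fix x x' assume x: "x \<in> Sy" "x' \<in> Sy" and eq: "Tr x = Tr x'"
      \<comment> \<open>Induction on the depth: once the ancestors agree, so do the rounded
        estimates, and the residue determines the remaining pad symbol.\<close>
      have main: "x (t, b) = x' (t, b)" if "t < n" "b \<in> {1..B}" for t b
        using that(2)
      proof (induction "dep b" arbitrary: b rule: less_induct)
        case less
        show ?case
        proof (cases "\<exists>k\<in>{1..K}. tx k = b \<and> t \<in> T k")
          case False
          then show ?thesis using Tr_idle[OF that(1) less.prems False] fun_cong[OF eq, of "(t, b)"] by (simp only:)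
        next
          case True
          then obtain k where k: "k \<in> {1..K}" "tx k = b" "t \<in> T k" by blast
          have e: "\<phi> k w (ob k) x t = \<phi> k w (ob k) x' t"
            using Tr_active[OF k(1,3), of x] Tr_active[OF k(1,3), of x'] eq by (simp only:)
          have "x (t, j) = x' (t, j)" if j: "j \<in> ?N k - {tx k}" for j
          proof -
            have "anc j b" "j \<noteq> b" "j \<in> {1..B}" using j M_iff_anc[OF k(1)] k(2) by auto
            then show ?thesis using anc_dep[OF less.prems] by (intro less.hyps) auto
          qed
          then have "(\<Sum>j\<in>?N k - {tx k}. snd (ob k t) j * (a * of_int (x (t, j)))) = (\<Sum>j\<in>?N k - {tx k}. snd (ob k t) j * (a * of_int (x' (t, j))))"
            by (intro sum.cong) auto
          then have "res k (ob k) x t = res k (ob k) x' t" by (simp only: res_def)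
          then have "(ce k (w k) t + res k (ob k) x t - x (t, b)) mod int Q = (ce k (w k) t + res k (ob k) x t - x' (t, b)) mod int Q"
            using e unfolding \<phi>_def k(2) by (simp only:)
          then show ?thesis by (rule mod_cancel_left) (use Sy_syms[OF _ that(1) less.prems] x in auto)
        qed
      qed
      show "x = x'"
      proof (rule PiE_ext)
        show "x \<in> {..<n} \<times> {1..B} \<rightarrow>\<^sub>E syms" "x' \<in> {..<n} \<times> {1..B} \<rightarrow>\<^sub>E syms" using x by (simp_all add: Sy_def)
        show "x p = x' p" if "p \<in> {..<n} \<times> {1..B}" for p
          using main[of "fst p" "snd p"] that by auto
      qed
    qed
    moreover have "dd k w (ob k) x = cd k (\<lambda>t. Tr x (t, tx k))" if "k \<in> {1..K}" for k x
      unfolding dd_def by (rule hcodeD(4)[OF c[OF that]]) (simp add: Tr_active[OF that])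
    ultimately show "\<exists>Tr. inj_on Tr Sy \<and> Tr ` Sy \<subseteq> Sy \<and>
        (\<forall>x\<in>Sy. \<forall>k\<in>{1..K}. dd k w (ob k) x = cd k (\<lambda>t. Tr x (t, tx k)))"
      using into by (intro exI[of _ Tr]) blast
  qed
  have ddm: "(\<lambda>ob. dd k w ob x) \<in> gOM n B \<rightarrow>\<^sub>M count_space UNIV" if k: "k \<in> {1..K}" for k w x
    unfolding dd_def
  proof (rule measurable_of_finite_vector[OF slots_okD(3)[OF T k] syms_props(1) \<phi>s])
    show "cd k s = cd k s'" if "\<And>t. t \<in> T k \<Longrightarrow> s t = s' t" for s s' by (rule hcodeD(4)[OF c[OF k] that])
    show "(\<lambda>ob. \<phi> k w ob x t) \<in> gOM n B \<rightarrow>\<^sub>M count_space UNIV" if "t \<in> T k" for t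
    proof -
      have t: "t < n" using slots_okD(1)[OF T k] that by auto
      note [measurable] = measurable_gOM_components(1)[OF t] measurable_gOM_components(2)[OF t tx_props(1)[OF k]]
      have [measurable]: "(\<lambda>ob. snd (ob t) j) \<in> borel_measurable (gOM n B)" if "j \<in> ?N k - {tx k}" for j
        using that by (intro measurable_gOM_components(2)[OF t]) auto
      have [measurable]: "(\<lambda>ob. res k ob x t) \<in> gOM n B \<rightarrow>\<^sub>M count_space UNIV" unfolding res_def by measurable
      show ?thesis unfolding \<phi>_def by measurable
    qed
  qed
  have set_nsb: "set_pmf (nsb i) = (\<lambda>x. (emb x, \<lambda>k. if k \<in> {1..K} then dd k (fst i) (snd i k) x else 0)) ` Sy" for i
    using set_pmf_of_set[OF neS finS] by (simp add: nsb_def split_def)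
  have nsb_prob: "measure_pmf.prob (nsb (w, ob)) E = (\<Sum>x\<in>Sy. indicator E (emb x, \<lambda>k. if k \<in> {1..K} then dd k w (ob k) x else 0)) / real (card Sy)" for w ob E
  proof -
    let ?h = "\<lambda>x. (emb x, \<lambda>k. if k \<in> {1..K} then dd k w (ob k) x else 0)"
    have "measure_pmf.prob (nsb (w, ob)) E = measure_pmf.prob (pmf_of_set Sy) (?h -` E)"
      by (simp add: nsb_def)
    also have "\<dots> = real (card (Sy \<inter> ?h -` E)) / real (card Sy)" by (rule measure_pmf_of_set[OF neS finS])
    also have "real (card (Sy \<inter> ?h -` E)) = (\<Sum>x\<in>Sy. indicator E (?h x))"
      using finS by (simp add: indicator_def sum.If_cases Int_def vimage_def)
    finally show ?thesis .
  qed
  \<comment> \<open>The embedding is injective, so the emitted input identifies the pad, and the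
    receivers' outputs are then deterministic.\<close>
  have nsb_prob_emb: "measure_pmf.prob (nsb (w, ob)) {(x', v). x' = emb x \<and> R v}
      = (if R (\<lambda>k. if k \<in> {1..K} then dd k w (ob k) x else 0) then 1 else 0) / real (card Sy)" if x: "x \<in> Sy" for w ob x R
  proof -
    let ?v = "\<lambda>x k. if k \<in> {1..K} then dd k w (ob k) x else 0"
    have "(\<Sum>x'\<in>Sy. indicator {(x', v). x' = emb x \<and> R v} (emb x', ?v x')) = (\<Sum>x'\<in>{x}. (if R (?v x) then 1 else 0) :: real)"
      using x inj by (intro sum.mono_neutral_cong_right finS) (auto simp: inj_on_eq_iff)
    then show ?thesis unfolding nsb_prob by simp
  qed
  have gp: "gpow n B (emb x) \<le> P" if "x \<in> Sy" for x
    using P KB_pos(2) amplitude[OF Sy_syms[OF that]] by (intro gpow_le) (auto simp: emb_def)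
  interpret G: prob_space "gState M K B n f" by (rule prob_space_gState[OF adm])
  have scheme: "g_ns_scheme K B n P m f M nsb A"
    unfolding g_ns_scheme_def
  proof (intro conjI ns ballI allI m1)
    show "finite A" unfolding A_def using finS by simp
    show "set_pmf (nsb i) \<subseteq> A" for i
      unfolding set_nsb A_def msg_set_def dd_def using hcodeD(5)[OF c] by auto
    fix w and p :: "(nat \<times> nat \<Rightarrow> real) \<times> (nat \<Rightarrow> nat)"
    have "(\<lambda>ob. pmf (nsb (w, ob)) p) = (\<lambda>ob. (\<Sum>x\<in>Sy. if emb x = fst p \<and> (\<forall>k. k \<notin> {1..K} \<longrightarrow> snd p k = 0) \<and> (\<forall>k\<in>{1..K}. dd k w (ob k) x = snd p k) then 1 else 0) / real (card Sy))"
    proof (rule ext)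
      fix ob
      have "pmf (nsb (w, ob)) p = (\<Sum>x\<in>Sy. indicator {p} (emb x, \<lambda>k. if k \<in> {1..K} then dd k w (ob k) x else 0)) / real (card Sy)"
        unfolding nsb_prob[symmetric] by (simp only: measure_pmf_single)
      also have "\<dots> = (\<Sum>x\<in>Sy. if emb x = fst p \<and> (\<forall>k. k \<notin> {1..K} \<longrightarrow> snd p k = 0) \<and> (\<forall>k\<in>{1..K}. dd k w (ob k) x = snd p k) then 1 else 0) / real (card Sy)"
        by (intro arg_cong2[of _ _ _ _ "(/)"] sum.cong refl) (cases p, auto simp: indicator_def fun_eq_iff)
      finally show "pmf (nsb (w, ob)) p = \<dots>" .
    qed
    moreover have "(\<lambda>ob. (\<Sum>x\<in>Sy. if emb x = fst p \<and> (\<forall>k. k \<notin> {1..K} \<longrightarrow> snd p k = 0) \<and> (\<forall>k\<in>{1..K}. dd k w (ob k) x = snd p k) then 1 else 0) / real (card Sy))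
        \<in> borel_measurable (\<Pi>\<^sub>M k\<in>{1..K}. gOM n B)"
    proof -
      have [measurable]: "(\<lambda>ob. dd k w (ob k) x) \<in> (\<Pi>\<^sub>M k\<in>{1..K}. gOM n B) \<rightarrow>\<^sub>M count_space UNIV" if "k \<in> {1..K}" for k x
        by (rule measurable_compose[OF measurable_component_singleton[OF that] ddm[OF that]])
      show ?thesis by measurable
    qed
    ultimately show "(\<lambda>ob. pmf (nsb (w, ob)) p) \<in> borel_measurable (\<Pi>\<^sub>M k\<in>{1..K}. gOM n B)" by (simp only:)
  next
    \<comment> \<open>Each input is emitted with probability \<open>1 / card Sy\<close> under every
      observation, so the power constraint follows from the bound on individual codewords.\<close>
    have one: "(\<integral>s. measure_pmf.prob (nsb (w, \<lambda>k\<in>{1..K}. gobs n B x s k)) {p. fst p = x} * gpow n B x \<partial>gState M K B n f) \<le> P / real (card Sy)"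
      if x: "x \<in> emb ` Sy" for w x
    proof -
      obtain y where y: "y \<in> Sy" "x = emb y" using x by blast
      have "{p :: (nat \<times> nat \<Rightarrow> real) \<times> (nat \<Rightarrow> nat). fst p = x} = {(x', v). x' = emb y \<and> True}" using y(2) by auto
      then have "measure_pmf.prob (nsb (w, \<lambda>k\<in>{1..K}. gobs n B x s k)) {p. fst p = x} = 1 / real (card Sy)" for s
        using nsb_prob_emb[OF y(1), of w "\<lambda>k\<in>{1..K}. gobs n B x s k" "\<lambda>_. True"] by (simp only: if_True)
      then show ?thesis using gp[OF y(1)] cS y(2) by (simp add: G.prob_space divide_right_mono)
    qed
    have "(\<Sum>w\<in>msg_set K m. \<Sum>x\<in>fst ` A. \<integral>s. measure_pmf.prob (nsb (w, \<lambda>k\<in>{1..K}. gobs n B x s k)) {p. fst p = x} * gpow n B x \<partial>gState M K B n f)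
       \<le> (\<Sum>w\<in>msg_set K m. \<Sum>x\<in>emb ` Sy. P / real (card Sy))"
      unfolding fstA by (intro sum_mono one)
    also have "\<dots> = P * real (card (msg_set K m))" using card_image[OF inj] cS by simp
    finally show "(\<Sum>w\<in>msg_set K m. \<Sum>x\<in>fst ` A. \<integral>s. measure_pmf.prob (nsb (w, \<lambda>k\<in>{1..K}. gobs n B x s k)) {p. fst p = x} * gpow n B x \<partial>gState M K B n f)
       \<le> P * real (card (msg_set K m))" .
  qed
  have err: "0 \<le> g_ns_err M K B f n m nsb A k \<and> g_ns_err M K B f n m nsb A k \<le> (sqrt 2 / exp 1) ^ n"
    if k: "k \<in> {1..K}" for k
  proof -
    let ?I = "\<lambda>w x. \<integral>s. measure_pmf.prob (nsb (w, \<lambda>k'\<in>{1..K}. gobs n B x s k')) {(x', v). x' = x \<and> v k \<noteq> w k} \<partial>gState M K B n f"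
    have one: "?I w x \<le> 1 / real (card Sy) * (sqrt 2 / exp 1) ^ n" if w: "w \<in> msg_set K m" and x: "x \<in> emb ` Sy" for w x
    proof -
      obtain y where y: "y \<in> Sy" "x = emb y" using x by blast
      have eq: "measure_pmf.prob (nsb (w, \<lambda>k'\<in>{1..K}. gobs n B x s k')) {(x', v). x' = x \<and> v k \<noteq> w k}
          = (if dd k w (gobs n B x s k) y \<noteq> w k then 1 else 0) / real (card Sy)" for s
        unfolding y(2) nsb_prob_emb[OF y(1), of w _ "\<lambda>v. v k \<noteq> w k"] using k by simp
      have [measurable]: "(\<lambda>s. dd k w (gobs n B x s k) y) \<in> gState M K B n f \<rightarrow>\<^sub>M count_space UNIV"
        by (rule measurable_compose[OF measurable_gobs[OF k] ddm[OF k]])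
      show ?thesis
        unfolding eq
      proof (rule gState_error_bound[OF adm k])
        show "(\<lambda>s. (if dd k w (gobs n B x s k) y \<noteq> w k then 1 else 0) / real (card Sy)) \<in> borel_measurable (gState M K B n f)"
          by measurable
        fix g z assume g: "\<And>t j. t < n \<Longrightarrow> j \<in> {1..B} \<Longrightarrow> if M k j then 1 / c \<le> \<bar>g (t, k, j)\<bar> else g (t, k, j) = 0"
          and z: "noise_ok n k z"
        have "dd k w (gobs n B x (g, z) k) y = w k"
          unfolding dd_def
        proof (rule hcodeD(3)[OF c[OF k]])
          show "w k < m k" using w k by (simp add: msg_set_def)
          show "card {t \<in> T k. \<phi> k w (gobs n B x (g, z) k) y t \<noteq> ce k (w k) t} \<le> radius n"
          proof (rule few_symbol_errors[OF z slots_okD(1)[OF T k]])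
            fix t assume t: "t \<in> T k" and small: "\<bar>z (t, k)\<bar> < a / (2 * c)"
            have tn: "t < n" using slots_okD(1)[OF T k] t by auto
            have gb: "1 / c \<le> \<bar>g (t, k, tx k)\<bar>" using g[OF tn tx_props(1)[OF k]] tx_props(2)[OF k] by simp
            have g0: "\<forall>j\<in>{1..B}. \<not> M k j \<longrightarrow> g (t, k, j) = 0" using g[OF tn] by fastforce
            have xy: "x (t, j) = a * of_int (y (t, j))" if "j \<in> {1..B}" for j
              using that tn by (simp add: y(2) emb_def)
            have bN: "tx k \<in> ?N k" using tx_props[OF k] by simp
            have "(\<Sum>j\<in>?N k. g (t, k, j) * x (t, j)) = (\<Sum>j\<in>?N k. g (t, k, j) * (a * of_int (y (t, j))))"
              using xy by (intro sum.cong) auto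
            also have "\<dots> = g (t, k, tx k) * (a * of_int (y (t, tx k))) + (\<Sum>j\<in>?N k - {tx k}. g (t, k, j) * (a * of_int (y (t, j))))"
              using bN by (intro sum.remove) auto
            finally have f1: "fst (gobs n B x (g, z) k t) = g (t, k, tx k) * (a * of_int (y (t, tx k)))
               + (\<Sum>j\<in>?N k - {tx k}. g (t, k, j) * (a * of_int (y (t, j)))) + z (t, k)"
              using gobs_nth(1)[where g=g and z=z and x=x, OF tn k g0] by (simp only:)
            have f2: "(\<Sum>j\<in>?N k - {tx k}. snd (gobs n B x (g, z) k t) j * (a * of_int (y (t, j)))) = (\<Sum>j\<in>?N k - {tx k}. g (t, k, j) * (a * of_int (y (t, j))))"
              using gobs_nth(2)[where g=g and z=z and x=x, OF tn k g0] by (intro sum.cong) auto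
            have "res k (gobs n B x (g, z) k) y t = round ((g (t, k, tx k) * (a * of_int (y (t, tx k))) + z (t, k)) / (a * g (t, k, tx k)))"
              unfolding res_def f1 f2 gobs_nth(2)[where g=g and z=z and x=x, OF tn k g0 tx_props(1)[OF k]] by (simp add: algebra_simps)
            also have "\<dots> = y (t, tx k)" by (rule round_estimate[OF gb small])
            finally show "\<phi> k w (gobs n B x (g, z) k) y t = ce k (w k) t"
              using hcodeD(2)[OF c[OF k] t, of "w k"] by (simp add: \<phi>_def)
          qed
        qed
        then show "(if dd k w (gobs n B x (g, z) k) y \<noteq> w k then 1 else 0) / real (card Sy) = 0" by simp
      qed (use cS in \<open>auto simp: divide_right_mono\<close>)
    qed
    have "0 < card (msg_set K m)" unfolding card_msg_set using m1 by (intro prod_pos) force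
    then have N: "0 < real (card (msg_set K m))" by simp
    have "(\<Sum>w\<in>msg_set K m. \<Sum>x\<in>fst ` A. ?I w x) \<le> (\<Sum>w\<in>msg_set K m. \<Sum>x\<in>emb ` Sy. 1 / real (card Sy) * (sqrt 2 / exp 1) ^ n)"
      unfolding fstA by (intro sum_mono one)
    also have "\<dots> = (sqrt 2 / exp 1) ^ n * real (card (msg_set K m))" using card_image[OF inj] cS by simp
    finally have "g_ns_err M K B f n m nsb A k \<le> (sqrt 2 / exp 1) ^ n"
      unfolding g_ns_err_def using N by (simp add: divide_le_eq)
    moreover have "0 \<le> g_ns_err M K B f n m nsb A k"
      unfolding g_ns_err_def by (intro divide_nonneg_nonneg sum_nonneg integral_nonneg_AE) auto
    ultimately show ?thesis by blast
  qed
  show ?thesis using scheme err code_size[OF T _ c] by blast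
qed

end

context gauss_tree
begin

text \<open>In the slots of \<open>k\<close> all strict ancestors of its transmitter send the symbol
  0, hence amplitude 0, so the receiver sees one scaled lattice point plus noise. The transmitter is
  deterministic.\<close>

lemma gauss_cl_code:
  assumes T: "slots_ok n d T" "quiet_above T"
  shows "\<exists>m enc dec. g_cl_scheme K B n P m enc dec \<and>
     (\<forall>k\<in>{1..K}. 0 \<le> g_cl_err M K B f n m enc dec k \<and> g_cl_err M K B f n m enc dec k \<le> (sqrt 2 / exp 1) ^ n) \<and>
     (\<forall>k\<in>{1..K}. Q ^ nat \<lfloor>real n * d k\<rfloor> \<le> m k * (2 ^ n * Q ^ (2 * radius n)))"
proof -
  obtain m ce cd where c: "\<And>k. k \<in> {1..K} \<Longrightarrow> hcode syms (T k) (radius n) (m k) (ce k) (cd k)"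
    using ex_hcodes[OF syms_props(1,2), of "{1..K}" T "radius n"] slots_okD(3)[OF T(1)] by blast
  define X where "X = (\<lambda>w. \<lambda>p\<in>{..<n} \<times> {1..B}. a * of_int (place T (\<lambda>k. ce k (w k)) 0 (fst p) (snd p)))"
  define enc where "enc = (\<lambda>w. return (gX n B) (X w))"
  \<comment> \<open>Large noise may push the rounded value out of the alphabet; the residue forces
    it back, so only finitely many values occur, as measurability of the decoder requires.\<close>
  define est where "est = (\<lambda>k (ob :: nat \<Rightarrow> real \<times> (nat \<Rightarrow> real)) t. round (fst (ob t) / (a * snd (ob t) (tx k))) mod int Q)"
  define dec where "dec = (\<lambda>k ob. return_pmf (cd k (est k ob)))"
  have pl: "place T (\<lambda>k. ce k (w k)) 0 t b \<in> syms" for w t b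
  proof (cases "\<exists>k\<in>{1..K}. tx k = b \<and> t \<in> T k")
    case True
    then obtain k where k: "k \<in> {1..K}" "tx k = b" "t \<in> T k" by blast
    have "place T (\<lambda>k. ce k (w k)) 0 t b = ce k (w k) t" using place_active[OF T(1) k(1,3)] k(2) by simp
    then show ?thesis using hcodeD(2)[OF c[OF k(1)] k(3)] by simp
  next
    case False
    then show ?thesis using syms_props(4) unfolding place_def by (subst if_not_P)
  qed
  have Xs: "X w \<in> space (gX n B)" for w by (auto simp: X_def gX_def space_PiM)
  have Xp: "gpow n B (X w) \<le> P" for w
    using P KB_pos(2) amplitude[OF pl] by (intro gpow_le) (auto simp: X_def)
  have m1: "1 \<le> m k" if "k \<in> {1..K}" for k by (rule hcodeD(1)[OF c[OF that]])
  have cm: "(\<lambda>ob. cd k (est k ob)) \<in> gOM n B \<rightarrow>\<^sub>M count_space UNIV" if k: "k \<in> {1..K}" for k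
  proof (rule measurable_of_finite_vector[OF slots_okD(3)[OF T(1) k] syms_props(1)])
    show "est k ob t \<in> syms" for ob t using Q by (simp add: est_def)
    show "cd k s = cd k s'" if "\<And>t. t \<in> T k \<Longrightarrow> s t = s' t" for s s' by (rule hcodeD(4)[OF c[OF k] that])
    show "(\<lambda>ob. est k ob t) \<in> gOM n B \<rightarrow>\<^sub>M count_space UNIV" if "t \<in> T k" for t
    proof -
      have t: "t < n" using slots_okD(1)[OF T(1) k] that by auto
      note [measurable] = measurable_gOM_components(1)[OF t] measurable_gOM_components(2)[OF t tx_props(1)[OF k]]
      show ?thesis unfolding est_def by measurable
    qed
  qed
  have pm: "(\<lambda>ob. pmf (dec k ob) v) \<in> borel_measurable (gOM n B)" if k: "k \<in> {1..K}" for k v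
    unfolding dec_def by (rule measurable_compose[OF cm[OF k], of "\<lambda>u. pmf (return_pmf u) v"]) simp
  have scheme: "g_cl_scheme K B n P m enc dec"
    unfolding g_cl_scheme_def
  proof (intro conjI ballI allI m1 pm)
    fix w show "enc w \<in> space (prob_algebra (gX n B))"
      unfolding enc_def space_prob_algebra using Xs by (auto intro: prob_space_return)
  next
    have "(\<integral>\<^sup>+x. ennreal (gpow n B x) \<partial>enc w) = ennreal (gpow n B (X w))" for w
      unfolding enc_def using Xs by (intro nn_integral_return) auto
    then have "(\<Sum>w\<in>msg_set K m. \<integral>\<^sup>+x. ennreal (gpow n B x) \<partial>enc w) \<le> (\<Sum>w\<in>msg_set K m. ennreal P)"
      using Xp by (simp only:) (intro sum_mono ennreal_leI)
    also have "\<dots> = ennreal (P * real (card (msg_set K m)))"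
      using P by (simp add: ennreal_of_nat_eq_real_of_nat ennreal_mult mult.commute)
    finally show "(\<Sum>w\<in>msg_set K m. \<integral>\<^sup>+x. ennreal (gpow n B x) \<partial>enc w) \<le> ennreal (P * real (card (msg_set K m)))" .
  qed auto
  have err: "0 \<le> g_cl_err M K B f n m enc dec k \<and> g_cl_err M K B f n m enc dec k \<le> (sqrt 2 / exp 1) ^ n"
    if k: "k \<in> {1..K}" for k
  proof -
    interpret G: prob_space "gState M K B n f" by (rule prob_space_gState[OF adm])
    have Dm: "(\<lambda>s. pmf (dec k (gobs n B x s k)) v) \<in> borel_measurable (gState M K B n f)" for x v
      by (rule measurable_compose[OF measurable_gobs[OF k] pm[OF k]])
    define S where "S = (\<lambda>w. \<integral>s. pmf (dec k (gobs n B (X w) s k)) (w k) \<partial>gState M K B n f)"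
    have enc_int: "(\<integral>x. (\<integral>s. pmf (dec k (gobs n B x s k)) (w k) \<partial>gState M K B n f) \<partial>enc w) = S w" for w
      unfolding enc_def S_def
    proof (rule integral_return[OF Xs])
      have "(\<lambda>p. pmf (dec k (gobs n B (fst p) (snd p) k)) (w k)) \<in> borel_measurable (gX n B \<Otimes>\<^sub>M gState M K B n f)"
        using measurable_compose[OF measurable_gobs_pair[OF k] pm[OF k]] by (simp add: split_def)
      then show "(\<lambda>x. \<integral>s. pmf (dec k (gobs n B x s k)) (w k) \<partial>gState M K B n f) \<in> borel_measurable (gX n B)"
        by (intro G.borel_measurable_lebesgue_integral) (simp add: split_def)
    qed
    have S1: "S w \<le> 1" and S2: "w \<in> msg_set K m \<Longrightarrow> 1 - (sqrt 2 / exp 1) ^ n \<le> S w" for w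
    proof -
      let ?p = "\<lambda>s. pmf (dec k (gobs n B (X w) s k)) (w k)"
      have int: "integrable (gState M K B n f) ?p"
        by (rule G.integrable_const_bound[of _ 1]) (use Dm in \<open>auto simp: pmf_le_1\<close>)
      have "S w \<le> (\<integral>s. 1 \<partial>gState M K B n f)" unfolding S_def by (intro integral_mono int) (auto simp: pmf_le_1)
      then show "S w \<le> 1" by (simp add: G.prob_space)
      assume w: "w \<in> msg_set K m"
      have "(\<integral>s. 1 - ?p s \<partial>gState M K B n f) \<le> 1 * (sqrt 2 / exp 1) ^ n"
      proof (rule gState_error_bound[OF adm k])
        fix g z assume g: "\<And>t j. t < n \<Longrightarrow> j \<in> {1..B} \<Longrightarrow> if M k j then 1 / c \<le> \<bar>g (t, k, j)\<bar> else g (t, k, j) = 0"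
          and z: "noise_ok n k z"
        have "cd k (est k (gobs n B (X w) (g, z) k)) = w k"
        proof (rule hcodeD(3)[OF c[OF k]])
          show "w k < m k" using w k by (simp add: msg_set_def)
          show "card {t \<in> T k. est k (gobs n B (X w) (g, z) k) t \<noteq> ce k (w k) t} \<le> radius n"
          proof (rule few_symbol_errors[OF z slots_okD(1)[OF T(1) k]])
            fix t assume t: "t \<in> T k" and small: "\<bar>z (t, k)\<bar> < a / (2 * c)"
            have tn: "t < n" using slots_okD(1)[OF T(1) k] t by auto
            have gb: "1 / c \<le> \<bar>g (t, k, tx k)\<bar>" using g[OF tn tx_props(1)[OF k]] tx_props(2)[OF k] by simp
            have g0: "\<forall>j\<in>{1..B}. \<not> M k j \<longrightarrow> g (t, k, j) = 0" using g[OF tn] by fastforce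
            have Xq: "X w (t, j) = 0" if "j \<in> {j\<in>{1..B}. M k j}" "j \<noteq> tx k" for j
              using that tn place_quiet[OF T(2) k t, of j "\<lambda>k. ce k (w k)" 0] M_iff_anc[OF k] by (auto simp: X_def)
            have Xa: "X w (t, tx k) = a * of_int (ce k (w k) t)"
              using tn tx_props(1)[OF k] place_active[OF T(1) k t, of "\<lambda>k. ce k (w k)" 0] by (auto simp: X_def)
            have "(\<Sum>j\<in>{j\<in>{1..B}. M k j}. g (t, k, j) * X w (t, j)) = (\<Sum>j\<in>{tx k}. g (t, k, j) * X w (t, j))"
              by (rule sum.mono_neutral_right) (use Xq tx_props[OF k] in auto)
            then have "fst (gobs n B (X w) (g, z) k t) = g (t, k, tx k) * (a * of_int (ce k (w k) t)) + z (t, k)"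
              using gobs_nth(1)[where g=g and z=z and x="X w", OF tn k g0] by (simp add: Xa)
            then have "est k (gobs n B (X w) (g, z) k) t = ce k (w k) t mod int Q"
              using gobs_nth(2)[where g=g and z=z and x="X w", OF tn k g0 tx_props(1)[OF k]]
              by (simp only: est_def round_estimate[OF gb small])
            then show "est k (gobs n B (X w) (g, z) k) t = ce k (w k) t"
              using hcodeD(2)[OF c[OF k] t, of "w k"] by simp
          qed
        qed
        then show "1 - ?p (g, z) = 0" by (simp add: dec_def)
      qed (use Dm in \<open>auto simp: pmf_le_1\<close>)
      also have "(\<integral>s. 1 - ?p s \<partial>gState M K B n f) = 1 - S w"
        unfolding S_def using int by (simp add: G.prob_space)
      finally show "1 - (sqrt 2 / exp 1) ^ n \<le> S w" by simp
    qed
    have "0 < card (msg_set K m)" unfolding card_msg_set using m1 by (intro prod_pos) force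
    then have N: "0 < real (card (msg_set K m))" by simp
    have "(\<Sum>w\<in>msg_set K m. S w) \<le> (\<Sum>w\<in>msg_set K m. 1)" by (intro sum_mono S1)
    moreover have "(\<Sum>w\<in>msg_set K m. 1 - (sqrt 2 / exp 1) ^ n) \<le> (\<Sum>w\<in>msg_set K m. S w)" by (intro sum_mono S2)
    ultimately have "(\<Sum>w\<in>msg_set K m. S w) / real (card (msg_set K m)) \<le> 1"
      "1 - (sqrt 2 / exp 1) ^ n \<le> (\<Sum>w\<in>msg_set K m. S w) / real (card (msg_set K m))"
      using N by (simp_all add: divide_le_eq le_divide_eq mult.commute)
    then show ?thesis unfolding g_cl_err_def enc_int by linarith
  qed
  show ?thesis using scheme err code_size[OF T(1) _ c] by blast
qed

end

lemma chernoff_tendsto: "(\<lambda>n. (sqrt 2 / exp 1 :: real) ^ n) \<longlonglongrightarrow> 0"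
proof (rule LIMSEQ_realpow_zero)
  have "sqrt 2 < 2" by (rule real_less_lsqrt) auto
  also have "2 \<le> exp (1::real)" using exp_ge_add_one_self[of 1] by simp
  finally show "sqrt 2 / exp 1 < 1" by simp
qed simp

context gauss_tree
begin

text \<open>The code gives up \<open>2 * \<delta> * n\<close> symbols for correcting errors and one
  bit per use for the number of error sets; rounding down the block length vanishes in the limit.
  The maximum with 0 is attained trivially because \<open>1 \<le> m n\<close>.\<close>

lemma gauss_rate:
  fixes m :: "nat \<Rightarrow> nat"
  assumes len: "\<And>n. Q ^ nat \<lfloor>real n * d\<rfloor> \<le> m n * (2 ^ n * Q ^ (2 * radius n))" and m: "\<And>n. 1 \<le> m n" and d: "0 \<le> d"
  shows "ereal (max 0 ((d - 2 * \<delta>) * log 2 (real Q) - 1)) \<le> liminf (\<lambda>n. ereal (log 2 (real (m n)) / real n))"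
proof -
  let ?L = "log 2 (real Q)"
  have L: "0 \<le> ?L" using Q by simp
  have "ereal ((d - 2 * \<delta>) * ?L - 1) \<le> liminf (\<lambda>n. ereal (log 2 (real (m n)) / real n))"
  proof (rule le_Liminf_of_tendsto)
    show "(\<lambda>n. (d - 2 * \<delta>) * ?L - 1 - ?L / real n) \<longlonglongrightarrow> (d - 2 * \<delta>) * ?L - 1"
      using tendsto_diff[OF tendsto_const lim_const_over_n[of ?L]] by simp
    show "\<forall>\<^sub>F n in sequentially. (d - 2 * \<delta>) * ?L - 1 - ?L / real n \<le> log 2 (real (m n)) / real n"
      using eventually_gt_at_top[of 0]
    proof eventually_elim
      case (elim n)
      let ?l = "nat \<lfloor>real n * d\<rfloor>"
      have "real Q ^ ?l \<le> real (m n) * (2 ^ n * real Q ^ (2 * radius n))"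
        using of_nat_mono[OF len[of n], where ?'a=real] by simp
      then have "log 2 (real Q ^ ?l) \<le> log 2 (real (m n) * (2 ^ n * real Q ^ (2 * radius n)))"
        using Q by (intro log_mono) auto
      also have "\<dots> = log 2 (real (m n)) + (real n + real (2 * radius n) * ?L)"
        using Q m[of n] by (simp add: log_mult log_nat_power)
      finally have a: "real ?l * ?L \<le> log 2 (real (m n)) + (real n + real (2 * radius n) * ?L)"
        using Q by (simp add: log_nat_power)
      have "real n * d - 1 \<le> real ?l" using d by linarith
      then have b: "(real n * d - 1) * ?L \<le> real ?l * ?L" using L by (rule mult_right_mono)
      have "real (2 * radius n) \<le> 2 * (\<delta> * real n)"
        using \<delta> of_nat_floor[of "\<delta> * real n"] by (simp add: radius_def)
      then have "real (2 * radius n) * ?L \<le> 2 * (\<delta> * real n) * ?L" using L by (rule mult_right_mono)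
      then have "((d - 2 * \<delta>) * ?L - 1) * real n - ?L \<le> log 2 (real (m n))" using a b by (simp add: algebra_simps)
      then have "(((d - 2 * \<delta>) * ?L - 1) * real n - ?L) / real n \<le> log 2 (real (m n)) / real n"
        by (rule divide_right_mono) simp
      then show ?case using elim by (simp add: diff_divide_distrib)
    qed
  qed
  moreover have "ereal 0 \<le> liminf (\<lambda>n. ereal (log 2 (real (m n)) / real n))"
  proof (rule le_Liminf_of_tendsto[OF _ tendsto_const])
    have "0 \<le> log 2 (real (m n)) / real n" for n using m[of n] by simp
    then show "\<forall>\<^sub>F n in sequentially. 0 \<le> log 2 (real (m n)) / real n" by simp
  qed
  ultimately show ?thesis by (simp add: max_def)
qed

definition gauss_rates :: "(nat \<Rightarrow> real) \<Rightarrow> nat \<Rightarrow> real" where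
  "gauss_rates d k = (if k \<in> {1..K} then max 0 ((d k - 2 * \<delta>) * log 2 (real Q) - 1) else 0)"

lemma gauss_rates_rplus: "gauss_rates d \<in> rplus K"
  by (simp add: gauss_rates_def rplus_def)

lemma gauss_cl_rates:
  assumes d: "d \<in> tree_dof_region K B par M"
  shows "gauss_rates d \<in> g_cl_cap M K B f P"
proof -
  have d0: "d \<in> rplus K" using d by (simp add: tree_dof_region_def)
  define S where "S = (\<lambda>n c. g_cl_scheme K B n P (fst c) (fst (snd c)) (snd (snd c)) \<and>
     (\<forall>k\<in>{1..K}. 0 \<le> g_cl_err M K B f n (fst c) (fst (snd c)) (snd (snd c)) k \<and> g_cl_err M K B f n (fst c) (fst (snd c)) (snd (snd c)) k \<le> (sqrt 2 / exp 1) ^ n) \<and>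
     (\<forall>k\<in>{1..K}. Q ^ nat \<lfloor>real n * d k\<rfloor> \<le> fst c k * (2 ^ n * Q ^ (2 * radius n))))"
  have "\<forall>n. \<exists>c. S n c"
  proof
    fix n
    obtain T where "slots_ok n d T" "quiet_above T" using ex_cl_slots[OF d] by blast
    then have "\<exists>m enc dec. S n (m, enc, dec)" unfolding S_def fst_conv snd_conv by (rule gauss_cl_code)
    then obtain m enc dec where "S n (m, enc, dec)" by (elim exE)
    then show "\<exists>c. S n c" by (rule exI[of "S n"])
  qed
  then obtain c where c: "\<forall>n. S n (c n)" using choice[of S] by blast
  define m enc dec where "m = (\<lambda>n. fst (c n))" and "enc = (\<lambda>n. fst (snd (c n)))" and "dec = (\<lambda>n. snd (snd (c n)))"
  have s: "g_cl_scheme K B n P (m n) (enc n) (dec n)"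
    and e: "\<And>k. k \<in> {1..K} \<Longrightarrow> 0 \<le> g_cl_err M K B f n (m n) (enc n) (dec n) k \<and> g_cl_err M K B f n (m n) (enc n) (dec n) k \<le> (sqrt 2 / exp 1) ^ n"
    and r: "\<And>k. k \<in> {1..K} \<Longrightarrow> Q ^ nat \<lfloor>real n * d k\<rfloor> \<le> m n k * (2 ^ n * Q ^ (2 * radius n))" for n
    using c[THEN spec, of n] unfolding S_def m_def enc_def dec_def by blast+
  show ?thesis unfolding g_cl_cap_def
  proof (intro subsetD[OF closure_subset] CollectI conjI exI[of _ m] exI[of _ enc] exI[of _ dec] allI ballI gauss_rates_rplus)
    show "(\<lambda>n. Max ((\<lambda>k. g_cl_err M K B f n (m n) (enc n) (dec n) k) ` {1..K})) \<longlonglongrightarrow> 0"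
      by (rule Max_err_tendsto[OF KB_pos(1) _ _ chernoff_tendsto]) (use e in auto)
    fix k assume k: "k \<in> {1..K}"
    show "ereal (gauss_rates d k) \<le> liminf_rate m k"
      unfolding gauss_rates_def if_P[OF k]
    proof (rule gauss_rate[OF r[OF k]])
      show "1 \<le> m n k" for n using s[of n] k by (simp add: g_cl_scheme_def)
      show "0 \<le> d k" using d0 k by (simp add: rplus_def)
    qed
  qed (rule s)
qed

lemma gauss_ns_rates:
  assumes d: "d \<in> ns_dof_region K B par M"
  shows "gauss_rates d \<in> g_ns_cap M K B f P"
proof -
  have d0: "d \<in> rplus K" using d by (simp add: ns_dof_region_def)
  define S where "S = (\<lambda>n c. g_ns_scheme K B n P (fst c) f M (fst (snd c)) (snd (snd c)) \<and>
     (\<forall>k\<in>{1..K}. 0 \<le> g_ns_err M K B f n (fst c) (fst (snd c)) (snd (snd c)) k \<and> g_ns_err M K B f n (fst c) (fst (snd c)) (snd (snd c)) k \<le> (sqrt 2 / exp 1) ^ n) \<and>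
     (\<forall>k\<in>{1..K}. Q ^ nat \<lfloor>real n * d k\<rfloor> \<le> fst c k * (2 ^ n * Q ^ (2 * radius n))))"
  have "\<forall>n. \<exists>c. S n c"
  proof
    fix n
    obtain T where "slots_ok n d T" using ex_ns_slots[OF d] by blast
    then have "\<exists>m nsb A. S n (m, nsb, A)" unfolding S_def fst_conv snd_conv by (rule gauss_ns_code)
    then obtain m nsb A where "S n (m, nsb, A)" by (elim exE)
    then show "\<exists>c. S n c" by (rule exI[of "S n"])
  qed
  then obtain c where c: "\<forall>n. S n (c n)" using choice[of S] by blast
  define m nsb A where "m = (\<lambda>n. fst (c n))" and "nsb = (\<lambda>n. fst (snd (c n)))" and "A = (\<lambda>n. snd (snd (c n)))"
  have s: "g_ns_scheme K B n P (m n) f M (nsb n) (A n)"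
    and e: "\<And>k. k \<in> {1..K} \<Longrightarrow> 0 \<le> g_ns_err M K B f n (m n) (nsb n) (A n) k \<and> g_ns_err M K B f n (m n) (nsb n) (A n) k \<le> (sqrt 2 / exp 1) ^ n"
    and r: "\<And>k. k \<in> {1..K} \<Longrightarrow> Q ^ nat \<lfloor>real n * d k\<rfloor> \<le> m n k * (2 ^ n * Q ^ (2 * radius n))" for n
    using c[THEN spec, of n] unfolding S_def m_def nsb_def A_def by blast+
  show ?thesis unfolding g_ns_cap_def
  proof (intro subsetD[OF closure_subset] CollectI conjI exI[of _ m] exI[of _ nsb] exI[of _ A] allI ballI gauss_rates_rplus)
    show "(\<lambda>n. Max ((\<lambda>k. g_ns_err M K B f n (m n) (nsb n) (A n) k) ` {1..K})) \<longlonglongrightarrow> 0"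
      by (rule Max_err_tendsto[OF KB_pos(1) _ _ chernoff_tendsto]) (use e in auto)
    fix k assume k: "k \<in> {1..K}"
    show "ereal (gauss_rates d k) \<le> liminf_rate m k"
      unfolding gauss_rates_def if_P[OF k]
    proof (rule gauss_rate[OF r[OF k]])
      show "1 \<le> m n k" for n using s[of n] k by (simp add: g_ns_scheme_def)
      show "0 \<le> d k" using d0 k by (simp add: rplus_def)
    qed
  qed (rule s)
qed

end

section \<open>From rates to degrees of freedom\<close>

context tree_network
begin

text \<open>For fixed \<open>\<delta>\<close> the alphabet grows like the square root of
  \<open>P\<close>, so the tuple with entries \<open>max 0 (d k - 2 * \<delta>)\<close> is reached
  as \<open>P\<close> grows. The closure in the definition of the region then allows
  \<open>\<delta>\<close> to tend to 0. The capacity map \<open>cap\<close> is abstract so that both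
  kinds of schemes are covered.\<close>

lemma dof_closure_of_rates:
  assumes d0: "d \<in> rplus K" and adm: "admissible_density f c"
    and cap: "\<And>\<delta> P a Q. gauss_tree K B par M f c \<delta> P a Q \<Longrightarrow> gauss_tree.gauss_rates K \<delta> Q d \<in> cap P"
  shows "d \<in> closure {d \<in> rplus K. \<exists>R. (\<forall>P>0. R P \<in> cap P) \<and>
     (\<forall>k\<in>{1..K}. ereal (d k) \<le> Liminf at_top (\<lambda>P. ereal (R P k / (log 2 P / 2))))}" (is "d \<in> closure ?S")
proof -
  define \<gamma> where "\<gamma> = (\<lambda>\<delta> k. if k \<in> {1..K} then max 0 (d k - 2 * \<delta>) else 0)"
  have c: "0 < c" using adm by (simp add: admissible_density_def)
  have "\<gamma> \<delta> \<in> ?S" if \<delta>: "0 < \<delta>" for \<delta>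
  proof -
    define a where "a = 4 * c / sqrt \<delta>"
    \<comment> \<open>The largest alphabet whose amplitudes fit the power; the added 1 accounts for
      the symbol 0 and keeps the alphabet nonempty for small \<open>P\<close>.\<close>
    define Q where "Q = (\<lambda>P. nat \<lfloor>sqrt (P / real B) / a\<rfloor> + 1)"
    define R where "R = (\<lambda>P. gauss_tree.gauss_rates K \<delta> (Q P) d)"
    have a: "0 < a" using c \<delta> by (simp add: a_def)
    have Qlo: "sqrt (P / real B) / a \<le> real (Q P)" for P unfolding Q_def by linarith
    have g: "gauss_tree K B par M f c \<delta> P a (Q P)" if P: "0 < P" for P
    proof unfold_locales
      have "real (Q P) - 1 \<le> sqrt (P / real B) / a"
        using of_nat_floor[of "sqrt (P / real B) / a"] P a by (simp add: Q_def)
      then show "a * (real (Q P) - 1) \<le> sqrt (P / real B)" using a by (simp add: field_simps)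
    qed (use adm \<delta> P in \<open>auto simp: a_def Q_def\<close>)
    have Rk: "R P k = max 0 ((d k - 2 * \<delta>) * log 2 (real (Q P)) - 1)" if "0 < P" "k \<in> {1..K}" for P k
      unfolding R_def gauss_tree.gauss_rates_def[OF g[OF that(1)]] using that(2) by simp
    have "ereal (\<gamma> \<delta> k) \<le> Liminf at_top (\<lambda>P. ereal (R P k / (log 2 P / 2)))" if k: "k \<in> {1..K}" for k
    proof (cases "d k - 2 * \<delta> \<le> 0")
      case True
      have "\<forall>\<^sub>F P in at_top. 0 \<le> R P k / (log 2 P / 2)"
        using eventually_gt_at_top[of 1] by eventually_elim (simp add: Rk[OF _ k])
      then have "ereal 0 \<le> Liminf at_top (\<lambda>P. ereal (R P k / (log 2 P / 2)))" by (rule le_Liminf_of_tendsto[OF _ tendsto_const])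
      then show ?thesis using True k by (simp add: \<gamma>_def)
    next
      case False
      define e where "e = d k - 2 * \<delta>"
      have e: "0 < e" using False by (simp add: e_def)
      have "\<forall>\<^sub>F P in at_top. (e * log 2 (sqrt (P / real B) / a) - 1) / (log 2 P / 2) \<le> R P k / (log 2 P / 2)"
        using eventually_gt_at_top[of 1]
      proof eventually_elim
        case (elim P)
        have "log 2 (sqrt (P / real B) / a) \<le> log 2 (real (Q P))"
          using Qlo[of P] elim a KB_pos by (intro log_mono) auto
        then have "e * log 2 (sqrt (P / real B) / a) \<le> e * log 2 (real (Q P))" using e by (intro mult_left_mono) auto
        then have "e * log 2 (sqrt (P / real B) / a) - 1 \<le> R P k" using Rk[of P k] elim k by (simp add: e_def)
        then show ?case using elim by (intro divide_right_mono) auto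
      qed
      moreover have "((\<lambda>P. (e * log 2 (sqrt (P / real B) / a) - 1) / (log 2 P / 2)) \<longlongrightarrow> e) at_top"
        using a KB_pos by real_asymp
      ultimately have "ereal e \<le> Liminf at_top (\<lambda>P. ereal (R P k / (log 2 P / 2)))" by (rule le_Liminf_of_tendsto)
      then show ?thesis using False k by (simp add: \<gamma>_def e_def)
    qed
    moreover have "\<gamma> \<delta> \<in> rplus K" by (simp add: \<gamma>_def rplus_def)
    moreover have "\<forall>P>0. R P \<in> cap P" unfolding R_def using cap[OF g] by blast
    ultimately show ?thesis by blast
  qed
  then have "\<gamma> ` {0<..} \<subseteq> closure ?S" using closure_subset[of ?S] by blast
  \<comment> \<open>Continuity up to the boundary point 0 carries the membership for positive
    \<open>\<delta>\<close> over to the limit.\<close>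
  moreover have "continuous_on (closure {0<..}) \<gamma>"
    unfolding \<gamma>_def
  proof (rule continuous_on_coordinatewise_then_product)
    fix k show "continuous_on (closure {0<..}) (\<lambda>\<delta>. if k \<in> {1..K} then max 0 (d k - 2 * \<delta>) else 0)"
      by (cases "k \<in> {1..K}") (auto intro!: continuous_intros)
  qed
  ultimately have "\<gamma> ` closure {0<..} \<subseteq> closure ?S" by (intro image_closure_subset) auto
  then have "\<gamma> 0 \<in> closure ?S" by auto
  moreover have "\<gamma> 0 = d" using d0 by (auto simp: \<gamma>_def rplus_def)
  ultimately show ?thesis by simp
qed

theorem gauss_cl_achievable:
  assumes "admissible_density f c" "d \<in> tree_dof_region K B par M"
  shows "d \<in> g_cl_dof M K B f"
  unfolding g_cl_dof_def
  by (rule dof_closure_of_rates[OF _ assms(1)]) (use assms(2) in \<open>auto simp: tree_dof_region_def intro: gauss_tree.gauss_cl_rates\<close>)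

theorem gauss_ns_achievable:
  assumes "admissible_density f c" "d \<in> ns_dof_region K B par M"
  shows "d \<in> g_ns_dof M K B f"
  unfolding g_ns_dof_def
  by (rule dof_closure_of_rates[OF _ assms(1)]) (use assms(2) in \<open>auto simp: ns_dof_region_def intro: gauss_tree.gauss_ns_rates\<close>)

end

section \<open>Capacity and degrees-of-freedom regions\<close>

text \<open>The region quantifies over fields carried by the natural numbers, so the residue ring of
  integers is transported along \<open>nat\<close>, which is injective on its carrier.\<close>

lemma ex_prime_field:
  assumes "prime p"
  shows "\<exists>F :: nat ring. field F \<and> finite (carrier F) \<and> card (carrier F) = p"
proof -
  interpret residues_prime p "residue_ring (int p)" by unfold_locales (simp_all add: assms)
  have car: "carrier (residue_ring (int p)) = {0..int p - 1}" by (rule res_carrier_eq)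
  have inj: "inj_on nat (carrier (residue_ring (int p)))" unfolding car by (auto simp: inj_on_def)
  have "field (image_ring nat (residue_ring (int p)))"
    using is_field inj by (rule field.inj_imp_image_ring_is_field)
  moreover have "card (carrier (image_ring nat (residue_ring (int p)))) = p"
    unfolding image_ring_carrier using card_image[OF inj] by (simp add: car)
  moreover have "finite (carrier (image_ring nat (residue_ring (int p))))"
    unfolding image_ring_carrier by (simp add: car)
  ultimately show ?thesis by blast
qed

text \<open>Primes are prime powers and unbounded, so a statement about large primes holds
  frequently along prime powers. Together with an eventual lower bound this suffices for a converse,
  without constructing fields of composite order.\<close>

lemma frequently_prime_powers:
  assumes "\<forall>\<^sub>F q in sequentially. prime q \<longrightarrow> R q"
  shows "\<exists>\<^sub>F q in at_top \<sqinter> principal prime_powers. R q"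
proof (rule ccontr)
  assume "\<not> (\<exists>\<^sub>F q in at_top \<sqinter> principal prime_powers. R q)"
  then have "\<forall>\<^sub>F q in sequentially. q \<in> prime_powers \<longrightarrow> \<not> R q"
    by (simp add: not_frequently eventually_inf_principal)
  then have "\<forall>\<^sub>F q in sequentially. \<not> prime (q::nat)"
    using assms
  proof eventually_elim
    case (elim q)
    have "q \<in> prime_powers" if "prime q"
      unfolding prime_powers_def by (intro CollectI exI[of _ q] exI[of _ "1::nat"]) (use that in auto)
    then show ?case using elim by blast
  qed
  then obtain N where N: "\<And>q. N \<le> q \<Longrightarrow> \<not> prime (q::nat)" by (auto simp: eventually_sequentially)
  obtain q where "prime q" "N < q" using bigger_prime by blast
  then show False using N[of q] by simp
qed

section \<open>Outer bounds for the capacity regions\<close>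

context tree_network
begin

text \<open>The factor 2 per receiver and use amounts to at most \<open>K\<close> bits, independent
  of the field order, and so is lost when dividing by \<open>log 2 (real q)\<close>.\<close>

lemma ff_cl_cap_bound:
  fixes F :: "('a, 'b) ring_scheme"
  assumes F: "field F" "finite (carrier F)" and R: "R \<in> ff_cl_cap F M K B" and bs: "rtl_path B par bs"
  shows "(\<Sum>k\<in>path_rx bs. R k) \<le> log 2 (real (card (carrier F))) + real K"
proof -
  interpret finite_field F using F by (simp add: finite_field_def finite_field_axioms_def)
  let ?S = "path_rx bs" and ?q = "card (carrier F)"
  obtain ks where ks: "distinct ks" "set ks = ?S"
    "sorted_wrt (\<lambda>k k'. {j\<in>{1..B}. M k j} \<subseteq> {j\<in>{1..B}. M k' j}) ks"
    using path_receivers_sorted[OF bs] by blast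
  have sub: "set ks \<subseteq> {1..K}" unfolding ks(2) by blast
  have len: "length ks \<le> K"
    using card_mono[OF _ sub] distinct_card[OF ks(1)] by simp
  show ?thesis
  proof (rule closure_sum_bound(2)[OF R[unfolded ff_cl_cap_def]])
    fix R assume "R \<in> {R \<in> rplus K. \<exists>m enc dec. (\<forall>n. ff_cl_scheme F K B n (m n) (enc n)) \<and>
       (\<lambda>n. Max ((\<lambda>k. ff_cl_err F M K B n (m n) (enc n) (dec n) k) ` {1..K})) \<longlonglongrightarrow> 0 \<and>
       (\<forall>k\<in>{1..K}. ereal (R k) \<le> liminf_rate m k)}"
    then obtain m enc dec where s: "\<And>n. ff_cl_scheme F K B n (m n) (enc n)"
      and e: "(\<lambda>n. Max ((\<lambda>k. ff_cl_err F M K B n (m n) (enc n) (dec n) k) ` {1..K})) \<longlonglongrightarrow> 0"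
      and r: "\<And>k. k \<in> {1..K} \<Longrightarrow> ereal (R k) \<le> liminf_rate m k" by blast
    have "(\<Sum>k\<in>set ks. R k) \<le> log 2 (real ?q * 2 ^ length ks)"
    proof (rule rate_sum_bound)
      show "1 \<le> m n k" if "k \<in> set ks" for n k using s[of n] that sub by (auto simp: ff_cl_scheme_def)
      show "ereal (R k) \<le> liminf_rate m k" if "k \<in> set ks" for k
        using r that sub by blast
      show "\<forall>\<^sub>F n in sequentially. (\<Prod>k\<in>set ks. real (m n k)) \<le> 4 * (real ?q * 2 ^ length ks) ^ n"
        using eventually_sum_err_le[OF e sub]
        by eventually_elim (rule ff_cl_converse[OF ks(1) sub ks(3) s])
    qed (use card_ge_2 in auto)
    also have "\<dots> = log 2 (real ?q) + real (length ks)"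
    proof -
      have "log 2 (x * 2 ^ l) = log 2 x + real l" if "0 < x" for x :: real and l using that by (simp add: log_mult log_nat_power)
      moreover have "0 < real ?q" using card_ge_2 by linarith
      ultimately show ?thesis by blast
    qed
    also have "\<dots> \<le> log 2 (real ?q) + real K" using len by simp
    finally show "(\<Sum>k\<in>?S. R k) \<le> log 2 (real ?q) + real K" unfolding ks(2) .
  qed blast
qed

lemma ff_ns_cap_bound:
  fixes F :: "('a, 'b) ring_scheme"
  assumes F: "field F" "finite (carrier F)" and R: "R \<in> ff_ns_cap F M K B" and b: "b \<in> {1..B}"
  shows "txsum K B par M R b \<le> log 2 (real (card (carrier F)))" "R \<in> rplus K"
proof -
  interpret finite_field F using F by (simp add: finite_field_def finite_field_axioms_def)
  let ?S = "{k\<in>{1..K}. tx k = b}" and ?q = "card (carrier F)"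
  let ?C = "{R \<in> rplus K. \<exists>m nsb. (\<forall>n. ff_ns_scheme F K B n (m n) (nsb n)) \<and>
       (\<lambda>n. Max ((\<lambda>k. ff_ns_err F M K B n (m n) (nsb n) k) ` {1..K})) \<longlonglongrightarrow> 0 \<and>
       (\<forall>k\<in>{1..K}. ereal (R k) \<le> liminf_rate m k)}"
  have "\<exists>k\<in>{1..K}. tx k = b" using tree b unfolding tree_net_def by blast
  then obtain k0 where k0: "k0 \<in> ?S" by blast
  have nb: "M k j = M k0 j" if "k \<in> ?S" "j \<in> {1..B}" for k j
    by (rule tx_same_nbhd) (use that k0 in auto)
  have main: "(\<Sum>k\<in>?S. R k) \<le> log 2 (real ?q)" if "R \<in> ?C" for R
  proof -
    obtain m nsb where s: "\<And>n. ff_ns_scheme F K B n (m n) (nsb n)"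
      and e: "(\<lambda>n. Max ((\<lambda>k. ff_ns_err F M K B n (m n) (nsb n) k) ` {1..K})) \<longlonglongrightarrow> 0"
      and r: "\<And>k. k \<in> {1..K} \<Longrightarrow> ereal (R k) \<le> liminf_rate m k"
      using \<open>R \<in> ?C\<close> by blast
    have sub: "?S \<subseteq> {1..K}" by auto
    show ?thesis
    proof (rule rate_sum_bound)
      show "1 \<le> m n k" if "k \<in> ?S" for n k using s[of n] that by (auto simp: ff_ns_scheme_def)
      show "\<forall>\<^sub>F n in sequentially. (\<Prod>k\<in>?S. real (m n k)) \<le> 2 * real ?q ^ n"
        using eventually_sum_err_le[OF e sub]
      proof eventually_elim
        case (elim n)
        show ?case
          by (rule ff_ns_converse[where M=M, OF s sub k0 nb]) (use elim in linarith)+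
      qed
    qed (use r card_ge_2 in auto)
  qed
  have "?C \<subseteq> rplus K" by blast
  from closure_sum_bound[OF R[unfolded ff_ns_cap_def] this, of ?S "log 2 (real ?q)"] main
  show "txsum K B par M R b \<le> log 2 (real ?q)" "R \<in> rplus K" unfolding txsum_def by blast+
qed

lemma g_cl_cap_bound:
  assumes adm: "admissible_density f c" and fm: "\<And>x. f x \<le> fm" "0 \<le> fm" and a: "1 / 2 < a" "a \<le> 1" and P: "0 < P"
    and R: "R \<in> g_cl_cap M K B f P" and bs: "rtl_path B par bs"
  shows "(\<Sum>k\<in>path_rx bs. R k) \<le> a * log 2 (1 + 16 * P)
     + real K * (log 2 (1 + 4 * (1 + c\<^sup>2 * real B) * gtail a * (4 + 8 * fm * real B)) + (a - 1 / 2) * log 2 (1 + 16 * P))"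
proof -
  let ?S = "path_rx bs"
  \<comment> \<open>The leading 1 makes \<open>D\<close> at least one, so the exponent
    \<open>length ks\<close>, which depends on the path, may be raised to \<open>K\<close>.\<close>
  define D where "D = 1 + 4 * (1 + c\<^sup>2 * real B) * gtail a * (4 + 8 * fm * real B)"
  have D: "1 \<le> D" unfolding D_def using fm(2) by (simp add: gtail_def)
  define G where "G = (1 + 16 * P) powr a * (D * (1 + 16 * P) powr (a - 1/2)) ^ K"
  obtain ks where ks: "distinct ks" "set ks = ?S"
    "sorted_wrt (\<lambda>k k'. {j\<in>{1..B}. M k j} \<subseteq> {j\<in>{1..B}. M k' j}) ks"
    using path_receivers_sorted[OF bs] by blast
  have sub: "set ks \<subseteq> {1..K}" unfolding ks(2) by blast
  have len: "length ks \<le> K"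
    using card_mono[OF _ sub] distinct_card[OF ks(1)] by simp
  have pw: "1 \<le> (1 + 16 * P) powr (a - 1/2)" using P a by (simp add: ge_one_powr_ge_zero)
  have G0: "0 < G" unfolding G_def using P D by (intro mult_pos_pos zero_less_power) auto
  show ?thesis
  proof (rule closure_sum_bound(2)[OF R[unfolded g_cl_cap_def]])
    fix R assume "R \<in> {R \<in> rplus K. \<exists>m enc dec. (\<forall>n. g_cl_scheme K B n P (m n) (enc n) (dec n)) \<and>
       (\<lambda>n. Max ((\<lambda>k. g_cl_err M K B f n (m n) (enc n) (dec n) k) ` {1..K})) \<longlonglongrightarrow> 0 \<and>
       (\<forall>k\<in>{1..K}. ereal (R k) \<le> liminf_rate m k)}"
    then obtain m enc dec where s: "\<And>n. g_cl_scheme K B n P (m n) (enc n) (dec n)"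
      and e: "(\<lambda>n. Max ((\<lambda>k. g_cl_err M K B f n (m n) (enc n) (dec n) k) ` {1..K})) \<longlonglongrightarrow> 0"
      and r: "\<And>k. k \<in> {1..K} \<Longrightarrow> ereal (R k) \<le> liminf_rate m k" by blast
    have "(\<Sum>k\<in>set ks. R k) \<le> log 2 G"
    proof (rule rate_sum_bound)
      show "1 \<le> m n k" if "k \<in> set ks" for n k using s[of n] that sub by (auto simp: g_cl_scheme_def)
      show "ereal (R k) \<le> liminf_rate m k" if "k \<in> set ks" for k
        using r that sub by blast
      show "\<forall>\<^sub>F n in sequentially. (\<Prod>k\<in>set ks. real (m n k)) \<le> 4 * G ^ n"
        using eventually_sum_err_le[OF e sub] eventually_gt_at_top[of 0]
      proof eventually_elim
        case (elim n)
        let ?h = "(4 * (1 + c\<^sup>2 * real B) * gtail a) * ((4 + 8 * fm * real B) * (1 + 16 * P) powr (a - 1/2))"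
        have h0: "0 \<le> ?h" using fm(2) by (simp add: gtail_def)
        have "?h = (D - 1) * (1 + 16 * P) powr (a - 1/2)" by (simp add: D_def)
        also have "\<dots> \<le> D * (1 + 16 * P) powr (a - 1/2)" by (intro mult_right_mono) auto
        finally have h: "?h \<le> D * (1 + 16 * P) powr (a - 1/2)" .
        have "1 * 1 \<le> D * (1 + 16 * P) powr (a - 1/2)" using D pw by (intro mult_mono) auto
        then have "?h ^ length ks \<le> (D * (1 + 16 * P) powr (a - 1/2)) ^ K"
          using power_mono[OF h h0, of "length ks"] power_increasing[OF len, of "D * (1 + 16 * P) powr (a - 1/2)"] by linarith
        then have "(1 + 16 * P) powr a * ?h ^ length ks \<le> G" unfolding G_def by (intro mult_left_mono) auto
        then have "((1 + 16 * P) powr a * ?h ^ length ks) ^ n \<le> G ^ n"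
          by (rule power_mono) (intro mult_nonneg_nonneg[OF _ zero_le_power[OF h0]], simp)
        moreover have "\<exists>j\<in>{1..B}. M k j" if "k \<in> {1..K}" for k using tx_props[OF that] by blast
        ultimately show ?case
          using gauss_cl_converse[OF adm fm a P elim(2) ks(1) sub ks(3) _ s elim(1)] by (meson mult_left_mono order_trans zero_le_numeral)
      qed
    qed (use G0 in auto)
    also have "log 2 G = a * log 2 (1 + 16 * P) + real K * (log 2 D + (a - 1 / 2) * log 2 (1 + 16 * P))"
      unfolding G_def using P D by (simp add: log_mult log_nat_power log_powr)
    finally show "(\<Sum>k\<in>?S. R k) \<le> a * log 2 (1 + 16 * P)
     + real K * (log 2 (1 + 4 * (1 + c\<^sup>2 * real B) * gtail a * (4 + 8 * fm * real B)) + (a - 1 / 2) * log 2 (1 + 16 * P))"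
      unfolding ks(2) D_def .
  qed blast
qed

lemma g_ns_cap_bound:
  assumes adm: "admissible_density f c" and P: "0 < P" and R: "R \<in> g_ns_cap M K B f P" and b: "b \<in> {1..B}"
  shows "txsum K B par M R b \<le> log 2 (sqrt (2 + P) * exp (4 * c\<^sup>2 * real B))"
  unfolding txsum_def
proof (rule closure_sum_bound(2)[OF R[unfolded g_ns_cap_def]])
  let ?S = "{k\<in>{1..K}. tx k = b}"
  have "\<exists>k\<in>{1..K}. tx k = b" using tree b unfolding tree_net_def by blast
  then obtain k0 where k0: "k0 \<in> ?S" by blast
  have nb: "M k j = M k0 j" if "k \<in> ?S" "j \<in> {1..B}" for k j
    by (rule tx_same_nbhd) (use that k0 in auto)
  fix R assume "R \<in> {R \<in> rplus K. \<exists>m nsb A. (\<forall>n. g_ns_scheme K B n P (m n) f M (nsb n) (A n)) \<and>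
       (\<lambda>n. Max ((\<lambda>k. g_ns_err M K B f n (m n) (nsb n) (A n) k) ` {1..K})) \<longlonglongrightarrow> 0 \<and>
       (\<forall>k\<in>{1..K}. ereal (R k) \<le> liminf_rate m k)}"
  then obtain m nsb A where s: "\<And>n. g_ns_scheme K B n P (m n) f M (nsb n) (A n)"
    and e: "(\<lambda>n. Max ((\<lambda>k. g_ns_err M K B f n (m n) (nsb n) (A n) k) ` {1..K})) \<longlonglongrightarrow> 0"
    and r: "\<And>k. k \<in> {1..K} \<Longrightarrow> ereal (R k) \<le> liminf_rate m k" by blast
  have sub: "?S \<subseteq> {1..K}" by auto
  show "(\<Sum>k\<in>?S. R k) \<le> log 2 (sqrt (2 + P) * exp (4 * c\<^sup>2 * real B))"
  proof (rule rate_sum_bound)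
    show "1 \<le> m n k" if "k \<in> ?S" for n k using s[of n] that by (auto simp: g_ns_scheme_def)
    show "\<forall>\<^sub>F n in sequentially. (\<Prod>k\<in>?S. real (m n k)) \<le> 2 * (sqrt (2 + P) * exp (4 * c\<^sup>2 * real B)) ^ n"
      using eventually_sum_err_le[OF e sub] eventually_gt_at_top[of 0]
    proof eventually_elim
      case (elim n)
      show ?case
        by (rule gauss_ns_converse[OF adm P elim(2) s sub k0 nb elim(1)])
    qed
  qed (use r P in auto)
qed blast

end

section \<open>Characterisation of the regions\<close>

context tree_network
begin

text \<open>An additive constant \<open>C\<close> in the capacity bound disappears after division by
  \<open>log 2 (real q)\<close>. Only prime orders are tested, since frequent validity is
  enough.\<close>

lemma ff_region_converse:
  fixes cap :: "nat ring \<Rightarrow> (nat \<Rightarrow> real) set"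
  assumes d: "d \<in> closure {d \<in> rplus K. \<exists>R :: nat \<Rightarrow> nat \<Rightarrow> real.
     (\<forall>F :: nat ring. field F \<and> finite (carrier F) \<longrightarrow> R (card (carrier F)) \<in> cap F) \<and>
     (\<forall>k\<in>{1..K}. ereal (d k) \<le> Liminf (at_top \<sqinter> principal prime_powers) (\<lambda>q. ereal (R q k / log 2 (real q))))}"
    and S: "S \<subseteq> {1..K}"
    and bound: "\<And>F R. field F \<Longrightarrow> finite (carrier F) \<Longrightarrow> R \<in> cap F \<Longrightarrow> (\<Sum>k\<in>S. R k) \<le> log 2 (real (card (carrier F))) + C"
  shows "d \<in> rplus K" "(\<Sum>k\<in>S. d k) \<le> 1"
proof -
  let ?A = "{d \<in> rplus K. \<exists>R :: nat \<Rightarrow> nat \<Rightarrow> real.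
     (\<forall>F :: nat ring. field F \<and> finite (carrier F) \<longrightarrow> R (card (carrier F)) \<in> cap F) \<and>
     (\<forall>k\<in>{1..K}. ereal (d k) \<le> Liminf (at_top \<sqinter> principal prime_powers) (\<lambda>q. ereal (R q k / log 2 (real q))))}"
  have "(\<Sum>k\<in>S. d k) \<le> 1" if dA: "d \<in> ?A" for d
  proof -
    obtain R where R: "\<And>F :: nat ring. field F \<Longrightarrow> finite (carrier F) \<Longrightarrow> R (card (carrier F)) \<in> cap F"
      and dR: "\<And>k. k \<in> {1..K} \<Longrightarrow> ereal (d k) \<le> Liminf (at_top \<sqinter> principal prime_powers) (\<lambda>q. ereal (R q k / log 2 (real q)))"
      using dA by blast
    show ?thesis
    proof (rule sum_le_of_Liminf)
      show "finite S" using S finite_subset by blast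
      show "ereal (d k) \<le> Liminf (at_top \<sqinter> principal prime_powers) (\<lambda>q. ereal (R q k / log 2 (real q)))" if "k \<in> S" for k
        using dR that S by blast
      fix e :: real assume e: "0 < e"
      have "((\<lambda>q. C / log 2 (real q)) \<longlongrightarrow> 0) sequentially" by real_asymp
      then have "\<forall>\<^sub>F q in sequentially. C / log 2 (real q) < e" using e by (rule order_tendstoD)
      then have "\<forall>\<^sub>F q in sequentially. prime q \<longrightarrow> (\<Sum>k\<in>S. R q k / log 2 (real q)) \<le> 1 + e"
        using eventually_ge_at_top[of 2]
      proof eventually_elim
        case (elim q)
        show ?case
        proof
          assume "prime q"
          then obtain F :: "nat ring" where F: "field F" "finite (carrier F)" "card (carrier F) = q"
            using ex_prime_field by blast
          have l: "0 < log 2 (real q)" using elim(2) by simp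
          have "(\<Sum>k\<in>S. R q k) \<le> log 2 (real q) + C" using bound[OF F(1,2) R[OF F(1,2)]] F(3) by simp
          then have "(\<Sum>k\<in>S. R q k) / log 2 (real q) \<le> (log 2 (real q) + C) / log 2 (real q)"
            using l by (intro divide_right_mono) auto
          also have "\<dots> = 1 + C / log 2 (real q)" using l by (simp add: add_divide_distrib)
          finally show "(\<Sum>k\<in>S. R q k / log 2 (real q)) \<le> 1 + e" using elim(1) by (simp add: sum_divide_distrib)
        qed
      qed
      then show "\<exists>\<^sub>F q in at_top \<sqinter> principal prime_powers. (\<Sum>k\<in>S. R q k / log 2 (real q)) \<le> 1 + e"
        by (rule frequently_prime_powers)
    qed
  qed
  moreover have "?A \<subseteq> rplus K" by blast
  ultimately show "d \<in> rplus K" "(\<Sum>k\<in>S. d k) \<le> 1" using closure_sum_bound[OF d] by blast+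
qed

text \<open>The bounding function \<open>u\<close> may depend on \<open>e\<close>, because the
  classical bound involves an exponent \<open>a\<close> that has to approach \<open>1/2\<close> as
  \<open>e\<close> shrinks.\<close>

lemma gauss_region_converse:
  fixes cap :: "real \<Rightarrow> (nat \<Rightarrow> real) set"
  assumes d: "d \<in> closure {d \<in> rplus K. \<exists>R :: real \<Rightarrow> nat \<Rightarrow> real. (\<forall>P>0. R P \<in> cap P) \<and>
     (\<forall>k\<in>{1..K}. ereal (d k) \<le> Liminf at_top (\<lambda>P. ereal (R P k / (log 2 P / 2))))}"
    and S: "S \<subseteq> {1..K}"
    and bound: "\<And>e. 0 < e \<Longrightarrow> \<exists>u. (\<forall>P>0. \<forall>R\<in>cap P. (\<Sum>k\<in>S. R k) \<le> u P) \<and> (\<forall>\<^sub>F P in at_top. u P / (log 2 P / 2) \<le> 1 + e)"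
  shows "d \<in> rplus K" "(\<Sum>k\<in>S. d k) \<le> 1"
proof -
  let ?A = "{d \<in> rplus K. \<exists>R :: real \<Rightarrow> nat \<Rightarrow> real. (\<forall>P>0. R P \<in> cap P) \<and>
     (\<forall>k\<in>{1..K}. ereal (d k) \<le> Liminf at_top (\<lambda>P. ereal (R P k / (log 2 P / 2))))}"
  have "(\<Sum>k\<in>S. d k) \<le> 1" if dA: "d \<in> ?A" for d
  proof -
    obtain R where R: "\<And>P. 0 < P \<Longrightarrow> R P \<in> cap P"
      and dR: "\<And>k. k \<in> {1..K} \<Longrightarrow> ereal (d k) \<le> Liminf at_top (\<lambda>P. ereal (R P k / (log 2 P / 2)))"
      using dA by blast
    show ?thesis
    proof (rule sum_le_of_Liminf)
      show "finite S" using S finite_subset by blast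
      show "ereal (d k) \<le> Liminf at_top (\<lambda>P. ereal (R P k / (log 2 P / 2)))" if "k \<in> S" for k
        using dR that S by blast
      fix e :: real assume "0 < e"
      from bound[OF this] obtain u where u: "\<forall>P>0. \<forall>R\<in>cap P. (\<Sum>k\<in>S. R k) \<le> u P"
        "\<forall>\<^sub>F P in at_top. u P / (log 2 P / 2) \<le> 1 + e" by (elim exE conjE)
      have "\<forall>\<^sub>F P in at_top. (\<Sum>k\<in>S. R P k / (log 2 P / 2)) \<le> 1 + e"
        using u(2) eventually_gt_at_top[of 1]
      proof eventually_elim
        case (elim P)
        have P: "0 < P" using elim(2) by simp
        have "(\<Sum>k\<in>S. R P k) \<le> u P" by (rule u(1)[rule_format, OF P R[OF P]])
        then have "(\<Sum>k\<in>S. R P k) / (log 2 P / 2) \<le> u P / (log 2 P / 2)"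
          using elim(2) by (intro divide_right_mono) auto
        then show ?case using elim(1) by (simp only: sum_divide_distrib)
      qed
      then show "\<exists>\<^sub>F P in at_top. (\<Sum>k\<in>S. R P k / (log 2 P / 2)) \<le> 1 + e"
        by (rule eventually_frequently[rotated]) simp
    qed
  qed
  moreover have "?A \<subseteq> rplus K" by blast
  ultimately show "d \<in> rplus K" "(\<Sum>k\<in>S. d k) \<le> 1" using closure_sum_bound[OF d] by blast+
qed

lemma tree_regionI:
  assumes "d \<in> rplus K" "\<And>bs. rtl_path B par bs \<Longrightarrow> (\<Sum>k\<in>path_rx bs. d k) \<le> 1"
  shows "d \<in> tree_dof_region K B par M"
  unfolding tree_dof_region_def using assms path_sum[of _ d] by simp

lemma ex_rtl_path: "\<exists>bs. rtl_path B par bs"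
  using rtl_path_through[of 1] KB_pos by auto

theorem ff_cl_dof_eq: "ff_cl_dof M K B = tree_dof_region K B par M"
proof
  show "ff_cl_dof M K B \<subseteq> tree_dof_region K B par M"
  proof
    fix d assume d: "d \<in> ff_cl_dof M K B"
    have *: "d \<in> rplus K \<and> (\<Sum>k\<in>path_rx bs. d k) \<le> 1" if bs: "rtl_path B par bs" for bs
    proof -
      have sub: "path_rx bs \<subseteq> {1..K}" by blast
      have bd: "(\<Sum>k\<in>path_rx bs. R k) \<le> log 2 (real (card (carrier F))) + real K"
        if "field F" "finite (carrier F)" "R \<in> ff_cl_cap F M K B" for F :: "nat ring" and R
        by (rule ff_cl_cap_bound[OF that bs])
      show ?thesis using ff_region_converse[OF d[unfolded ff_cl_dof_def] sub bd] by blast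
    qed
    then show "d \<in> tree_dof_region K B par M" using ex_rtl_path by (intro tree_regionI) blast+
  qed
  show "tree_dof_region K B par M \<subseteq> ff_cl_dof M K B"
  proof
    fix d assume d: "d \<in> tree_dof_region K B par M"
    show "d \<in> ff_cl_dof M K B"
      unfolding ff_cl_dof_def
    proof (intro subsetD[OF closure_subset] CollectI conjI exI[of _ "\<lambda>q k. d k * log 2 (real q)"] allI impI ballI)
      show "d \<in> rplus K" using d by (simp add: tree_dof_region_def)
      fix F :: "nat ring" assume "field F \<and> finite (carrier F)"
      then interpret ff_tree K B par M F
        by (simp add: ff_tree_def finite_field_def finite_field_axioms_def tree_network_axioms)
      show "(\<lambda>k. d k * log 2 (real (card (carrier F)))) \<in> ff_cl_cap F M K B" by (rule ff_cl_achievable[OF d])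
    next
      fix k
      have "\<forall>\<^sub>F q in sequentially. d k \<le> d k * log 2 (real q) / log 2 (real q)"
        using eventually_ge_at_top[of 2]
      proof eventually_elim
        case (elim q)
        then have "0 < log 2 (real q)" by simp
        then show ?case by simp
      qed
      then show "ereal (d k) \<le> Liminf (at_top \<sqinter> principal prime_powers) (\<lambda>q. ereal (d k * log 2 (real q) / log 2 (real q)))"
        by (intro le_Liminf_of_tendsto[OF _ tendsto_const]) (simp add: eventually_inf_principal eventually_mono)
    qed
  qed
qed

theorem ff_ns_dof_eq: "ff_ns_dof M K B = ns_dof_region K B par M"
proof
  show "ff_ns_dof M K B \<subseteq> ns_dof_region K B par M"
  proof
    fix d assume d: "d \<in> ff_ns_dof M K B"
    have *: "d \<in> rplus K \<and> txsum K B par M d b \<le> 1" if b: "b \<in> {1..B}" for b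
    proof -
      have bd: "(\<Sum>k\<in>{k\<in>{1..K}. tx k = b}. R k) \<le> log 2 (real (card (carrier F))) + 0"
        if "field F" "finite (carrier F)" "R \<in> ff_ns_cap F M K B" for F :: "nat ring" and R
        using ff_ns_cap_bound(1)[OF that b] by (simp add: txsum_def)
      have sub: "{k\<in>{1..K}. tx k = b} \<subseteq> {1..K}" by blast
      show ?thesis unfolding txsum_def using ff_region_converse[OF d[unfolded ff_ns_dof_def] sub bd] by blast
    qed
    then show "d \<in> ns_dof_region K B par M" using KB_pos(2) unfolding ns_dof_region_def by force
  qed
  show "ns_dof_region K B par M \<subseteq> ff_ns_dof M K B"
  proof
    fix d assume d: "d \<in> ns_dof_region K B par M"
    show "d \<in> ff_ns_dof M K B"
      unfolding ff_ns_dof_def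
    proof (intro subsetD[OF closure_subset] CollectI conjI exI[of _ "\<lambda>q k. d k * log 2 (real q)"] allI impI ballI)
      show "d \<in> rplus K" using d by (simp add: ns_dof_region_def)
      fix F :: "nat ring" assume "field F \<and> finite (carrier F)"
      then interpret ff_tree K B par M F
        by (simp add: ff_tree_def finite_field_def finite_field_axioms_def tree_network_axioms)
      show "(\<lambda>k. d k * log 2 (real (card (carrier F)))) \<in> ff_ns_cap F M K B" by (rule ff_ns_achievable[OF d])
    next
      fix k
      have "\<forall>\<^sub>F q in sequentially. d k \<le> d k * log 2 (real q) / log 2 (real q)"
        using eventually_ge_at_top[of 2]
      proof eventually_elim
        case (elim q)
        then have "0 < log 2 (real q)" by simp
        then show ?case by simp
      qed
      then show "ereal (d k) \<le> Liminf (at_top \<sqinter> principal prime_powers) (\<lambda>q. ereal (d k * log 2 (real q) / log 2 (real q)))"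
        by (intro le_Liminf_of_tendsto[OF _ tendsto_const]) (simp add: eventually_inf_principal eventually_mono)
    qed
  qed
qed

text \<open>The finite-field box construction has zero error and full-rate codes, so for this one
  field it reaches any rate tuple exactly after dividing by \<open>log 2 q\<close>; the converse
  carries no additive constant either. Hence capacity, and not only its growth, is
  determined.\<close>

theorem ff_ns_cap_eq:
  fixes F :: "('a, 'b) ring_scheme"
  assumes F: "field F" "finite (carrier F)"
  shows "ff_ns_cap F M K B = {R \<in> rplus K. \<forall>b\<in>{1..B}. txsum K B par M R b \<le> log 2 (real (card (carrier F)))}"
proof
  interpret ff_tree K B par M F
    using F by (simp add: ff_tree_def finite_field_def finite_field_axioms_def tree_network_axioms)
  let ?l = "log 2 (real (card (carrier F)))"
  have "log 2 1 < ?l" using card_ge_2 by (subst log_less_cancel_iff) auto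
  then have l: "0 < ?l" by simp
  show "ff_ns_cap F M K B \<subseteq> {R \<in> rplus K. \<forall>b\<in>{1..B}. txsum K B par M R b \<le> ?l}"
    using ff_ns_cap_bound[OF F] KB_pos(2) by force
  show "{R \<in> rplus K. \<forall>b\<in>{1..B}. txsum K B par M R b \<le> ?l} \<subseteq> ff_ns_cap F M K B"
  proof
    fix R assume R: "R \<in> {R \<in> rplus K. \<forall>b\<in>{1..B}. txsum K B par M R b \<le> ?l}"
    have "txsum K B par M (\<lambda>k. R k / ?l) b \<le> 1" if "b \<in> {1..B}" for b
      using R that l by (simp add: txsum_def sum_divide_distrib[symmetric])
    moreover have "(\<lambda>k. R k / ?l) \<in> rplus K" using R l by (simp add: rplus_def)
    ultimately have "(\<lambda>k. R k / ?l) \<in> ns_dof_region K B par M" by (simp add: ns_dof_region_def)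
    from ff_ns_achievable[OF this] show "R \<in> ff_ns_cap F M K B" using l by simp
  qed
qed

theorem g_cl_dof_eq:
  assumes adm: "admissible_density f c"
  shows "g_cl_dof M K B f = tree_dof_region K B par M"
proof
  show "tree_dof_region K B par M \<subseteq> g_cl_dof M K B f" using gauss_cl_achievable[OF adm] by blast
  obtain fm0 where fm0: "\<And>x. f x \<le> fm0" using adm unfolding admissible_density_def by (auto simp: bdd_above_def)
  define fm where "fm = max 0 fm0"
  have fm: "\<And>x. f x \<le> fm" "0 \<le> fm" using fm0 by (auto simp: fm_def le_max_iff_disj)
  show "g_cl_dof M K B f \<subseteq> tree_dof_region K B par M"
  proof
    fix d assume d: "d \<in> g_cl_dof M K B f"
    have *: "d \<in> rplus K \<and> (\<Sum>k\<in>path_rx bs. d k) \<le> 1" if bs: "rtl_path B par bs" for bs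
    proof -
      let ?S = "path_rx bs"
      have sub: "?S \<subseteq> {1..K}" by blast
      have bd: "\<exists>u. (\<forall>P>0. \<forall>R\<in>g_cl_cap M K B f P. (\<Sum>k\<in>?S. R k) \<le> u P) \<and> (\<forall>\<^sub>F P in at_top. u P / (log 2 P / 2) \<le> 1 + e)" if e: "0 < e" for e
      proof -
        \<comment> \<open>With \<open>a = 1/2 + \<eta>\<close> the limit below equals
          \<open>1 + 2 * \<eta> * (1 + K)\<close>, which is at most \<open>1 + e / 2\<close>; the
          minimum with \<open>1/2\<close> ensures \<open>a \<le> 1\<close>.\<close>
        define \<eta> where "\<eta> = min (1/2) (e / (4 * (1 + real K)))"
        define a where "a = 1 / 2 + \<eta>"
        have K4: "0 < 4 * (1 + real K)" by simp
        have \<eta>: "0 < \<eta>" using e K4 by (simp add: \<eta>_def)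
        have \<eta>2: "\<eta> \<le> 1 / 2" unfolding \<eta>_def by (rule min.cobounded1)
        have "\<eta> \<le> e / (4 * (1 + real K))" by (simp add: \<eta>_def)
        then have \<eta>3: "\<eta> * (4 * (1 + real K)) \<le> e" using pos_le_divide_eq[OF K4] by blast
        have a: "1 / 2 < a" "a \<le> 1" using \<eta> \<eta>2 by (auto simp: a_def)
        define D where "D = log 2 (1 + 4 * (1 + c\<^sup>2 * real B) * gtail a * (4 + 8 * fm * real B))"
        define k where "k = real K"
        define u where "u = (\<lambda>P. a * log 2 (1 + 16 * P) + k * (D + (a - 1 / 2) * log 2 (1 + 16 * P)))"
        have "((\<lambda>P. u P / (log 2 P / 2)) \<longlongrightarrow> 2 * (a + k * (a - 1 / 2))) at_top"
          unfolding u_def by (real_asymp simp: field_simps)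
        moreover have "2 * (a + k * (a - 1 / 2)) < 1 + e"
        proof -
          have "2 * (a + k * (a - 1 / 2)) = 1 + \<eta> * (4 * (1 + real K)) / 2" by (simp add: a_def k_def field_simps)
          then show ?thesis using \<eta>3 e by linarith
        qed
        ultimately have "\<forall>\<^sub>F P in at_top. u P / (log 2 P / 2) < 1 + e" by (rule order_tendstoD)
        then have "\<forall>\<^sub>F P in at_top. u P / (log 2 P / 2) \<le> 1 + e" by (rule eventually_mono) simp
        moreover have "(\<Sum>k\<in>?S. R k) \<le> u P" if "0 < P" "R \<in> g_cl_cap M K B f P" for P R
          unfolding u_def k_def D_def by (rule g_cl_cap_bound[OF adm fm a that bs])
        ultimately show ?thesis by blast
      qed
      show ?thesis using gauss_region_converse[OF d[unfolded g_cl_dof_def] sub bd] by blast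
    qed
    then show "d \<in> tree_dof_region K B par M" using ex_rtl_path by (intro tree_regionI) blast+
  qed
qed

theorem g_ns_dof_eq:
  assumes adm: "admissible_density f c"
  shows "g_ns_dof M K B f = ns_dof_region K B par M"
proof
  show "ns_dof_region K B par M \<subseteq> g_ns_dof M K B f" using gauss_ns_achievable[OF adm] by blast
  show "g_ns_dof M K B f \<subseteq> ns_dof_region K B par M"
  proof
    fix d assume d: "d \<in> g_ns_dof M K B f"
    have *: "d \<in> rplus K \<and> txsum K B par M d b \<le> 1" if b: "b \<in> {1..B}" for b
    proof -
      let ?S = "{k\<in>{1..K}. tx k = b}"
      have sub: "?S \<subseteq> {1..K}" by blast
      have bd: "\<exists>u. (\<forall>P>0. \<forall>R\<in>g_ns_cap M K B f P. (\<Sum>k\<in>?S. R k) \<le> u P) \<and> (\<forall>\<^sub>F P in at_top. u P / (log 2 P / 2) \<le> 1 + e)" if e: "0 < e" for e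
      proof -
        define C where "C = exp (4 * c\<^sup>2 * real B)"
        have C: "0 < C" by (simp add: C_def)
        define u where "u = (\<lambda>P. log 2 (sqrt (2 + P) * C))"
        have "((\<lambda>P. u P / (log 2 P / 2)) \<longlongrightarrow> 1) at_top" unfolding u_def using C by real_asymp
        then have "\<forall>\<^sub>F P in at_top. u P / (log 2 P / 2) < 1 + e" by (rule order_tendstoD) (use e in simp)
        then have "\<forall>\<^sub>F P in at_top. u P / (log 2 P / 2) \<le> 1 + e" by (rule eventually_mono) simp
        moreover have "(\<Sum>k\<in>?S. R k) \<le> u P" if "0 < P" "R \<in> g_ns_cap M K B f P" for P R
          using g_ns_cap_bound[OF adm that b] by (simp add: u_def C_def txsum_def)
        ultimately show ?thesis by blast
      qed
      show ?thesis unfolding txsum_def using gauss_region_converse[OF d[unfolded g_ns_dof_def] sub bd] by blast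
    qed
    then show "d \<in> ns_dof_region K B par M" using KB_pos(2) unfolding ns_dof_region_def by force
  qed
qed

end

theorem theorem6:
  fixes K B :: nat and par :: "nat \<Rightarrow> nat" and M :: "nat \<Rightarrow> nat \<Rightarrow> bool"
  assumes "tree_net K B par M"
  shows "ff_cl_dof M K B = tree_dof_region K B par M \<and>
         ff_ns_dof M K B = ns_dof_region K B par M \<and>
         (\<forall>f c. admissible_density f c \<longrightarrow>
             g_cl_dof M K B f = tree_dof_region K B par M \<and>
             g_ns_dof M K B f = ns_dof_region K B par M) \<and>
         (\<forall>F :: 'a ring. field F \<and> finite (carrier F) \<longrightarrow>
             ff_ns_cap F M K B = {R \<in> rplus K. \<forall>b\<in>{1..B}.
                txsum K B par M R b \<le> log 2 (real (card (carrier F)))})"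
proof -
  interpret tree_network K B par M by (rule tree_network.intro[OF assms])
  show ?thesis using ff_cl_dof_eq ff_ns_dof_eq g_cl_dof_eq g_ns_dof_eq ff_ns_cap_eq by blast
qed

end
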